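(* Let $A$ be a non-periodic abelian group. Then there is a subgroup $Q(A)$ of $\mathrm{IAut}(A)$, which is isomorphic to a multiplicative group of rational numbers, such that $$\mathrm{IAut}(A)=\mathrm{IAut}_1(A)\times Q(A).$$ Moreover, there is a normal subgroup $\Gamma$ of $\mathrm{IAut}_1(A)$ such that: (i) $\mathrm{IAut}_1(A)/\Gamma$ is locally finite; (ii) the derived subgroup $\Gamma'$ of $\Gamma$ is a periodic abelian group and each subgroup of $\Gamma'$ is normal in $\Gamma$.
   Context: Abelian groups $A$ are written additively; endomorphisms act on the right. An automorphism $\gamma$ of an abelian group $A$ is called inertial if $(H+H\gamma)/H$ is finite for each subgroup $H\le A$. $\mathrm{IAut}(A)$ denotes the subgroup of $\mathrm{Aut}(A)$ generated by all inertial automorphisms of $A$. $T(A)$ denotes the torsion subgroup of $A$, and $\mathrm{IAut}_1(A)$ denotes the subgroup of $\mathrm{IAut}(A)$ consisting of the inertial automorphisms of $A$ that act as the identity map on $A/T(A)$. A multiplicative group of rational numbers means a subgroup of the multiplicative group of non-zero rational numbers. *)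

theory Defs
  imports "HOL-Algebra.Algebra"
begin

text \<open>
  Abelian groups are commutative groups of \<open>HOL-Algebra\<close>, so their operation, which one may
  read additively, is written \<open>\<otimes>\<close>: \<open>H + H\<gamma>\<close> becomes \<open>H <#>\<^bsub>A\<^esub> \<gamma> ` H\<close> and \<open>n a\<close> becomes
  \<open>a [^]\<^bsub>A\<^esub> n\<close>. Automorphisms form the group \<^const>\<open>AutoGroup\<close>, whose product is
  composition of left-acting maps. Letting automorphisms act on the right replaces it by its
  opposite group. The two have the same subgroups, generated subgroups, normal subgroups, derived
  subgroups and internal direct products.
\<close>

definition torsion_subgroup :: "('a, 'b) monoid_scheme \<Rightarrow> 'a set" where
  "torsion_subgroup G = {x \<in> carrier G. \<exists>n::nat. n > 0 \<and> x [^]\<^bsub>G\<^esub> n = \<one>\<^bsub>G\<^esub>}"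

definition periodic :: "('a, 'b) monoid_scheme \<Rightarrow> bool" where
  "periodic G \<longleftrightarrow> (\<forall>x\<in>carrier G. \<exists>n::nat. n > 0 \<and> x [^]\<^bsub>G\<^esub> n = \<one>\<^bsub>G\<^esub>)"

definition locally_finite :: "('a, 'b) monoid_scheme \<Rightarrow> bool" where
  "locally_finite G \<longleftrightarrow> (\<forall>S. S \<subseteq> carrier G \<longrightarrow> finite S \<longrightarrow> finite (generate G S))"

definition internal_direct_product ::
    "('a, 'b) monoid_scheme \<Rightarrow> 'a set \<Rightarrow> 'a set \<Rightarrow> bool" where
  "internal_direct_product G H K \<longleftrightarrow>
     H \<lhd> G \<and> K \<lhd> G \<and> H \<inter> K = {\<one>\<^bsub>G\<^esub>} \<and> H <#>\<^bsub>G\<^esub> K = carrier G"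

definition rat_mult_group :: "rat monoid" where
  "rat_mult_group = \<lparr>carrier = {q. q \<noteq> 0}, monoid.mult = (*), one = 1\<rparr>"

definition inertial_automorphism :: "('a, 'b) monoid_scheme \<Rightarrow> ('a \<Rightarrow> 'a) \<Rightarrow> bool" where
  "inertial_automorphism A \<gamma> \<longleftrightarrow> \<gamma> \<in> auto A \<and>
     (\<forall>H. subgroup H A \<longrightarrow> finite (carrier ((A\<lparr>carrier := H <#>\<^bsub>A\<^esub> (\<gamma> ` H)\<rparr>) Mod H)))"

text \<open>
  The inverse of an inertial automorphism need not be inertial (multiplication by \<open>2\<close> on a
  rational vector space of infinite dimension), so \<open>IAut A\<close> may contain non-inertial automorphisms.
\<close>

definition IAut :: "('a, 'b) monoid_scheme \<Rightarrow> ('a \<Rightarrow> 'a) monoid" where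
  "IAut A = (AutoGroup A)\<lparr>carrier := generate (AutoGroup A) {\<gamma>. inertial_automorphism A \<gamma>}\<rparr>"

definition IAut1 :: "('a, 'b) monoid_scheme \<Rightarrow> ('a \<Rightarrow> 'a) set" where
  "IAut1 A = {\<gamma> \<in> carrier (IAut A). inertial_automorphism A \<gamma> \<and>
     (\<forall>a\<in>carrier A. torsion_subgroup A #>\<^bsub>A\<^esub> \<gamma> a = torsion_subgroup A #>\<^bsub>A\<^esub> a)}"

end

theory Submission
  imports Defs
begin

text \<open>
  An inertial automorphism acts on \<open>A/T(A)\<close> as multiplication by a rational number \<open>m/n\<close>. For a
  prime \<open>p\<close> dividing \<open>m n\<close>, the group is the direct sum of its \<open>p\<close>-component and a \<open>p\<close>-divisible
  complement, which is unique and hence invariant under all automorphisms. Therefore the map that is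
  multiplication by \<open>p\<close> on the complement and the identity on the component is a central
  automorphism. These maps and \<open>-1\<close> generate \<open>Q(A)\<close>; dividing them out removes the primes of \<open>m/n\<close>
  one by one and leaves an automorphism that is trivial on \<open>A/T(A)\<close>.

  The group \<open>\<Gamma>\<close> consists of the elements of \<open>IAut\<^sub>1(A)\<close> that map each torsion element of prime power
  order to a multiple of itself. An inertial map has this property on almost all primary components. On
  each of the others, finitely many inertial maps act in this way on a subgroup that, together with the
  elements of some bounded order, generates the component; their action on the latter elements is
  given by finite data. This makes \<open>IAut\<^sub>1(A)/\<Gamma>\<close> locally finite. A commutator \<open>f\<close> of \<open>\<Gamma>\<close> is the identity
  on \<open>T(A)\<close> and on \<open>A/T(A)\<close>, and the image of \<open>f - 1\<close> is finite. Such maps form a periodic abelian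
  group. An element of \<open>\<Gamma>\<close> acts on the finite image as a multiple, so that it conjugates \<open>f\<close> to a
  power of \<open>f\<close>.
\<close>

text \<open>Inertial automorphisms are closed under composition but not under inverses, so the
  primes of \<open>m\<close> and \<open>n\<close> need different treatment. A prime of
  \<open>n\<close> is cancelled by composing with a scaling, which is inertial. A prime of
  \<open>m\<close> requires the inverse of a scaling; the composite is inertial only because the
  given map already involves the factor \<open>p\<close> modulo torsion. For maps that are trivial
  modulo torsion the difficulty disappears, since they permute finite sets. The scaling by
  \<open>p\<close> has to be the identity on the \<open>p\<close>-component, where multiplication by
  \<open>p\<close> is not injective unless the component is trivial. Hence it is not formal that an
  element of \<open>Q(A)\<close> acting trivially on \<open>A/T(A)\<close> is trivial: the equality
  \<open>m = n\<close> has to be transported to every component, where the powers of that prime are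
  missing from the action. On a single \<open>p\<close>-component the maps act by multiples on a
  subgroup \<open>C\<close> whose quotient has finite socle, yet \<open>C\<close> may be far too
  small. A bounded \<open>C\<close> is replaced by a divisible subgroup. On an unbounded
  \<open>C\<close> the multiples define a \<open>p\<close>-adic integer, and the action by this
  integer is extended beyond \<open>C\<close>.\<close>

definition primary :: "('a, 'b) monoid_scheme \<Rightarrow> int \<Rightarrow> 'a set" where
  "primary G p = {x \<in> carrier G. \<exists>n::nat. x [^]\<^bsub>G\<^esub> (p ^ n) = \<one>\<^bsub>G\<^esub>}"

text \<open>For a subgroup \<open>H\<close> it means that \<open>K\<close> meets only finitely many
  cosets of \<open>H\<close>. Since \<open>K\<close> is an arbitrary subset, the relation also
  covers images, layers of \<open>p\<close>-groups and sets of differences \<open>g x - x\<close>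
  (additive notation is used in the comments).\<close>

definition almost_le :: "('a, 'b) monoid_scheme \<Rightarrow> 'a set \<Rightarrow> 'a set \<Rightarrow> bool" where
  "almost_le G K H \<longleftrightarrow> (\<exists>S\<subseteq>carrier G. finite S \<and> K \<subseteq> H <#>\<^bsub>G\<^esub> S)"

definition inertial_map :: "('a, 'b) monoid_scheme \<Rightarrow> ('a \<Rightarrow> 'a) \<Rightarrow> bool" where
  "inertial_map G g \<longleftrightarrow> g \<in> iso G G \<and> (\<forall>H. subgroup H G \<longrightarrow> almost_le G (g ` H) H)"

text \<open>The exponent may vary with the element. For a homomorphism and a subgroup
  \<open>H\<close> this says that every subgroup of \<open>H\<close> is mapped into itself; if
  \<open>H\<close> is killed by a power of a prime, one exponent serves all elements by
  \<open>power_on_uniform\<close>.\<close>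

definition power_on :: "('a, 'b) monoid_scheme \<Rightarrow> ('a \<Rightarrow> 'a) \<Rightarrow> 'a set \<Rightarrow> bool" where
  "power_on G g H \<longleftrightarrow> (\<forall>x\<in>H. \<exists>k::int. g x = x [^]\<^bsub>G\<^esub> k)"

definition adjoin :: "('a, 'b) monoid_scheme \<Rightarrow> 'a set \<Rightarrow> 'a \<Rightarrow> 'a set" where
  "adjoin G H x = {h \<otimes>\<^bsub>G\<^esub> x [^]\<^bsub>G\<^esub> k |h k::int. h \<in> H}"

context comm_group
begin

section \<open>Subgroups of an abelian group\<close>

lemmas expand = m_ac int_pow_distrib int_pow_mult int_pow_diff int_pow_neg int_pow_pow
  inv_mult_group int_pow_inv

lemma m_inv_cancel [simp]:
  assumes "x \<in> carrier G" "y \<in> carrier G"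
  shows "x \<otimes> (inv x \<otimes> y) = y" "inv x \<otimes> (x \<otimes> y) = y" "y \<otimes> x \<otimes> inv x = y" "y \<otimes> inv x \<otimes> x = y"
  using assms by (simp_all add: m_assoc[symmetric]) (simp_all add: m_assoc)

lemma sub_carr: "subgroup H G \<Longrightarrow> x \<in> H \<Longrightarrow> x \<in> carrier G"
  by (rule subgroup.mem_carrier)

lemma sub_mult: "subgroup H G \<Longrightarrow> x \<in> H \<Longrightarrow> y \<in> H \<Longrightarrow> x \<otimes> y \<in> H"
  by (rule subgroup.m_closed)

lemma sub_inv: "subgroup H G \<Longrightarrow> x \<in> H \<Longrightarrow> inv x \<in> H"
  by (rule subgroup.m_inv_closed)

lemma sub_pow: "subgroup H G \<Longrightarrow> x \<in> H \<Longrightarrow> x [^] (k::int) \<in> H"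
  by (rule subgroup_int_pow_closed)

lemma sub_one: "subgroup H G \<Longrightarrow> \<one> \<in> H"
  by (rule subgroup.one_closed)

lemmas sub_intros = sub_mult sub_inv sub_pow sub_one

lemma sub_cancel:
  assumes "subgroup H G" "x \<in> H" "y \<in> carrier G" "x \<otimes> y \<in> H"
  shows "y \<in> H"
proof -
  have "y = inv x \<otimes> (x \<otimes> y)" using assms by (simp add: sub_carr)
  then show ?thesis using assms by (metis sub_inv sub_mult)
qed

lemma sub_cancel':
  assumes "subgroup H G" "x \<in> H" "y \<in> carrier G" "y \<otimes> x \<in> H"
  shows "y \<in> H"
  using assms by (metis m_comm sub_cancel sub_carr)

lemma subgroupI':
  assumes "H \<subseteq> carrier G" "\<one> \<in> H" "\<And>x y. x \<in> H \<Longrightarrow> y \<in> H \<Longrightarrow> x \<otimes> inv y \<in> H"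
  shows "subgroup H G"
proof (rule subgroupI)
  show inv: "inv a \<in> H" if "a \<in> H" for a
    using assms(3)[OF assms(2) that] that assms(1) by auto
  show "a \<otimes> b \<in> H" if "a \<in> H" "b \<in> H" for a b
    using assms(3)[OF that(1) inv[OF that(2)]] that assms(1) by (metis inv_inv subsetD)
qed (use assms in auto)

lemma subgroup_one_set: "subgroup {\<one>} G"
  by (rule subgroupI') auto

lemma subgroup_Int: "subgroup H G \<Longrightarrow> subgroup K G \<Longrightarrow> subgroup (H \<inter> K) G"
  by (rule subgroups_Inter_pair)

lemma subgroup_UN_chain:
  assumes "\<And>n::nat. subgroup (H n) G" "\<And>n. H n \<subseteq> H (Suc n)"
  shows "subgroup (\<Union>n. H n) G"
proof (rule subgroupI')
  show "\<Union> (range H) \<subseteq> carrier G" using assms(1) sub_carr by blast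
  show "\<one> \<in> \<Union> (range H)" using assms(1) sub_one by blast
  fix x y assume "x \<in> \<Union> (range H)" "y \<in> \<Union> (range H)"
  then obtain m n where mn: "x \<in> H m" "y \<in> H n" by blast
  have "H m \<subseteq> H (max m n)" "H n \<subseteq> H (max m n)"
    by (rule lift_Suc_mono_le[of H], rule assms(2), simp)+
  then have "x \<otimes> inv y \<in> H (max m n)"
    using mn sub_mult[OF assms(1)] sub_inv[OF assms(1)] by blast
  then show "x \<otimes> inv y \<in> \<Union> (range H)" by blast
qed

lemma adjoin_subgroup:
  assumes "subgroup H G" "x \<in> carrier G"
  shows "subgroup (adjoin G H x) G"
proof (rule subgroupI')
  show "adjoin G H x \<subseteq> carrier G" using assms sub_carr by (auto simp: adjoin_def)
  have "\<one> = \<one> \<otimes> x [^] (0::int)" by simp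
  then show "\<one> \<in> adjoin G H x" using assms sub_one unfolding adjoin_def by blast
  fix u v assume "u \<in> adjoin G H x" "v \<in> adjoin G H x"
  then obtain h k h' k' where *: "u = h \<otimes> x [^] (k::int)" "v = h' \<otimes> x [^] (k'::int)" "h \<in> H" "h' \<in> H"
    by (auto simp: adjoin_def)
  then have "u \<otimes> inv v = (h \<otimes> inv h') \<otimes> x [^] (k - k')"
    using assms sub_carr by (simp add: expand)
  then show "u \<otimes> inv v \<in> adjoin G H x"
    using assms * unfolding adjoin_def by (blast intro: sub_intros)
qed

lemma adjoin_base:
  assumes "H \<subseteq> carrier G" shows "H \<subseteq> adjoin G H x"
proof
  fix h assume "h \<in> H"
  then have "h = h \<otimes> x [^] (0::int)" using assms by auto
  then show "h \<in> adjoin G H x" using \<open>h \<in> H\<close> unfolding adjoin_def by blast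
qed

lemma adjoin_self:
  assumes "subgroup H G" "x \<in> carrier G" shows "x \<in> adjoin G H x"
proof -
  have "x = \<one> \<otimes> x [^] (1::int)" using assms by simp
  then show ?thesis using assms sub_one unfolding adjoin_def by blast
qed

lemma adjoin_least:
  assumes "subgroup K G" "H \<subseteq> K" "x \<in> K" shows "adjoin G H x \<subseteq> K"
  using assms by (auto simp: adjoin_def intro!: sub_intros)

lemma pow_mod:
  assumes "x \<in> carrier G" "x [^] (n::int) = \<one>"
  shows "x [^] (k::int) = x [^] (k mod n)"
proof -
  have "x [^] k = x [^] (n * (k div n) + k mod n)" by simp
  also have "\<dots> = (x [^] n) [^] (k div n) \<otimes> x [^] (k mod n)"
    using assms(1) by (simp only: int_pow_mult int_pow_pow)
  finally show ?thesis using assms by simp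
qed

lemma pow_cong:
  assumes "x \<in> carrier G" "x [^] (n::int) = \<one>" "n dvd k - l"
  shows "x [^] (k::int) = x [^] l"
  using assms pow_mod by (metis mod_eq_dvd_iff)

lemma pow_dvd_one:
  assumes "x \<in> carrier G" "x [^] (n::int) = \<one>" "n dvd k"
  shows "x [^] (k::int) = \<one>"
  using pow_cong[of x n k 0] assms by simp

lemma adjoin_finite:
  assumes "finite H" "H \<subseteq> carrier G" "x \<in> carrier G" "n > 0" "x [^] (n::int) = \<one>"
  shows "finite (adjoin G H x)"
proof -
  have "adjoin G H x \<subseteq> (\<lambda>(h, k). h \<otimes> x [^] k) ` (H \<times> {0..<n})"
  proof
    fix y assume "y \<in> adjoin G H x"
    then obtain h k where "h \<in> H" "y = h \<otimes> x [^] (k::int)" by (auto simp: adjoin_def)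
    then have "y = h \<otimes> x [^] (k mod n)" using pow_mod assms by metis
    moreover have "k mod n \<in> {0..<n}" using assms by simp
    ultimately show "y \<in> (\<lambda>(h, k). h \<otimes> x [^] k) ` (H \<times> {0..<n})" using \<open>h \<in> H\<close> by force
  qed
  then show ?thesis using assms(1) finite_subset by fastforce
qed

section \<open>Containment up to finitely many cosets\<close>

lemma almost_leI:
  assumes "finite S" "S \<subseteq> carrier G" "\<And>k. k \<in> K \<Longrightarrow> \<exists>h\<in>H. \<exists>s\<in>S. k = h \<otimes> s"
  shows "almost_le G K H"
proof -
  have "K \<subseteq> H <#> S" using assms(3) unfolding set_mult_def by fastforce
  then show ?thesis using assms unfolding almost_le_def by blast
qed

lemma almost_leD:
  assumes "almost_le G K H"
  shows "\<exists>S. finite S \<and> S \<subseteq> carrier G \<and> (\<forall>k\<in>K. \<exists>h\<in>H. \<exists>s\<in>S. k = h \<otimes> s)"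
proof -
  obtain S where S: "finite S" "S \<subseteq> carrier G" "K \<subseteq> H <#> S"
    using assms unfolding almost_le_def by blast
  have "\<exists>h\<in>H. \<exists>s\<in>S. k = h \<otimes> s" if "k \<in> K" for k
    using S(3) that unfolding set_mult_def by fastforce
  then show ?thesis using S by blast
qed

text \<open>A coset that meets \<open>K\<close> can be represented by an element of
  \<open>K\<close>, and one that misses \<open>K\<close> is dropped. Representatives inside
  \<open>K\<close> inherit its properties, for example being torsion.\<close>

lemma almost_leD':
  assumes "almost_le G K H" "subgroup H G" "K \<subseteq> carrier G"
  shows "\<exists>S. finite S \<and> S \<subseteq> K \<and> (\<forall>k\<in>K. \<exists>h\<in>H. \<exists>s\<in>S. k = h \<otimes> s)"
proof -
  obtain S where S: "finite S" "S \<subseteq> carrier G" "\<And>k. k \<in> K \<Longrightarrow> \<exists>h\<in>H. \<exists>s\<in>S. k = h \<otimes> s"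
    using almost_leD[OF assms(1)] by blast
  define good where "good s \<longleftrightarrow> (\<exists>k\<in>K. \<exists>h\<in>H. k = h \<otimes> s)" for s
  define r where "r s = (SOME k. k \<in> K \<and> (\<exists>h\<in>H. k = h \<otimes> s))" for s
  have r: "r s \<in> K \<and> (\<exists>h\<in>H. r s = h \<otimes> s)" if "good s" for s
    using that unfolding good_def r_def by (metis (mono_tags, lifting) someI_ex)
  show ?thesis
  proof (intro exI conjI ballI)
    show "finite (r ` {s\<in>S. good s})" using S by simp
    show "r ` {s\<in>S. good s} \<subseteq> K" using r by blast
    fix k assume "k \<in> K"
    then obtain h s where hs: "h \<in> H" "s \<in> S" "k = h \<otimes> s" using S by blast
    then have "good s" using \<open>k \<in> K\<close> unfolding good_def by blast
    then obtain h' where h': "h' \<in> H" "r s = h' \<otimes> s" using r by blast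
    have "k = (h \<otimes> inv h') \<otimes> r s"
      using hs h' S assms(2) sub_carr by (simp add: m_assoc subsetD)
    moreover have "h \<otimes> inv h' \<in> H" using hs h' assms(2) by (simp add: sub_intros)
    ultimately show "\<exists>h\<in>H. \<exists>s\<in>r ` {s\<in>S. good s}. k = h \<otimes> s"
      using \<open>good s\<close> hs by blast
  qed
qed

lemma almost_le_mono: "almost_le G K H \<Longrightarrow> K' \<subseteq> K \<Longrightarrow> H \<subseteq> H' \<Longrightarrow> almost_le G K' H'"
  unfolding almost_le_def by (meson mono_set_mult order_refl order_trans)

lemma almost_le_refl: "H \<subseteq> K \<Longrightarrow> K \<subseteq> carrier G \<Longrightarrow> almost_le G H K"
  by (rule almost_leI[of "{\<one>}"]) (auto intro!: bexI)

lemma almost_le_trans: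
  assumes "almost_le G K H" "almost_le G H L" "L \<subseteq> carrier G"
  shows "almost_le G K L"
proof -
  obtain S where S: "finite S" "S \<subseteq> carrier G" "\<And>k. k \<in> K \<Longrightarrow> \<exists>h\<in>H. \<exists>s\<in>S. k = h \<otimes> s"
    using almost_leD[OF assms(1)] by blast
  obtain S' where S': "finite S'" "S' \<subseteq> carrier G" "\<And>k. k \<in> H \<Longrightarrow> \<exists>h\<in>L. \<exists>s\<in>S'. k = h \<otimes> s"
    using almost_leD[OF assms(2)] by blast
  show ?thesis
  proof (rule almost_leI)
    show "finite (S' <#> S)" using S S' by (simp add: set_mult_def)
    show "S' <#> S \<subseteq> carrier G" using S S' set_mult_closed by blast
    fix k assume "k \<in> K"
    then obtain h s where hs: "h \<in> H" "s \<in> S" "k = h \<otimes> s" using S by blast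
    then obtain l s' where ls: "l \<in> L" "s' \<in> S'" "h = l \<otimes> s'" using S' by blast
    have "k = l \<otimes> (s' \<otimes> s)" using hs ls S S' assms(3) by (simp add: m_assoc subsetD)
    then show "\<exists>h\<in>L. \<exists>s\<in>S' <#> S. k = h \<otimes> s"
      using hs ls by (auto simp: set_mult_def)
  qed
qed

lemma almost_le_mult:
  assumes "almost_le G K H" "almost_le G K' H" "subgroup H G"
  shows "almost_le G (K <#> K') H"
proof -
  obtain S where S: "finite S" "S \<subseteq> carrier G" "\<And>k. k \<in> K \<Longrightarrow> \<exists>h\<in>H. \<exists>s\<in>S. k = h \<otimes> s"
    using almost_leD[OF assms(1)] by blast
  obtain S' where S': "finite S'" "S' \<subseteq> carrier G" "\<And>k. k \<in> K' \<Longrightarrow> \<exists>h\<in>H. \<exists>s\<in>S'. k = h \<otimes> s"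
    using almost_leD[OF assms(2)] by blast
  show ?thesis
  proof (rule almost_leI)
    show "finite (S <#> S')" using S S' by (simp add: set_mult_def)
    show "S <#> S' \<subseteq> carrier G" using S S' set_mult_closed by blast
    fix k assume "k \<in> K <#> K'"
    then obtain a b where ab: "a \<in> K" "b \<in> K'" "k = a \<otimes> b" by (auto simp: set_mult_def)
    obtain h s where hs: "h \<in> H" "s \<in> S" "a = h \<otimes> s" using S ab by blast
    obtain h' s' where ls: "h' \<in> H" "s' \<in> S'" "b = h' \<otimes> s'" using S' ab by blast
    have "k = (h \<otimes> h') \<otimes> (s \<otimes> s')"
      using ab hs ls S S' assms(3) by (simp add: m_ac subsetD sub_carr)
    then show "\<exists>h\<in>H. \<exists>s\<in>S <#> S'. k = h \<otimes> s"
      using hs ls assms(3) by (auto simp: set_mult_def intro!: sub_mult)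
  qed
qed

text \<open>Elements of \<open>K\<close> are sorted by their coset of \<open>H\<close> and their
  coset of \<open>L\<close> at once. Two elements of the same class differ by an element of both
  subgroups, so one representative per nonempty class is enough.\<close>

lemma almost_le_Int:
  assumes "almost_le G K H" "almost_le G K L" "subgroup H G" "subgroup L G" "K \<subseteq> carrier G"
  shows "almost_le G K (H \<inter> L)"
proof -
  obtain S where S: "finite S" "S \<subseteq> carrier G" "\<And>k. k \<in> K \<Longrightarrow> \<exists>h\<in>H. \<exists>s\<in>S. k = h \<otimes> s"
    using almost_leD[OF assms(1)] by blast
  obtain S' where S': "finite S'" "S' \<subseteq> carrier G" "\<And>k. k \<in> K \<Longrightarrow> \<exists>h\<in>L. \<exists>s\<in>S'. k = h \<otimes> s"
    using almost_leD[OF assms(2)] by blast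
  define P where "P s s' k \<longleftrightarrow> k \<in> K \<and> (\<exists>h\<in>H. k = h \<otimes> s) \<and> (\<exists>h\<in>L. k = h \<otimes> s')" for s s' k
  \<comment> \<open>Empty classes get the default value \<open>\<one>\<close>, which keeps every
    \<open>r s s'\<close> in the group.\<close>
  define r where "r s s' = (if \<exists>k. P s s' k then SOME k. P s s' k else \<one>)" for s s'
  have r: "P s s' (r s s')" if "P s s' k" for s s' k
    using that unfolding r_def by (metis someI)
  have rc: "r s s' \<in> carrier G" for s s'
  proof (cases "\<exists>k. P s s' k")
    case True
    then show ?thesis using r assms(5) unfolding P_def by blast
  qed (simp add: r_def)
  have key: "k \<otimes> inv k' \<in> M" if "k = h \<otimes> s" "k' = h' \<otimes> s" "h \<in> M" "h' \<in> M" "s \<in> carrier G" "subgroup M G"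
    for k k' h h' s M
  proof -
    have "k \<otimes> inv k' = h \<otimes> inv h'" using that sub_carr by (simp add: expand)
    then show ?thesis using that by (simp add: sub_intros)
  qed
  show ?thesis
  proof (rule almost_leI)
    show "finite ((\<lambda>(s, s'). r s s') ` (S \<times> S'))" using S S' by simp
    show "(\<lambda>(s, s'). r s s') ` (S \<times> S') \<subseteq> carrier G" using rc by auto
    fix k assume k: "k \<in> K"
    obtain s s' where ss: "s \<in> S" "s' \<in> S'" "P s s' k" using S(3)[OF k] S'(3)[OF k] k unfolding P_def by blast
    then have P: "P s s' (r s s')" using r by blast
    have c: "s \<in> carrier G" "s' \<in> carrier G" using S S' ss by auto
    have "k \<otimes> inv (r s s') \<in> H" using ss(3) P key[of k _ s "r s s'" _ H] c assms(3) unfolding P_def by blast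
    moreover have "k \<otimes> inv (r s s') \<in> L" using ss(3) P key[of k _ s' "r s s'" _ L] c assms(4) unfolding P_def by blast
    moreover have "k = (k \<otimes> inv (r s s')) \<otimes> r s s'" using k assms(5) rc by (simp add: subsetD)
    ultimately show "\<exists>h\<in>H \<inter> L. \<exists>s\<in>(\<lambda>(s, s'). r s s') ` (S \<times> S'). k = h \<otimes> s"
      using ss by blast
  qed
qed

lemma almost_le_restrict:
  assumes "almost_le G K H" "subgroup H G" "K \<subseteq> carrier G" "subgroup M G"
  shows "almost_le G (K \<inter> M) (H \<inter> M)"
proof -
  have "almost_le G (K \<inter> M) M" using assms(4) sub_carr by (intro almost_le_refl) auto
  moreover have "almost_le G (K \<inter> M) H" using assms(1) almost_le_mono by blast
  ultimately show ?thesis using almost_le_Int assms by blast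
qed

text \<open>The inertial property is contradicted below by a subgroup together with an infinite
  sequence of values of the map that are pairwise incongruent modulo this subgroup.\<close>

lemma almost_le_pigeonhole:
  assumes "almost_le G K H" "subgroup H G" "\<And>n::nat. f n \<in> K"
  obtains i j where "i < j" "f j \<otimes> inv (f i) \<in> H"
proof -
  obtain S where S: "finite S" "S \<subseteq> carrier G" "\<And>k. k \<in> K \<Longrightarrow> \<exists>h\<in>H. \<exists>s\<in>S. k = h \<otimes> s"
    using almost_leD[OF assms(1)] by blast
  obtain h s where hs: "\<And>n. h n \<in> H \<and> s n \<in> S \<and> f n = h n \<otimes> s n"
    using S(3)[OF assms(3)] by metis
  have "\<not> inj s" using hs S(1) by (meson finite_imageD finite_subset image_subsetI infinite_UNIV_nat)
  then obtain i j where ij: "i < j" "s i = s j" by (metis injI linorder_neqE_nat)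
  have "f j \<otimes> inv (f i) = h j \<otimes> inv (h i)"
    using hs[of i] hs[of j] ij S(2) assms(2) sub_carr by (simp add: expand subsetD)
  then show ?thesis using that ij hs assms(2) by (metis sub_inv sub_mult)
qed

text \<open>Among the multiples of \<open>k\<close> by \<open>0, ..., card S\<close> two lie in one
  coset, so that \<open>d k\<close> is in \<open>H\<close> for some positive
  \<open>d \<le> card S\<close>.\<close>

lemma almost_le_exponent:
  assumes "almost_le G K H" "subgroup H G" "subgroup K G"
  shows "\<exists>e::int. e > 0 \<and> (\<forall>k\<in>K. k [^] e \<in> H)"
proof -
  obtain S where S: "finite S" "S \<subseteq> carrier G" "\<And>k. k \<in> K \<Longrightarrow> \<exists>h\<in>H. \<exists>s\<in>S. k = h \<otimes> s"
    using almost_leD[OF assms(1)] by blast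
  \<comment> \<open>Divisible by every difference that the pigeonhole argument can produce, hence
    independent of \<open>k\<close>.\<close>
  define e where "e = (fact (card S) :: int)"
  have e: "k [^] e \<in> H" if k: "k \<in> K" for k
  proof -
    have "\<exists>h s. h \<in> H \<and> s \<in> S \<and> k [^] int n = h \<otimes> s" for n
      using S(3)[OF sub_pow[OF assms(3) k]] by blast
    then obtain h s where hs: "\<And>n::nat. h n \<in> H \<and> s n \<in> S \<and> k [^] int n = h n \<otimes> s n"
      by metis
    have "\<not> inj_on s {0..card S}"
    proof
      assume "inj_on s {0..card S}"
      then have "card {0..card S} \<le> card S" using hs S(1) by (intro card_inj_on_le[of s]) auto
      then show False by simp
    qed
    then obtain a b where ab: "a \<le> card S" "b \<le> card S" "s a = s b" "a \<noteq> b"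
      by (auto simp: inj_on_def)
    define i j where "i = min a b" and "j = max a b"
    have ij: "i < j" "j \<le> card S" "s i = s j"
      using ab by (auto simp: i_def j_def min_def max_def)
    have "k [^] (int j - int i) = h j \<otimes> inv (h i)"
      using hs[of i] hs[of j] ij S(2) assms(2,3) sub_carr k by (simp add: expand subsetD)
    then have "k [^] (int j - int i) \<in> H" using hs assms(2) by (simp add: sub_intros)
    moreover have "int (j - i) dvd e"
    proof -
      have "(j - i) dvd fact (card S)" using ij by (intro dvd_fact) auto
      then show ?thesis unfolding e_def by (metis of_nat_dvd_iff of_nat_fact)
    qed
    then obtain q where "e = (int j - int i) * q" using ij by (auto simp: of_nat_diff elim: dvdE)
    ultimately show ?thesis
      using sub_pow[OF assms(2), of "k [^] (int j - int i)" q] sub_carr[OF assms(3) k] by (simp add: int_pow_pow)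
  qed
  have "e > 0" by (simp add: e_def)
  then show ?thesis using e by blast
qed

lemma almost_le_one_iff:
  assumes "K \<subseteq> carrier G"
  shows "almost_le G K {\<one>} \<longleftrightarrow> finite K"
proof
  assume *: "almost_le G K {\<one>}"
  obtain S where S: "finite S" "S \<subseteq> carrier G" "\<And>k. k \<in> K \<Longrightarrow> \<exists>h\<in>{\<one>}. \<exists>s\<in>S. k = h \<otimes> s"
    using almost_leD[OF *] by blast
  have "K \<subseteq> S" using S by fastforce
  then show "finite K" using S(1) finite_subset by blast
next
  assume "finite K"
  then show "almost_le G K {\<one>}" using assms by (intro almost_leI[of K]) (force dest: subsetD)+
qed

end

section \<open>Inertial maps on torsion groups\<close>

text \<open>The subgroup generated by \<open>x\<close> and \<open>g x\<close> meets \<open>E\<close>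
  trivially, spelled out by coefficients. It is verified below by placing \<open>x\<close> and
  \<open>g x\<close> in a subgroup that avoids \<open>E\<close>.\<close>

definition independent_pair :: "('a, 'b) monoid_scheme \<Rightarrow> ('a \<Rightarrow> 'a) \<Rightarrow> 'a set \<Rightarrow> 'a \<Rightarrow> bool" where
  "independent_pair G g E x \<longleftrightarrow> (\<forall>(a::int) (b::int). x [^]\<^bsub>G\<^esub> a \<otimes>\<^bsub>G\<^esub> g x [^]\<^bsub>G\<^esub> b \<in> E \<longrightarrow>
     x [^]\<^bsub>G\<^esub> a \<otimes>\<^bsub>G\<^esub> g x [^]\<^bsub>G\<^esub> b = \<one>\<^bsub>G\<^esub>)"

context comm_group
begin

lemma hom_pow:
  assumes "g \<in> hom G G" "x \<in> carrier G"
  shows "g (x [^] (k::int)) = g x [^] k"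
  using assms by (simp add: hom_int_pow)

lemma hom_inv':
  assumes "g \<in> hom G G" "x \<in> carrier G"
  shows "g (inv x) = inv (g x)"
  using hom_pow[OF assms, of "-1"] assms by (simp add: int_pow_neg hom_in_carrier)

lemma hom_one': "g \<in> hom G G \<Longrightarrow> g \<one> = \<one>"
  by (simp add: hom_one)

lemma iso_hom: "g \<in> iso G G \<Longrightarrow> g \<in> hom G G"
  by (simp add: iso_def)

lemma iso_inj: "g \<in> iso G G \<Longrightarrow> inj_on g (carrier G)"
  by (simp add: iso_def bij_betw_def)

lemma iso_surj: "g \<in> iso G G \<Longrightarrow> g ` carrier G = carrier G"
  by (simp add: iso_def bij_betw_def)

lemma iso_eq_one:
  assumes "g \<in> iso G G" "x \<in> carrier G" "g x = \<one>" shows "x = \<one>"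
  using inj_onD[OF iso_inj[OF assms(1)], of x \<one>] assms hom_one'[OF iso_hom[OF assms(1)]] by simp

lemma hom_image_subgroup:
  assumes "g \<in> hom G G" "subgroup H G" shows "subgroup (g ` H) G"
proof (rule subgroupI')
  note hc = hom_in_carrier[OF assms(1)] sub_carr[OF assms(2)]
  show "g ` H \<subseteq> carrier G" using hc by auto
  show "\<one> \<in> g ` H" using hom_one'[OF assms(1)] sub_one[OF assms(2)] by (metis image_eqI)
  fix x y assume "x \<in> g ` H" "y \<in> g ` H"
  then obtain a b where ab: "a \<in> H" "b \<in> H" "x = g a" "y = g b" by blast
  have "x \<otimes> inv y = g (a \<otimes> inv b)"
    using ab hc assms by (simp add: hom_mult hom_inv')
  then show "x \<otimes> inv y \<in> g ` H" using ab assms(2) by (blast intro: sub_intros)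
qed

lemma hom_vimage_subgroup:
  assumes "g \<in> hom G G" "subgroup H G" "subgroup M G" shows "subgroup {x\<in>M. g x \<in> H} G"
proof (rule subgroupI')
  note sc = sub_carr[OF assms(3)]
  show "{x\<in>M. g x \<in> H} \<subseteq> carrier G" using sc by auto
  show "\<one> \<in> {x\<in>M. g x \<in> H}" using hom_one'[OF assms(1)] sub_one assms by simp
  fix x y assume "x \<in> {x\<in>M. g x \<in> H}" "y \<in> {x\<in>M. g x \<in> H}"
  then show "x \<otimes> inv y \<in> {x\<in>M. g x \<in> H}"
    using assms sc by (simp add: hom_mult hom_inv' sub_intros)
qed

lemma pow_hom: "(\<lambda>x. x [^] (k::int)) \<in> hom G G"
  by (simp add: hom_def int_pow_distrib)

text \<open>\<open>g\<close> induces an injection from cosets of the preimage of \<open>C\<close> to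
  cosets of \<open>C\<close>; pulling back representatives of the latter gives representatives of
  the former.\<close>

lemma almost_le_vimage:
  assumes "almost_le G (g ` K) C" "g \<in> hom G G" "subgroup C G" "K \<subseteq> M" "subgroup M G"
  shows "almost_le G K {x\<in>M. g x \<in> C}"
proof -
  note sc = sub_carr[OF assms(5)] sub_carr[OF assms(3)] hom_in_carrier[OF assms(2)]
  have gK: "g ` K \<subseteq> carrier G" using assms(4) sc by auto
  obtain S where S: "finite S" "S \<subseteq> g ` K" "\<forall>k\<in>g ` K. \<exists>h\<in>C. \<exists>s\<in>S. k = h \<otimes> s"
    using almost_leD'[OF assms(1,3) gK] by blast
  obtain r where r: "\<And>s. s \<in> S \<Longrightarrow> r s \<in> K \<and> g (r s) = s"
  proof -
    have "\<forall>s\<in>S. \<exists>x. x \<in> K \<and> g x = s" using S(2) by blast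
    then show ?thesis using bchoice[of S "\<lambda>s x. x \<in> K \<and> g x = s"] that by blast
  qed
  show ?thesis
  proof (rule almost_leI)
    show "finite (r ` S)" using S by simp
    show "r ` S \<subseteq> carrier G" using r assms(4) sc by blast
    fix k assume k: "k \<in> K"
    then obtain h s where hs: "h \<in> C" "s \<in> S" "g k = h \<otimes> s" using S(3) by blast
    have c: "k \<in> carrier G" "r s \<in> carrier G" "k \<in> M" "r s \<in> M" using k r hs assms(4) sc by auto
    have "s \<in> carrier G" using r[OF hs(2)] c sc by metis
    then have "g (k \<otimes> inv (r s)) = h"
      using c hs r[OF hs(2)] sc assms(2) by (simp add: hom_mult hom_inv' m_assoc)
    then have "k \<otimes> inv (r s) \<in> {x\<in>M. g x \<in> C}" using hs c assms(5) by (simp add: sub_intros)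
    moreover have "k = (k \<otimes> inv (r s)) \<otimes> r s" using c by simp
    ultimately show "\<exists>h\<in>{x \<in> M. g x \<in> C}. \<exists>s\<in>r ` S. k = h \<otimes> s" using hs by blast
  qed
qed

lemma almost_le_image:
  assumes "almost_le G K C" "g \<in> hom G G" "C \<subseteq> carrier G"
  shows "almost_le G (g ` K) (g ` C)"
proof -
  obtain S where S: "finite S" "S \<subseteq> carrier G" "\<forall>k\<in>K. \<exists>h\<in>C. \<exists>s\<in>S. k = h \<otimes> s"
    using almost_leD[OF assms(1)] by blast
  show ?thesis
  proof (rule almost_leI)
    show "finite (g ` S)" "g ` S \<subseteq> carrier G" using S hom_in_carrier[OF assms(2)] by auto
    fix y assume "y \<in> g ` K"
    then obtain k where "k \<in> K" "y = g k" by blast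
    then obtain h s where hs: "h \<in> C" "s \<in> S" "k = h \<otimes> s" using S by blast
    have "y = g h \<otimes> g s" using hs \<open>y = g k\<close> assms S by (simp add: hom_mult subsetD)
    then show "\<exists>h\<in>g ` C. \<exists>s\<in>g ` S. y = h \<otimes> s" using hs by blast
  qed
qed

lemma torsion_iff: "x \<in> torsion_subgroup G \<longleftrightarrow> x \<in> carrier G \<and> (\<exists>n::int. n > 0 \<and> x [^] n = \<one>)"
proof -
  have "(\<exists>n::nat. n > 0 \<and> x [^] n = \<one>) \<longleftrightarrow> (\<exists>n::int. n > 0 \<and> x [^] n = \<one>)"
    by (metis int_pow_int of_nat_0_less_iff zero_less_imp_eq_int)
  then show ?thesis by (auto simp: torsion_subgroup_def)
qed

lemma torsionI: "x \<in> carrier G \<Longrightarrow> n \<noteq> 0 \<Longrightarrow> x [^] (n::int) = \<one> \<Longrightarrow> x \<in> torsion_subgroup G"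
  unfolding torsion_iff by (metis abs_dvd_iff dvd_refl pow_dvd_one zero_less_abs_iff)

lemma torsion_subgroup: "subgroup (torsion_subgroup G) G"
proof (rule subgroupI')
  show "torsion_subgroup G \<subseteq> carrier G" by (auto simp: torsion_subgroup_def)
  show "\<one> \<in> torsion_subgroup G" by (rule torsionI[of _ 1]) auto
  fix x y assume "x \<in> torsion_subgroup G" "y \<in> torsion_subgroup G"
  then obtain m n :: int where *: "x \<in> carrier G" "y \<in> carrier G" "m > 0" "n > 0" "x [^] m = \<one>" "y [^] n = \<one>"
    unfolding torsion_iff by blast
  have "x [^] (m * n) = \<one>" "y [^] (m * n) = \<one>"
    using * pow_dvd_one[of x m "m * n"] pow_dvd_one[of y n "m * n"] by auto
  then have "(x \<otimes> inv y) [^] (m * n) = \<one>" using * by (simp add: int_pow_distrib int_pow_inv)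
  then show "x \<otimes> inv y \<in> torsion_subgroup G" using * by (intro torsionI[of _ "m * n"]) auto
qed

lemmas torsion_carr = sub_carr[OF torsion_subgroup]

lemma adjoin_finite':
  assumes "subgroup E G" "finite E" "x \<in> torsion_subgroup G"
  shows "finite (adjoin G E x)"
proof -
  obtain n :: int where "n > 0" "x [^] n = \<one>" using assms torsion_iff by blast
  then show ?thesis using adjoin_finite[of E x n] assms sub_carr torsion_carr by blast
qed

text \<open>Adjoining torsion elements one at a time keeps a subgroup finite.\<close>

lemma finite_generate_torsion:
  assumes "finite S" "S \<subseteq> M" "M \<subseteq> torsion_subgroup G" "subgroup M G"
  obtains E where "subgroup E G" "finite E" "S \<subseteq> E" "E \<subseteq> M"
proof -
  have "\<exists>E. subgroup E G \<and> finite E \<and> S \<subseteq> E \<and> E \<subseteq> M"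
    using assms(1,2)
  proof (induction S)
    case empty
    then show ?case using subgroup_one_set assms(4) sub_one by blast
  next
    case (insert x S)
    then obtain E where E: "subgroup E G" "finite E" "S \<subseteq> E" "E \<subseteq> M" by auto
    have x: "x \<in> torsion_subgroup G" "x \<in> M" using insert assms by auto
    have "insert x S \<subseteq> adjoin G E x"
      using E adjoin_self[OF E(1) torsion_carr[OF x(1)]] adjoin_base[of E x] sub_carr[OF E(1)] by blast
    then show ?case
      using adjoin_subgroup[OF E(1) torsion_carr[OF x(1)]] adjoin_finite'[OF E(1,2) x(1)]
        adjoin_least[OF assms(4) E(4) x(2)] by blast
  qed
  then show ?thesis using that by blast
qed

lemma hom_torsion:
  assumes "g \<in> hom G G" "x \<in> torsion_subgroup G" shows "g x \<in> torsion_subgroup G"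
  using assms hom_pow[OF assms(1)] hom_one'[OF assms(1)] hom_in_carrier[OF assms(1)]
  unfolding torsion_iff by metis

lemma inertial_iso: "inertial_map G g \<Longrightarrow> g \<in> iso G G"
  by (simp add: inertial_map_def)

lemma inertial_hom: "inertial_map G g \<Longrightarrow> g \<in> hom G G"
  by (simp add: inertial_map_def iso_def)

lemma inertial_almost_le: "inertial_map G g \<Longrightarrow> subgroup H G \<Longrightarrow> almost_le G (g ` H) H"
  by (simp add: inertial_map_def)

text \<open>Failure of this statement would produce an infinite sequence \<open>x\<^sub>i\<close> such that the sum of the
  subgroups generated by the pairs \<open>x\<^sub>i, g x\<^sub>i\<close> is direct and \<open>g x\<^sub>i\<close> is no power of \<open>x\<^sub>i\<close>. Then
  the \<open>g x\<^sub>i\<close> are pairwise incongruent modulo the subgroup generated by all \<open>x\<^sub>i\<close>.\<close>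

lemma inertial_power_off_finite:
  assumes g: "inertial_map G g"
  shows "\<exists>E. subgroup E G \<and> finite E \<and> E \<subseteq> torsion_subgroup G \<and>
      (\<forall>x\<in>torsion_subgroup G. independent_pair G g E x \<longrightarrow> power_on G g {x})"
proof (rule ccontr)
  assume contr: "\<not> ?thesis"
  let ?T = "torsion_subgroup G"
  note gh = inertial_hom[OF g]
  define bad where "bad E x \<longleftrightarrow> x \<in> ?T \<and> independent_pair G g E x \<and> \<not> power_on G g {x}" for E x
  have "\<exists>x. bad E x" if "subgroup E G" "finite E" "E \<subseteq> ?T" for E
    using contr that unfolding bad_def by blast
  then have "bad E (SOME x. bad E x)" if "subgroup E G" "finite E" "E \<subseteq> ?T" for E
    using that someI_ex[of "bad E"] by blast
  then obtain f where f: "\<And>E. subgroup E G \<Longrightarrow> finite E \<Longrightarrow> E \<subseteq> ?T \<Longrightarrow> bad E (f E)" by (rule that)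
  \<comment> \<open>\<open>E n\<close> contains \<open>x i\<close> and \<open>g (x i)\<close> for
    all \<open>i < n\<close>, so that the next element is independent of all earlier pairs.\<close>
  define E where "E = rec_nat {\<one>} (\<lambda>_ E. adjoin G (adjoin G E (f E)) (g (f E)))"
  define x where "x n = f (E n)" for n
  have E0: "E 0 = {\<one>}" and ES: "E (Suc n) = adjoin G (adjoin G (E n) (x n)) (g (x n))" for n
    by (simp_all add: E_def x_def)
  have E: "subgroup (E n) G \<and> finite (E n) \<and> E n \<subseteq> ?T" for n
  proof (induction n)
    case 0
    then show ?case using E0 subgroup_one_set sub_one[OF torsion_subgroup] by auto
  next
    case (Suc n)
    then have xT: "x n \<in> ?T" using f[of "E n"] by (auto simp: bad_def x_def)
    then have gT: "g (x n) \<in> ?T" using hom_torsion gh by blast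
    have s1: "subgroup (adjoin G (E n) (x n)) G" "finite (adjoin G (E n) (x n))" "adjoin G (E n) (x n) \<subseteq> ?T"
      using Suc adjoin_subgroup xT torsion_carr adjoin_finite' adjoin_least[OF torsion_subgroup] by auto
    then show ?case
      unfolding ES using adjoin_subgroup gT torsion_carr adjoin_finite' adjoin_least[OF torsion_subgroup] by auto
  qed
  have bad: "bad (E n) (x n)" for n using f E by (simp add: x_def)
  have xc: "x n \<in> carrier G" "g (x n) \<in> carrier G" for n
    using bad[of n] torsion_carr hom_in_carrier[OF gh] by (auto simp: bad_def)
  have sub1: "subgroup (adjoin G (E n) (x n)) G" for n using adjoin_subgroup E xc by blast
  have Esub: "E n \<subseteq> E (Suc n)" "x n \<in> E (Suc n)" "g (x n) \<in> E (Suc n)" for n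
    unfolding ES using adjoin_base[of "adjoin G (E n) (x n)"] adjoin_base[of "E n" "x n"]
      adjoin_self[of "E n" "x n"] adjoin_self[OF sub1[of n] xc(2)[of n]] E[of n] sub1[of n] xc[of n]
    by (meson sub_carr subset_eq)+
  have Emono: "E m \<subseteq> E n" if "m \<le> n" for m n using lift_Suc_mono_le[of E, OF Esub(1) that] .
  \<comment> \<open>Only the \<open>x i\<close> enter here. The union of the \<open>H n\<close> is
    the subgroup on which the inertial property is tested.\<close>
  define H where "H = rec_nat {\<one>} (\<lambda>n H. adjoin G H (x n))"
  have H0: "H 0 = {\<one>}" and HS: "H (Suc n) = adjoin G (H n) (x n)" for n by (simp_all add: H_def)
  have H: "subgroup (H n) G" for n
    by (induction n) (simp_all add: H0 HS subgroup_one_set adjoin_subgroup xc)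
  have Hsub: "H n \<subseteq> H (Suc n)" "x n \<in> H (Suc n)" for n
    unfolding HS using adjoin_base[of "H n"] adjoin_self[OF H] H sub_carr xc by (blast, blast)
  have Hmono: "H m \<subseteq> H n" if "m \<le> n" for m n using lift_Suc_mono_le[of H, OF Hsub(1) that] .
  have HE: "H n \<subseteq> E n" for n
  proof (induction n)
    case (Suc n)
    then show ?case unfolding HS using adjoin_least[of "E (Suc n)" "H n" "x n"] E Esub by blast
  qed (simp add: H0 E0)
  have HE': "y \<in> H n" if "y \<in> H m" "y \<in> E n" for y m n
    using that(1)
  proof (induction m)
    case 0
    then show ?case using H0 sub_one[OF H] by auto
  next
    case (Suc m)
    show ?case
    proof (cases "Suc m \<le> n")
      case True
      then show ?thesis using Hmono Suc.prems by blast
    next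
      case False
      then have yE: "y \<in> E m" using that(2) Emono[of n m] by auto
      obtain h k where hk: "h \<in> H m" "y = h \<otimes> x m [^] (k::int)" using Suc.prems by (auto simp: HS adjoin_def)
      then have "x m [^] k \<in> E m"
        using sub_cancel[of "E m" h "x m [^] k"] E HE[of m] yE xc by (auto simp: subsetD)
      then have "x m [^] k \<otimes> g (x m) [^] (0::int) = \<one>"
        using bad[of m] xc unfolding bad_def independent_pair_def by (metis int_pow_0 int_pow_closed r_one)
      then have "y = h" using hk xc sub_carr[OF H hk(1)] by auto
      then show ?thesis using Suc.IH hk by simp
    qed
  qed
  have U: "subgroup (\<Union>n. H n) G" using subgroup_UN_chain[of H] H Hsub by blast
  obtain i j where ij: "i < j" "g (x j) \<otimes> inv g (x i) \<in> (\<Union>n. H n)"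
  proof (rule almost_le_pigeonhole[OF inertial_almost_le[OF g U] U, of "\<lambda>n. g (x n)"])
    show "g (x n) \<in> g ` (\<Union>n. H n)" for n using Hsub by blast
  qed
  have gE: "g (x i) \<in> E j" using Esub(3)[of i] Emono[of "Suc i" j] ij by auto
  then have "g (x j) \<otimes> inv g (x i) \<in> E (Suc j)"
    using Esub[of j] E[of "Suc j"] by (blast intro: sub_intros)
  then have "g (x j) \<otimes> inv g (x i) \<in> H (Suc j)" using HE' ij by blast
  then obtain h k where hk: "h \<in> H j" "g (x j) \<otimes> inv g (x i) = h \<otimes> x j [^] (k::int)"
    by (auto simp: HS adjoin_def)
  have hc: "h \<in> carrier G" using hk H sub_carr by blast
  have e: "g (x j) = h \<otimes> x j [^] k \<otimes> g (x i)"
  proof -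
    have "g (x j) = (g (x j) \<otimes> inv g (x i)) \<otimes> g (x i)" using xc by (simp only: m_inv_cancel)
    then show ?thesis by (simp only: hk(2))
  qed
  \<comment> \<open>The right-hand side lies in \<open>E j\<close>, the left-hand side in the
    subgroup generated by \<open>x j\<close> and \<open>g (x j)\<close>. By independence both
    vanish, and \<open>g (x j)\<close> is a multiple of \<open>x j\<close>.\<close>
  have "x j [^] (-k) \<otimes> g (x j) [^] (1::int) = h \<otimes> g (x i)"
  proof -
    have "x j [^] (-k) \<otimes> (h \<otimes> x j [^] k \<otimes> g (x i)) = x j [^] (-k) \<otimes> (x j [^] k \<otimes> (h \<otimes> g (x i)))"
      using xc hc by (simp add: m_ac)
    also have "\<dots> = h \<otimes> g (x i)" using xc hc by (simp add: int_pow_neg)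
    finally show ?thesis unfolding int_pow_1[OF xc(2)] using e by simp
  qed
  moreover have "h \<otimes> g (x i) \<in> E j" using hk HE gE E by (blast intro: sub_intros)
  ultimately have "x j [^] (-k) \<otimes> g (x j) [^] (1::int) = \<one>" using bad[of j] unfolding bad_def independent_pair_def by metis
  then have "x j [^] k \<otimes> (inv (x j [^] k) \<otimes> g (x j)) = x j [^] k \<otimes> \<one>" using xc[of j]
    by (simp add: int_pow_neg)
  then have "g (x j) = x j [^] k" using xc[of j] by simp
  then show False using bad[of j] unfolding bad_def power_on_def by blast
qed

lemma subgroup_Union_chain:
  assumes "\<C> \<noteq> {}" "\<And>C. C \<in> \<C> \<Longrightarrow> subgroup C G" "\<And>C D. C \<in> \<C> \<Longrightarrow> D \<in> \<C> \<Longrightarrow> C \<subseteq> D \<or> D \<subseteq> C"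
  shows "subgroup (\<Union>\<C>) G"
proof (rule subgroupI')
  show "\<Union>\<C> \<subseteq> carrier G" using assms(2) sub_carr by blast
  show "\<one> \<in> \<Union>\<C>" using assms(1,2) sub_one by blast
  fix x y assume "x \<in> \<Union>\<C>" "y \<in> \<Union>\<C>"
  then obtain C where "C \<in> \<C>" "x \<in> C" "y \<in> C" using assms(3) by blast
  then show "x \<otimes> inv y \<in> \<Union>\<C>" using sub_mult[of C] sub_inv[of C] assms(2) by blast
qed

text \<open>Zorn's lemma, with maximality stated element by element. A finite \<open>E\<close> leads
  to a quotient with finite socle, a divisible \<open>E\<close> to a direct complement, and the
  torsion subgroup as \<open>E\<close> to a torsion-free subgroup with torsion quotient.\<close>

lemma max_disjoint_subgroup:
  assumes "subgroup B G"
  obtains C where "subgroup C G" "C \<subseteq> B" "C \<inter> E \<subseteq> {\<one>}"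
    "\<forall>x\<in>B - C. \<exists>c\<in>C. \<exists>k::int. c \<otimes> x [^] k \<in> E \<and> c \<otimes> x [^] k \<noteq> \<one>"
proof -
  define \<A> where "\<A> = {C. subgroup C G \<and> C \<subseteq> B \<and> C \<inter> E \<subseteq> {\<one>}}"
  have "\<exists>M\<in>\<A>. (\<forall>D\<in>\<A>. (M \<subseteq> D \<longrightarrow> D = M))"
  proof (rule subset_Zorn_nonempty)
    have "{\<one>} \<in> \<A>" unfolding \<A>_def using subgroup_one_set assms sub_one by auto
    then show "\<A> \<noteq> {}" by blast
    fix \<C> assume c: "\<C> \<noteq> {}" "subset.chain \<A> \<C>"
    have *: "\<C> \<subseteq> \<A>" "\<And>C D. C \<in> \<C> \<Longrightarrow> D \<in> \<C> \<Longrightarrow> C \<subseteq> D \<or> D \<subseteq> C"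
      using c(2) by (auto simp: subset.chain_def)
    have "subgroup (\<Union>\<C>) G"
      by (rule subgroup_Union_chain[OF c(1) _ *(2)]) (use * in \<open>auto simp: \<A>_def\<close>)
    then show "\<Union>\<C> \<in> \<A>" using c unfolding \<A>_def by (auto simp: subset.chain_def)
  qed
  then obtain C where CA: "C \<in> \<A>" and max: "\<forall>D\<in>\<A>. C \<subseteq> D \<longrightarrow> D = C" by blast
  have C: "subgroup C G" "C \<subseteq> B" "C \<inter> E \<subseteq> {\<one>}" using CA by (auto simp: \<A>_def)
  show ?thesis
  proof (rule that[OF C], rule ballI)
    fix x assume "x \<in> B - C"
    then have x: "x \<in> B" "x \<notin> C" by auto
    have xc: "x \<in> carrier G" using x assms sub_carr by blast
    have "C \<subseteq> adjoin G C x" using adjoin_base[of C x] sub_carr[OF C(1)] by blast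
    then have "adjoin G C x \<notin> \<A>" using max adjoin_self[OF C(1) xc] x by blast
    then have "\<not> adjoin G C x \<inter> E \<subseteq> {\<one>}"
      using adjoin_subgroup[OF C(1) xc] adjoin_least[OF assms C(2) x(1)] by (auto simp: \<A>_def)
    then show "\<exists>c\<in>C. \<exists>k::int. c \<otimes> x [^] k \<in> E \<and> c \<otimes> x [^] k \<noteq> \<one>"
      by (auto simp: adjoin_def)
  qed
qed

end

section \<open>Primary groups\<close>

hide_const (open) Divisibility.prime

definition p_subgroup :: "('a, 'b) monoid_scheme \<Rightarrow> int \<Rightarrow> 'a set \<Rightarrow> bool" where
  "p_subgroup G p P \<longleftrightarrow> prime p \<and> subgroup P G \<and> P \<subseteq> primary G p"

definition p_divisible :: "('a, 'b) monoid_scheme \<Rightarrow> int \<Rightarrow> 'a set \<Rightarrow> bool" where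
  "p_divisible G p D \<longleftrightarrow> (\<forall>x\<in>D. \<exists>y\<in>D. x = y [^]\<^bsub>G\<^esub> p)"

text \<open>The elements of order dividing \<open>p\<close> in the quotient \<open>P/C\<close> form a finite group.\<close>

definition finite_socle :: "('a, 'b) monoid_scheme \<Rightarrow> int \<Rightarrow> 'a set \<Rightarrow> 'a set \<Rightarrow> bool" where
  "finite_socle G p P C \<longleftrightarrow> subgroup C G \<and> C \<subseteq> P \<and> almost_le G {x\<in>P. x [^]\<^bsub>G\<^esub> p \<in> C} C"

context comm_group
begin

lemma p_subgroup_carr: "p_subgroup G p P \<Longrightarrow> x \<in> P \<Longrightarrow> x \<in> carrier G"
  by (auto simp: p_subgroup_def primary_def)

lemma p_subgroup_ord: "p_subgroup G p P \<Longrightarrow> x \<in> P \<Longrightarrow> \<exists>n. x [^] (p ^ n) = \<one>"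
  by (auto simp: p_subgroup_def primary_def)

lemma p_subgroup_sub: "p_subgroup G p P \<Longrightarrow> subgroup C G \<Longrightarrow> C \<subseteq> P \<Longrightarrow> p_subgroup G p C"
  by (auto simp: p_subgroup_def)

lemma pow_p_mono:
  assumes "x \<in> carrier G" "x [^] (p ^ m) = \<one>" "m \<le> n" shows "x [^] ((p::int) ^ n) = \<one>"
  using pow_dvd_one[OF assms(1,2)] assms(3) by (simp add: le_imp_power_dvd)

lemma primary_torsion: "prime p \<Longrightarrow> primary G p \<subseteq> torsion_subgroup G"
  by (auto simp: primary_def intro!: torsionI[of _ "p ^ _"])

lemma primary_subgroup: "subgroup (primary G p) G"
proof (rule subgroupI')
  show "primary G p \<subseteq> carrier G" by (auto simp: primary_def)
  show "\<one> \<in> primary G p" by (simp add: primary_def)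
  fix x y assume "x \<in> primary G p" "y \<in> primary G p"
  then obtain m n where *: "x \<in> carrier G" "y \<in> carrier G" "x [^] (p ^ m) = \<one>" "y [^] (p ^ n) = \<one>"
    by (auto simp: primary_def)
  have "x [^] (p ^ (m + n)) = \<one>" "y [^] (p ^ (m + n)) = \<one>"
    using * pow_p_mono[of x p m "m + n"] pow_p_mono[of y p n "m + n"] by auto
  then have "(x \<otimes> inv y) [^] (p ^ (m + n)) = \<one>" using * by (simp add: int_pow_distrib int_pow_inv)
  then show "x \<otimes> inv y \<in> primary G p" using * by (auto simp: primary_def)
qed

lemma p_subgroup_primary: "prime p \<Longrightarrow> p_subgroup G p (primary G p)"
  by (simp add: p_subgroup_def primary_subgroup)

lemma hom_primary:
  assumes "g \<in> hom G G" shows "g ` primary G p \<subseteq> primary G p"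
proof
  fix y assume "y \<in> g ` primary G p"
  then obtain x n where x: "x \<in> carrier G" "x [^] (p ^ n) = \<one>" "y = g x" by (auto simp: primary_def)
  then have "y [^] (p ^ n) = \<one>" using hom_pow[OF assms, of x "p ^ n"] hom_one'[OF assms] by simp
  then show "y \<in> primary G p" using hom_in_carrier[OF assms] x by (auto simp: primary_def)
qed

lemma pow_gcd_mem:
  assumes "subgroup H G" "x \<in> carrier G" "x [^] a \<in> H" "x [^] b \<in> H" shows "x [^] (gcd a b :: int) \<in> H"
proof -
  obtain u v where "u * a + v * b = gcd a b" using bezout_int by blast
  then have "x [^] (gcd a b) = (x [^] a) [^] u \<otimes> (x [^] b) [^] v"
    using assms(2) by (metis int_pow_mult int_pow_pow mult.commute)
  then show ?thesis using assms by (simp add: sub_intros)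
qed

lemma gcd_primepow:
  assumes "prime (p::int)" "\<not> p ^ n dvd k"
  shows "\<exists>i<n. gcd k (p ^ n) = p ^ i"
proof -
  have "gcd k (p ^ n) dvd p ^ n" by simp
  from divides_primepow[OF assms(1) this]
  obtain i where i: "i \<le> n" "normalize (gcd k (p ^ n)) = p ^ i" .
  then have *: "gcd k (p ^ n) = p ^ i" by simp
  have "i \<noteq> n"
  proof
    assume "i = n"
    then have "gcd k (p ^ n) = p ^ n" using * by simp
    then show False using assms(2) gcd_dvd1[of k "p ^ n"] by simp
  qed
  then show ?thesis using i * by (intro exI[of _ i]) auto
qed

text \<open>Otherwise the gcd of \<open>k\<close> and \<open>p ^ Suc n\<close> would be a smaller
  power of \<open>p\<close> that still carries \<open>x\<close> into \<open>H\<close>, although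
  \<open>x\<close> has order \<open>p ^ Suc n\<close> modulo \<open>H\<close>.\<close>

lemma pow_mem_dvd:
  assumes "prime p" "subgroup H G" "x \<in> carrier G" "x [^] (p ^ Suc n) \<in> H" "x [^] (p ^ n) \<notin> H" "x [^] (k::int) \<in> H"
  shows "p ^ Suc n dvd k"
proof (rule ccontr)
  assume "\<not> p ^ Suc n dvd k"
  then obtain i where i: "i < Suc n" "gcd k (p ^ Suc n) = p ^ i" using gcd_primepow[OF assms(1)] by blast
  then have "x [^] (p ^ i) \<in> H" using pow_gcd_mem[OF assms(2,3,6,4)] by simp
  then have "(x [^] (p ^ i)) [^] (p ^ (n - i)) \<in> H" using assms(2) by (rule sub_pow[rotated])
  moreover have "p ^ i * p ^ (n - i) = p ^ n" using i by (simp flip: power_add)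
  ultimately show False using assms(3,5) by (simp add: int_pow_pow)
qed

lemma pow_one_dvd:
  assumes "prime p" "x \<in> carrier G" "x [^] (p ^ Suc n) = \<one>" "x [^] (p ^ n) \<noteq> \<one>" "x [^] (k::int) = \<one>"
  shows "p ^ Suc n dvd k"
  using pow_mem_dvd[OF assms(1) subgroup_one_set assms(2), of n k] assms by simp

lemma coprime_pow_mem:
  assumes "subgroup H G" "x \<in> carrier G" "x [^] (a::int) \<in> H" "x [^] b \<in> H" "coprime a b"
  shows "x \<in> H"
  using pow_gcd_mem[OF assms(1-4)] assms(2,5) by simp

lemma coprime_pow_one:
  assumes "x \<in> carrier G" "x [^] (a::int) = \<one>" "x [^] b = \<one>" "coprime a b"
  shows "x = \<one>"
  using coprime_pow_mem[OF subgroup_one_set assms(1)] assms by simp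

lemma prime_not_dvd_coprime: "prime (p::int) \<Longrightarrow> \<not> p dvd k \<Longrightarrow> coprime k (p ^ n)"
  using prime_imp_coprime[of p k] by (simp add: coprime_commute)

text \<open>Let \<open>x\<close> lie outside \<open>C\<close> with \<open>p x\<close> in
  \<open>C\<close>. Maximality puts some nonzero \<open>c + k x\<close> into \<open>E\<close>, and
  \<open>k\<close> is prime to \<open>p\<close> since otherwise \<open>c + k x\<close> would lie in
  \<open>C\<close>. Multiplying by an inverse of \<open>k\<close> modulo \<open>p\<close> shows that
  \<open>x\<close> is congruent to a multiple of an element of \<open>E\<close>.\<close>

lemma finite_socle_max:
  assumes P: "p_subgroup G p P" and E: "finite E" "E \<subseteq> carrier G"
    and C: "subgroup C G" "C \<subseteq> P" "C \<inter> E \<subseteq> {\<one>}"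
    and max: "\<forall>x\<in>P - C. \<exists>c\<in>C. \<exists>k::int. c \<otimes> x [^] k \<in> E \<and> c \<otimes> x [^] k \<noteq> \<one>"
  shows "finite_socle G p P C"
proof -
  have "almost_le G {x\<in>P. x [^] p \<in> C} C"
  proof (rule almost_leI)
    obtain u0 where "u0 \<in> C" using sub_one[OF C(1)] by blast
    \<comment> \<open>Coefficients below \<open>p\<close> suffice because \<open>p x\<close> is in
      \<open>C\<close>; \<open>\<one>\<close> represents the elements of \<open>C\<close>
      itself.\<close>
    define E' where "E' = insert \<one> ((\<lambda>(e, u). e [^] u) ` (E \<times> {0..<p}))"
    have p: "p > 0" "prime p" using P prime_gt_0_int by (auto simp: p_subgroup_def)
    show "finite E'" using E by (simp add: E'_def)
    show "E' \<subseteq> carrier G" using E by (auto simp: E'_def)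
    fix x assume x: "x \<in> {x\<in>P. x [^] p \<in> C}"
    then have xc: "x \<in> carrier G" using p_subgroup_carr[OF P] by auto
    show "\<exists>h\<in>C. \<exists>s\<in>E'. x = h \<otimes> s"
    proof (cases "x \<in> C")
      case True
      then show ?thesis using xc by (intro bexI[of _ x] bexI[of _ \<one>]) (simp_all add: E'_def)
    next
      case False
      then obtain c k where ck: "c \<in> C" "c \<otimes> x [^] (k::int) \<in> E" "c \<otimes> x [^] k \<noteq> \<one>" using max x by blast
      have cc: "c \<in> carrier G" using sub_carr[OF C(1) ck(1)] .
      have "\<not> p dvd k"
      proof
        assume "p dvd k"
        then obtain q where "k = p * q" by blast
        then have "x [^] k \<in> C" using sub_pow[OF C(1), of "x [^] p" q] x xc by (simp add: int_pow_pow)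
        then have "c \<otimes> x [^] k \<in> C" using ck sub_mult[OF C(1)] by blast
        then show False using ck C(3) by blast
      qed
      then have "coprime k p" using prime_not_dvd_coprime[of p k 1] p by simp
      then obtain u w0 where u: "u * k + w0 * p = 1" using bezout_int[of k p] by auto
      \<comment> \<open>Reducing the inverse \<open>u\<close> of \<open>k\<close> modulo
        \<open>p\<close> keeps the representative in the finite set \<open>E'\<close>. The error is
        a multiple of \<open>p x\<close> and so lies in \<open>C\<close>.\<close>
      define v where "v = u mod p"
      obtain d where d: "u = v + p * d" by (metis v_def mod_mult_div_eq)
      define w where "w = - w0 - k * d"
      have w: "k * v = 1 + p * w" using u unfolding d by (simp add: w_def algebra_simps)
      let ?e = "(c \<otimes> x [^] k) [^] v"
      have "?e = c [^] v \<otimes> x [^] (k * v)" using cc xc by (simp add: int_pow_distrib int_pow_pow)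
      also have "\<dots> = c [^] v \<otimes> (x \<otimes> (x [^] p) [^] w)" using xc by (simp add: w int_pow_mult int_pow_pow)
      finally have e: "?e = c [^] v \<otimes> (x \<otimes> (x [^] p) [^] w)" .
      have "x = (inv (c [^] v) \<otimes> inv ((x [^] p) [^] w)) \<otimes> ?e"
        unfolding e using cc xc by (simp add: m_ac)
      moreover have "inv (c [^] v) \<otimes> inv ((x [^] p) [^] w) \<in> C"
        using sub_pow[OF C(1) ck(1), of v] sub_pow[OF C(1), of "x [^] p" w] x by (simp add: C(1) sub_mult sub_inv)
      moreover have "?e \<in> E'" using ck p by (auto simp: E'_def v_def intro!: image_eqI[of _ _ "(c \<otimes> x [^] k, v)"])
      ultimately show ?thesis by blast
    qed
  qed
  then show ?thesis using C by (simp add: finite_socle_def)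
qed

lemma finite_socle_self: "p_subgroup G p P \<Longrightarrow> finite_socle G p P P"
  using p_subgroup_carr[of p P]
  by (auto simp: finite_socle_def p_subgroup_def intro!: almost_le_refl)

lemma finite_socle_Int:
  assumes "p_subgroup G p P" "finite_socle G p P C" "finite_socle G p P C'"
  shows "finite_socle G p P (C \<inter> C')"
proof -
  have K: "{x\<in>P. x [^] p \<in> C \<inter> C'} \<subseteq> carrier G" using p_subgroup_carr[OF assms(1)] by auto
  have "almost_le G {x\<in>P. x [^] p \<in> C \<inter> C'} C" "almost_le G {x\<in>P. x [^] p \<in> C \<inter> C'} C'"
    using assms unfolding finite_socle_def by (auto intro: almost_le_mono)
  then have "almost_le G {x\<in>P. x [^] p \<in> C \<inter> C'} (C \<inter> C')"
    using almost_le_Int K assms unfolding finite_socle_def by blast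
  then show ?thesis using assms subgroup_Int by (auto simp: finite_socle_def)
qed

text \<open>\<open>g\<close> embeds the quotient of \<open>P\<close> by the preimage of
  \<open>C\<close> into \<open>P/C\<close>, so its socle is finite as well.\<close>

lemma finite_socle_vimage:
  assumes P: "p_subgroup G p P" and C: "finite_socle G p P C" and g: "g \<in> hom G G" "g ` P \<subseteq> P"
  shows "finite_socle G p P {x\<in>P. g x \<in> C}"
proof -
  have sC: "subgroup C G" and sP: "subgroup P G" using P C by (auto simp: finite_socle_def p_subgroup_def)
  have sV: "subgroup {x\<in>P. g x \<in> C} G" by (rule hom_vimage_subgroup[OF g(1) sC sP])
  let ?K = "{x\<in>P. x [^] p \<in> {x\<in>P. g x \<in> C}}"
  have "g ` ?K \<subseteq> {x\<in>P. x [^] p \<in> C}"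
    using g hom_pow[OF g(1)] p_subgroup_carr[OF P] by auto
  then have "almost_le G (g ` ?K) C" using C almost_le_mono unfolding finite_socle_def by blast
  then have "almost_le G ?K {x\<in>P. g x \<in> C}"
    by (rule almost_le_vimage[OF _ g(1) sC _ sP]) auto
  then show ?thesis using sV by (auto simp: finite_socle_def)
qed

text \<open>Multiplication by \<open>p\<close> maps each layer of \<open>P/C\<close> into the
  previous one, and its kernel is the finite socle.\<close>

lemma finite_socle_pow:
  assumes P: "p_subgroup G p P" and C: "finite_socle G p P C"
  shows "almost_le G {x\<in>P. x [^] (p ^ n) \<in> C} C"
proof (induction n)
  case 0
  have "{x \<in> P. x [^] p ^ 0 \<in> C} \<subseteq> C" using p_subgroup_carr[OF P] by auto
  then show ?case using C sub_carr[of C] by (intro almost_le_refl) (auto simp: finite_socle_def)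
next
  case (Suc n)
  have sC: "subgroup C G" and sP: "subgroup P G" using P C by (auto simp: finite_socle_def p_subgroup_def)
  let ?K = "{x\<in>P. x [^] (p ^ Suc n) \<in> C}"
  have "(\<lambda>x. x [^] p) ` ?K \<subseteq> {x\<in>P. x [^] (p ^ n) \<in> C}"
    using sub_pow[OF sP] p_subgroup_carr[OF P] by (auto simp: int_pow_pow)
  then have "almost_le G ((\<lambda>x. x [^] p) ` ?K) C" using Suc almost_le_mono by blast
  then have "almost_le G ?K {x\<in>P. x [^] p \<in> C}"
    by (rule almost_le_vimage[OF _ pow_hom sC _ sP]) auto
  moreover have "almost_le G {x\<in>P. x [^] p \<in> C} C" using C by (simp add: finite_socle_def)
  ultimately show ?case using almost_le_trans sub_carr[OF sC] by blast
qed

lemma p_divisible_pow: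
  assumes "p_divisible G p D" "D \<subseteq> carrier G" "x \<in> D"
  shows "\<exists>y\<in>D. x = y [^] (p ^ n)"
proof (induction n)
  case 0
  then show ?case using assms by force
next
  case (Suc n)
  then obtain y where y: "y \<in> D" "x = y [^] (p ^ n)" by blast
  then obtain z where z: "z \<in> D" "y = z [^] p" using assms by (auto simp: p_divisible_def)
  have "x = z [^] (p ^ Suc n)" using y z assms by (auto simp: int_pow_pow)
  then show ?case using z by blast
qed

text \<open>The descending chain \<open>p\<^sup>n P + C\<close> becomes stationary on the finitely many cosets of order \<open>p\<close>,
  and its limit term is divisible modulo \<open>C\<close>.\<close>

lemma finite_socle_divisible:
  assumes P: "p_subgroup G p P" and C: "finite_socle G p P C"
  obtains D where "subgroup D G" "C \<subseteq> D" "D \<subseteq> P" "\<forall>x\<in>D. \<exists>y\<in>D. \<exists>c\<in>C. x = y [^] p \<otimes> c" "almost_le G P D"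
proof -
  have sC: "subgroup C G" and CP: "C \<subseteq> P" and sP: "subgroup P G" using P C by (auto simp: finite_socle_def p_subgroup_def)
  note Pc = p_subgroup_carr[OF P]
  define D where "D n = {y [^] (p ^ n) \<otimes> c |y c. y \<in> P \<and> c \<in> C}" for n
  have D: "subgroup (D n) G" for n
  proof -
    have "D n = ((\<lambda>y. y [^] (p ^ n)) ` P) <#> C" unfolding D_def set_mult_def by blast
    then show ?thesis using mult_subgroups[OF hom_image_subgroup[OF pow_hom sP] sC] by simp
  qed
  have DP: "D n \<subseteq> P" for n unfolding D_def using sP CP by (auto intro!: sub_intros)
  have CD: "C \<subseteq> D n" for n
  proof
    fix c assume "c \<in> C"
    then have "c = \<one> [^] (p ^ n) \<otimes> c" using sub_carr[OF sC] by simp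
    then show "c \<in> D n" unfolding D_def using sub_one[OF sP] \<open>c \<in> C\<close> by blast
  qed
  have Dmono: "D n \<subseteq> D m" if "m \<le> n" for m n
  proof
    fix x assume "x \<in> D n"
    then obtain y c where yc: "y \<in> P" "c \<in> C" "x = y [^] (p ^ n) \<otimes> c" by (auto simp: D_def)
    have "p ^ n = p ^ (n - m) * p ^ m" using that by (simp flip: power_add)
    then have "x = (y [^] (p ^ (n - m))) [^] (p ^ m) \<otimes> c" using yc Pc by (simp add: int_pow_pow)
    then show "x \<in> D m" using yc sub_pow[OF sP] unfolding D_def by blast
  qed
  have K: "{x\<in>P. x [^] p \<in> C} \<subseteq> carrier G" using Pc by auto
  have al: "almost_le G {x\<in>P. x [^] p \<in> C} C" using C by (simp add: finite_socle_def)
  obtain S where S: "finite S" "S \<subseteq> {x\<in>P. x [^] p \<in> C}"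
    "\<forall>k\<in>{x\<in>P. x [^] p \<in> C}. \<exists>h\<in>C. \<exists>s\<in>S. k = h \<otimes> s"
    using almost_leD'[OF al sC K] by blast
  \<comment> \<open>The finite sets \<open>S \<inter> D n\<close> decrease; their cardinality is
    least at \<open>n0\<close>, and they are constant from there on.\<close>
  obtain n0 where n0: "\<And>n. card (S \<inter> D n0) \<le> card (S \<inter> D n)"
    using ex_has_least_nat[of "\<lambda>_. True" 0 "\<lambda>n. card (S \<inter> D n)"] by auto
  have stat: "s \<in> D n" if "s \<in> S" "s \<in> D n0" for s n
  proof (cases "n0 \<le> n")
    case True
    then have "S \<inter> D n = S \<inter> D n0"
      using n0[of n] Dmono[OF True] S(1) by (intro card_seteq) auto
    then show ?thesis using that by blast
  next
    case False
    then show ?thesis using Dmono[of n n0] that by auto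
  qed
  \<comment> \<open>Induction on the order of \<open>x\<close> modulo \<open>C\<close>. The multiple
    \<open>p ^ k x\<close> is congruent to some \<open>s\<close> that lies in every term of the
    chain, so \<open>s\<close> is congruent to \<open>p ^ Suc k u\<close> with \<open>u\<close> in
    \<open>D n0\<close>. Subtracting \<open>p u\<close> from \<open>x\<close> lowers the
    order.\<close>
  have div: "\<exists>y\<in>D n0. \<exists>c\<in>C. x = y [^] p \<otimes> c" if "x \<in> D n0" "x [^] (p ^ k) \<in> C" for x k
    using that
  proof (induction k arbitrary: x)
    case 0
    then have "x \<in> C" using sub_carr[OF D 0(1)] by simp
    then show ?case using sub_one[OF D] sub_carr[OF sC] by (intro bexI[of _ \<one>] bexI[of _ x]) auto
  next
    case (Suc k)
    have xP: "x \<in> P" "x \<in> carrier G" using Suc.prems DP Pc by auto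
    let ?z = "x [^] (p ^ k)"
    have zD: "?z \<in> D n0" "?z \<in> P" using sub_pow[OF D Suc.prems(1)] DP by blast+
    have "?z [^] p \<in> C" using Suc.prems xP by (simp add: int_pow_pow mult.commute)
    then obtain c s where cs: "c \<in> C" "s \<in> S" "?z = c \<otimes> s" using S(3) zD by blast
    have sP': "s \<in> carrier G" "c \<in> carrier G" using cs S Pc sub_carr[OF sC] by auto
    have "s \<in> D n0" using sub_cancel[OF D, of c n0 s] cs CD zD sP' by auto
    then have "s \<in> D (Suc k + n0)" using stat cs by blast
    then obtain t c' where t: "t \<in> P" "c' \<in> C" "s = t [^] (p ^ (Suc k + n0)) \<otimes> c'" by (auto simp: D_def)
    have tc: "t \<in> carrier G" "c' \<in> carrier G" using t Pc sub_carr[OF sC] by auto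
    let ?u = "t [^] (p ^ n0)"
    have uD: "?u \<in> D n0" using t(1) sub_one[OF sC] tc unfolding D_def by force
    have "(?u [^] p) [^] (p ^ k) = t [^] (p ^ (Suc k + n0))"
      using tc by (simp add: int_pow_pow power_add mult_ac)
    then have "(x \<otimes> inv (?u [^] p)) [^] (p ^ k) = c \<otimes> s \<otimes> inv (t [^] (p ^ (Suc k + n0)))"
      using xP tc cs by (simp add: int_pow_distrib int_pow_inv)
    also have "\<dots> = c \<otimes> c'" using tc sP' t(3) by (simp add: m_ac)
    finally have "(x \<otimes> inv (?u [^] p)) [^] (p ^ k) \<in> C" using cs t sub_mult[OF sC] by simp
    moreover have "x \<otimes> inv (?u [^] p) \<in> D n0"
      using Suc.prems uD by (simp add: sub_mult[OF D] sub_inv[OF D] sub_pow[OF D])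
    ultimately obtain y d where yd: "y \<in> D n0" "d \<in> C" "x \<otimes> inv (?u [^] p) = y [^] p \<otimes> d"
      using Suc.IH by blast
    have ydc: "y \<in> carrier G" "d \<in> carrier G" using yd sub_carr[OF D] sub_carr[OF sC] by auto
    have "x = (x \<otimes> inv (?u [^] p)) \<otimes> ?u [^] p" using xP tc by simp
    also have "\<dots> = (y \<otimes> ?u) [^] p \<otimes> d" unfolding yd(3) using ydc tc by (simp add: int_pow_distrib m_ac)
    finally show ?case using yd uD sub_mult[OF D] by blast
  qed
  have div': "\<forall>x\<in>D n0. \<exists>y\<in>D n0. \<exists>c\<in>C. x = y [^] p \<otimes> c"
  proof
    fix x assume x: "x \<in> D n0"
    obtain k where "x [^] (p ^ k) = \<one>" using p_subgroup_ord[OF P, of x] DP[of n0] x by blast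
    then have "x [^] (p ^ k) \<in> C" using sub_one[OF sC] by simp
    then show "\<exists>y\<in>D n0. \<exists>c\<in>C. x = y [^] p \<otimes> c" using div[OF x] by blast
  qed
  have divn: "\<exists>y\<in>D n0. \<exists>c\<in>C. x = y [^] (p ^ k) \<otimes> c" if "x \<in> D n0" for x k
  proof (induction k)
    case 0
    have "x = x [^] (p ^ 0) \<otimes> \<one>" using sub_carr[OF D that] by simp
    then show ?case using that sub_one[OF sC] by blast
  next
    case (Suc k)
    then obtain y c where y: "y \<in> D n0" "c \<in> C" "x = y [^] (p ^ k) \<otimes> c" by blast
    then obtain z d where z: "z \<in> D n0" "d \<in> C" "y = z [^] p \<otimes> d" using div' by blast
    have cc: "z \<in> carrier G" "d \<in> carrier G" "c \<in> carrier G" using y z sub_carr[OF D] sub_carr[OF sC] by auto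
    have "x = z [^] (p ^ Suc k) \<otimes> (d [^] (p ^ k) \<otimes> c)"
      unfolding y(3) z(3) using cc by (simp add: int_pow_distrib int_pow_pow m_assoc)
    moreover have "d [^] (p ^ k) \<otimes> c \<in> C" using y z sub_pow[OF sC] sub_mult[OF sC] by blast
    ultimately show ?case using z by blast
  qed
  have "almost_le G P (D n0)"
  proof -
    have a1: "almost_le G (D n0) (D n0)" using sub_carr[OF D] by (intro almost_le_refl) auto
    have a2: "almost_le G {x\<in>P. x [^] (p ^ n0) \<in> C} (D n0)"
      using finite_socle_pow[OF P C] CD almost_le_mono by blast
    \<comment> \<open>For \<open>x\<close> in \<open>P\<close> the multiple \<open>p ^ n0 x\<close>
      lies in \<open>D n0\<close>, hence equals \<open>p ^ n0 y\<close> modulo \<open>C\<close> for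
      some \<open>y\<close> in \<open>D n0\<close>. The difference of \<open>x\<close> and
      \<open>y\<close> belongs to a layer that is finite modulo \<open>C\<close>.\<close>
    have "P \<subseteq> D n0 <#> {x\<in>P. x [^] (p ^ n0) \<in> C}"
    proof
      fix x assume x: "x \<in> P"
      have "x [^] (p ^ n0) = x [^] (p ^ n0) \<otimes> \<one>" using x Pc by simp
      then have "x [^] (p ^ n0) \<in> D n0" unfolding D_def using x sub_one[OF sC] by blast
      then obtain y c where y: "y \<in> D n0" "c \<in> C" "x [^] (p ^ n0) = y [^] (p ^ n0) \<otimes> c" using divn by blast
      have cc: "y \<in> carrier G" "c \<in> carrier G" "x \<in> carrier G" "y \<in> P"
        using y sub_carr[OF D] sub_carr[OF sC] Pc x DP[of n0] by auto
      have "(inv y \<otimes> x) [^] (p ^ n0) = c" using cc y by (simp add: int_pow_distrib int_pow_inv)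
      then have "inv y \<otimes> x \<in> {x\<in>P. x [^] (p ^ n0) \<in> C}" using y x cc sub_mult[OF sP] sub_inv[OF sP] by auto
      moreover have "x = y \<otimes> (inv y \<otimes> x)" using cc by simp
      ultimately show "x \<in> D n0 <#> {x\<in>P. x [^] (p ^ n0) \<in> C}" unfolding set_mult_def using y by blast
    qed
    then show ?thesis using almost_le_mult[OF a1 a2 D] almost_le_mono by blast
  qed
  then show ?thesis using that[of "D n0"] D CD DP div' by blast
qed

text \<open>Multiplication by \<open>p ^ b\<close> kills \<open>C\<close> and turns divisibility
  modulo \<open>C\<close> into divisibility. Each \<open>h\<close> in \<open>D0\<close> then differs
  by an element killed by \<open>p ^ b\<close> from an element of the divisible group, and the
  finitely many coset representatives of \<open>D0\<close> only raise the bound.\<close>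

lemma finite_socle_bounded:
  assumes P: "p_subgroup G p P" and C: "finite_socle G p P C" and b: "\<forall>c\<in>C. c [^] (p ^ b) = \<one>"
  obtains D j where "subgroup D G" "D \<subseteq> P" "p_divisible G p D"
    "\<forall>x\<in>P. \<exists>d\<in>D. \<exists>y\<in>P. y [^] (p ^ j) = \<one> \<and> x = d \<otimes> y"
proof -
  have sC: "subgroup C G" and CP: "C \<subseteq> P" and sP: "subgroup P G" using P C by (auto simp: finite_socle_def p_subgroup_def)
  note Pc = p_subgroup_carr[OF P]
  obtain D0 where D0: "subgroup D0 G" "C \<subseteq> D0" "D0 \<subseteq> P" "\<forall>x\<in>D0. \<exists>y\<in>D0. \<exists>c\<in>C. x = y [^] p \<otimes> c" "almost_le G P D0"
    by (rule finite_socle_divisible[OF P C])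
  have Psub: "P \<subseteq> carrier G" using Pc by auto
  obtain S where S: "finite S" "S \<subseteq> P" "\<forall>k\<in>P. \<exists>h\<in>D0. \<exists>s\<in>S. k = h \<otimes> s"
    using almost_leD'[OF D0(5,1) Psub] by blast
  have "\<forall>s\<in>S. \<exists>n. s [^] (p ^ n) = \<one>" using p_subgroup_ord[OF P] S(2) by blast
  then obtain nn where nn: "\<forall>s\<in>S. s [^] (p ^ nn s) = \<one>" by metis
  define j0 where "j0 = Max (insert 0 (nn ` S))"
  have j0: "s [^] (p ^ j0) = \<one>" if "s \<in> S" for s
  proof -
    have "nn s \<le> j0" using S(1) that by (auto simp: j0_def)
    then show ?thesis using pow_p_mono[of s p "nn s" j0] nn that S(2) Pc by auto
  qed
  define D where "D = (\<lambda>x. x [^] (p ^ b)) ` D0"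
  have D: "subgroup D G" unfolding D_def by (rule hom_image_subgroup[OF pow_hom D0(1)])
  have DD0: "D \<subseteq> D0" unfolding D_def using sub_pow[OF D0(1)] by auto
  have div: "p_divisible G p D"
    unfolding p_divisible_def
  proof
    fix x assume "x \<in> D"
    then obtain y where y: "y \<in> D0" "x = y [^] (p ^ b)" by (auto simp: D_def)
    then obtain z c where z: "z \<in> D0" "c \<in> C" "y = z [^] p \<otimes> c" using D0(4) by blast
    have zc: "z \<in> carrier G" "c \<in> carrier G" using z sub_carr[OF D0(1)] sub_carr[OF sC] by auto
    have "x = (z [^] (p ^ b)) [^] p"
      unfolding y(2) z(3) using zc b z(2) by (simp add: int_pow_distrib int_pow_pow mult.commute)
    then show "\<exists>y\<in>D. x = y [^] p" using z by (auto simp: D_def)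
  qed
  have "\<exists>d\<in>D. \<exists>y\<in>P. y [^] (p ^ (b + j0)) = \<one> \<and> x = d \<otimes> y" if x: "x \<in> P" for x
  proof -
    obtain h s where hs: "h \<in> D0" "s \<in> S" "x = h \<otimes> s" using S(3) x by blast
    have "h [^] (p ^ b) \<in> D" using hs by (auto simp: D_def)
    moreover have "D \<subseteq> carrier G" using sub_carr[OF D] by auto
    ultimately obtain d where d: "d \<in> D" "h [^] (p ^ b) = d [^] (p ^ b)" using p_divisible_pow[OF div] by blast
    have cc: "h \<in> carrier G" "s \<in> carrier G" "d \<in> carrier G" using hs d S(2) Pc sub_carr[OF D0(1)] sub_carr[OF D] by auto
    have dP: "d \<in> P" "h \<in> P" "s \<in> P" using d DD0 D0(3) hs S(2) by auto
    let ?y = "inv d \<otimes> h \<otimes> s"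
    have "(inv d \<otimes> h) [^] (p ^ b) = \<one>" using d cc by (simp add: int_pow_distrib int_pow_inv)
    then have "(inv d \<otimes> h) [^] (p ^ (b + j0)) = \<one>" using pow_p_mono[of "inv d \<otimes> h" p b "b + j0"] cc by simp
    moreover have "s [^] (p ^ (b + j0)) = \<one>" using pow_p_mono[of s p j0 "b + j0"] j0 hs cc by simp
    ultimately have "?y [^] (p ^ (b + j0)) = \<one>" using cc int_pow_distrib[of "inv d \<otimes> h" s] by simp
    moreover have "x = d \<otimes> ?y" using cc hs by (simp add: m_assoc)
    moreover have "?y \<in> P" using dP by (simp add: sub_mult[OF sP] sub_inv[OF sP])
    ultimately show ?thesis using d by blast
  qed
  then show ?thesis using that[OF D _ div, of "b + j0"] DD0 D0(3) by blast
qed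

section \<open>Chains of p-th roots\<close>

definition root_chain :: "int \<Rightarrow> (nat \<Rightarrow> 'a) \<Rightarrow> bool" where
  "root_chain p z \<longleftrightarrow> (\<forall>i. z i \<in> carrier G \<and> z i = z (Suc i) [^] p)"

text \<open>A quasicyclic group if the \<open>z i\<close> have \<open>p\<close>-power order and
  \<open>z 0\<close> is not trivial. As an ascending union of cyclic groups it consists of multiples
  of single terms of the chain.\<close>

definition chain_group :: "(nat \<Rightarrow> 'a) \<Rightarrow> 'a set" where
  "chain_group z = {z i [^] (k::int) |i k. True}"

lemma p_divisible_chain:
  assumes "p_divisible G p D" "x \<in> D" "D \<subseteq> carrier G"
  obtains z where "z 0 = x" "root_chain p z" "\<forall>i. z i \<in> D"
proof -
  define z where "z = rec_nat x (\<lambda>_ y. SOME w. w \<in> D \<and> y = w [^] p)"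
  have z0: "z 0 = x" and zS: "z (Suc i) = (SOME w. w \<in> D \<and> z i = w [^] p)" for i by (simp_all add: z_def)
  have step: "z (Suc i) \<in> D \<and> z i = z (Suc i) [^] p" if "z i \<in> D" for i
  proof -
    have "\<exists>w. w \<in> D \<and> z i = w [^] p" using assms(1) that by (auto simp: p_divisible_def)
    then show ?thesis unfolding zS by (rule someI_ex)
  qed
  have zD: "z i \<in> D" for i by (induction i) (use z0 assms step in auto)
  have "root_chain p z" unfolding root_chain_def
  proof
    show "z i \<in> carrier G \<and> z i = z (Suc i) [^] p" for i using step[OF zD[of i]] zD[of i] assms(3) by blast
  qed
  then show ?thesis using that z0 zD by blast
qed

lemma root_chain_carr: "root_chain p z \<Longrightarrow> z i \<in> carrier G"
  unfolding root_chain_def by blast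

lemma root_chain_pow: assumes "root_chain p z" shows "z i = z (i + j) [^] (p ^ j)"
proof (induction j)
  case (Suc j)
  have "z (i + j) = z (Suc (i + j)) [^] p" using assms unfolding root_chain_def by blast
  then show ?case using Suc root_chain_carr[OF assms] by (simp add: int_pow_pow)
qed (use root_chain_carr[OF assms] in simp)

lemma chain_group_mem: "z i [^] (k::int) \<in> chain_group z"
  by (auto simp: chain_group_def)

lemma chain_group_self: "root_chain p z \<Longrightarrow> z i \<in> chain_group z"
  using chain_group_mem[of z i 1] root_chain_carr by simp

lemma chain_group_lift:
  assumes "root_chain p z" "i \<le> j" shows "z i [^] (k::int) = z j [^] (p ^ (j - i) * k)"
  using root_chain_pow[OF assms(1), of i "j - i"] assms root_chain_carr[OF assms(1)] int_pow_pow[of "z j" "p ^ (j - i)" k]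
  by simp

lemma chain_group_subgroup:
  assumes "root_chain p z" shows "subgroup (chain_group z) G"
proof (rule subgroupI')
  show "chain_group z \<subseteq> carrier G" using root_chain_carr[OF assms] by (auto simp: chain_group_def)
  show "\<one> \<in> chain_group z" using chain_group_mem[of z 0 0] by simp
  fix x y assume "x \<in> chain_group z" "y \<in> chain_group z"
  then obtain i k j l where "x = z i [^] (k::int)" "y = z j [^] (l::int)" by (auto simp: chain_group_def)
  then have "x = z (i + j) [^] (p ^ j * k)" "y = z (i + j) [^] (p ^ i * l)"
    using chain_group_lift[OF assms, of i "i + j"] chain_group_lift[OF assms, of j "i + j"] by auto
  then have "x \<otimes> inv y = z (i + j) [^] (p ^ j * k - p ^ i * l)"
    using root_chain_carr[OF assms] by (simp add: int_pow_diff)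
  then show "x \<otimes> inv y \<in> chain_group z" using chain_group_mem by simp
qed

lemma chain_group_divisible:
  assumes "root_chain p z" shows "p_divisible G p (chain_group z)"
  unfolding p_divisible_def
proof
  fix x assume "x \<in> chain_group z"
  then obtain i k where x: "x = z i [^] (k::int)" by (auto simp: chain_group_def)
  then have "x = (z (Suc i) [^] k) [^] p"
    using chain_group_lift[OF assms, of i "Suc i" k] root_chain_carr[OF assms] by (simp add: int_pow_pow mult.commute)
  then show "\<exists>y\<in>chain_group z. x = y [^] p" using chain_group_mem by blast
qed

lemma chain_group_subset: "subgroup D G \<Longrightarrow> \<forall>i. z i \<in> D \<Longrightarrow> chain_group z \<subseteq> D"
  by (auto simp: chain_group_def sub_pow)

lemma exact_order:
  assumes "x \<in> carrier G" "x [^] ((p::int) ^ n) = \<one>" "x \<noteq> \<one>"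
  obtains m where "x [^] (p ^ Suc m) = \<one>" "x [^] (p ^ m) \<noteq> \<one>"
proof -
  define M where "M = (LEAST n. x [^] (p ^ n) = \<one>)"
  have M: "x [^] (p ^ M) = \<one>" unfolding M_def using assms(2) by (rule LeastI)
  have "M \<noteq> 0" using M assms by (intro notI) simp
  then obtain m where m: "M = Suc m" using not0_implies_Suc by blast
  have "x [^] (p ^ m) \<noteq> \<one>" using not_less_Least[of m "\<lambda>n. x [^] (p ^ n) = \<one>"] m M_def by simp
  then show ?thesis using that M m by simp
qed

lemma prime_decompose:
  assumes "prime (p::int)" "e \<noteq> 0"
  obtains a e' where "e = p ^ a * e'" "\<not> p dvd e'"
proof -
  have "\<not> is_unit p" using assms(1) not_prime_unit by blast
  from multiplicity_decompose'[OF assms(2) this]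
  obtain e' where "e = p ^ multiplicity p e * e'" "\<not> p dvd e'" .
  then show ?thesis using that by blast
qed

text \<open>A nontrivial \<open>x\<close> lies in a quasicyclic group \<open>Z\<close>. The image of
  \<open>Z\<close> has bounded exponent modulo \<open>Z\<close>, and divisibility removes the
  \<open>p\<close>-part of this bound, so \<open>g x\<close> is in \<open>Z\<close>. In a cyclic
  \<open>p\<close>-group, an element whose order divides that of \<open>x\<close> is a multiple of
  \<open>x\<close>.\<close>

lemma inertial_power_on_divisible:
  assumes g: "inertial_map G g" and D: "p_subgroup G p D" "p_divisible G p D"
  shows "power_on G g D"
  unfolding power_on_def
proof
  fix x assume x: "x \<in> D"
  note gh = inertial_hom[OF g]
  have p: "prime p" and sD: "subgroup D G" using D by (auto simp: p_subgroup_def)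
  note Dc = p_subgroup_carr[OF D(1)]
  show "\<exists>k::int. g x = x [^] k"
  proof (cases "x = \<one>")
    case True
    then show ?thesis using hom_one'[OF gh] by simp
  next
    case False
    have "D \<subseteq> carrier G" using Dc by auto
    then obtain z where z: "z 0 = x" "root_chain p z" "\<forall>i. z i \<in> D"
      using p_divisible_chain[OF D(2) x] by blast
    note zc = root_chain_carr[OF z(2)]
    let ?Z = "chain_group z"
    have sZ: "subgroup ?Z G" by (rule chain_group_subgroup[OF z(2)])
    have ZD: "?Z \<subseteq> D" using chain_group_subset sD z(3) by blast
    obtain e where e: "e > 0" "\<forall>k\<in>g ` ?Z. k [^] (e::int) \<in> ?Z"
      using almost_le_exponent[OF inertial_almost_le[OF g sZ] sZ hom_image_subgroup[OF gh sZ]] by blast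
    have "e \<noteq> 0" using e by simp
    then obtain a e' where ae: "e = p ^ a * e'" "\<not> p dvd e'" using prime_decompose[OF p] by blast
    \<comment> \<open>Dividing \<open>x\<close> by \<open>p ^ a\<close> inside \<open>Z\<close>
      absorbs the \<open>p\<close>-part of \<open>e\<close>: the multiple \<open>e' (g x)\<close>
      equals \<open>e (g w)\<close>.\<close>
    have "\<exists>w\<in>?Z. x = w [^] (p ^ a)"
      using p_divisible_pow[OF chain_group_divisible[OF z(2)]] sub_carr[OF sZ] chain_group_self[OF z(2), of 0] z(1) by blast
    then obtain w where w: "w \<in> ?Z" "x = w [^] (p ^ a)" by blast
    have wc: "w \<in> carrier G" "g w \<in> carrier G" "x \<in> carrier G" "g x \<in> carrier G"
      using w sub_carr[OF sZ] hom_in_carrier[OF gh] Dc x by auto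
    have "(g x) [^] e' = (g w) [^] e" unfolding w(2) ae(1) using wc by (simp add: hom_pow[OF gh] int_pow_pow)
    then have 1: "(g x) [^] e' \<in> ?Z" using e(2) w by simp
    obtain n where n: "x [^] (p ^ n) = \<one>" using p_subgroup_ord[OF D(1) x] by blast
    then have "(g x) [^] (p ^ n) = \<one>" using hom_pow[OF gh, of x "p ^ n"] hom_one'[OF gh] wc by simp
    then have 2: "(g x) [^] (p ^ n) \<in> ?Z" using sub_one[OF sZ] by simp
    have "g x \<in> ?Z" by (rule coprime_pow_mem[OF sZ _ 1 2]) (use wc prime_not_dvd_coprime[OF p ae(2)] in auto)
    then obtain i k where ik: "g x = z i [^] (k::int)" by (auto simp: chain_group_def)
    obtain m where m: "x [^] (p ^ Suc m) = \<one>" "x [^] (p ^ m) \<noteq> \<one>" by (rule exact_order[OF wc(3) n False])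
    have xz: "x = z i [^] (p ^ i)" using root_chain_pow[OF z(2), of 0 i] z(1) by simp
    have "z i [^] (p ^ Suc (i + m)) = \<one>" using m(1) zc by (simp add: xz int_pow_pow power_add mult_ac)
    moreover have "z i [^] (p ^ (i + m)) \<noteq> \<one>" using m(2) zc by (simp add: xz int_pow_pow power_add mult_ac)
    moreover have "z i [^] (k * p ^ Suc m) = \<one>"
    proof -
      have "z i [^] (k * p ^ Suc m) = (g x) [^] (p ^ Suc m)" unfolding ik using zc by (simp add: int_pow_pow)
      also have "\<dots> = g (x [^] (p ^ Suc m))" using hom_pow[OF gh wc(3)] by simp
      finally show ?thesis using m(1) hom_one'[OF gh] by simp
    qed
    \<comment> \<open>\<open>z i\<close> has order \<open>p ^ Suc (i + m)\<close>, while
      \<open>g x = k (z i)\<close> is killed by \<open>p ^ Suc m\<close>. Hence \<open>p ^ i\<close>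
      divides \<open>k\<close>, and \<open>x = p ^ i (z i)\<close>.\<close>
    ultimately have "p ^ Suc (i + m) dvd k * p ^ Suc m" using pow_one_dvd[OF p zc] by blast
    then have "p ^ i * p ^ Suc m dvd k * p ^ Suc m" by (simp add: power_add mult_ac)
    then have "p ^ i dvd k" using p by (simp add: dvd_mult_cancel_right)
    then obtain q where "k = p ^ i * q" by blast
    then have "g x = x [^] q" using ik xz zc by (simp add: int_pow_pow)
    then show ?thesis by blast
  qed
qed

lemma cyclic_subgroup: "x \<in> carrier G \<Longrightarrow> subgroup (range (\<lambda>k::int. x [^] k)) G"
proof -
  assume x: "x \<in> carrier G"
  have "range (\<lambda>k::int. x [^] k) = adjoin G {\<one>} x"
    using x by (auto simp: adjoin_def)
  then show ?thesis using adjoin_subgroup[OF subgroup_one_set x] by simp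
qed

text \<open>Compare every element with one of maximal order: after subtracting a multiple of the latter,
  the two generate a direct sum.\<close>

lemma power_on_uniform:
  assumes p: "prime (p::int)" and C: "subgroup C G" and g: "g \<in> hom G G" "power_on G g C"
    and bd: "\<forall>c\<in>C. c [^] (p ^ n) = \<one>"
  shows "\<exists>k::int. \<forall>c\<in>C. g c = c [^] k"
proof -
  note Cc = sub_carr[OF C]
  define M where "M = (LEAST n. \<forall>c\<in>C. c [^] (p ^ n) = \<one>)"
  have M: "\<forall>c\<in>C. c [^] (p ^ M) = \<one>" unfolding M_def using bd by (rule LeastI)
  show ?thesis
  proof (cases M)
    case 0
    have "c = \<one>" if "c \<in> C" for c using bspec[OF M that] Cc[OF that] 0 by simp
    then show ?thesis using hom_one'[OF g(1)] by (intro exI[of _ 0]) auto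
  next
    case (Suc m)
    then have "\<not> (\<forall>c\<in>C. c [^] (p ^ m) = \<one>)"
      using not_less_Least[of m "\<lambda>n. \<forall>c\<in>C. c [^] (p ^ n) = \<one>"] M_def by simp
    then obtain c0 where c0: "c0 \<in> C" "c0 [^] (p ^ m) \<noteq> \<one>" by blast
    have c0c: "c0 \<in> carrier G" using Cc c0 by simp
    define H where "H = range (\<lambda>k::int. c0 [^] k)"
    have H: "subgroup H G" unfolding H_def by (rule cyclic_subgroup[OF c0c])
    have dvd0: "p ^ M dvd a" if "c0 [^] (a::int) = \<one>" for a
      using pow_one_dvd[OF p c0c _ c0(2), of a] M c0(1) Suc that by simp
    obtain k where k: "g c0 = c0 [^] (k::int)" using g(2) c0 by (auto simp: power_on_def)
    have "g c = c [^] k" if c: "c \<in> C" for c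
    proof -
      have cc: "c \<in> carrier G" using Cc c by simp
      define t where "t = (LEAST t. c [^] (p ^ t) \<in> H)"
      have "c [^] (p ^ M) \<in> H" using M c sub_one[OF H] by simp
      then have t: "c [^] (p ^ t) \<in> H" "t \<le> M" unfolding t_def by (rule LeastI, rule Least_le)
      have tdvd: "p ^ t dvd a" if "c [^] (a::int) \<in> H" for a
      proof (cases t)
        case (Suc t')
        then have "c [^] (p ^ t') \<notin> H" using not_less_Least[of t' "\<lambda>t. c [^] (p ^ t) \<in> H"] t_def by simp
        then show ?thesis using pow_mem_dvd[OF p H cc, of t' a] t(1) Suc that by simp
      qed simp
      obtain u where u: "c [^] (p ^ t) = c0 [^] (u::int)" using t(1) by (auto simp: H_def)
      have pM: "p ^ M = p ^ t * p ^ (M - t)" using t(2) by (simp flip: power_add)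
      \<comment> \<open>The order of \<open>c\<close> is at most that of \<open>c0\<close>, which is
        \<open>p ^ M\<close>. This makes \<open>u\<close> divisible by \<open>p ^ t\<close>, so
        \<open>c\<close> can be corrected by a multiple of \<open>c0\<close> to an element
        \<open>c1\<close> killed by \<open>p ^ t\<close>, its order modulo \<open>H\<close>.\<close>
      have "c0 [^] (u * p ^ (M - t)) = (c [^] (p ^ t)) [^] (p ^ (M - t))" unfolding u using c0c by (simp add: int_pow_pow)
      also have "\<dots> = c [^] (p ^ M)" using cc pM by (simp add: int_pow_pow)
      also have "\<dots> = \<one>" using M c by simp
      finally have "p ^ M dvd u * p ^ (M - t)" by (rule dvd0)
      then have "p ^ t * p ^ (M - t) dvd u * p ^ (M - t)" by (simp only: pM)
      then have "p ^ t dvd u" using p by (simp add: dvd_mult_cancel_right)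
      then obtain u' where u': "u = p ^ t * u'" by blast
      define c1 where "c1 = c \<otimes> inv (c0 [^] u')"
      have c1: "c1 \<in> C" "c1 \<in> carrier G" unfolding c1_def
        using c c0 sub_mult[OF C] sub_inv[OF C] sub_pow[OF C] Cc by auto
      have c1t: "c1 [^] (p ^ t) = \<one>" unfolding c1_def
        using cc c0c u u' by (simp add: int_pow_distrib int_pow_inv int_pow_pow mult.commute)
      have cdec: "c = c1 \<otimes> c0 [^] u'" unfolding c1_def using cc c0c by simp
      have key: "c1 [^] a = \<one>" if "c1 [^] (a::int) \<in> H" for a
      proof -
        have "c [^] a = c1 [^] a \<otimes> c0 [^] (u' * a)" using cdec c1 c0c by (simp add: int_pow_distrib int_pow_pow)
        moreover have "c0 [^] (u' * a) \<in> H" by (simp add: H_def)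
        ultimately have "c [^] a \<in> H" using that sub_mult[OF H] by simp
        then show ?thesis using tdvd pow_dvd_one[OF c1(2) c1t] by blast
      qed
      obtain l where l: "g c1 = c1 [^] (l::int)" using g(2) c1 by (auto simp: power_on_def)
      \<comment> \<open>The exponent of the sum ties the exponents of the two summands together:
        modulo the order of \<open>c0\<close> it agrees with \<open>k\<close>, modulo that of
        \<open>c1\<close> with \<open>l\<close>.\<close>
      have "c0 \<otimes> c1 \<in> C" using c0 c1 sub_mult[OF C] by blast
      then obtain j where j: "g (c0 \<otimes> c1) = (c0 \<otimes> c1) [^] (j::int)" using g(2) by (auto simp: power_on_def)
      have e: "c0 [^] k \<otimes> c1 [^] l = c0 [^] j \<otimes> c1 [^] j"
        using j k l g(1) c0c c1 by (simp add: hom_mult int_pow_distrib)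
      have "c1 [^] (l - j) = c0 [^] (j - k)"
      proof -
        have "c1 [^] (l - j) = inv (c0 [^] k) \<otimes> (c0 [^] k \<otimes> c1 [^] l) \<otimes> inv (c1 [^] j)"
          using c0c c1 by (simp add: int_pow_diff m_assoc)
        also have "\<dots> = c0 [^] (j - k)" unfolding e using c0c c1 by (simp add: int_pow_diff m_assoc m_comm[of "c0 [^] j"])
        finally show ?thesis .
      qed
      then have 1: "c1 [^] (l - j) = \<one>" by (intro key) (simp add: H_def)
      then have "c0 [^] (j - k) = \<one>" using \<open>c1 [^] (l - j) = c0 [^] (j - k)\<close> by simp
      then have "p ^ M dvd j - k" by (rule dvd0)
      then have "c1 [^] (j - k) = \<one>" using M c1 pow_dvd_one by blast
      then have "c1 [^] ((l - j) + (j - k)) = \<one>" using 1 c1 int_pow_mult[of c1 "l - j" "j - k"] by simp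
      then have "c1 [^] l = c1 [^] k" using c1(2)
        by (intro pow_cong[of c1 "l - k"]) simp_all
      then have "g c = c1 [^] k \<otimes> (c0 [^] k) [^] u'"
        unfolding cdec using l k g(1) c0c c1 by (simp add: hom_mult hom_pow)
      also have "\<dots> = c [^] k" unfolding cdec using c0c c1 by (simp add: int_pow_distrib int_pow_pow mult.commute)
      finally show ?thesis .
    qed
    then show ?thesis by blast
  qed
qed

text \<open>For a new map \<open>g\<close>, let \<open>C1\<close> be maximal disjoint from the
  finite obstruction \<open>E\<close>. On the elements of \<open>C1\<close> that \<open>g\<close>
  maps into \<open>C1\<close> again, the pair \<open>x\<close>, \<open>g x\<close> is independent of
  \<open>E\<close>, so \<open>g\<close> acts by multiples. Finiteness of the socle survives
  preimages and intersections.\<close>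

lemma inertial_common_power_on:
  assumes P: "p_subgroup G p P" and F: "finite F" "\<forall>g\<in>F. inertial_map G g \<and> g ` P \<subseteq> P"
  shows "\<exists>C. finite_socle G p P C \<and> (\<forall>g\<in>F. power_on G g C)"
  using F
proof (induction F)
  case empty
  then show ?case using finite_socle_self[OF P] by blast
next
  case (insert g F)
  then obtain C where C: "finite_socle G p P C" "\<forall>g\<in>F. power_on G g C" by auto
  have g: "inertial_map G g" "g ` P \<subseteq> P" using insert by auto
  note gh = inertial_hom[OF g(1)]
  have pp: "prime p" "subgroup P G" "P \<subseteq> torsion_subgroup G"
    using P primary_torsion by (auto simp: p_subgroup_def)
  obtain E where E: "subgroup E G" "finite E"
    "\<forall>x\<in>torsion_subgroup G. independent_pair G g E x \<longrightarrow> power_on G g {x}"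
    using inertial_power_off_finite[OF g(1)] by blast
  obtain C1 where C1: "subgroup C1 G" "C1 \<subseteq> P" "C1 \<inter> E \<subseteq> {\<one>}"
    "\<forall>x\<in>P - C1. \<exists>c\<in>C1. \<exists>k::int. c \<otimes> x [^] k \<in> E \<and> c \<otimes> x [^] k \<noteq> \<one>"
    by (rule max_disjoint_subgroup[OF pp(2)])
  have "E \<subseteq> carrier G" using sub_carr[OF E(1)] by blast
  then have f1: "finite_socle G p P C1" by (rule finite_socle_max[OF P E(2) _ C1])
  then have f2: "finite_socle G p P (C1 \<inter> {x\<in>P. g x \<in> C1})"
    by (intro finite_socle_Int[OF P] finite_socle_vimage[OF P _ gh g(2)])
  have pw: "power_on G g (C1 \<inter> {x\<in>P. g x \<in> C1})"
    unfolding power_on_def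
  proof
    fix x assume x: "x \<in> C1 \<inter> {x\<in>P. g x \<in> C1}"
    have "independent_pair G g E x"
      unfolding independent_pair_def
    proof (intro allI impI)
      fix a b :: int assume "x [^] a \<otimes> g x [^] b \<in> E"
      moreover have "x [^] a \<otimes> g x [^] b \<in> C1" using x by (simp add: sub_mult[OF C1(1)] sub_pow[OF C1(1)])
      ultimately show "x [^] a \<otimes> g x [^] b = \<one>" using C1(3) by blast
    qed
    then show "\<exists>k::int. g x = x [^] k" using E(3) x pp(3) by (auto simp: power_on_def)
  qed
  have "finite_socle G p P (C1 \<inter> {x\<in>P. g x \<in> C1} \<inter> C)" by (rule finite_socle_Int[OF P f2 C(1)])
  moreover have "\<forall>h\<in>insert g F. power_on G h (C1 \<inter> {x\<in>P. g x \<in> C1} \<inter> C)"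
    using pw C(2) by (auto simp: power_on_def)
  ultimately show ?case by blast
qed

section \<open>Finite invariant subgroups\<close>

lemma pow_kernel_subgroup: "subgroup P G \<Longrightarrow> subgroup {y\<in>P. y [^] (k::int) = \<one>} G"
  using hom_vimage_subgroup[OF pow_hom[of k] subgroup_one_set, of P] by simp

text \<open>Modulo \<open>C\<close> a bounded layer \<open>Q\<close> is represented by a finite set
  \<open>S\<close>. If a finite \<open>W\<close> contains \<open>S\<close> and its images, then the
  \<open>C\<close>-component of an element of \<open>W\<close> is itself in \<open>W\<close> and is
  mapped to a multiple of itself; thus \<open>W\<close> is invariant.\<close>

lemma finite_invariant_primary:
  assumes p: "prime p" and F: "finite F" "\<forall>g\<in>F. inertial_map G g" and x: "x \<in> primary G p"
  shows "\<exists>W. subgroup W G \<and> finite W \<and> W \<subseteq> torsion_subgroup G \<and> x \<in> W \<and> (\<forall>g\<in>F. g ` W \<subseteq> W)"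
proof -
  let ?P = "primary G p"
  note P = p_subgroup_primary[OF p]
  have F': "\<forall>g\<in>F. inertial_map G g \<and> g ` ?P \<subseteq> ?P" using F hom_primary inertial_hom by blast
  obtain C where C: "finite_socle G p ?P C" "\<forall>g\<in>F. power_on G g C"
    using inertial_common_power_on[OF P F(1) F'] by blast
  have sC: "subgroup C G" using C by (simp add: finite_socle_def)
  obtain n where n: "x [^] (p ^ n) = \<one>" using x by (auto simp: primary_def)
  define Q where "Q = {y\<in>?P. y [^] (p ^ n) = \<one>}"
  have sQ: "subgroup Q G" unfolding Q_def by (rule pow_kernel_subgroup[OF primary_subgroup])
  have QT: "Q \<subseteq> torsion_subgroup G" using primary_torsion[OF p] by (auto simp: Q_def)
  have Qc: "Q \<subseteq> carrier G" using sub_carr[OF sQ] by blast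
  have "Q \<subseteq> {y\<in>?P. y [^] (p ^ n) \<in> C}" using sub_one[OF sC] by (auto simp: Q_def)
  then have al: "almost_le G Q C" using finite_socle_pow[OF P C(1), of n] almost_le_mono by blast
  obtain S where S: "finite S" "S \<subseteq> Q" "\<forall>k\<in>Q. \<exists>h\<in>C. \<exists>s\<in>S. k = h \<otimes> s"
    using almost_leD'[OF al sC Qc] by blast
  have gQ: "g y \<in> Q" if "g \<in> F" "y \<in> Q" for g y
  proof -
    have gh: "g \<in> hom G G" using F inertial_hom that by blast
    have "g y [^] (p ^ n) = g (y [^] (p ^ n))" using hom_pow[OF gh, of y "p ^ n"] that Qc by auto
    then show ?thesis using that hom_one'[OF gh] F' by (auto simp: Q_def)
  qed
  define R where "R = insert x (S \<union> (\<Union>g\<in>F. g ` S))"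
  have "finite R" "R \<subseteq> Q" using S F gQ x n by (auto simp: R_def Q_def)
  then obtain W where W: "subgroup W G" "finite W" "R \<subseteq> W" "W \<subseteq> Q"
    using finite_generate_torsion[OF _ _ QT sQ] by blast
  have "g w \<in> W" if g: "g \<in> F" and w: "w \<in> W" for g w
  proof -
    have gh: "g \<in> hom G G" using F inertial_hom g by blast
    obtain c s where cs: "c \<in> C" "s \<in> S" "w = c \<otimes> s" using S(3) w W(4) by blast
    have sW: "s \<in> W" "g s \<in> W" using cs W(3) g by (auto simp: R_def)
    have cc: "c \<in> carrier G" "s \<in> carrier G" using sub_carr[OF sC cs(1)] sub_carr[OF W(1) sW(1)] by auto
    have "c \<in> W" using sub_cancel'[OF W(1) sW(1) cc(1)] cs w by simp
    moreover obtain k where "g c = c [^] (k::int)" using C(2) g cs by (auto simp: power_on_def)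
    ultimately have "g w = c [^] k \<otimes> g s" "c [^] k \<in> W" using cs cc gh by (simp_all add: hom_mult sub_pow[OF W(1)])
    then show ?thesis using sW sub_mult[OF W(1)] by simp
  qed
  then show ?thesis using W QT by (intro exI[of _ W]) (auto simp: R_def)
qed

text \<open>Replaces the decomposition into primary components. A prime dividing the order is split
  off by Bezout, and the remaining factor has smaller order.\<close>

lemma torsion_induct [consumes 1, case_names one primary mult]:
  assumes "x \<in> torsion_subgroup G"
    and "Q \<one>"
    and "\<And>p y. prime (p::int) \<Longrightarrow> y \<in> primary G p \<Longrightarrow> Q y"
    and "\<And>y z. y \<in> torsion_subgroup G \<Longrightarrow> z \<in> torsion_subgroup G \<Longrightarrow> Q y \<Longrightarrow> Q z \<Longrightarrow> Q (y \<otimes> z)"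
  shows "Q x"
proof -
  have "\<forall>x\<in>carrier G. n > 0 \<longrightarrow> x [^] int n = \<one> \<longrightarrow> Q x" for n
  proof (induction n rule: less_induct)
    case (less n)
    show ?case
    proof (intro ballI impI)
      fix x assume x: "x \<in> carrier G" "n > 0" "x [^] int n = \<one>"
      show "Q x"
      proof (cases "n = 1")
        case True
        then show ?thesis using x assms(2) by simp
      next
        case False
        then obtain q where q: "prime (q::nat)" "q dvd n" using prime_factor_nat by blast
        define p where "p = int q"
        have p: "prime p" "p dvd int n" using q by (auto simp: p_def)
        obtain a e where ae: "int n = p ^ a * e" "\<not> p dvd e" using prime_decompose[OF p(1), of "int n"] x by auto
        have a: "a \<noteq> 0" using ae p(2) by (intro notI) simp
        have p1: "p > 1" using p(1) prime_gt_1_int by blast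
        have e: "e > 0" using ae(1) x(2) p1 by (metis of_nat_0_less_iff zero_less_mult_pos zero_less_power order_less_trans zero_less_one)
        have "e * 1 < e * p ^ a" using e p1 a by (intro mult_strict_left_mono) (auto intro: one_less_power)
        then have lt: "nat e < n" using ae(1) e by (simp add: mult.commute nat_less_iff)
        have "coprime (p ^ a) e" using prime_not_dvd_coprime[OF p(1) ae(2)] by (simp add: coprime_commute)
        then obtain u v where uv: "u * p ^ a + v * e = 1" using bezout_int[of "p ^ a" e] by auto
        define y z where "y = x [^] (u * p ^ a)" and "z = x [^] (v * e)"
        have xyz: "x = y \<otimes> z" unfolding y_def z_def using x uv int_pow_mult[of x "u * p ^ a" "v * e"] by simp
        have c: "y \<in> carrier G" "z \<in> carrier G" using x by (auto simp: y_def z_def)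
        have "y [^] e = (x [^] int n) [^] u" unfolding y_def ae(1) using x(1) by (simp add: int_pow_pow mult_ac)
        then have ye: "y [^] e = \<one>" using x by simp
        then have "Q y" using less[OF lt] c e by simp
        have "z [^] (p ^ a) = (x [^] int n) [^] v" unfolding z_def ae(1) using x(1) by (simp add: int_pow_pow mult_ac)
        then have "z \<in> primary G p" using x c by (auto simp: primary_def)
        then have "Q z" using assms(3) p by blast
        show ?thesis unfolding xyz
          using assms(4) \<open>Q y\<close> \<open>Q z\<close> torsionI[OF c(1) _ ye] e primary_torsion[OF p(1)] \<open>z \<in> primary G p\<close> by auto
      qed
    qed
  qed
  moreover obtain n :: int where "n > 0" "x [^] n = \<one>" "x \<in> carrier G" using assms(1) torsion_iff by blast
  ultimately show ?thesis by (metis int_nat_eq less_imp_le zero_less_nat_eq)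
qed

text \<open>Finitely many inertial maps act locally finitely on the torsion subgroup: invariant
  subgroups found for single elements are added up. Its main use is that an injective map on a
  finite set is surjective.\<close>

lemma finite_invariant:
  assumes F: "finite F" "\<forall>g\<in>F. inertial_map G g" and S: "finite S" "S \<subseteq> torsion_subgroup G"
  shows "\<exists>W. subgroup W G \<and> finite W \<and> W \<subseteq> torsion_subgroup G \<and> S \<subseteq> W \<and> (\<forall>g\<in>F. g ` W = W)"
proof -
  define inv_sub where "inv_sub W \<longleftrightarrow> subgroup W G \<and> finite W \<and> W \<subseteq> torsion_subgroup G \<and> (\<forall>g\<in>F. g ` W \<subseteq> W)" for W
  have join: "inv_sub (W <#> W')" if "inv_sub W" "inv_sub W'" for W W'
  proof -
    have c: "W \<subseteq> carrier G" "W' \<subseteq> carrier G" using that sub_carr by (auto simp: inv_sub_def)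
    have "g ` (W <#> W') \<subseteq> W <#> W'" if g: "g \<in> F" for g
    proof
      fix y assume "y \<in> g ` (W <#> W')"
      then obtain a b where ab: "a \<in> W" "b \<in> W'" "y = g (a \<otimes> b)" unfolding set_mult_def by blast
      have gh: "g \<in> hom G G" using F(2) g inertial_hom by blast
      have "y = g a \<otimes> g b" using ab hom_mult[OF gh, of a b] c by auto
      moreover have "g a \<in> W" "g b \<in> W'" using ab g \<open>inv_sub W\<close> \<open>inv_sub W'\<close> unfolding inv_sub_def by blast+
      ultimately show "y \<in> W <#> W'" unfolding set_mult_def by blast
    qed
    moreover have "finite (W <#> W')" using that by (simp add: inv_sub_def set_mult_def)
    moreover have "W <#> W' \<subseteq> torsion_subgroup G"
      using that sub_mult[OF torsion_subgroup] unfolding inv_sub_def set_mult_def by blast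
    ultimately show ?thesis using that mult_subgroups by (simp add: inv_sub_def)
  qed
  have mem: "W \<subseteq> W <#> W'" "W' \<subseteq> W <#> W'" if "inv_sub W" "inv_sub W'" for W W'
  proof -
    have s: "subgroup W G" "subgroup W' G" using that by (auto simp: inv_sub_def)
    show "W \<subseteq> W <#> W'"
    proof
      fix x assume "x \<in> W"
      then have "x = x \<otimes> \<one>" using sub_carr[OF s(1)] by simp
      then show "x \<in> W <#> W'" using \<open>x \<in> W\<close> sub_one[OF s(2)] unfolding set_mult_def by blast
    qed
    show "W' \<subseteq> W <#> W'"
    proof
      fix x assume "x \<in> W'"
      then have "x = \<one> \<otimes> x" using sub_carr[OF s(2)] by simp
      then show "x \<in> W <#> W'" using \<open>x \<in> W'\<close> sub_one[OF s(1)] unfolding set_mult_def by blast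
    qed
  qed
  have one: "inv_sub {\<one>}"
    using subgroup_one_set sub_one[OF torsion_subgroup] F inertial_hom hom_one' by (auto simp: inv_sub_def)
  have ex: "\<exists>W. inv_sub W \<and> x \<in> W" if "x \<in> torsion_subgroup G" for x
    using that
  proof (induction rule: torsion_induct)
    case one
    then show ?case using \<open>inv_sub {\<one>}\<close> by blast
  next
    case (primary p y)
    then show ?case using finite_invariant_primary[OF _ F] unfolding inv_sub_def by blast
  next
    case (mult y z)
    then obtain W W' where W: "inv_sub W" "y \<in> W" "inv_sub W'" "z \<in> W'" by blast
    then have "y \<otimes> z \<in> W <#> W'" unfolding set_mult_def by blast
    then show ?case using join W by blast
  qed
  have "\<exists>W. inv_sub W \<and> S \<subseteq> W"
    using S
  proof (induction S)
    case empty
    then show ?case using one by blast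
  next
    case (insert x S)
    then obtain W W' where W: "inv_sub W" "S \<subseteq> W" "inv_sub W'" "x \<in> W'" using ex[of x] by auto
    then show ?case using join[OF W(1,3)] mem[OF W(1,3)] by (intro exI[of _ "W <#> W'"]) auto
  qed
  then obtain W where W: "inv_sub W" "S \<subseteq> W" by blast
  have "g ` W = W" if "g \<in> F" for g
  proof -
    have "inj_on g W" using F(2) that W(1) inertial_iso iso_inj sub_carr by (metis inj_on_subset inv_sub_def subsetI)
    then show ?thesis using W that endo_inj_surj[of W g] by (auto simp: inv_sub_def)
  qed
  then show ?thesis using W by (auto simp: inv_sub_def)
qed

section \<open>The p-adic exponent on an unbounded subgroup\<close>

lemma exact_order_in_unbounded:
  assumes P: "p_subgroup G p C" and unb: "\<forall>b. \<exists>c\<in>C. c [^] (p ^ b) \<noteq> \<one>"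
  obtains c where "c \<in> C" "c [^] (p ^ n) = \<one>" "\<forall>k::int. c [^] k = \<one> \<longrightarrow> p ^ n dvd k"
proof -
  have p: "prime p" and sC: "subgroup C G" using P by (auto simp: p_subgroup_def)
  obtain c where c: "c \<in> C" "c [^] (p ^ n) \<noteq> \<one>" using unb by blast
  have cc: "c \<in> carrier G" using sub_carr[OF sC c(1)] .
  have c1: "c \<noteq> \<one>" using c by auto
  obtain N where N: "c [^] (p ^ N) = \<one>" using p_subgroup_ord[OF P c(1)] by blast
  obtain m where m: "c [^] (p ^ Suc m) = \<one>" "c [^] (p ^ m) \<noteq> \<one>" by (rule exact_order[OF cc N c1])
  have nm: "n \<le> m"
  proof (rule ccontr)
    assume "\<not> n \<le> m"
    then have "Suc m \<le> n" by simp
    then show False using pow_p_mono[OF cc m(1)] c(2) by blast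
  qed
  define e where "e = Suc m - n"
  have e: "p ^ e * p ^ n = p ^ Suc m" using nm by (simp add: e_def flip: power_add)
  have "(c [^] (p ^ e)) [^] (p ^ n) = \<one>" using cc e m(1) by (simp add: int_pow_pow)
  moreover have "p ^ n dvd k" if "(c [^] (p ^ e)) [^] k = \<one>" for k
  proof -
    have "c [^] (p ^ e * k) = \<one>" using that cc by (simp add: int_pow_pow)
    then have "p ^ e * p ^ n dvd p ^ e * k" using pow_one_dvd[OF p cc m] e by metis
    then show ?thesis using p by (simp add: dvd_mult_cancel_left)
  qed
  ultimately show ?thesis using that[of "c [^] (p ^ e)"] sub_pow[OF sC c(1)] by blast
qed

lemma p_divisible_unbounded:
  assumes P: "p_subgroup G p D" and div: "p_divisible G p D" and d0: "d0 \<in> D" "d0 \<noteq> \<one>"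
  shows "\<forall>b. \<exists>c\<in>D. c [^] (p ^ b) \<noteq> \<one>"
proof
  fix b
  have "D \<subseteq> carrier G" using p_subgroup_carr[OF P] by blast
  then show "\<exists>c\<in>D. c [^] (p ^ b) \<noteq> \<one>" using p_divisible_pow[OF div _ d0(1), of b] d0(2) by blast
qed

text \<open>On an unbounded \<open>C\<close> the powers fit together to a \<open>p\<close>-adic integer, which acts on all of \<open>P\<close>;
  \<open>\<psi>\<close> is the difference of \<open>g\<close> and this action.\<close>

lemma power_deviation:
  assumes P: "p_subgroup G p P" and C: "subgroup C G" "C \<subseteq> P"
    and g: "g \<in> hom G G" "g ` P \<subseteq> P" "power_on G g C"
    and unb: "\<forall>b. \<exists>c\<in>C. c [^] (p ^ b) \<noteq> \<one>"
  obtains \<psi> where "\<forall>x\<in>P. \<psi> x \<in> P" "\<forall>x\<in>P. \<forall>y\<in>P. \<psi> (x \<otimes> y) = \<psi> x \<otimes> \<psi> y" "\<forall>c\<in>C. \<psi> c = \<one>"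
    "\<forall>n. \<exists>a::int. \<forall>x\<in>P. x [^] (p ^ n) = \<one> \<longrightarrow> \<psi> x = g x \<otimes> x [^] a"
proof -
  have p: "prime p" and sP: "subgroup P G" using P by (auto simp: p_subgroup_def)
  note Pc = p_subgroup_carr[OF P]
  note Cp = p_subgroup_sub[OF P C]
  have "\<exists>k::int. \<forall>c\<in>{c\<in>C. c [^] (p ^ n) = \<one>}. g c = c [^] k" for n
  proof (rule power_on_uniform[OF p pow_kernel_subgroup[OF C(1)] g(1), of "p ^ n" n])
    show "power_on G g {c\<in>C. c [^] (p ^ n) = \<one>}" using g(3) by (auto simp: power_on_def)
  qed simp
  then obtain k :: "nat \<Rightarrow> int" where k: "\<forall>n. \<forall>c\<in>{c\<in>C. c [^] (p ^ n) = \<one>}. g c = c [^] k n" by metis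
  \<comment> \<open>Both exponents are compared on an element of order exactly \<open>p ^ n\<close>,
    which exists because \<open>C\<close> is unbounded. Their residue classes thus form a compatible
    system, that is, a \<open>p\<close>-adic integer.\<close>
  have cons: "p ^ n dvd k m - k n" if "n \<le> m" for m n
  proof -
    obtain c where c: "c \<in> C" "c [^] (p ^ n) = \<one>" "\<forall>k::int. c [^] k = \<one> \<longrightarrow> p ^ n dvd k"
      by (rule exact_order_in_unbounded[OF Cp unb])
    have cc: "c \<in> carrier G" using sub_carr[OF C(1) c(1)] .
    have "c [^] (p ^ m) = \<one>" using pow_p_mono[OF cc c(2) that] .
    then have "g c = c [^] k m" "g c = c [^] k n" using k c(1,2) by blast+
    then have "c [^] k m = c [^] k n" by simp
    then have "c [^] (k m - k n) = \<one>" using cc by (simp add: int_pow_diff)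
    then show ?thesis using c(3) by blast
  qed
  \<comment> \<open>Every \<open>n\<close> with \<open>p ^ n x = 0\<close> gives the same value of
    \<open>\<psi>\<close>; the least one is a mere choice.\<close>
  define N where "N x = (LEAST n. x [^] (p ^ n) = \<one>)" for x
  define \<psi> where "\<psi> x = g x \<otimes> x [^] (- k (N x))" for x
  have \<psi>: "\<psi> x = g x \<otimes> x [^] (- k n)" if "x \<in> P" "x [^] (p ^ n) = \<one>" for x n
  proof -
    have "x [^] (p ^ N x) = \<one>" unfolding N_def using that(2) by (rule LeastI)
    moreover have "N x \<le> n" unfolding N_def using that(2) by (rule Least_le)
    then have "p ^ N x dvd - k (N x) - (- k n)" using cons by simp
    ultimately show ?thesis unfolding \<psi>_def using pow_cong Pc[OF that(1)] by metis
  qed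
  have ord: "\<exists>n. x [^] (p ^ n) = \<one> \<and> y [^] (p ^ n) = \<one>" if xy: "x \<in> P" "y \<in> P" for x y
  proof -
    obtain m n where "x [^] (p ^ m) = \<one>" "y [^] (p ^ n) = \<one>" using p_subgroup_ord[OF P] xy by blast
    then have "x [^] (p ^ (m + n)) = \<one>" "y [^] (p ^ (m + n)) = \<one>"
      using pow_p_mono[of x p m "m + n"] pow_p_mono[of y p n "m + n"] Pc xy by auto
    then show ?thesis by blast
  qed
  show ?thesis
  proof (rule that[of \<psi>])
    show "\<forall>x\<in>P. \<psi> x \<in> P"
    proof
      fix x assume x: "x \<in> P"
      then have "g x \<in> P" using g(2) by blast
      then show "\<psi> x \<in> P" unfolding \<psi>_def using sub_mult[OF sP] sub_pow[OF sP x] by blast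
    qed
    show "\<forall>x\<in>P. \<forall>y\<in>P. \<psi> (x \<otimes> y) = \<psi> x \<otimes> \<psi> y"
    proof (intro ballI)
      fix x y assume xy: "x \<in> P" "y \<in> P"
      obtain n where n: "x [^] (p ^ n) = \<one>" "y [^] (p ^ n) = \<one>" using ord[OF xy] by blast
      have c: "x \<in> carrier G" "y \<in> carrier G" "g x \<in> carrier G" "g y \<in> carrier G"
        using xy Pc hom_in_carrier[OF g(1)] by auto
      have "(x \<otimes> y) [^] (p ^ n) = \<one>" using n c by (simp add: int_pow_distrib)
      then show "\<psi> (x \<otimes> y) = \<psi> x \<otimes> \<psi> y"
        using \<psi>[OF xy(1) n(1)] \<psi>[OF xy(2) n(2)] \<psi>[OF sub_mult[OF sP xy]] c g(1)
        by (simp add: hom_mult int_pow_distrib m_ac)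
    qed
    show "\<forall>c\<in>C. \<psi> c = \<one>"
    proof
      fix c assume c: "c \<in> C"
      then obtain n where n: "c [^] (p ^ n) = \<one>" using p_subgroup_ord[OF Cp] by blast
      have "g c = c [^] k n" using k c n by blast
      then show "\<psi> c = \<one>" using \<psi>[OF _ n] c C(2) sub_carr[OF C(1) c] by (auto simp: int_pow_neg)
    qed
    show "\<forall>n. \<exists>a::int. \<forall>x\<in>P. x [^] (p ^ n) = \<one> \<longrightarrow> \<psi> x = g x \<otimes> x [^] a"
      using \<psi> by blast
  qed
qed

text \<open>If two terms coincide, then \<open>d i\<close> is killed by
  \<open>p ^ (j - i) - 1\<close>, which is prime to \<open>p\<close>, as well as by a power of
  \<open>p\<close>.\<close>

lemma root_chain_distinct:
  assumes p: "prime p" and d: "root_chain p d" "d 0 [^] (p ^ n) = \<one>" "d 0 \<noteq> \<one>" and ij: "i < j"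
  shows "d i \<noteq> d j"
proof
  assume e: "d i = d j"
  note c = root_chain_carr[OF d(1)]
  have "d i = d i [^] (p ^ (j - i))" using root_chain_pow[OF d(1), of i "j - i"] ij e by simp
  then have "d i [^] (p ^ (j - i) - 1) = \<one>" using c[of i] by (simp add: int_pow_diff)
  moreover have d0: "d 0 = d i [^] (p ^ i)" using root_chain_pow[OF d(1), of 0 i] by simp
  then have "d i [^] (p ^ (i + n)) = \<one>" using d(2) c by (simp add: int_pow_pow power_add)
  moreover have "\<not> p dvd p ^ (j - i) - 1"
  proof
    assume "p dvd p ^ (j - i) - 1"
    moreover have "p dvd p ^ (j - i)" using ij by (intro dvd_power) auto
    ultimately have "p dvd 1" using dvd_diff[of p "p ^ (j - i)" "p ^ (j - i) - 1"] by simp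
    then show False using p not_prime_unit by blast
  qed
  then have "coprime (p ^ (j - i) - 1) (p ^ (i + n))" using prime_not_dvd_coprime[OF p] by blast
  ultimately have "d i = \<one>" using coprime_pow_one[OF c] by blast
  then show False using d0 d(3) by simp
qed

text \<open>Suppose that \<open>\<psi> z0\<close> is not trivial and let \<open>Z\<close> be a
  quasicyclic group through \<open>z0\<close>. Elements \<open>x n\<close> of \<open>C\<close> are
  attached to the roots \<open>z n\<close> such that the \<open>u n = x n + z n\<close> generate a
  subgroup \<open>U\<close> avoiding \<open>Z\<close>. As \<open>\<psi>\<close> kills
  \<open>C\<close>, its value at \<open>u n\<close> is that at \<open>z n\<close>. These values lie
  in \<open>g U + U\<close> and in \<open>Z\<close>, so only finitely many are distinct; but they
  form a nontrivial chain of roots.\<close>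

lemma deviation_on_divisible:
  assumes P: "p_subgroup G p P" and C: "finite_socle G p P C"
    and g: "inertial_map G g" "g ` P \<subseteq> P" "power_on G g C"
    and unb: "\<forall>b. \<exists>c\<in>C. c [^] (p ^ b) \<noteq> \<one>"
    and \<psi>: "\<forall>x\<in>P. \<forall>y\<in>P. \<psi> (x \<otimes> y) = \<psi> x \<otimes> \<psi> y" "\<forall>c\<in>C. \<psi> c = \<one>"
      "\<forall>n. \<exists>a::int. \<forall>x\<in>P. x [^] (p ^ n) = \<one> \<longrightarrow> \<psi> x = g x \<otimes> x [^] a"
    and D: "subgroup D G" "D \<subseteq> P" "p_divisible G p D" "z0 \<in> D"
  shows "\<psi> z0 = \<one>"
proof (rule ccontr)
  assume nz: "\<psi> z0 \<noteq> \<one>"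
  have p: "prime p" and sP: "subgroup P G" using P by (auto simp: p_subgroup_def)
  note Pc = p_subgroup_carr[OF P]
  note gh = inertial_hom[OF g(1)]
  have sC: "subgroup C G" and CP: "C \<subseteq> P" using C by (auto simp: finite_socle_def)
  note Cp = p_subgroup_sub[OF P sC CP]
  have "D \<subseteq> carrier G" using sub_carr[OF D(1)] by blast
  then obtain z where z: "z 0 = z0" "root_chain p z" "\<forall>i. z i \<in> D"
    using p_divisible_chain[OF D(3,4)] by blast
  note zc = root_chain_carr[OF z(2)]
  define Z where "Z = chain_group z"
  have sZ: "subgroup Z G" unfolding Z_def by (rule chain_group_subgroup[OF z(2)])
  have ZP: "Z \<subseteq> P" using chain_group_subset[OF D(1) z(3)] D(2) by (simp add: Z_def)
  have divZ: "p_divisible G p Z" unfolding Z_def by (rule chain_group_divisible[OF z(2)])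
  have zZ: "z i \<in> Z" for i unfolding Z_def by (rule chain_group_self[OF z(2)])
  note Zp = p_subgroup_sub[OF P sZ ZP]
  have zP: "z i \<in> P" for i using zZ ZP by blast
  \<comment> \<open>\<open>C\<close> has no nontrivial divisible subgroup \<open>D'\<close>.
    Otherwise \<open>g\<close> acts on the \<open>p ^ n\<close>-layer of the divisible group
    \<open>D' + Z\<close> with one exponent. It is cancelled on an element of order
    \<open>p ^ n\<close> in \<open>D'\<close>, where \<open>\<psi>\<close> vanishes, and therefore
    \<open>\<psi> z0\<close> vanishes too.\<close>
  have noD: False if D': "subgroup D' G" "D' \<subseteq> C" "p_divisible G p D'" "d0 \<in> D'" "d0 \<noteq> \<one>" for D' d0
  proof -
    note D'p = p_subgroup_sub[OF Cp D'(1,2)]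
    have D'c: "D' \<subseteq> carrier G" using sub_carr[OF D'(1)] by blast
    have Zc: "Z \<subseteq> carrier G" using sub_carr[OF sZ] by blast
    define B where "B = D' <#> Z"
    have sB: "subgroup B G" unfolding B_def by (rule mult_subgroups[OF D'(1) sZ])
    have BP: "B \<subseteq> P" unfolding B_def set_mult_def using D'(2) CP ZP sub_mult[OF sP] by blast
    have D'B: "D' \<subseteq> B"
    proof
      fix x assume x: "x \<in> D'"
      then have "x = x \<otimes> \<one>" using D'c by auto
      then show "x \<in> B" unfolding B_def set_mult_def using x sub_one[OF sZ] by blast
    qed
    have ZB: "Z \<subseteq> B"
    proof
      fix x assume x: "x \<in> Z"
      then have "x = \<one> \<otimes> x" using Zc by auto
      then show "x \<in> B" unfolding B_def set_mult_def using x sub_one[OF D'(1)] by blast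
    qed
    have "p_divisible G p B"
      unfolding p_divisible_def
    proof
      fix x assume "x \<in> B"
      then obtain d w where dw: "d \<in> D'" "w \<in> Z" "x = d \<otimes> w" unfolding B_def set_mult_def by blast
      obtain d1 w1 where 1: "d1 \<in> D'" "w1 \<in> Z" "d = d1 [^] p" "w = w1 [^] p"
        using D'(3) divZ dw unfolding p_divisible_def by blast
      have "x = (d1 \<otimes> w1) [^] p" using dw 1 D'c Zc by (simp add: int_pow_distrib subsetD)
      then show "\<exists>y\<in>B. x = y [^] p" using 1 unfolding B_def set_mult_def by blast
    qed
    then have pw: "power_on G g B" by (rule inertial_power_on_divisible[OF g(1) p_subgroup_sub[OF P sB BP]])
    obtain n where n: "z0 [^] (p ^ n) = \<one>" using p_subgroup_ord[OF P, of z0] zP[of 0] z(1) by auto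
    have "\<exists>l::int. \<forall>c\<in>{c\<in>B. c [^] (p ^ n) = \<one>}. g c = c [^] l"
    proof (rule power_on_uniform[OF p pow_kernel_subgroup[OF sB] gh, of "p ^ n" n])
      show "power_on G g {c\<in>B. c [^] (p ^ n) = \<one>}" using pw by (auto simp: power_on_def)
    qed simp
    then obtain l :: int where l: "\<forall>c\<in>{c\<in>B. c [^] (p ^ n) = \<one>}. g c = c [^] l" by blast
    obtain a :: int where a: "\<forall>x\<in>P. x [^] (p ^ n) = \<one> \<longrightarrow> \<psi> x = g x \<otimes> x [^] a" using \<psi>(3) by blast
    have \<psi>l: "\<psi> c = c [^] (l + a)" if "c \<in> B" "c [^] (p ^ n) = \<one>" for c
      using l a that BP Pc by (auto simp: int_pow_mult)
    obtain d where d: "d \<in> D'" "d [^] (p ^ n) = \<one>" "\<forall>k::int. d [^] k = \<one> \<longrightarrow> p ^ n dvd k"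
      by (rule exact_order_in_unbounded[OF D'p p_divisible_unbounded[OF D'p D'(3-5)]])
    have "d \<in> B" "\<psi> d = \<one>" using d(1) D'B \<psi>(2) D'(2) by blast+
    then have "d [^] (l + a) = \<one>" using \<psi>l[OF _ d(2)] by simp
    then have "p ^ n dvd l + a" using d(3) by blast
    then have "z0 [^] (l + a) = \<one>" using pow_dvd_one[OF _ n] zc[of 0] z(1) by simp
    then show False using nz \<psi>l[of z0] n zZ[of 0] z(1) ZB by auto
  qed
  have z0C: "z0 \<notin> C" using nz \<psi>(2) by blast
  have fin: "finite (Z \<inter> C)"
  proof (rule finite_subset)
    have "z0 \<in> torsion_subgroup G"
      using zP[of 0] z(1) P primary_torsion[OF p] by (auto simp: p_subgroup_def)
    then show "finite (adjoin G {\<one>} z0)" by (intro adjoin_finite' subgroup_one_set) auto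
    show "Z \<inter> C \<subseteq> adjoin G {\<one>} z0"
    proof
      fix w assume w: "w \<in> Z \<inter> C"
      then obtain i k where ik: "w = z i [^] (k::int)" by (auto simp: Z_def chain_group_def)
      \<comment> \<open>Since \<open>z0 = p ^ i (z i)\<close> lies outside \<open>C\<close>, the
        order of \<open>z i\<close> modulo \<open>C\<close> exceeds \<open>p ^ i\<close>; a multiple
        of \<open>z i\<close> in \<open>C\<close> is therefore a multiple of
        \<open>z0\<close>.\<close>
      have notin: "z i [^] (p ^ j) \<notin> C" if "j \<le> i" for j
      proof
        assume "z i [^] (p ^ j) \<in> C"
        then have "(z i [^] (p ^ j)) [^] (p ^ (i - j)) \<in> C" by (rule sub_pow[OF sC])
        moreover have "p ^ j * p ^ (i - j) = p ^ i" using that by (simp flip: power_add)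
        ultimately have "z i [^] (p ^ i) \<in> C" using zc by (simp add: int_pow_pow)
        then show False using root_chain_pow[OF z(2), of 0 i] z(1) z0C by simp
      qed
      define M where "M = (LEAST n. z i [^] (p ^ n) \<in> C)"
      obtain N where "z i [^] (p ^ N) = \<one>" using p_subgroup_ord[OF P zP] by blast
      then have "z i [^] (p ^ N) \<in> C" using sub_one[OF sC] by simp
      then have M: "z i [^] (p ^ M) \<in> C" unfolding M_def by (rule LeastI)
      then have "i < M" using notin[of M] by (meson not_le)
      then obtain m where m: "M = Suc m" "i \<le> m" by (metis Suc_le_D Suc_leI Suc_le_mono)
      have "z i [^] (p ^ m) \<notin> C" using not_less_Least[of m "\<lambda>n. z i [^] (p ^ n) \<in> C"] m M_def by simp
      then have "p ^ Suc m dvd k" using pow_mem_dvd[OF p sC zc, of i m k] M m w ik by simp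
      moreover have "p ^ i dvd p ^ Suc m" using m by (intro le_imp_power_dvd) simp
      ultimately have "p ^ i dvd k" by (rule dvd_trans[rotated])
      then obtain q where "k = p ^ i * q" by blast
      then have "w = z0 [^] q" using ik root_chain_pow[OF z(2), of 0 i] z(1) zc by (simp add: int_pow_pow)
      then have "w = \<one> \<otimes> z0 [^] q" using zc[of 0] z(1) by simp
      then show "w \<in> adjoin G {\<one>} z0" by (auto simp: adjoin_def)
    qed
  qed
  have sZC: "subgroup (Z \<inter> C) G" by (rule subgroup_Int[OF sZ sC])
  \<comment> \<open>The sum of \<open>Y\<close>, the cyclic group of \<open>x\<close> and
    \<open>Z\<close> is direct, and the order of \<open>x\<close> is a multiple of that of
    \<open>z n\<close>. The latter ensures that a multiple of \<open>x + z n\<close> whose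
    \<open>x\<close>-part vanishes is trivial.\<close>
  define good where "good Y n x \<longleftrightarrow> x \<in> C \<and> (\<forall>h\<in>Y. \<forall>k::int. h \<otimes> x [^] k \<in> Z \<longrightarrow> h = \<one> \<and> x [^] k = \<one> \<and> z n [^] k = \<one>)"
    for Y and n :: nat and x
  have step: "\<exists>x. good Y n x" if Y: "subgroup Y G" "finite Y" "Y \<subseteq> C" "Y \<inter> Z \<subseteq> {\<one>}" for Y n
  proof -
    define E where "E = Y <#> (Z \<inter> C)"
    have E: "finite E" "subgroup E G" unfolding E_def
      using Y(2) fin mult_subgroups[OF Y(1) sZC] by (simp_all add: set_mult_def)
    have Ec: "E \<subseteq> carrier G" using sub_carr[OF E(2)] by blast
    obtain M where M: "subgroup M G" "M \<subseteq> C" "M \<inter> E \<subseteq> {\<one>}"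
      "\<forall>x\<in>C - M. \<exists>c\<in>M. \<exists>k::int. c \<otimes> x [^] k \<in> E \<and> c \<otimes> x [^] k \<noteq> \<one>"
      by (rule max_disjoint_subgroup[OF sC])
    have fM: "finite_socle G p C M" by (rule finite_socle_max[OF Cp E(1) Ec M])
    obtain r where r: "z n [^] (p ^ r) = \<one>" using p_subgroup_ord[OF P zP] by blast
    \<comment> \<open>If \<open>M\<close> were bounded, \<open>C\<close> would be the sum of a
      divisible and a bounded subgroup. Being unbounded, it would contain a nontrivial divisible
      subgroup, which \<open>noD\<close> excludes.\<close>
    have "\<not> (\<forall>c\<in>M. c [^] (p ^ r) = \<one>)"
    proof
      assume bd: "\<forall>c\<in>M. c [^] (p ^ r) = \<one>"
      obtain D' j where D': "subgroup D' G" "D' \<subseteq> C" "p_divisible G p D'"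
        "\<forall>x\<in>C. \<exists>d\<in>D'. \<exists>y\<in>C. y [^] (p ^ j) = \<one> \<and> x = d \<otimes> y"
        by (rule finite_socle_bounded[OF Cp fM bd])
      obtain c where c: "c \<in> C" "c [^] (p ^ j) \<noteq> \<one>" using unb by blast
      obtain d y where dy: "d \<in> D'" "y \<in> C" "y [^] (p ^ j) = \<one>" "c = d \<otimes> y" using D'(4) c by blast
      have "d \<noteq> \<one>" using dy c sub_carr[OF sC dy(2)] by auto
      then show False using noD[OF D'(1-3) dy(1)] by blast
    qed
    then obtain x where x: "x \<in> M" "x [^] (p ^ r) \<noteq> \<one>" by blast
    have xc: "x \<in> carrier G" using sub_carr[OF M(1) x(1)] .
    have xC: "x \<in> C" using x M by blast
    have "good Y n x"
      unfolding good_def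
    proof (intro conjI ballI allI impI)
      show "x \<in> C" by (rule xC)
      fix h k assume h: "h \<in> Y" and hk: "h \<otimes> x [^] (k::int) \<in> Z"
      have hc: "h \<in> carrier G" "h \<in> C" using sub_carr[OF Y(1) h] Y(3) h by auto
      have "h \<otimes> x [^] k \<in> Z \<inter> C" using hk hc xC sub_mult[OF sC] sub_pow[OF sC] by blast
      moreover have "x [^] k = inv h \<otimes> (h \<otimes> x [^] k)" using hc xc by simp
      ultimately have "x [^] k \<in> E" unfolding E_def set_mult_def using sub_inv[OF Y(1) h] by blast
      then show xk: "x [^] k = \<one>" using M(3) sub_pow[OF M(1) x(1)] by blast
      then show "h = \<one>" using hk h Y(4) hc by auto
      have x1: "x \<noteq> \<one>" using x by auto
      obtain N where N: "x [^] (p ^ N) = \<one>" using p_subgroup_ord[OF Cp xC] by blast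
      obtain m where m: "x [^] (p ^ Suc m) = \<one>" "x [^] (p ^ m) \<noteq> \<one>" by (rule exact_order[OF xc N x1])
      have "r \<le> m"
      proof (rule ccontr)
        assume "\<not> r \<le> m"
        then have "Suc m \<le> r" by simp
        then show False using pow_p_mono[OF xc m(1)] x(2) by blast
      qed
      then have "p ^ r dvd p ^ Suc m" by (intro le_imp_power_dvd) simp
      then have "p ^ r dvd k" using pow_one_dvd[OF p xc m xk] by (rule dvd_trans)
      then show "z n [^] k = \<one>" using pow_dvd_one[OF zc r] by blast
    qed
    then show ?thesis by blast
  qed
  define sel where "sel n Y = (SOME x. good Y n x)" for n Y
  have sel: "good Y n (sel n Y)" if Y: "subgroup Y G" "finite Y" "Y \<subseteq> C" "Y \<inter> Z \<subseteq> {\<one>}" for Y n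
    unfolding sel_def using step[OF that] by (rule someI_ex)
  define Xs where "Xs = rec_nat {\<one>} (\<lambda>n Y. adjoin G Y (sel n Y))"
  define x where "x n = sel n (Xs n)" for n
  have X0: "Xs 0 = {\<one>}" and XS: "Xs (Suc n) = adjoin G (Xs n) (x n)" for n by (simp_all add: Xs_def x_def)
  have Xs: "subgroup (Xs n) G \<and> finite (Xs n) \<and> Xs n \<subseteq> C \<and> Xs n \<inter> Z \<subseteq> {\<one>}" for n
  proof (induction n)
    case 0
    then show ?case using X0 subgroup_one_set sub_one[OF sC] by auto
  next
    case (Suc n)
    then have gd: "good (Xs n) n (x n)" unfolding x_def using sel by blast
    then have xC: "x n \<in> C" by (simp add: good_def)
    have xc: "x n \<in> carrier G" using sub_carr[OF sC xC] .
    have "x n \<in> torsion_subgroup G" using xC CP P primary_torsion[OF p] by (auto simp: p_subgroup_def)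
    moreover have "adjoin G (Xs n) (x n) \<inter> Z \<subseteq> {\<one>}"
    proof
      fix y assume y: "y \<in> adjoin G (Xs n) (x n) \<inter> Z"
      then obtain h k where hk: "h \<in> Xs n" "y = h \<otimes> x n [^] (k::int)" by (auto simp: adjoin_def)
      then have "h = \<one>" "x n [^] k = \<one>" using gd y unfolding good_def by blast+
      then show "y \<in> {\<one>}" using hk by simp
    qed
    ultimately show ?case unfolding XS
      using Suc adjoin_subgroup[OF _ xc] adjoin_finite' adjoin_least[OF sC _ xC] by auto
  qed
  have gd: "good (Xs n) n (x n)" for n unfolding x_def using sel Xs by blast
  then have xC: "x n \<in> C" for n by (simp add: good_def)
  have xc: "x n \<in> carrier G" for n using sub_carr[OF sC xC] .
  define u where "u n = x n \<otimes> z n" for n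
  have uc: "u n \<in> carrier G" for n using xc zc by (simp add: u_def)
  define H where "H = rec_nat {\<one>} (\<lambda>n H. adjoin G H (u n))"
  have H0: "H 0 = {\<one>}" and HS: "H (Suc n) = adjoin G (H n) (u n)" for n by (simp_all add: H_def)
  have H: "subgroup (H n) G" for n
    by (induction n) (simp_all add: H0 HS subgroup_one_set adjoin_subgroup uc)
  have Hsub: "H n \<subseteq> H (Suc n)" "u n \<in> H (Suc n)" for n
  proof -
    have "H n \<subseteq> carrier G" using sub_carr[OF H] by blast
    then show "H n \<subseteq> H (Suc n)" unfolding HS by (rule adjoin_base)
    show "u n \<in> H (Suc n)" unfolding HS by (rule adjoin_self[OF H uc])
  qed
  \<comment> \<open>The \<open>Z\<close>-component of an element of \<open>H n\<close> is determined
    by its component in \<open>Xs n\<close>, in the sense that it vanishes with the latter. This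
    makes the union of the \<open>H n\<close> disjoint from \<open>Z\<close>.\<close>
  have HX: "\<exists>a\<in>Xs n. \<exists>b\<in>Z. h = a \<otimes> b \<and> (a = \<one> \<longrightarrow> b = \<one>)" if "h \<in> H n" for h n
    using that
  proof (induction n arbitrary: h)
    case 0
    then show ?case using H0 X0 sub_one[OF sZ] by (intro bexI[of _ \<one>]) auto
  next
    case (Suc n)
    then obtain h' k where h': "h' \<in> H n" "h = h' \<otimes> u n [^] (k::int)" by (auto simp: HS adjoin_def)
    then obtain a b where ab: "a \<in> Xs n" "b \<in> Z" "h' = a \<otimes> b" "a = \<one> \<longrightarrow> b = \<one>" using Suc.IH by blast
    have c: "a \<in> carrier G" "b \<in> carrier G" using sub_carr[of "Xs n" a] Xs ab sub_carr[OF sZ ab(2)] by auto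
    have e: "h = (a \<otimes> x n [^] k) \<otimes> (b \<otimes> z n [^] k)"
      unfolding h'(2) ab(3) u_def using c xc zc by (simp add: int_pow_distrib m_ac)
    have "a \<otimes> x n [^] k \<in> Xs (Suc n)" using ab by (auto simp: XS adjoin_def)
    moreover have "b \<otimes> z n [^] k \<in> Z" using ab zZ by (simp add: sub_mult[OF sZ] sub_pow[OF sZ])
    moreover have "b \<otimes> z n [^] k = \<one>" if "a \<otimes> x n [^] k = \<one>"
    proof -
      have "a \<otimes> x n [^] k \<in> Z" using that sub_one[OF sZ] by simp
      then have "a = \<one>" "z n [^] k = \<one>" using gd[of n] ab unfolding good_def by blast+
      then show ?thesis using ab(4) by simp
    qed
    ultimately show ?case using e by blast
  qed
  define U where "U = (\<Union>n. H n)"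
  have sU: "subgroup U G" unfolding U_def using subgroup_UN_chain[of H] H Hsub(1) by blast
  have UZ: "y = \<one>" if y: "y \<in> U" "y \<in> Z" for y
  proof -
    obtain n where "y \<in> H n" using y by (auto simp: U_def)
    then obtain a b where ab: "a \<in> Xs n" "b \<in> Z" "y = a \<otimes> b" "a = \<one> \<longrightarrow> b = \<one>" using HX by blast
    have ac: "a \<in> carrier G" using sub_carr[of "Xs n" a] Xs ab by blast
    have "a \<in> Z" using sub_cancel'[OF sZ ab(2) ac] ab y by simp
    then have "a = \<one>" using ab Xs by blast
    then show ?thesis using ab by simp
  qed
  have pwZ: "power_on G g Z" by (rule inertial_power_on_divisible[OF g(1) Zp divZ])
  have ex: "\<exists>a::int. \<psi> y = g y \<otimes> y [^] a" if yP: "y \<in> P" for y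
  proof -
    obtain n where "y [^] (p ^ n) = \<one>" using p_subgroup_ord[OF P yP] by blast
    then show ?thesis using \<psi>(3) yP by blast
  qed
  have \<psi>pow: "\<psi> (y [^] k) = \<psi> y [^] (k::int)" if y: "y \<in> P" for y k
  proof -
    obtain n where n: "y [^] (p ^ n) = \<one>" using p_subgroup_ord[OF P y] by blast
    obtain a :: int where a: "\<forall>x\<in>P. x [^] (p ^ n) = \<one> \<longrightarrow> \<psi> x = g x \<otimes> x [^] a" using \<psi>(3) by blast
    have yc: "y \<in> carrier G" "g y \<in> carrier G" using Pc[OF y] hom_in_carrier[OF gh] by auto
    have "(y [^] k) [^] (p ^ n) = (y [^] (p ^ n)) [^] k" using yc by (simp add: int_pow_pow mult.commute)
    then have "(y [^] k) [^] (p ^ n) = \<one>" using n by simp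
    then have "\<psi> (y [^] k) = g (y [^] k) \<otimes> (y [^] k) [^] a" using a sub_pow[OF sP y] by blast
    also have "\<dots> = (g y \<otimes> y [^] a) [^] k"
      using yc by (simp add: hom_pow[OF gh] int_pow_distrib int_pow_pow mult.commute)
    finally show ?thesis using a y n by simp
  qed
  define e where "e n = \<psi> (z n)" for n
  have eZ: "e n \<in> Z" for n
  proof -
    obtain a l :: int where "\<psi> (z n) = g (z n) \<otimes> z n [^] a" "g (z n) = z n [^] l"
      using ex[OF zP] pwZ zZ by (metis power_on_def)
    then show ?thesis unfolding e_def using zZ sub_mult[OF sZ] sub_pow[OF sZ] by simp
  qed
  have ech: "root_chain p e"
    unfolding root_chain_def
  proof
    fix i
    have "z i = z (Suc i) [^] p" using z(2) unfolding root_chain_def by blast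
    then have "e i = e (Suc i) [^] p" unfolding e_def using \<psi>pow[OF zP] by metis
    then show "e i \<in> carrier G \<and> e i = e (Suc i) [^] p" using eZ sub_carr[OF sZ] by blast
  qed
  \<comment> \<open>Here the choice of \<open>u n\<close> pays off: \<open>\<psi>\<close> does not
    see \<open>x n\<close>, so a value belonging to \<open>Z\<close> is expressed by an element of
    \<open>U\<close> and its image.\<close>
  have eU: "e n \<in> g ` U <#> U" for n
  proof -
    have uU: "u n \<in> U" using Hsub(2) by (auto simp: U_def)
    have uP: "u n \<in> P" using xC CP zP sub_mult[OF sP] unfolding u_def by blast
    obtain a :: int where a: "\<psi> (u n) = g (u n) \<otimes> u n [^] a" using ex[OF uP] by blast
    have "\<psi> (u n) = \<psi> (x n) \<otimes> \<psi> (z n)" unfolding u_def using \<psi>(1) xC CP zP by blast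
    also have "\<dots> = e n" using \<psi>(2) xC eZ[of n] sub_carr[OF sZ] by (simp add: e_def)
    finally have "e n = g (u n) \<otimes> u n [^] a" using a by simp
    then show ?thesis unfolding set_mult_def using uU sub_pow[OF sU uU] by blast
  qed
  have "almost_le G U U" using sub_carr[OF sU] by (intro almost_le_refl) auto
  then have al: "almost_le G (g ` U <#> U) U" using almost_le_mult[OF inertial_almost_le[OF g(1) sU] _ sU] by blast
  obtain i j where ij: "i < j" "e j \<otimes> inv e i \<in> U" by (rule almost_le_pigeonhole[OF al sU eU])
  have "e j \<otimes> inv e i \<in> Z" using eZ sub_mult[OF sZ] sub_inv[OF sZ] by blast
  then have "e j \<otimes> inv e i = \<one>" using UZ ij by blast
  then have "e i = e j" using eZ sub_carr[OF sZ] by (metis inv_equality inv_closed inv_inv)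
  moreover obtain n where "e 0 [^] (p ^ n) = \<one>" using p_subgroup_ord[OF Zp eZ] by blast
  moreover have "e 0 \<noteq> \<one>" using nz z(1) by (simp add: e_def)
  ultimately show False using root_chain_distinct[OF p ech _ _ ij(1)] by blast
qed

text \<open>Let \<open>R\<close> be maximal disjoint from \<open>D\<close>. If \<open>p x\<close>
  lies in \<open>R + D\<close>, subtracting an element of the divisible \<open>D\<close> moves
  \<open>p x\<close> into \<open>R\<close>, and maximality then yields a multiple of
  \<open>x\<close> prime to \<open>p\<close> inside \<open>R + D\<close>. Induction on the order
  covers all of \<open>P\<close>.\<close>

lemma p_divisible_complement:
  assumes P: "p_subgroup G p P" and D: "subgroup D G" "D \<subseteq> P" "p_divisible G p D"
  obtains R where "subgroup R G" "R \<subseteq> P" "R \<inter> D \<subseteq> {\<one>}" "P \<subseteq> R <#> D"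
proof -
  have p: "prime p" and sP: "subgroup P G" using P by (auto simp: p_subgroup_def)
  note Pc = p_subgroup_carr[OF P]
  obtain R where R: "subgroup R G" "R \<subseteq> P" "R \<inter> D \<subseteq> {\<one>}"
    "\<forall>x\<in>P - R. \<exists>c\<in>R. \<exists>k::int. c \<otimes> x [^] k \<in> D \<and> c \<otimes> x [^] k \<noteq> \<one>"
    by (rule max_disjoint_subgroup[OF sP])
  define B where "B = R <#> D"
  have sB: "subgroup B G" unfolding B_def by (rule mult_subgroups[OF R(1) D(1)])
  have RB: "r \<in> B" if "r \<in> R" for r
  proof -
    have "r = r \<otimes> \<one>" using sub_carr[OF R(1) that] by simp
    then show ?thesis unfolding B_def set_mult_def using that sub_one[OF D(1)] by blast
  qed
  have DB: "d \<in> B" if "d \<in> D" for d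
  proof -
    have "d = \<one> \<otimes> d" using sub_carr[OF D(1) that] by simp
    then show ?thesis unfolding B_def set_mult_def using that sub_one[OF R(1)] by blast
  qed
  have one_step: "x \<in> B" if x: "x \<in> P" "x [^] p \<in> B" for x
  proof -
    obtain r d where rd: "r \<in> R" "d \<in> D" "x [^] p = r \<otimes> d" using x(2) unfolding B_def set_mult_def by blast
    obtain d' where d': "d' \<in> D" "d = d' [^] p" using D(3) rd by (auto simp: p_divisible_def)
    have c: "x \<in> carrier G" "d' \<in> carrier G" "r \<in> carrier G"
      using Pc x d' sub_carr[OF D(1)] sub_carr[OF R(1)] rd by auto
    define y where "y = x \<otimes> inv d'"
    have yc: "y \<in> carrier G" using c by (simp add: y_def)
    have yP: "y \<in> P" unfolding y_def using x d' D(2) sub_mult[OF sP] sub_inv[OF sP] by blast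
    have yp: "y [^] p = r" unfolding y_def using c rd d' by (simp add: int_pow_distrib int_pow_inv)
    have "y \<in> B"
    proof (cases "y \<in> R")
      case False
      then obtain c0 k where ck: "c0 \<in> R" "c0 \<otimes> y [^] (k::int) \<in> D" "c0 \<otimes> y [^] k \<noteq> \<one>" using R(4) yP by blast
      have "\<not> p dvd k"
      proof
        assume "p dvd k"
        then obtain q where "k = p * q" by blast
        then have "y [^] k \<in> R" using yp rd yc sub_pow[OF R(1), of r q] int_pow_pow[of y p q] by simp
        then have "c0 \<otimes> y [^] k \<in> R" using ck sub_mult[OF R(1)] by blast
        then show False using ck R(3) by blast
      qed
      then have cop: "coprime k p" using prime_not_dvd_coprime[OF p, of k 1] by simp
      have "y [^] k \<in> B" using sub_cancel[OF sB RB[OF ck(1)]] DB[OF ck(2)] yc by simp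
      moreover have "y [^] p \<in> B" using yp RB rd by simp
      ultimately show ?thesis using coprime_pow_mem[OF sB yc _ _ cop] by blast
    qed (rule RB)
    moreover have "x = y \<otimes> d'" unfolding y_def using c by simp
    ultimately show ?thesis using DB[OF d'(1)] sub_mult[OF sB] by simp
  qed
  have steps: "x \<in> B" if "x \<in> P" "x [^] (p ^ n) \<in> B" for x n
    using that
  proof (induction n arbitrary: x)
    case 0
    then show ?case using Pc by simp
  next
    case (Suc n)
    have "(x [^] p) [^] (p ^ n) \<in> B" using Suc.prems Pc by (simp add: int_pow_pow)
    then have "x [^] p \<in> B" using Suc sub_pow[OF sP] by blast
    then show ?case using one_step Suc.prems by blast
  qed
  have "P \<subseteq> B"
  proof
    fix x assume x: "x \<in> P"
    then obtain n where "x [^] (p ^ n) = \<one>" using p_subgroup_ord[OF P] by blast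
    then show "x \<in> B" using steps[OF x, of n] sub_one[OF sB] by simp
  qed
  then show ?thesis using that[OF R(1-3)] by (simp add: B_def)
qed

text \<open>It suffices that \<open>\<psi>\<close> vanishes on \<open>D\<close>. Dividing
  \<open>x\<close> repeatedly by \<open>p\<close> modulo \<open>C\<close> and applying
  \<open>\<psi>\<close>, which kills \<open>C\<close>, gives a genuine chain of roots starting at
  \<open>\<psi> x\<close>. It spans a divisible group \<open>D1\<close>, on which
  \<open>\<psi>\<close> vanishes, so that the chain is also obtained from elements of a complement
  of \<open>D1\<close>.\<close>

lemma power_on_divisible_hull:
  assumes P: "p_subgroup G p P" and C: "finite_socle G p P C"
    and g: "inertial_map G g" "g ` P \<subseteq> P" "power_on G g C"
    and unb: "\<forall>b. \<exists>c\<in>C. c [^] (p ^ b) \<noteq> \<one>"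
    and D: "subgroup D G" "D \<subseteq> P" "\<forall>x\<in>D. \<exists>y\<in>D. \<exists>c\<in>C. x = y [^] p \<otimes> c"
  shows "power_on G g D"
proof -
  have p: "prime p" and sP: "subgroup P G" using P by (auto simp: p_subgroup_def)
  note Pc = p_subgroup_carr[OF P]
  note gh = inertial_hom[OF g(1)]
  have sC: "subgroup C G" and CP: "C \<subseteq> P" using C by (auto simp: finite_socle_def)
  obtain \<psi> where \<psi>: "\<forall>x\<in>P. \<psi> x \<in> P" "\<forall>x\<in>P. \<forall>y\<in>P. \<psi> (x \<otimes> y) = \<psi> x \<otimes> \<psi> y" "\<forall>c\<in>C. \<psi> c = \<one>"
    "\<forall>n. \<exists>a::int. \<forall>x\<in>P. x [^] (p ^ n) = \<one> \<longrightarrow> \<psi> x = g x \<otimes> x [^] a"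
    by (rule power_deviation[OF P sC CP gh g(2,3) unb])
  note dev = deviation_on_divisible[OF P C g unb \<psi>(2-4)]
  have ex: "\<exists>a::int. \<psi> y = g y \<otimes> y [^] a" if yP: "y \<in> P" for y
  proof -
    obtain n where "y [^] (p ^ n) = \<one>" using p_subgroup_ord[OF P yP] by blast
    then show ?thesis using \<psi>(4) yP by blast
  qed
  have \<psi>p: "\<psi> (y [^] p) = \<psi> y [^] p" if y: "y \<in> P" for y
  proof -
    obtain n where n: "y [^] (p ^ n) = \<one>" using p_subgroup_ord[OF P y] by blast
    obtain a :: int where a: "\<forall>x\<in>P. x [^] (p ^ n) = \<one> \<longrightarrow> \<psi> x = g x \<otimes> x [^] a" using \<psi>(4) by blast
    have yc: "y \<in> carrier G" "g y \<in> carrier G" using Pc[OF y] hom_in_carrier[OF gh] by auto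
    have "(y [^] p) [^] (p ^ n) = (y [^] (p ^ n)) [^] p" using yc by (simp add: int_pow_pow mult.commute)
    then have "(y [^] p) [^] (p ^ n) = \<one>" using n by simp
    then have "\<psi> (y [^] p) = g (y [^] p) \<otimes> (y [^] p) [^] a" using a sub_pow[OF sP y] by blast
    also have "\<dots> = (g y \<otimes> y [^] a) [^] p"
      using yc by (simp add: hom_pow[OF gh] int_pow_distrib int_pow_pow mult.commute)
    finally show ?thesis using a y n by simp
  qed
  have zero: "\<psi> x = \<one>" if x: "x \<in> D" for x
  proof (rule ccontr)
    assume nz: "\<psi> x \<noteq> \<one>"
    define y where "y = rec_nat x (\<lambda>_ y. SOME w. w \<in> D \<and> (\<exists>c\<in>C. y = w [^] p \<otimes> c))"
    have y0: "y 0 = x" and yS: "y (Suc i) = (SOME w. w \<in> D \<and> (\<exists>c\<in>C. y i = w [^] p \<otimes> c))" for i by (simp_all add: y_def)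
    have ystep: "y (Suc i) \<in> D \<and> (\<exists>c\<in>C. y i = y (Suc i) [^] p \<otimes> c)" if "y i \<in> D" for i
    proof -
      have "\<exists>w. w \<in> D \<and> (\<exists>c\<in>C. y i = w [^] p \<otimes> c)" using D(3) that by blast
      then show ?thesis unfolding yS by (rule someI_ex)
    qed
    have yD: "y i \<in> D" for i by (induction i) (use y0 x ystep in auto)
    have yP: "y i \<in> P" for i using yD D(2) by blast
    define d where "d i = \<psi> (y i)" for i
    have dP: "d i \<in> P" for i unfolding d_def using \<psi>(1) yP by blast
    have dch: "root_chain p d"
      unfolding root_chain_def
    proof
      fix i
      obtain c where c: "c \<in> C" "y i = y (Suc i) [^] p \<otimes> c" using ystep[OF yD] by blast
      have "d i = \<psi> (y (Suc i) [^] p) \<otimes> \<psi> c" unfolding d_def c(2) using \<psi>(2) c(1) CP yP sub_pow[OF sP] by blast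
      also have "\<dots> = d (Suc i) [^] p" using \<psi>(3) c(1) \<psi>p[OF yP] Pc[OF dP[of "Suc i"]] by (simp add: d_def)
      finally show "d i \<in> carrier G \<and> d i = d (Suc i) [^] p" using Pc[OF dP] by blast
    qed
    define D1 where "D1 = chain_group d"
    have sD1: "subgroup D1 G" unfolding D1_def by (rule chain_group_subgroup[OF dch])
    have D1P: "D1 \<subseteq> P" unfolding D1_def using chain_group_subset[OF sP] dP by blast
    have D1div: "p_divisible G p D1" unfolding D1_def by (rule chain_group_divisible[OF dch])
    have dD1: "d i \<in> D1" for i unfolding D1_def by (rule chain_group_self[OF dch])
    obtain R where R: "subgroup R G" "R \<subseteq> P" "R \<inter> D1 \<subseteq> {\<one>}" "P \<subseteq> R <#> D1"
      by (rule p_divisible_complement[OF P sD1 D1P D1div])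
    \<comment> \<open>Replacing \<open>y i\<close> by its component in \<open>R\<close> does not
      change the value of \<open>\<psi>\<close>. Hence the chain lies in \<open>g R + R\<close>, and
      two of its terms differ by an element of \<open>R \<inter> D1\<close>.\<close>
    have dR: "d i \<in> g ` R <#> R" for i
    proof -
      obtain r w where rw: "r \<in> R" "w \<in> D1" "y i = r \<otimes> w" using R(4) yP[of i] unfolding set_mult_def by blast
      have rP: "r \<in> P" "w \<in> P" using rw R(2) D1P by auto
      have "d i = \<psi> r \<otimes> \<psi> w" unfolding d_def rw(3) using \<psi>(2) rP by blast
      also have "\<psi> w = \<one>" using dev[OF sD1 D1P D1div] rw(2) by blast
      finally have "d i = \<psi> r" using \<psi>(1) rP Pc by simp
      moreover obtain a :: int where "\<psi> r = g r \<otimes> r [^] a" using ex[OF rP(1)] by blast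
      ultimately show ?thesis unfolding set_mult_def using rw(1) sub_pow[OF R(1) rw(1)] by force
    qed
    have "almost_le G R R" using sub_carr[OF R(1)] by (intro almost_le_refl) auto
    then have al: "almost_le G (g ` R <#> R) R"
      using almost_le_mult[OF inertial_almost_le[OF g(1) R(1)] _ R(1)] by blast
    obtain i j where ij: "i < j" "d j \<otimes> inv d i \<in> R" by (rule almost_le_pigeonhole[OF al R(1) dR])
    have "d j \<otimes> inv d i \<in> D1" using dD1 sub_mult[OF sD1] sub_inv[OF sD1] by blast
    then have "d j \<otimes> inv d i = \<one>" using R(3) ij by blast
    then have "d i = d j" using dP Pc by (metis inv_equality inv_closed inv_inv)
    moreover obtain n where "d 0 [^] (p ^ n) = \<one>" using p_subgroup_ord[OF P dP] by blast
    moreover have "d 0 \<noteq> \<one>" using nz y0 by (simp add: d_def)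
    ultimately show False using root_chain_distinct[OF p dch _ _ ij(1)] by blast
  qed
  show ?thesis
    unfolding power_on_def
  proof
    fix x assume x: "x \<in> D"
    then have xP: "x \<in> P" using D(2) by blast
    obtain a :: int where a: "\<psi> x = g x \<otimes> x [^] a" using ex[OF xP] by blast
    have c: "x \<in> carrier G" "g x \<in> carrier G" using Pc[OF xP] hom_in_carrier[OF gh] by auto
    have "g x = (g x \<otimes> x [^] a) \<otimes> inv (x [^] a)" using c by simp
    also have "\<dots> = x [^] (- a)" using zero[OF x] a c by (simp add: int_pow_neg)
    finally show "\<exists>k::int. g x = x [^] k" by blast
  qed
qed

text \<open>If the common subgroup \<open>C\<close> is bounded, \<open>K\<close> is a divisible
  subgroup, on which every inertial map acts by multiples. Otherwise \<open>K\<close> is the hull of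
  \<open>C\<close> that is divisible modulo \<open>C\<close>; it has only finitely many cosets in
  the component, and these are represented by elements of bounded order.\<close>

theorem inertial_primary_structure:
  assumes p: "prime p" and F: "finite F" "\<forall>g\<in>F. inertial_map G g"
  shows "\<exists>K j. subgroup K G \<and> K \<subseteq> primary G p \<and> (\<forall>g\<in>F. power_on G g K) \<and>
    (\<forall>x\<in>primary G p. \<exists>k\<in>K. \<exists>y\<in>primary G p. y [^] (p ^ j) = \<one> \<and> x = k \<otimes> y)"
proof -
  let ?P = "primary G p"
  note P = p_subgroup_primary[OF p]
  note Pc = p_subgroup_carr[OF P]
  have F': "\<forall>g\<in>F. inertial_map G g \<and> g ` ?P \<subseteq> ?P" using F hom_primary inertial_hom by blast
  obtain C where C: "finite_socle G p ?P C" "\<forall>g\<in>F. power_on G g C"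
    using inertial_common_power_on[OF P F(1) F'] by blast
  show ?thesis
  proof (cases "\<exists>b. \<forall>c\<in>C. c [^] (p ^ b) = \<one>")
    case True
    then obtain b where b: "\<forall>c\<in>C. c [^] (p ^ b) = \<one>" by blast
    obtain D j where D: "subgroup D G" "D \<subseteq> ?P" "p_divisible G p D"
      "\<forall>x\<in>?P. \<exists>d\<in>D. \<exists>y\<in>?P. y [^] (p ^ j) = \<one> \<and> x = d \<otimes> y"
      by (rule finite_socle_bounded[OF P C(1) b])
    have "\<forall>g\<in>F. power_on G g D"
      using F inertial_power_on_divisible[OF _ p_subgroup_sub[OF P D(1,2)] D(3)] by blast
    then show ?thesis using D by blast
  next
    case False
    then have unb: "\<forall>b. \<exists>c\<in>C. c [^] (p ^ b) \<noteq> \<one>" by blast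
    obtain D where D: "subgroup D G" "C \<subseteq> D" "D \<subseteq> ?P" "\<forall>x\<in>D. \<exists>y\<in>D. \<exists>c\<in>C. x = y [^] p \<otimes> c" "almost_le G ?P D"
      by (rule finite_socle_divisible[OF P C(1)])
    have pw: "\<forall>g\<in>F. power_on G g D"
      using power_on_divisible_hull[OF P C(1) _ _ _ unb D(1,3,4)] F' C(2) by blast
    have Psub: "?P \<subseteq> carrier G" using Pc by blast
    obtain S where S: "finite S" "S \<subseteq> ?P" "\<forall>k\<in>?P. \<exists>h\<in>D. \<exists>s\<in>S. k = h \<otimes> s"
      using almost_leD'[OF D(5,1) Psub] by blast
    have "\<forall>s\<in>S. \<exists>n. s [^] (p ^ n) = \<one>" using p_subgroup_ord[OF P] S(2) by blast
    then obtain nn where nn: "\<forall>s\<in>S. s [^] (p ^ nn s) = \<one>" by metis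
    define j where "j = Max (insert 0 (nn ` S))"
    have j: "s [^] (p ^ j) = \<one>" if "s \<in> S" for s
    proof -
      have "nn s \<le> j" using S(1) that by (auto simp: j_def)
      then show ?thesis using pow_p_mono[of s p "nn s" j] nn that S(2) Pc by auto
    qed
    have "\<forall>x\<in>?P. \<exists>k\<in>D. \<exists>y\<in>?P. y [^] (p ^ j) = \<one> \<and> x = k \<otimes> y" using S j by blast
    then show ?thesis using D pw by blast
  qed
qed

section \<open>Finiteness of commutators\<close>

lemma primary_disjoint:
  assumes "prime p" "prime q" "p \<noteq> q" "x \<in> primary G p" "x \<in> primary G q" shows "x = \<one>"
proof -
  obtain m n where mn: "x [^] (p ^ m) = \<one>" "x [^] (q ^ n) = \<one>" using assms by (auto simp: primary_def)
  have "coprime p q" using assms primes_coprime by blast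
  then have "coprime (p ^ m) (q ^ n)" by simp
  then show ?thesis using coprime_pow_one[OF _ mn] assms(4) by (auto simp: primary_def)
qed

text \<open>The exceptional primes are those for which the finite obstruction \<open>E\<close>
  contains a nontrivial element of \<open>p\<close>-power order. For every other \<open>p\<close>
  the whole \<open>p\<close>-component is disjoint from \<open>E\<close> apart from
  \<open>\<one>\<close>.\<close>

lemma inertial_power_on_almost_all:
  assumes F: "finite F" "\<forall>g\<in>F. inertial_map G g"
  obtains \<P> where "finite \<P>" "\<forall>p\<in>\<P>. prime (p::int)"
    "\<forall>g\<in>F. \<forall>p. prime p \<longrightarrow> p \<notin> \<P> \<longrightarrow> power_on G g (primary G p)"
proof -
  have "\<exists>\<P>. finite \<P> \<and> (\<forall>p\<in>\<P>. prime (p::int)) \<and> (\<forall>p. prime p \<longrightarrow> p \<notin> \<P> \<longrightarrow> power_on G g (primary G p))"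
    if g: "inertial_map G g" for g
  proof -
    obtain E where E: "subgroup E G" "finite E"
      "\<forall>x\<in>torsion_subgroup G. independent_pair G g E x \<longrightarrow> power_on G g {x}"
      using inertial_power_off_finite[OF g] by blast
    define Q where "Q e = {p::int. prime p \<and> e \<in> primary G p}" for e
    have Q: "finite (Q e)" if "e \<noteq> \<one>" for e
    proof (cases "\<exists>p. p \<in> Q e")
      case True
      then obtain p where "p \<in> Q e" by blast
      then have "Q e \<subseteq> {p}" using primary_disjoint that by (auto simp: Q_def)
      then show ?thesis using finite_subset by blast
    next
      case False
      then have "Q e = {}" by blast
      then show ?thesis by simp
    qed
    define \<P> where "\<P> = (\<Union>e\<in>E - {\<one>}. Q e)"
    have "finite \<P>" unfolding \<P>_def using E(2) Q by blast
    moreover have "power_on G g (primary G p)" if p: "prime p" "p \<notin> \<P>" for p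
      unfolding power_on_def
    proof
      fix x assume x: "x \<in> primary G p"
      have gx: "g x \<in> primary G p" using hom_primary[OF inertial_hom[OF g]] x by blast
      have "independent_pair G g E x"
        unfolding independent_pair_def
      proof (intro allI impI)
        fix a b :: int assume e: "x [^] a \<otimes> g x [^] b \<in> E"
        have "x [^] a \<otimes> g x [^] b \<in> primary G p"
          using x gx by (simp add: sub_mult[OF primary_subgroup] sub_pow[OF primary_subgroup])
        then show "x [^] a \<otimes> g x [^] b = \<one>" using e p by (auto simp: \<P>_def Q_def)
      qed
      then show "\<exists>k::int. g x = x [^] k" using E(3) x primary_torsion[OF p(1)] by (auto simp: power_on_def)
    qed
    moreover have "\<forall>p\<in>\<P>. prime p" by (auto simp: \<P>_def Q_def)
    ultimately show ?thesis by blast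
  qed
  then obtain P where P: "\<forall>g\<in>F. finite (P g) \<and> (\<forall>p\<in>P g. prime (p::int)) \<and>
      (\<forall>p. prime p \<longrightarrow> p \<notin> P g \<longrightarrow> power_on G g (primary G p))" using F(2) by metis
  show ?thesis by (rule that[of "\<Union>g\<in>F. P g"]) (use F(1) P in auto)
qed

lemma power_on_commute:
  assumes "g \<in> hom G G" "h \<in> hom G G" "power_on G g K" "power_on G h K" "x \<in> K" "x \<in> carrier G"
  shows "g (h x) = h (g x)"
proof -
  obtain a :: int where a: "g x = x [^] a" using assms unfolding power_on_def by blast
  obtain b :: int where b: "h x = x [^] b" using assms unfolding power_on_def by blast
  then show ?thesis using assms a by (simp add: hom_pow int_pow_pow mult.commute)
qed

text \<open>The commutator in the endomorphism ring. Unlike the group commutator it is additive in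
  terms of its argument without passing to inverses, and \<open>\<Gamma>_commutator\<close> shows
  that both have the same displacements.\<close>

definition commutator_map :: "('a \<Rightarrow> 'a) \<Rightarrow> ('a \<Rightarrow> 'a) \<Rightarrow> 'a \<Rightarrow> 'a" where
  "commutator_map g h x = g (h x) \<otimes> inv (h (g x))"

lemma commutator_map_hom:
  assumes "g \<in> hom G G" "h \<in> hom G G" shows "commutator_map g h \<in> hom G G"
  using hom_in_carrier[OF assms(1)] hom_in_carrier[OF assms(2)]
  by (intro homI) (simp_all add: commutator_map_def hom_mult[OF assms(1)] hom_mult[OF assms(2)] inv_mult_group m_ac)

text \<open>With representatives chosen inside the layer, the part from \<open>C\<close> stays in
  the layer too, where it has bounded order.\<close>

lemma bounded_primary_cover:
  assumes p: "prime p" and C: "finite_socle G p (primary G p) C"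
  obtains S where "finite S" "S \<subseteq> {y\<in>primary G p. y [^] (p ^ n) = \<one>}"
    "\<forall>y\<in>{y\<in>primary G p. y [^] (p ^ n) = \<one>}. \<exists>c\<in>C. \<exists>s\<in>S. c [^] (p ^ n) = \<one> \<and> y = c \<otimes> s"
proof -
  note P = p_subgroup_primary[OF p]
  have sC: "subgroup C G" using C by (simp add: finite_socle_def)
  define Q where "Q = {y\<in>primary G p. y [^] (p ^ n) = \<one>}"
  have sQ: "subgroup Q G" unfolding Q_def by (rule pow_kernel_subgroup[OF primary_subgroup])
  have Qc: "Q \<subseteq> carrier G" using sub_carr[OF sQ] by blast
  have "Q \<subseteq> {y\<in>primary G p. y [^] (p ^ n) \<in> C}" using sub_one[OF sC] by (auto simp: Q_def)
  then have al: "almost_le G Q C" using finite_socle_pow[OF P C, of n] almost_le_mono by blast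
  obtain S where S: "finite S" "S \<subseteq> Q" "\<forall>k\<in>Q. \<exists>h\<in>C. \<exists>s\<in>S. k = h \<otimes> s"
    using almost_leD'[OF al sC Qc] by blast
  have "\<exists>c\<in>C. \<exists>s\<in>S. c [^] (p ^ n) = \<one> \<and> y = c \<otimes> s" if y: "y \<in> Q" for y
  proof -
    obtain c s where cs: "c \<in> C" "s \<in> S" "y = c \<otimes> s" using S(3) y by blast
    have "s \<in> Q" using cs S(2) by blast
    moreover have "c \<in> carrier G" using sub_carr[OF sC cs(1)] .
    ultimately have "c \<in> Q" using sub_cancel'[OF sQ, of s c] y cs by simp
    then show ?thesis using cs by (auto simp: Q_def)
  qed
  then show ?thesis using that S by (auto simp: Q_def)
qed

text \<open>The commutator vanishes wherever both maps act by multiples: on almost all components,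
  and within each of the others on \<open>K\<close> and on \<open>C\<close>. Modulo these a
  component is represented by the finite set \<open>S\<close>, so its image is finite.\<close>

lemma torsion_commutator_finite:
  assumes tors: "carrier G \<subseteq> torsion_subgroup G" and g: "inertial_map G g" and h: "inertial_map G h"
  shows "finite (commutator_map g h ` carrier G)"
proof -
  note gh = inertial_hom[OF g] inertial_hom[OF h]
  let ?d = "commutator_map g h"
  note dh = commutator_map_hom[OF gh]
  have F: "finite {g, h}" "\<forall>k\<in>{g, h}. inertial_map G k" using g h by auto
  obtain \<P> where \<P>: "finite \<P>" "\<forall>p\<in>\<P>. prime (p::int)"
    "\<forall>k\<in>{g, h}. \<forall>p. prime p \<longrightarrow> p \<notin> \<P> \<longrightarrow> power_on G k (primary G p)"
    by (rule inertial_power_on_almost_all[OF F])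
  have zero: "?d x = \<one>" if "power_on G g K" "power_on G h K" "x \<in> K" "x \<in> carrier G" for K x
    using power_on_commute[OF gh that] that hom_in_carrier[OF gh(1)] hom_in_carrier[OF gh(2)]
    by (simp add: commutator_map_def)
  have fin: "finite (?d ` primary G p)" if p: "prime p" for p
  proof -
    note P = p_subgroup_primary[OF p]
    have F': "\<forall>k\<in>{g, h}. inertial_map G k \<and> k ` primary G p \<subseteq> primary G p"
      using F hom_primary inertial_hom by blast
    obtain C where C: "finite_socle G p (primary G p) C" "\<forall>k\<in>{g, h}. power_on G k C"
      using inertial_common_power_on[OF P F(1) F'] by blast
    obtain K j where K: "subgroup K G" "K \<subseteq> primary G p" "\<forall>k\<in>{g, h}. power_on G k K"
      "\<forall>x\<in>primary G p. \<exists>k\<in>K. \<exists>y\<in>primary G p. y [^] (p ^ j) = \<one> \<and> x = k \<otimes> y"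
      using inertial_primary_structure[OF p F] by blast
    obtain S where S: "finite S" "S \<subseteq> {y\<in>primary G p. y [^] (p ^ j) = \<one>}"
      "\<forall>y\<in>{y\<in>primary G p. y [^] (p ^ j) = \<one>}. \<exists>c\<in>C. \<exists>s\<in>S. c [^] (p ^ j) = \<one> \<and> y = c \<otimes> s"
      by (rule bounded_primary_cover[OF p C(1)])
    have "?d ` primary G p \<subseteq> ?d ` S"
    proof
      fix z assume "z \<in> ?d ` primary G p"
      then obtain x where x: "x \<in> primary G p" "z = ?d x" by blast
      obtain k y where ky: "k \<in> K" "y \<in> primary G p" "y [^] (p ^ j) = \<one>" "x = k \<otimes> y" using K(4) x by blast
      obtain c s where cs: "c \<in> C" "s \<in> S" "y = c \<otimes> s" using S(3) ky by blast
      have c: "k \<in> carrier G" "c \<in> carrier G" "s \<in> carrier G"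
        using sub_carr[OF K(1) ky(1)] C(1) cs S(2) sub_carr[of C c] by (auto simp: finite_socle_def primary_def)
      have "z = ?d k \<otimes> (?d c \<otimes> ?d s)" unfolding x(2) ky(4) cs(3) using c by (simp add: hom_mult[OF dh])
      also have "?d k = \<one>" using zero[of K k] K(3) ky(1) c by simp
      also have "?d c = \<one>" using zero[of C c] C(2) cs(1) c by simp
      finally have "z = ?d s" using c hom_in_carrier[OF dh] by simp
      then show "z \<in> ?d ` S" using cs by blast
    qed
    then show ?thesis using S(1) finite_surj by blast
  qed
  define V0 where "V0 = (\<Union>p\<in>\<P>. ?d ` primary G p)"
  have V0: "finite V0" "V0 \<subseteq> carrier G" unfolding V0_def using \<P>(1,2) fin hom_in_carrier[OF dh]
    by (auto simp: primary_def)
  obtain V where V: "subgroup V G" "finite V" "V0 \<subseteq> V"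
    by (rule finite_generate_torsion[OF V0 tors subgroup_self])
  have "?d x \<in> V" if "x \<in> torsion_subgroup G" for x
    using that
  proof (induction rule: torsion_induct)
    case one
    then show ?case using hom_one'[OF dh] sub_one[OF V(1)] by simp
  next
    case (primary p y)
    show ?case
    proof (cases "p \<in> \<P>")
      case True
      then show ?thesis using V(3) primary by (auto simp: V0_def)
    next
      case False
      then have "?d y = \<one>" using zero[of "primary G p" y] \<P>(3) primary by (auto simp: primary_def)
      then show ?thesis using sub_one[OF V(1)] by simp
    qed
  next
    case (mult y z)
    then show ?case using hom_mult[OF dh] torsion_carr sub_mult[OF V(1)] by simp
  qed
  then have "?d ` carrier G \<subseteq> V" using tors by blast
  then show ?thesis using V(2) finite_subset by blast
qed

lemma almost_le_iff_finite_cosets: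
  assumes "subgroup B G" "K \<subseteq> carrier G"
  shows "almost_le G K B \<longleftrightarrow> finite ((\<lambda>x. B #> x) ` K)"
proof
  assume al: "almost_le G K B"
  obtain S where S: "finite S" "S \<subseteq> carrier G" "\<forall>k\<in>K. \<exists>h\<in>B. \<exists>s\<in>S. k = h \<otimes> s"
    using almost_leD[OF al] by blast
  have "B #> k \<in> (\<lambda>x. B #> x) ` S" if k: "k \<in> K" for k
  proof -
    obtain h s where hs: "h \<in> B" "s \<in> S" "k = h \<otimes> s" using S(3) k by blast
    have c: "h \<in> carrier G" "s \<in> carrier G" "B \<subseteq> carrier G" using sub_carr[OF assms(1)] hs(1,2) S(2) by blast+
    have "B #> k = (B #> h) #> s" unfolding hs(3) by (rule coset_mult_assoc[OF c(3,1,2), symmetric])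
    also have "B #> h = B" using coset_join2[OF c(1) assms(1) hs(1)] .
    finally show ?thesis using hs by blast
  qed
  then show "finite ((\<lambda>x. B #> x) ` K)" using S(1) by (meson finite_surj image_subsetI)
next
  assume fin: "finite ((\<lambda>x. B #> x) ` K)"
  obtain S where S: "S \<subseteq> K" "finite S" "(\<lambda>x. B #> x) ` K = (\<lambda>x. B #> x) ` S"
    using finite_subset_image[OF fin order_refl] by metis
  show "almost_le G K B"
  proof (rule almost_leI[OF S(2)])
    show "S \<subseteq> carrier G" using S(1) assms(2) by blast
    fix k assume k: "k \<in> K"
    then obtain s where s: "s \<in> S" "B #> k = B #> s" using S(3) by blast
    have "k \<in> B #> s" using rcos_self[OF _ assms(1), of k] s(2) k assms(2) by blast
    then show "\<exists>h\<in>B. \<exists>s\<in>S. k = h \<otimes> s" using s(1) unfolding r_coset_def by blast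
  qed
qed

text \<open>Modulo a free subgroup with torsion quotient and a finite group, the maps become inertial
  automorphisms of a torsion group.\<close>

lemma commutator_finite:
  assumes g: "inertial_map G g" "\<forall>x\<in>carrier G. g x \<otimes> inv x \<in> torsion_subgroup G"
    and h: "inertial_map G h" "\<forall>x\<in>carrier G. h x \<otimes> inv x \<in> torsion_subgroup G"
  shows "finite (commutator_map g h ` carrier G)"
proof -
  let ?T = "torsion_subgroup G"
  obtain F0 where F0: "subgroup F0 G" "F0 \<subseteq> carrier G" "F0 \<inter> ?T \<subseteq> {\<one>}"
    "\<forall>x\<in>carrier G - F0. \<exists>c\<in>F0. \<exists>k::int. c \<otimes> x [^] k \<in> ?T \<and> c \<otimes> x [^] k \<noteq> \<one>"
    by (rule max_disjoint_subgroup[OF subgroup_self])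
  \<comment> \<open>By maximality some \<open>c + k x\<close> is torsion; a further multiple
    vanishes and leaves a nonzero multiple of \<open>x\<close> in \<open>F0\<close>.\<close>
  have tors: "\<exists>n::int. n > 0 \<and> x [^] n \<in> F0" if x: "x \<in> carrier G" for x
  proof (cases "x \<in> F0")
    case True
    then show ?thesis using x by (intro exI[of _ 1]) simp
  next
    case False
    then obtain c k where ck: "c \<in> F0" "c \<otimes> x [^] (k::int) \<in> ?T" "c \<otimes> x [^] k \<noteq> \<one>" using F0(4) x by blast
    have cc: "c \<in> carrier G" using F0 ck by blast
    have k0: "k \<noteq> 0"
    proof
      assume "k = 0"
      then have "c \<otimes> x [^] k \<in> F0 \<inter> ?T" using ck cc by simp
      then show False using ck F0(3) by blast
    qed
    obtain N :: int where N: "N > 0" "(c \<otimes> x [^] k) [^] N = \<one>" using ck torsion_iff by blast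
    have "c [^] N \<otimes> x [^] (k * N) = \<one>" using N(2) cc x by (simp add: int_pow_distrib int_pow_pow)
    then have "c [^] N \<otimes> x [^] (k * N) \<in> F0" using sub_one[OF F0(1)] by simp
    then have "x [^] (k * N) \<in> F0" using sub_cancel[OF F0(1) sub_pow[OF F0(1) ck(1)]] x by simp
    then have "(x [^] (k * N)) [^] (sgn k) \<in> F0" by (rule sub_pow[OF F0(1)])
    moreover have "k * N * sgn k = \<bar>k\<bar> * N" by (metis abs_sgn mult.commute mult.left_commute)
    ultimately have "x [^] (\<bar>k\<bar> * N) \<in> F0" using x by (simp add: int_pow_pow)
    moreover have "\<bar>k\<bar> * N > 0" using k0 N by simp
    ultimately show ?thesis by blast
  qed
  \<comment> \<open>The differences lie in the torsion subgroup and in finitely many cosets of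
    \<open>F0\<close>. As these two subgroups meet trivially, only finitely many differences
    occur.\<close>
  have fdiff: "finite ((\<lambda>x. f x \<otimes> inv x) ` F0)"
    if f: "inertial_map G f" "\<forall>x\<in>carrier G. f x \<otimes> inv x \<in> ?T" for f
  proof -
    have fc: "f x \<in> carrier G" if "x \<in> carrier G" for x using hom_in_carrier[OF inertial_hom[OF f(1)]] that by simp
    let ?D = "(\<lambda>x. f x \<otimes> inv x) ` F0"
    have "almost_le G F0 F0" using F0(2) by (intro almost_le_refl) auto
    then have "almost_le G (f ` F0 <#> F0) F0"
      using almost_le_mult[OF inertial_almost_le[OF f(1) F0(1)] _ F0(1)] by blast
    moreover have "?D \<subseteq> f ` F0 <#> F0"
      unfolding set_mult_def using sub_inv[OF F0(1)] by blast
    ultimately have al: "almost_le G ?D F0" using almost_le_mono by blast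
    have Dc: "?D \<subseteq> carrier G" using fc F0(2) by auto
    have "?D \<inter> ?T = ?D" using f(2) F0(2) by blast
    then have "almost_le G ?D (F0 \<inter> ?T)"
      using almost_le_restrict[OF al F0(1) Dc torsion_subgroup] by simp
    then have "almost_le G ?D {\<one>}" using F0(3) almost_le_mono by blast
    then show ?thesis using almost_le_one_iff[OF Dc] by blast
  qed
  define S where "S = (\<lambda>x. g x \<otimes> inv x) ` F0 \<union> (\<lambda>x. h x \<otimes> inv x) ` F0"
  have S: "finite S" "S \<subseteq> ?T" unfolding S_def using fdiff[OF g] fdiff[OF h] g(2) h(2) F0(2) by auto
  have Fgh: "finite {g, h}" "\<forall>k\<in>{g, h}. inertial_map G k" using g h by auto
  obtain W where W: "subgroup W G" "finite W" "W \<subseteq> ?T" "S \<subseteq> W" "\<forall>k\<in>{g, h}. k ` W = W"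
    using finite_invariant[OF Fgh S] by blast
  have Wc: "W \<subseteq> carrier G" using sub_carr[OF W(1)] by blast
  define B where "B = F0 <#> W"
  have sB: "subgroup B G" unfolding B_def by (rule mult_subgroups[OF F0(1) W(1)])
  have FB: "x \<in> B" if "x \<in> F0" for x
  proof -
    have "x = x \<otimes> \<one>" using sub_carr[OF F0(1) that] by simp
    then show ?thesis unfolding B_def set_mult_def using that sub_one[OF W(1)] by blast
  qed
  have WB: "x \<in> B" if "x \<in> W" for x
  proof -
    have "x = \<one> \<otimes> x" using sub_carr[OF W(1) that] by simp
    then show ?thesis unfolding B_def set_mult_def using that sub_one[OF F0(1)] by blast
  qed
  have BT: "B \<inter> ?T \<subseteq> W"
  proof
    fix x assume x: "x \<in> B \<inter> ?T"
    then obtain f w where fw: "f \<in> F0" "w \<in> W" "x = f \<otimes> w" unfolding B_def set_mult_def by blast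
    have "f \<in> ?T" using sub_cancel'[OF torsion_subgroup, of w f] W(3) fw x F0(2) by blast
    then have "f = \<one>" using fw F0(3) by blast
    then show "x \<in> W" using fw Wc by auto
  qed
  \<comment> \<open>\<open>F0\<close> need not be invariant, but the maps move its elements only by
    elements of \<open>W\<close>. Adding \<open>W\<close> therefore makes it invariant, and
    equality, not mere inclusion, is what yields automorphisms of the quotient.\<close>
  have gB: "f ` B = B" if f: "inertial_map G f" "f ` W = W" "\<forall>x\<in>F0. f x \<otimes> inv x \<in> W" for f
  proof -
    note fh = inertial_hom[OF f(1)]
    have e: "f x = (f x \<otimes> inv x) \<otimes> x" if "x \<in> F0" for x
      using that F0(2) hom_in_carrier[OF fh] by (simp add: subsetD)
    show ?thesis
    proof
      show "f ` B \<subseteq> B"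
      proof
        fix y assume "y \<in> f ` B"
        then obtain x w where xw: "x \<in> F0" "w \<in> W" "y = f (x \<otimes> w)" unfolding B_def set_mult_def by blast
        have "y = f x \<otimes> f w" using xw F0(2) Wc hom_mult[OF fh] by auto
        moreover have "f x \<in> B" using e[OF xw(1)] sub_mult[OF sB WB[of "f x \<otimes> inv x"] FB[OF xw(1)]] f(3) xw(1) by simp
        moreover have "f w \<in> B" using f(2) xw(2) WB by blast
        ultimately show "y \<in> B" using sub_mult[OF sB] by simp
      qed
      show "B \<subseteq> f ` B"
      proof
        fix y assume "y \<in> B"
        then obtain x w where xw: "x \<in> F0" "w \<in> W" "y = x \<otimes> w" unfolding B_def set_mult_def by blast
        have c: "x \<in> carrier G" "w \<in> carrier G" "f x \<in> carrier G" using xw F0(2) Wc hom_in_carrier[OF fh] by auto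
        have "inv (f x \<otimes> inv x) \<otimes> w \<in> W" using f(3) xw sub_mult[OF W(1)] sub_inv[OF W(1)] by blast
        then obtain w' where w': "w' \<in> W" "f w' = inv (f x \<otimes> inv x) \<otimes> w" using f(2) by (metis imageE)
        have "f (x \<otimes> w') = f x \<otimes> f w'" using c w' Wc hom_mult[OF fh] by auto
        also have "\<dots> = f x \<otimes> (inv (f x) \<otimes> (x \<otimes> w))"
          unfolding w'(2) using c by (simp add: inv_mult_group m_ac)
        also have "\<dots> = y" using c xw by simp
        finally have "y = f (x \<otimes> w')" by simp
        moreover have "x \<otimes> w' \<in> B" unfolding B_def set_mult_def using xw w' by blast
        ultimately show "y \<in> f ` B" by blast
      qed
    qed
  qed
  define Q where "Q = G Mod B"
  define q where "q x = B #> x" for x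
  interpret Q: comm_group Q unfolding Q_def by (rule abelian_FactGroup[OF sB])
  interpret nB: normal B G using sB by (simp add: normal_iff_subgroup)
  have carrQ: "carrier Q = q ` carrier G" by (simp add: Q_def q_def carrier_FactGroup)
  have qh: "q \<in> hom G Q" using nB.r_coset_hom_Mod unfolding Q_def q_def .
  have q1: "q x = \<one>\<^bsub>Q\<^esub> \<longleftrightarrow> x \<in> B" if "x \<in> carrier G" for x
    using coset_join1[OF _ that sB] coset_join2[OF that sB] by (auto simp: Q_def q_def)
  have qmult: "q (x \<otimes> y) = q x \<otimes>\<^bsub>Q\<^esub> q y" if "x \<in> carrier G" "y \<in> carrier G" for x y
    using hom_mult[OF qh that] .
  have qc: "q x \<in> carrier Q" if "x \<in> carrier G" for x using carrQ that by blast
  have qinv: "q (inv x) = inv\<^bsub>Q\<^esub> q x" if "x \<in> carrier G" for x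
    using group_hom.hom_inv[of G Q q x] qh that by (simp add: group_hom_def group_hom_axioms_def is_group Q.is_group)
  have qpow: "q (x [^] k) = q x [^]\<^bsub>Q\<^esub> (k::int)" if "x \<in> carrier G" for x k
    using hom_int_pow[OF qh that] is_group Q.is_group by simp
  have qeq: "x \<otimes> inv y \<in> B" if "q x = q y" "x \<in> carrier G" "y \<in> carrier G" for x y
  proof -
    have "q (x \<otimes> inv y) = \<one>\<^bsub>Q\<^esub>" using that qc by (simp add: qmult qinv)
    then show ?thesis using q1 that by simp
  qed
  have qeq': "q x = q y" if "x \<otimes> inv y \<in> B" "x \<in> carrier G" "y \<in> carrier G" for x y
  proof -
    have "x = (x \<otimes> inv y) \<otimes> y" using that by simp
    then have "q x = q ((x \<otimes> inv y) \<otimes> y)" by (rule arg_cong)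
    also have "\<dots> = q (x \<otimes> inv y) \<otimes>\<^bsub>Q\<^esub> q y" using that by (intro qmult) auto
    also have "q (x \<otimes> inv y) = \<one>\<^bsub>Q\<^esub>" using q1 that by simp
    finally show ?thesis using qc that by simp
  qed
  have inertQ: "inertial_map Q ((`) f) \<and> (\<forall>x\<in>carrier G. f ` q x = q (f x))"
    if f: "inertial_map G f" and fB: "f ` B = B" for f
  proof -
    note fh = inertial_hom[OF f]
    have fc: "f x \<in> carrier G" if "x \<in> carrier G" for x using hom_in_carrier[OF fh that] .
    have Bc: "b \<in> carrier G" if "b \<in> B" for b using sub_carr[OF sB that] .
    have fq: "f ` q x = q (f x)" if x: "x \<in> carrier G" for x
    proof
      show "f ` q x \<subseteq> q (f x)"
      proof
        fix y assume "y \<in> f ` q x"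
        then obtain b where b: "b \<in> B" "y = f (b \<otimes> x)" unfolding q_def r_coset_def by blast
        have "y = f b \<otimes> f x" using b x Bc hom_mult[OF fh] by simp
        moreover have "f b \<in> B" using fB b by blast
        ultimately show "y \<in> q (f x)" unfolding q_def r_coset_def by blast
      qed
      show "q (f x) \<subseteq> f ` q x"
      proof
        fix y assume "y \<in> q (f x)"
        then obtain b where b: "b \<in> B" "y = b \<otimes> f x" unfolding q_def r_coset_def by blast
        then obtain b' where b': "b' \<in> B" "b = f b'" using fB by blast
        have "y = f (b' \<otimes> x)" using b b' x Bc hom_mult[OF fh] by simp
        moreover have "b' \<otimes> x \<in> q x" using b' unfolding q_def r_coset_def by blast
        ultimately show "y \<in> f ` q x" by blast
      qed
    qed
    have "(`) f \<in> iso Q Q"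
      unfolding iso_def
    proof (intro CollectI conjI)
      show "(`) f \<in> hom Q Q"
      proof (rule homI)
        fix u assume "u \<in> carrier Q"
        then show "f ` u \<in> carrier Q" using carrQ fq fc by auto
      next
        fix u v assume "u \<in> carrier Q" "v \<in> carrier Q"
        then obtain x y where xy: "x \<in> carrier G" "y \<in> carrier G" "u = q x" "v = q y" unfolding carrQ by blast
        have "f ` (u \<otimes>\<^bsub>Q\<^esub> v) = q (f (x \<otimes> y))" unfolding xy(3,4) qmult[OF xy(1,2), symmetric] using fq xy by simp
        also have "\<dots> = f ` u \<otimes>\<^bsub>Q\<^esub> f ` v" unfolding xy(3,4) using xy fq fc hom_mult[OF fh] by (simp add: qmult)
        finally show "f ` (u \<otimes>\<^bsub>Q\<^esub> v) = f ` u \<otimes>\<^bsub>Q\<^esub> f ` v" .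
      qed
      show "bij_betw ((`) f) (carrier Q) (carrier Q)"
        unfolding bij_betw_def
      proof
        show "inj_on ((`) f) (carrier Q)"
        proof (rule inj_onI)
          fix u v assume uv: "u \<in> carrier Q" "v \<in> carrier Q" "f ` u = f ` v"
          then obtain x y where xy: "x \<in> carrier G" "y \<in> carrier G" "u = q x" "v = q y" unfolding carrQ by blast
          then have "q (f x) = q (f y)" using uv fq by simp
          then have "f x \<otimes> inv (f y) \<in> B" using qeq fc xy by blast
          then have "f (x \<otimes> inv y) \<in> B" using xy by (simp add: hom_mult[OF fh] hom_inv'[OF fh])
          then obtain b where b: "b \<in> B" "f (x \<otimes> inv y) = f b" using fB by (metis imageE)
          then have "x \<otimes> inv y = b" using inj_onD[OF iso_inj[OF inertial_iso[OF f]]] xy Bc by simp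
          then show "u = v" using qeq' b xy by blast
        qed
        show "(`) f ` carrier Q = carrier Q"
        proof -
          have "(`) f ` carrier Q = (\<lambda>x. q (f x)) ` carrier G" unfolding carrQ using fq by (simp add: image_image)
          also have "\<dots> = q ` (f ` carrier G)" by (simp add: image_image)
          finally show ?thesis using iso_surj[OF inertial_iso[OF f]] carrQ by simp
        qed
      qed
    qed
    moreover have "almost_le Q ((`) f ` H) H" if H: "subgroup H Q" for H
    proof -
      define H' where "H' = {x \<in> carrier G. q x \<in> H}"
      have sH': "subgroup H' G"
      proof (rule subgroupI')
        show "H' \<subseteq> carrier G" by (auto simp: H'_def)
        show "\<one> \<in> H'" using q1[of \<one>] sub_one[OF sB] Q.sub_one[OF H] by (simp add: H'_def)
        fix x y assume "x \<in> H'" "y \<in> H'"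
        then show "x \<otimes> inv y \<in> H'" using Q.sub_mult[OF H] Q.sub_inv[OF H] by (simp add: H'_def qmult qinv)
      qed
      obtain S' where S': "finite S'" "S' \<subseteq> carrier G" "\<forall>k\<in>f ` H'. \<exists>h\<in>H'. \<exists>s\<in>S'. k = h \<otimes> s"
        using almost_leD[OF inertial_almost_le[OF f sH']] by blast
      show ?thesis
      proof (rule Q.almost_leI)
        show "finite (q ` S')" "q ` S' \<subseteq> carrier Q" using S' qc by auto
        fix k assume "k \<in> (`) f ` H"
        then obtain u where u: "u \<in> H" "k = f ` u" by blast
        then obtain x where x: "x \<in> carrier G" "u = q x" using carrQ Q.sub_carr[OF H] by blast
        then have "f x \<in> f ` H'" using u by (auto simp: H'_def)
        then obtain h s where hs: "h \<in> H'" "s \<in> S'" "f x = h \<otimes> s" using S'(3) by blast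
        have "k = q (f x)" using u x fq by simp
        also have "\<dots> = q h \<otimes>\<^bsub>Q\<^esub> q s" unfolding hs(3) using hs S'(2) by (auto simp: H'_def qmult)
        finally show "\<exists>h\<in>H. \<exists>s\<in>q ` S'. k = h \<otimes>\<^bsub>Q\<^esub> s" using hs by (auto simp: H'_def)
      qed
    qed
    ultimately show ?thesis using fq by (auto simp: inertial_map_def)
  qed
  have "\<forall>x\<in>F0. g x \<otimes> inv x \<in> W" "\<forall>x\<in>F0. h x \<otimes> inv x \<in> W" using W(4) unfolding S_def by blast+
  then have gW: "g ` B = B" "h ` B = B" using gB[OF g(1)] gB[OF h(1)] W(5) by simp_all
  note Qg = inertQ[OF g(1) gW(1)] and Qh = inertQ[OF h(1) gW(2)]
  have torsQ: "carrier Q \<subseteq> torsion_subgroup Q"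
  proof
    fix u assume "u \<in> carrier Q"
    then obtain x where x: "x \<in> carrier G" "u = q x" using carrQ by blast
    obtain n :: int where n: "n > 0" "x [^] n \<in> F0" using tors[OF x(1)] by blast
    have "u [^]\<^bsub>Q\<^esub> n = \<one>\<^bsub>Q\<^esub>" using qpow[OF x(1), of n] q1[of "x [^] n"] FB[OF n(2)] x by simp
    then show "u \<in> torsion_subgroup Q" using Q.torsionI[of u n] n x qc by simp
  qed
  have fin: "finite (Q.commutator_map ((`) g) ((`) h) ` carrier Q)"
    using Q.torsion_commutator_finite[OF torsQ] Qg Qh by blast
  let ?\<Delta> = "commutator_map g h ` carrier G"
  note ghh = inertial_hom[OF g(1)] inertial_hom[OF h(1)]
  note c = hom_in_carrier[OF ghh(1)] hom_in_carrier[OF ghh(2)]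
  have "q ` ?\<Delta> \<subseteq> Q.commutator_map ((`) g) ((`) h) ` carrier Q"
  proof
    fix y assume "y \<in> q ` ?\<Delta>"
    then obtain x where x: "x \<in> carrier G" "y = q (commutator_map g h x)" by blast
    have "y = Q.commutator_map ((`) g) ((`) h) (q x)"
      unfolding x(2) commutator_map_def Q.commutator_map_def using x(1) c Qg Qh by (simp add: qmult qinv)
    then show "y \<in> Q.commutator_map ((`) g) ((`) h) ` carrier Q" using qc[OF x(1)] by blast
  qed
  then have "finite (q ` ?\<Delta>)" using fin finite_subset by blast
  moreover have \<Delta>c: "?\<Delta> \<subseteq> carrier G" using hom_in_carrier[OF commutator_map_hom[OF ghh]] by blast
  ultimately have al: "almost_le G ?\<Delta> B" using almost_le_iff_finite_cosets[OF sB \<Delta>c] by (simp add: q_def)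
  have \<Delta>T: "?\<Delta> \<subseteq> ?T"
  proof
    fix y assume "y \<in> ?\<Delta>"
    then obtain x where x: "x \<in> carrier G" "y = commutator_map g h x" by blast
    have "g (h x) \<otimes> inv (h x) \<in> ?T" "h x \<otimes> inv x \<in> ?T" "g x \<otimes> inv x \<in> ?T" "h (g x) \<otimes> inv (g x) \<in> ?T"
      using g(2) h(2) x c by auto
    then have "(g (h x) \<otimes> inv (h x)) \<otimes> (h x \<otimes> inv x) \<otimes> inv ((h (g x) \<otimes> inv (g x)) \<otimes> (g x \<otimes> inv x)) \<in> ?T"
      by (simp add: sub_mult[OF torsion_subgroup] sub_inv[OF torsion_subgroup])
    also have "(g (h x) \<otimes> inv (h x)) \<otimes> (h x \<otimes> inv x) \<otimes> inv ((h (g x) \<otimes> inv (g x)) \<otimes> (g x \<otimes> inv x)) = y"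
    proof -
      have 1: "(a \<otimes> inv b) \<otimes> (b \<otimes> inv d) = a \<otimes> inv d"
        if "a \<in> carrier G" "b \<in> carrier G" "d \<in> carrier G" for a b d
        using that by (simp add: m_assoc)
      have 2: "(a \<otimes> inv d) \<otimes> inv (b \<otimes> inv d) = a \<otimes> inv b"
        if "a \<in> carrier G" "b \<in> carrier G" "d \<in> carrier G" for a b d
        using that by (simp add: inv_mult_group m_assoc)
      show ?thesis unfolding x(2) commutator_map_def using x(1) c by (simp only: 1 2)
    qed
    finally show "y \<in> ?T" .
  qed
  \<comment> \<open>Finiteness modulo \<open>B\<close> lifts to \<open>G\<close>: the commutator
    values are torsion, and \<open>B\<close> meets the torsion subgroup only inside the finite group
    \<open>W\<close>.\<close>
  have "almost_le G (?\<Delta> \<inter> ?T) (B \<inter> ?T)" by (rule almost_le_restrict[OF al sB \<Delta>c torsion_subgroup])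
  then have "almost_le G ?\<Delta> W" using \<Delta>T BT almost_le_mono by (metis inf.absorb1 order_refl)
  moreover have "almost_le G W {\<one>}" using almost_le_one_iff[OF Wc] W(2) by blast
  ultimately have "almost_le G ?\<Delta> {\<one>}" using almost_le_trans by blast
  then show ?thesis using almost_le_one_iff[OF \<Delta>c] by blast
qed

text \<open>A map in \<open>M\<close> is determined on \<open>Q\<close> by its exponent on \<open>C\<close> modulo \<open>N\<close> and its action on \<open>W\<close>.\<close>

lemma finite_restrictions:
  assumes W: "finite W" "W \<subseteq> carrier G" and C: "C \<subseteq> carrier G" "\<forall>c\<in>C. c [^] (N::int) = \<one>" "N > 0"
    and Q: "\<forall>y\<in>Q. \<exists>c\<in>C. \<exists>w\<in>W. y = c \<otimes> w"
    and M: "\<forall>\<theta>\<in>M. \<theta> \<in> hom G G \<and> \<theta> ` W \<subseteq> W \<and> (\<exists>k::int. \<forall>c\<in>C. \<theta> c = c [^] k)"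
  shows "finite ((\<lambda>\<theta>. restrict \<theta> Q) ` M)"
proof -
  obtain cc ww where cw: "\<forall>y\<in>Q. cc y \<in> C \<and> ww y \<in> W \<and> y = cc y \<otimes> ww y" using Q by metis
  \<comment> \<open>Rebuilds the restriction of a map from finite data, with one decomposition of
    each \<open>y\<close> fixed by \<open>cc\<close> and \<open>ww\<close>.\<close>
  define R where "R = (\<lambda>(k::int, r). restrict (\<lambda>y. cc y [^] k \<otimes> r (ww y)) Q)"
  have "(\<lambda>\<theta>. restrict \<theta> Q) ` M \<subseteq> R ` ({0..<N} \<times> (W \<rightarrow>\<^sub>E W))"
  proof
    fix t assume "t \<in> (\<lambda>\<theta>. restrict \<theta> Q) ` M"
    then obtain \<theta> where \<theta>: "\<theta> \<in> M" "t = restrict \<theta> Q" by blast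
    then obtain k :: int where k: "\<forall>c\<in>C. \<theta> c = c [^] k" using M by blast
    have th: "\<theta> \<in> hom G G" "\<theta> ` W \<subseteq> W" using M \<theta> by auto
    have kN: "\<theta> c = c [^] (k mod N)" if "c \<in> C" for c
      using k that pow_mod[of c N k] C by auto
    have "t = R (k mod N, restrict \<theta> W)"
    proof
      fix y
      show "t y = R (k mod N, restrict \<theta> W) y"
      proof (cases "y \<in> Q")
        case True
        then have c: "cc y \<in> C" "ww y \<in> W" "y = cc y \<otimes> ww y" using cw by auto
        have "\<theta> y = \<theta> (cc y \<otimes> ww y)" using c(3) by simp
        also have "\<dots> = \<theta> (cc y) \<otimes> \<theta> (ww y)" using c(1,2) C(1) W(2) by (intro hom_mult[OF th(1)]) auto
        finally show ?thesis using True c(1,2) kN by (simp add: R_def \<theta>(2))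
      next
        case False
        then show ?thesis by (simp add: R_def \<theta>(2))
      qed
    qed
    moreover have "k mod N \<in> {0..<N}" using C(3) by simp
    moreover have "restrict \<theta> W \<in> W \<rightarrow>\<^sub>E W" using th(2) by auto
    ultimately show "t \<in> R ` ({0..<N} \<times> (W \<rightarrow>\<^sub>E W))" by blast
  qed
  moreover have "finite ({0..<N} \<times> (W \<rightarrow>\<^sub>E W))" using W(1) by (intro finite_cartesian_product finite_PiE) auto
  ultimately show ?thesis using finite_surj by blast
qed

end

section \<open>Rational factors and splittings\<close>

text \<open>On the quotient by the torsion subgroup \<open>g\<close> is multiplication by
  \<open>m/n\<close>. The fraction is kept as a pair and may be unreduced, so that factors of
  products multiply without cancelling.\<close>

definition rational_action :: "('a, 'b) monoid_scheme \<Rightarrow> ('a \<Rightarrow> 'a) \<Rightarrow> int \<Rightarrow> int \<Rightarrow> bool" where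
  "rational_action G g m n \<longleftrightarrow>
     (\<forall>x\<in>carrier G. g x [^]\<^bsub>G\<^esub> n \<otimes>\<^bsub>G\<^esub> inv\<^bsub>G\<^esub> (x [^]\<^bsub>G\<^esub> m) \<in> torsion_subgroup G)"

text \<open>The last clause ties the decomposition to arbitrary subgroups: up to finitely many
  cosets each of them is the sum of its parts. It makes the scalings inertial and forces
  \<open>K\<close> to be unique.\<close>

definition splitting :: "('a, 'b) monoid_scheme \<Rightarrow> int \<Rightarrow> 'a set \<Rightarrow> bool" where
  "splitting G p K \<longleftrightarrow> prime p \<and> subgroup K G \<and> primary G p \<inter> K \<subseteq> {\<one>\<^bsub>G\<^esub>} \<and>
     carrier G \<subseteq> primary G p <#>\<^bsub>G\<^esub> K \<and> p_divisible G p K \<and>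
     (\<forall>H. subgroup H G \<longrightarrow> almost_le G H ((H \<inter> primary G p) <#>\<^bsub>G\<^esub> (H \<inter> K)))"

definition scaling :: "('a, 'b) monoid_scheme \<Rightarrow> int \<Rightarrow> 'a set \<Rightarrow> ('a \<Rightarrow> 'a) \<Rightarrow> bool" where
  "scaling G p K g \<longleftrightarrow> g \<in> iso G G \<and> (\<forall>x\<in>primary G p. g x = x) \<and> (\<forall>x\<in>K. g x = x [^]\<^bsub>G\<^esub> p)"

context comm_group
begin

section \<open>Composition, inverses and the rational factor\<close>

lemma inertial_comp:
  assumes "inertial_map G g" "inertial_map G h" shows "inertial_map G (g \<circ> h)"
  unfolding inertial_map_def
proof (intro conjI allI impI)
  show "g \<circ> h \<in> iso G G" using iso_set_trans[OF inertial_iso[OF assms(2)] inertial_iso[OF assms(1)]] .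
  fix H assume H: "subgroup H G"
  have "almost_le G (g ` (h ` H)) (g ` H)"
    using almost_le_image[OF inertial_almost_le[OF assms(2) H] inertial_hom[OF assms(1)]] sub_carr[OF H] by blast
  then have "almost_le G (g ` (h ` H)) H"
    using almost_le_trans[OF _ inertial_almost_le[OF assms(1) H]] sub_carr[OF H] by blast
  then show "almost_le G ((g \<circ> h) ` H) H" by (simp add: image_comp)
qed

text \<open>For \<open>h \<in> H\<close>, the map permutes the finite set of all elements of \<open>H + W\<close> that are congruent to
  \<open>h\<close> modulo a finite invariant subgroup.\<close>

lemma inertial_inverse:
  assumes g: "inertial_map G g" "\<forall>x\<in>carrier G. g x \<otimes> inv x \<in> torsion_subgroup G"
    and g': "g' \<in> iso G G" "\<forall>x\<in>carrier G. g' (g x) = x"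
  shows "inertial_map G g'"
  unfolding inertial_map_def
proof (intro conjI allI impI)
  let ?T = "torsion_subgroup G"
  show "g' \<in> iso G G" by (rule g'(1))
  fix H assume H: "subgroup H G"
  note gh = inertial_hom[OF g(1)]
  note gc = hom_in_carrier[OF gh]
  note Hc = sub_carr[OF H]
  have Hsub: "H \<subseteq> carrier G" using Hc by blast
  have Fg: "finite {g}" "\<forall>k\<in>{g}. inertial_map G k" using g by auto
  define D where "D = (\<lambda>x. g x \<otimes> inv x) ` H"
  have "almost_le G H H" using Hsub by (intro almost_le_refl) auto
  then have "almost_le G (g ` H <#> H) H" using almost_le_mult[OF inertial_almost_le[OF g(1) H] _ H] by blast
  moreover have "D \<subseteq> g ` H <#> H" unfolding D_def set_mult_def using sub_inv[OF H] by blast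
  ultimately have al: "almost_le G D H" using almost_le_mono by blast
  have DT: "D \<subseteq> ?T" unfolding D_def using g(2) Hc by blast
  have Dc: "D \<subseteq> carrier G" using DT torsion_carr by blast
  obtain S where S: "finite S" "S \<subseteq> D" "\<forall>k\<in>D. \<exists>h\<in>H. \<exists>s\<in>S. k = h \<otimes> s"
    using almost_leD'[OF al H Dc] by blast
  have ST: "S \<subseteq> ?T" using S(2) DT by blast
  obtain W where W: "subgroup W G" "finite W" "W \<subseteq> ?T" "S \<subseteq> W" "\<forall>k\<in>{g}. k ` W = W"
    using finite_invariant[OF Fg S(1) ST] by blast
  define Y where "Y = H <#> W"
  have sY: "subgroup Y G" unfolding Y_def by (rule mult_subgroups[OF H W(1)])
  have HY: "x \<in> Y" if "x \<in> H" for x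
  proof -
    have "x = x \<otimes> \<one>" using Hc[OF that] by simp
    then show ?thesis unfolding Y_def set_mult_def using that sub_one[OF W(1)] by blast
  qed
  have WY: "x \<in> Y" if "x \<in> W" for x
  proof -
    have "x = \<one> \<otimes> x" using sub_carr[OF W(1) that] by simp
    then show ?thesis unfolding Y_def set_mult_def using that sub_one[OF H] by blast
  qed
  have gY: "g y \<in> Y" if y: "y \<in> Y" for y
  proof -
    obtain h w where hw: "h \<in> H" "w \<in> W" "y = h \<otimes> w" using y unfolding Y_def set_mult_def by blast
    have c: "h \<in> carrier G" "w \<in> carrier G" using Hc hw sub_carr[OF W(1)] by auto
    have "g h \<otimes> inv h \<in> D" using hw by (simp add: D_def)
    then obtain h' s where hs: "h' \<in> H" "s \<in> S" "g h \<otimes> inv h = h' \<otimes> s" using S(3) by blast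
    have "g y = (g h \<otimes> inv h) \<otimes> h \<otimes> g w" using c hw(3) gc hom_mult[OF gh] by simp
    moreover have "g h \<otimes> inv h \<in> Y" unfolding hs(3) using HY[OF hs(1)] WY hs(2) W(4) sub_mult[OF sY] by blast
    moreover have "g w \<in> Y" using W(5) hw(2) WY by blast
    ultimately show ?thesis using HY[OF hw(1)] sub_mult[OF sY] by simp
  qed
  have "g' h \<in> Y" if h: "h \<in> H" for h
  proof -
    have hc: "h \<in> carrier G" using Hc h by simp
    have sub: "{g h \<otimes> inv h} \<subseteq> ?T" using g(2) hc by blast
    have "finite {g h \<otimes> inv h}" by simp
    from finite_invariant[OF Fg this sub] obtain V where V: "subgroup V G" "finite V" "{g h \<otimes> inv h} \<subseteq> V" "\<forall>k\<in>{g}. k ` V = V"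
      by blast
    define R where "R = Y \<inter> (V #> h)"
    have "finite R" unfolding R_def r_coset_def using V(2) by simp
    moreover have "g ` R \<subseteq> R"
    proof
      fix y assume "y \<in> g ` R"
      then obtain v where v: "v \<in> V" "v \<otimes> h \<in> Y" "y = g (v \<otimes> h)" unfolding R_def r_coset_def by blast
      have vc: "v \<in> carrier G" "g v \<in> carrier G" using sub_carr[OF V(1)] v gc by auto
      have "y = (g v \<otimes> (g h \<otimes> inv h)) \<otimes> h" using v(3) vc hc gc hom_mult[OF gh] by (simp add: m_assoc)
      moreover have "g v \<otimes> (g h \<otimes> inv h) \<in> V" using V(3,4) v(1) sub_mult[OF V(1)] by blast
      ultimately have "y \<in> V #> h" unfolding r_coset_def by blast
      then show "y \<in> R" using gY[OF v(2)] v(3) by (simp add: R_def)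
    qed
    moreover have Rc: "R \<subseteq> carrier G" using sub_carr[OF sY] by (auto simp: R_def)
    have "inj_on g R" using iso_inj[OF inertial_iso[OF g(1)]] Rc by (rule inj_on_subset)
    ultimately have "g ` R = R" using endo_inj_surj by blast
    moreover have "h = \<one> \<otimes> h" using hc by simp
    then have "h \<in> R" unfolding R_def r_coset_def using HY[OF h] sub_one[OF V(1)] by blast
    ultimately obtain y where y: "y \<in> R" "h = g y" by (metis imageE)
    then have "g' h = y" using g'(2) Rc by blast
    then show ?thesis using y by (simp add: R_def)
  qed
  then have "g' ` H \<subseteq> Y" by blast
  moreover have "almost_le G Y H"
  proof (rule almost_leI[OF W(2)])
    show "W \<subseteq> carrier G" using sub_carr[OF W(1)] by blast
    fix k assume "k \<in> Y"
    then show "\<exists>h\<in>H. \<exists>s\<in>W. k = h \<otimes> s" unfolding Y_def set_mult_def by blast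
  qed
  ultimately show "almost_le G (g' ` H) H" using almost_le_mono by blast
qed

lemma torsion_root:
  assumes "x \<in> carrier G" "x [^] (k::int) \<in> torsion_subgroup G" "k \<noteq> 0" shows "x \<in> torsion_subgroup G"
proof -
  obtain n :: int where n: "n > 0" "(x [^] k) [^] n = \<one>" using assms(2) torsion_iff by blast
  then have "x [^] (k * n) = \<one>" using assms(1) by (simp add: int_pow_pow)
  then show ?thesis using assms n by (intro torsionI[of x "k * n"]) auto
qed

text \<open>On each cyclic subgroup inertiality gives some relation \<open>n (g x) = m x\<close>.
  Comparing the relations for \<open>a\<close>, \<open>b\<close> and \<open>a + b\<close> shows that
  the ratios at \<open>a\<close> and \<open>b\<close> agree, because \<open>a\<close> has infinite
  order.\<close>

lemma inertial_factor:
  assumes g: "inertial_map G g" and a: "a \<in> carrier G" "a \<notin> torsion_subgroup G"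
  obtains m n where "n > 0" "m \<noteq> 0" "coprime m n" "rational_action G g m n"
proof -
  let ?T = "torsion_subgroup G"
  note gh = inertial_hom[OF g]
  note gc = hom_in_carrier[OF gh]
  have single: "\<exists>(n::int) (m::int). n > 0 \<and> g x [^] n = x [^] m" if x: "x \<in> carrier G" for x
  proof -
    define H where "H = range (\<lambda>k::int. x [^] k)"
    have H: "subgroup H G" unfolding H_def by (rule cyclic_subgroup[OF x])
    obtain e :: int where e: "e > 0" "\<forall>k\<in>g ` H. k [^] e \<in> H"
      using almost_le_exponent[OF inertial_almost_le[OF g H] H hom_image_subgroup[OF gh H]] by blast
    have "x [^] (1::int) \<in> H" unfolding H_def by blast
    then have "x \<in> H" using x by simp
    then have "g x [^] e \<in> H" using e by blast
    then show ?thesis using e(1) unfolding H_def by blast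
  qed
  obtain n m :: int where nm: "n > 0" "g a [^] n = a [^] m" using single[OF a(1)] by blast
  have act: "rational_action G g m n"
    unfolding rational_action_def
  proof
    fix b assume b: "b \<in> carrier G"
    obtain n' m' :: int where nm': "n' > 0" "g b [^] n' = b [^] m'" using single[OF b] by blast
    obtain n'' m'' :: int where nm'': "n'' > 0" "g (a \<otimes> b) [^] n'' = (a \<otimes> b) [^] m''"
      using single[of "a \<otimes> b"] a b by auto
    define u where "u = m * (n'' * n') - m'' * (n * n')"
    define v where "v = m'' * (n * n') - m' * (n'' * n)"
    have c: "g a \<in> carrier G" "g b \<in> carrier G" using gc a b by auto
    have e1: "(g a [^] n) [^] (n'' * n') \<otimes> (g b [^] n') [^] (n'' * n) = (g (a \<otimes> b) [^] n'') [^] (n * n')"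
      using a b c by (simp add: hom_mult[OF gh] int_pow_distrib int_pow_pow mult_ac)
    have e2: "a [^] (m * (n'' * n')) \<otimes> b [^] (m' * (n'' * n)) = a [^] (m'' * (n * n')) \<otimes> b [^] (m'' * (n * n'))"
      using e1 unfolding nm(2) nm'(2) nm''(2) using a b by (simp add: int_pow_distrib int_pow_pow)
    have e3: "a [^] u = b [^] v"
    proof -
      have "a [^] u = inv (a [^] (m'' * (n * n'))) \<otimes>
          (a [^] (m * (n'' * n')) \<otimes> b [^] (m' * (n'' * n))) \<otimes> inv (b [^] (m' * (n'' * n)))"
        unfolding u_def using a b by (simp add: int_pow_diff m_assoc m_comm[of "a [^] (m * (n'' * n'))"])
      also have "\<dots> = b [^] v" unfolding e2 v_def using a b by (simp add: int_pow_diff m_assoc)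
      finally show ?thesis .
    qed
    let ?z = "g b [^] n \<otimes> inv (b [^] m)"
    have zc: "?z \<in> carrier G" using b c by simp
    show "?z \<in> ?T"
    \<comment> \<open>If \<open>v = 0\<close>, then \<open>u = 0\<close> since \<open>a\<close> has
      infinite order, and the ratios at \<open>a\<close> and \<open>b\<close> coincide. Otherwise a
      nonzero multiple of \<open>b\<close> is a multiple of \<open>a\<close>, and the ratio is
      carried over from \<open>a\<close>.\<close>
    proof (cases "v = 0")
      case True
      then have "a [^] u = \<one>" using e3 by simp
      then have "u = 0" using a torsionI by blast
      then have "m * (n'' * n') = m' * (n'' * n)" using True unfolding u_def v_def by linarith
      then have "n'' * (m * n') = n'' * (m' * n)" by (simp only: mult.left_commute)
      then have mn: "m * n' = m' * n" using nm''(1) by simp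
      have "?z [^] n' = (g b [^] n') [^] n \<otimes> inv (b [^] (m * n'))"
        using b c by (simp add: int_pow_distrib int_pow_pow int_pow_inv mult.commute)
      also have "\<dots> = \<one>" unfolding nm'(2) mn using b by (simp add: int_pow_pow)
      finally have "?z [^] n' = \<one>" .
      moreover have "n' \<noteq> 0" using nm'(1) by simp
      ultimately show ?thesis using torsionI[OF zc] by blast
    next
      case False
      have "(g b [^] n) [^] v = (g (b [^] v)) [^] n" using b c by (simp add: hom_pow[OF gh] int_pow_pow mult.commute)
      also have "\<dots> = (g (a [^] u)) [^] n" using e3 by simp
      also have "\<dots> = (g a [^] n) [^] u" using a c by (simp add: hom_pow[OF gh] int_pow_pow mult.commute)
      also have "\<dots> = (a [^] u) [^] m" unfolding nm(2) using a by (simp add: int_pow_pow mult.commute)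
      also have "\<dots> = (b [^] m) [^] v" unfolding e3 using b by (simp add: int_pow_pow mult.commute)
      finally have "?z [^] v = \<one>" using b c by (simp add: int_pow_distrib int_pow_inv)
      then show ?thesis using torsionI[OF zc False] by blast
    qed
  qed
  have m0: "m \<noteq> 0"
  proof
    assume "m = 0"
    then have "g (a [^] n) = \<one>" using nm a hom_pow[OF gh, of a n] by simp
    then have "a [^] n = \<one>" using iso_eq_one[OF inertial_iso[OF g], of "a [^] n"] a by simp
    moreover have "n \<noteq> 0" using nm by simp
    ultimately have "a \<in> ?T" using torsionI[OF a(1)] by blast
    then show False using a(2) by simp
  qed
  define d where "d = gcd m n"
  have d: "d > 0" using nm(1) by (simp add: d_def)
  obtain m1 n1 where mn1: "m = m1 * d" "n = n1 * d" "coprime m1 n1"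
    using gcd_coprime_exists[of m n] d unfolding d_def by auto
  have "rational_action G g m1 n1"
    unfolding rational_action_def
  proof
    fix x assume x: "x \<in> carrier G"
    let ?z = "g x [^] n1 \<otimes> inv (x [^] m1)"
    have "?z [^] d = g x [^] n \<otimes> inv (x [^] m)"
      unfolding mn1(1,2) using x gc by (simp add: int_pow_distrib int_pow_pow int_pow_inv)
    then have "?z [^] d \<in> ?T" using act x by (simp add: rational_action_def)
    then show "?z \<in> ?T" using torsion_root[of ?z d] d x gc by simp
  qed
  moreover have "n1 > 0" using mn1(2) nm(1) d by (simp add: zero_less_mult_iff)
  moreover have "m1 \<noteq> 0" using m0 mn1 by auto
  ultimately show ?thesis using that mn1(3) by blast
qed

section \<open>Splitting off a primary component\<close>

definition prime_to :: "int \<Rightarrow> 'a set" where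
  "prime_to p = {x \<in> carrier G. \<exists>s::int. \<not> p dvd s \<and> x [^] s = \<one>}"

lemma prime_to_subgroup: assumes "prime p" shows "subgroup (prime_to p) G"
proof (rule subgroupI')
  show "prime_to p \<subseteq> carrier G" by (auto simp: prime_to_def)
  have "\<not> p dvd 1" using assms not_prime_unit by blast
  then show "\<one> \<in> prime_to p" by (auto simp: prime_to_def intro!: exI[of _ 1])
  fix x y assume "x \<in> prime_to p" "y \<in> prime_to p"
  then obtain s t :: int where st: "x \<in> carrier G" "y \<in> carrier G" "\<not> p dvd s" "\<not> p dvd t" "x [^] s = \<one>" "y [^] t = \<one>"
    by (auto simp: prime_to_def)
  have "x [^] (s * t) = \<one>" "y [^] (s * t) = \<one>"
    using st pow_dvd_one[of x s "s * t"] pow_dvd_one[of y t "s * t"] by auto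
  then have "(x \<otimes> inv y) [^] (s * t) = \<one>" using st by (simp add: int_pow_distrib int_pow_inv)
  moreover have "\<not> p dvd s * t" using st assms prime_dvd_mult_iff by blast
  ultimately show "x \<otimes> inv y \<in> prime_to p" using st by (auto simp: prime_to_def)
qed

lemma primary_prime_to:
  assumes "prime p" "x \<in> primary G p" "x \<in> prime_to p" shows "x = \<one>"
proof -
  obtain n s where ns: "x [^] (p ^ n) = \<one>" "x [^] (s::int) = \<one>" "\<not> p dvd s" "x \<in> carrier G"
    using assms by (auto simp: primary_def prime_to_def)
  show ?thesis by (rule coprime_pow_one[OF ns(4,2,1) prime_not_dvd_coprime[OF assms(1) ns(3)]])
qed

lemma torsion_decompose:
  assumes "prime p" "x \<in> torsion_subgroup G"
  obtains y z where "y \<in> primary G p" "z \<in> prime_to p" "x = y \<otimes> z"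
proof -
  obtain N :: int where N: "N > 0" "x [^] N = \<one>" "x \<in> carrier G" using assms(2) torsion_iff by blast
  obtain a e where ae: "N = p ^ a * e" "\<not> p dvd e" using prime_decompose[OF assms(1), of N] N by auto
  have "coprime e (p ^ a)" using prime_not_dvd_coprime[OF assms(1) ae(2)] .
  then obtain u v where uv: "u * e + v * p ^ a = 1" using bezout_int[of e "p ^ a"] by auto
  have "x [^] (u * e + v * p ^ a) = x [^] (u * e) \<otimes> x [^] (v * p ^ a)" using N(3) by (rule int_pow_mult)
  then have "x = x [^] (u * e) \<otimes> x [^] (v * p ^ a)" using uv N(3) by simp
  moreover have "(x [^] (u * e)) [^] (p ^ a) = (x [^] N) [^] u" unfolding ae(1) using N(3) by (simp add: int_pow_pow mult_ac)
  then have "x [^] (u * e) \<in> primary G p" using N by (auto simp: primary_def)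
  moreover have "(x [^] (v * p ^ a)) [^] e = (x [^] N) [^] v" unfolding ae(1) using N(3) by (simp add: int_pow_pow mult_ac)
  then have "x [^] (v * p ^ a) \<in> prime_to p" using N ae(2) by (auto simp: prime_to_def)
  ultimately show ?thesis using that by blast
qed

lemma hom_prime_to:
  assumes "g \<in> hom G G" "x \<in> prime_to p" shows "g x \<in> prime_to p"
proof -
  obtain s :: int where s: "\<not> p dvd s" "x [^] s = \<one>" "x \<in> carrier G" using assms(2) by (auto simp: prime_to_def)
  then have "g x [^] s = \<one>" using hom_pow[OF assms(1), of x s] hom_one'[OF assms(1)] by simp
  then show ?thesis using s hom_in_carrier[OF assms(1)] by (auto simp: prime_to_def)
qed

text \<open>The map \<open>n g - m\<close> sends \<open>G\<close> into its torsion subgroup and is bijective on the \<open>p\<close>-component;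
  the complement is the preimage of the \<open>p'\<close>-torsion.\<close>

lemma inertial_splitting:
  assumes g: "inertial_map G g" and act: "rational_action G g m n" and mn: "coprime m n"
    and p: "prime p" "p dvd m \<or> p dvd n"
  obtains K where "splitting G p K"
proof -
  let ?T = "torsion_subgroup G" and ?P = "primary G p"
  note gh = inertial_hom[OF g]
  note gc = hom_in_carrier[OF gh]
  have Fg: "finite {g}" "\<forall>k\<in>{g}. inertial_map G k" using g by auto
  have Pc: "x \<in> carrier G" if "x \<in> ?P" for x using that by (simp add: primary_def)
  have sP: "subgroup ?P G" by (rule primary_subgroup)
  have gP: "g x \<in> ?P" if "x \<in> ?P" for x using hom_primary[OF gh] that by blast
  define \<phi> where "\<phi> x = g x [^] n \<otimes> inv (x [^] m)" for x
  have \<phi>h: "\<phi> \<in> hom G G"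
    unfolding \<phi>_def using gc by (intro homI) (simp_all add: hom_mult[OF gh] int_pow_distrib inv_mult_group m_ac)
  have \<phi>c: "\<phi> x \<in> carrier G" if "x \<in> carrier G" for x using hom_in_carrier[OF \<phi>h that] .
  have \<phi>T: "\<phi> x \<in> ?T" if "x \<in> carrier G" for x using act that unfolding rational_action_def \<phi>_def by blast
  have \<phi>g: "\<phi> (g x) = g (\<phi> x)" if "x \<in> carrier G" for x
    unfolding \<phi>_def using that gc by (simp add: hom_mult[OF gh] hom_inv'[OF gh] hom_pow[OF gh])
  have \<phi>P: "\<phi> x \<in> ?P" if "x \<in> ?P" for x using hom_primary[OF \<phi>h] that by blast
  have \<phi>sub: "\<phi> x \<in> V" if "subgroup V G" "x \<in> V" "g x \<in> V" for V x
    unfolding \<phi>_def using that by (simp add: sub_mult sub_inv sub_pow)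
  have \<phi>inj0: "x = \<one>" if x: "x \<in> ?P" "\<phi> x = \<one>" for x
  proof (rule ccontr)
    assume x1: "x \<noteq> \<one>"
    obtain N where N: "x [^] (p ^ N) = \<one>" using x by (auto simp: primary_def)
    obtain k where k: "x [^] (p ^ Suc k) = \<one>" "x [^] (p ^ k) \<noteq> \<one>" by (rule exact_order[OF Pc[OF x(1)] N x1])
    \<comment> \<open>A nontrivial kernel contains an element \<open>y\<close> of order
      \<open>p\<close> with \<open>n (g y) = m y\<close>. As exactly one of \<open>m\<close> and
      \<open>n\<close> is divisible by \<open>p\<close>, one side vanishes, and on the other side
      the coefficient is prime to \<open>p\<close>.\<close>
    define y where "y = x [^] (p ^ k)"
    have y: "y \<in> carrier G" "y [^] p = \<one>" "y \<noteq> \<one>" using k Pc[OF x(1)] by (simp_all add: y_def int_pow_pow mult.commute)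
    have gy: "g y [^] p = \<one>" using y hom_pow[OF gh, of y p] hom_one'[OF gh] by simp
    have "\<phi> y = \<one>" unfolding y_def using hom_pow[OF \<phi>h Pc[OF x(1)]] x(2) by simp
    then have e: "g y [^] n = y [^] m" unfolding \<phi>_def using y gc by (metis inv_closed inv_equality inv_inv int_pow_closed)
    show False
    proof (cases "p dvd m")
      case True
      then have "\<not> p dvd n" using mn p(1) by (meson coprime_common_divisor not_prime_unit)
      moreover have "g y [^] n = \<one>" using e pow_dvd_one[OF y(1,2) True] by simp
      ultimately have "g y = \<one>" using coprime_pow_one[OF gc[OF y(1)] _ gy, of n] prime_not_dvd_coprime[OF p(1), of n 1] by simp
      then show False using iso_eq_one[OF inertial_iso[OF g] y(1)] y(3) by blast
    next
      case False
      then have "p dvd n" using p by blast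
      then have "y [^] m = \<one>" using e pow_dvd_one[OF gc[OF y(1)] gy] by simp
      then have "y = \<one>" using coprime_pow_one[OF y(1) _ y(2), of m] prime_not_dvd_coprime[OF p(1) False, of 1] by simp
      then show False using y by blast
    qed
  qed
  have \<phi>inj: "x = y" if "x \<in> ?P" "y \<in> ?P" "\<phi> x = \<phi> y" for x y
  proof -
    have "\<phi> (x \<otimes> inv y) = \<one>" using that Pc \<phi>c by (simp add: hom_mult[OF \<phi>h] hom_inv'[OF \<phi>h])
    moreover have "x \<otimes> inv y \<in> ?P" using that sub_mult[OF sP] sub_inv[OF sP] by blast
    ultimately have "x \<otimes> inv y = \<one>" using \<phi>inj0 by blast
    then show ?thesis using that Pc by (metis inv_closed inv_equality inv_inv)
  qed
  \<comment> \<open>Each element lies in a finite \<open>g\<close>-invariant part of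
    \<open>V\<close>; there \<open>\<phi>\<close> is injective, hence surjective.\<close>
  have \<phi>surj: "\<exists>x\<in>V. \<phi> x = y" if V: "subgroup V G" "V \<subseteq> ?P" "\<forall>v\<in>V. g v \<in> V" "y \<in> V" for V y
  proof -
    have sub: "{y} \<subseteq> ?T" using V primary_torsion[OF p(1)] by blast
    have "finite {y}" by simp
    from finite_invariant[OF Fg this sub] obtain W where W: "subgroup W G" "finite W" "W \<subseteq> ?T" "{y} \<subseteq> W" "\<forall>k\<in>{g}. k ` W = W"
      by blast
    have "\<phi> ` (W \<inter> V) \<subseteq> W \<inter> V"
    proof
      fix z assume "z \<in> \<phi> ` (W \<inter> V)"
      then obtain x where x: "x \<in> W" "x \<in> V" "z = \<phi> x" by blast
      have "g x \<in> W" "g x \<in> V" using x W(5) V(3) by blast+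
      then show "z \<in> W \<inter> V" using \<phi>sub W(1) V(1) x by blast
    qed
    moreover have "inj_on \<phi> (W \<inter> V)"
    proof (rule inj_onI)
      fix x y assume "x \<in> W \<inter> V" "y \<in> W \<inter> V" and e: "\<phi> x = \<phi> y"
      then have "x \<in> ?P" "y \<in> ?P" using V(2) by blast+
      then show "x = y" using e by (rule \<phi>inj)
    qed
    moreover have "finite (W \<inter> V)" using W(2) by simp
    ultimately have "\<phi> ` (W \<inter> V) = W \<inter> V" by (intro endo_inj_surj)
    moreover have "y \<in> W \<inter> V" using V(4) W(4) by blast
    ultimately have "y \<in> \<phi> ` (W \<inter> V)" by simp
    then show ?thesis by blast
  qed
  let ?R = "prime_to p"
  have sR: "subgroup ?R G" by (rule prime_to_subgroup[OF p(1)])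
  define K where "K = {x \<in> carrier G. \<phi> x \<in> ?R}"
  have sK: "subgroup K G" unfolding K_def by (rule hom_vimage_subgroup[OF \<phi>h sR subgroup_self])
  have Kc: "x \<in> carrier G" if "x \<in> K" for x using that by (simp add: K_def)
  have PK: "?P \<inter> K \<subseteq> {\<one>}"
  proof
    fix x assume x: "x \<in> ?P \<inter> K"
    then have "\<phi> x \<in> ?R" by (simp add: K_def)
    then have "\<phi> x = \<one>" using primary_prime_to[OF p(1)] \<phi>P x by blast
    then show "x \<in> {\<one>}" using \<phi>inj0 x by blast
  qed
  have dec: "\<exists>u\<in>?P. \<exists>v\<in>K. x = u \<otimes> v" if x: "x \<in> carrier G" for x
  proof -
    obtain y z where yz: "y \<in> ?P" "z \<in> ?R" "\<phi> x = y \<otimes> z" by (rule torsion_decompose[OF p(1) \<phi>T[OF x]])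
    have "\<forall>v\<in>?P. g v \<in> ?P" using gP by blast
    then obtain u where u: "u \<in> ?P" "\<phi> u = y" using \<phi>surj[OF sP order_refl _ yz(1)] by blast
    have zc: "z \<in> carrier G" using sub_carr[OF sR yz(2)] .
    have "\<phi> (inv u \<otimes> x) = z"
      using x u yz Pc zc by (simp add: hom_mult[OF \<phi>h] hom_inv'[OF \<phi>h])
    then have "inv u \<otimes> x \<in> K" using yz x Pc[OF u(1)] by (simp add: K_def)
    moreover have "x = u \<otimes> (inv u \<otimes> x)" using x Pc[OF u(1)] by simp
    ultimately show ?thesis using u(1) by blast
  qed
  have RK: "x \<in> K" if "x \<in> ?R" for x
    using that sub_carr[OF sR that] hom_prime_to[OF \<phi>h that] by (simp add: K_def)
  have Rdiv: "\<exists>y\<in>?R. x = y [^] p" if x: "x \<in> ?R" for x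
  proof -
    obtain s :: int where s: "\<not> p dvd s" "x [^] s = \<one>" "x \<in> carrier G" using x by (auto simp: prime_to_def)
    have "coprime s p" using prime_not_dvd_coprime[OF p(1) s(1), of 1] by simp
    then obtain a b where ab: "a * s + b * p = 1" using bezout_int[of s p] by auto
    have "x [^] (a * s + b * p) = (x [^] s) [^] a \<otimes> (x [^] b) [^] p"
      using s(3) by (simp add: int_pow_mult int_pow_pow mult.commute)
    then have "x = (x [^] b) [^] p" using ab s by simp
    then show ?thesis using sub_pow[OF sR x] by blast
  qed
  have gK: "g x \<in> K" if "x \<in> K" for x
    using that gc \<phi>g hom_prime_to[OF gh] by (simp add: K_def)
  define pK where "pK = (\<lambda>y. y [^] p) ` K"
  have spK: "subgroup pK G" unfolding pK_def by (rule hom_image_subgroup[OF pow_hom sK])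
  have RpK: "x \<in> pK" if "x \<in> ?R" for x using Rdiv[OF that] RK by (auto simp: pK_def)
  have powpK: "x [^] k \<in> pK" if xK: "x \<in> K" and pk: "p dvd k" for x k
  proof -
    obtain q where "k = p * q" using pk by blast
    then have "x [^] k = (x [^] q) [^] p" using Kc[OF xK] by (simp add: int_pow_pow mult.commute)
    then show ?thesis using sub_pow[OF sK xK] by (auto simp: pK_def)
  qed
  \<comment> \<open>A multiple \<open>k x\<close> in \<open>pK\<close> with \<open>k\<close> prime
    to \<open>p\<close> is enough. If \<open>p\<close> divides \<open>m\<close>, write
    \<open>x = g y\<close> and use \<open>n x = \<phi> y + m y\<close>; if it divides
    \<open>n\<close>, use \<open>m x = n (g x) - \<phi> x\<close>. The values of
    \<open>\<phi>\<close> occurring here are torsion of order prime to \<open>p\<close> and so are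
    divisible by \<open>p\<close>.\<close>
  have KpK: "x \<in> pK" if x: "x \<in> K" for x
  proof -
    obtain k where k: "x [^] k \<in> pK" "\<not> p dvd k"
    proof (cases "p dvd m")
      case True
      then have np: "\<not> p dvd n" using mn p(1) by (meson coprime_common_divisor not_prime_unit)
      obtain y where y: "y \<in> carrier G" "x = g y" using iso_surj[OF inertial_iso[OF g]] Kc[OF x] by (metis imageE)
      have "g (\<phi> y) \<in> ?R" using x y \<phi>g by (simp add: K_def)
      then obtain s :: int where s: "\<not> p dvd s" "g (\<phi> y) [^] s = \<one>" by (auto simp: prime_to_def)
      then have "\<phi> y [^] s = \<one>"
        using iso_eq_one[OF inertial_iso[OF g], of "\<phi> y [^] s"] hom_pow[OF gh \<phi>c[OF y(1)], of s] \<phi>c[OF y(1)] by simp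
      then have \<phi>y: "\<phi> y \<in> ?R" using s \<phi>c[OF y(1)] by (auto simp: prime_to_def)
      then have yK: "y \<in> K" using y by (simp add: K_def)
      have "x [^] n = \<phi> y \<otimes> y [^] m" unfolding \<phi>_def y(2) using y gc by simp
      then have "x [^] n \<in> pK" using RpK[OF \<phi>y] powpK[OF yK True] sub_mult[OF spK] by simp
      then show ?thesis using that np by blast
    next
      case False
      then have pn: "p dvd n" using p by blast
      have \<phi>x: "\<phi> x \<in> ?R" using x by (simp add: K_def)
      have "inv (\<phi> x) \<otimes> g x [^] n = x [^] m"
        unfolding \<phi>_def using Kc[OF x] gc by (simp add: inv_mult_group m_assoc)
      moreover have "inv (\<phi> x) \<otimes> g x [^] n \<in> pK"
        using RpK[OF \<phi>x] powpK[OF gK[OF x] pn] sub_mult[OF spK] sub_inv[OF spK] by blast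
      ultimately show ?thesis using that[of m] False by simp
    qed
    have "x [^] p \<in> pK" using powpK[OF x] by simp
    moreover have "coprime k p" using prime_not_dvd_coprime[OF p(1) k(2), of 1] by simp
    ultimately show ?thesis using coprime_pow_mem[OF spK Kc[OF x] k(1)] by blast
  qed
  have div: "p_divisible G p K" using KpK by (auto simp: p_divisible_def pK_def)
  \<comment> \<open>For \<open>h = x + y\<close> with \<open>x\<close> in the component and
    \<open>y\<close> in \<open>K\<close>, the value \<open>\<phi> x\<close> is a multiple of
    \<open>\<phi> h\<close> and lies in \<open>g H + H\<close>. This places it in a
    \<open>g\<close>-invariant subgroup \<open>Y\<close> that exceeds \<open>H \<inter> ?P\<close>
    only by a finite group. Since \<open>\<phi>\<close> is bijective on \<open>Y\<close>, also
    \<open>x\<close> lies in \<open>Y\<close>.\<close>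
  have alm: "almost_le G H ((H \<inter> ?P) <#> (H \<inter> K))" if H: "subgroup H G" for H
  proof -
    note Hc = sub_carr[OF H]
    have Hsub: "H \<subseteq> carrier G" using Hc by blast
    define L where "L = g ` H <#> H"
    have sL: "subgroup L G" unfolding L_def by (rule mult_subgroups[OF hom_image_subgroup[OF gh H] H])
    have "almost_le G H H" using Hsub by (intro almost_le_refl) auto
    then have alL: "almost_le G L H" unfolding L_def using almost_le_mult[OF inertial_almost_le[OF g H] _ H] by blast
    define Z where "Z = H \<inter> ?P"
    have sZ: "subgroup Z G" unfolding Z_def by (rule subgroup_Int[OF H sP])
    have Lc: "L \<subseteq> carrier G" using sub_carr[OF sL] by blast
    have alZ: "almost_le G (L \<inter> ?P) Z" unfolding Z_def by (rule almost_le_restrict[OF alL H Lc sP])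
    have LPc: "L \<inter> ?P \<subseteq> carrier G" using Lc by blast
    obtain S where S: "finite S" "S \<subseteq> L \<inter> ?P" "\<forall>k\<in>L \<inter> ?P. \<exists>h\<in>Z. \<exists>s\<in>S. k = h \<otimes> s"
      using almost_leD'[OF alZ sZ LPc] by blast
    have ST: "S \<subseteq> ?T" using S(2) primary_torsion[OF p(1)] by blast
    obtain W where W: "subgroup W G" "finite W" "W \<subseteq> ?T" "S \<subseteq> W" "\<forall>k\<in>{g}. k ` W = W"
      using finite_invariant[OF Fg S(1) ST] by blast
    define W' where "W' = W \<inter> ?P"
    have sW': "subgroup W' G" unfolding W'_def by (rule subgroup_Int[OF W(1) sP])
    define Y where "Y = Z <#> W'"
    have sY: "subgroup Y G" unfolding Y_def by (rule mult_subgroups[OF sZ sW'])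
    have YP: "Y \<subseteq> ?P" unfolding Y_def set_mult_def Z_def W'_def using sub_mult[OF sP] by blast
    have LPY: "x \<in> Y" if x: "x \<in> L \<inter> ?P" for x
    proof -
      obtain z s where "z \<in> Z" "s \<in> S" "x = z \<otimes> s" using S(3) x by blast
      then show ?thesis unfolding Y_def set_mult_def W'_def using W(4) S(2) by blast
    qed
    have gY: "\<forall>y\<in>Y. g y \<in> Y"
    proof
      fix y assume "y \<in> Y"
      then obtain z w where zw: "z \<in> Z" "w \<in> W'" "y = z \<otimes> w" unfolding Y_def set_mult_def by blast
      have c: "z \<in> carrier G" "w \<in> carrier G" using sub_carr[OF sZ zw(1)] sub_carr[OF sW' zw(2)] by auto
      have "g z = g z \<otimes> \<one>" using c gc by simp
      then have "g z \<in> L" unfolding L_def set_mult_def using zw(1) sub_one[OF H] by (auto simp: Z_def)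
      then have gz: "g z \<in> Y" using LPY gP zw(1) by (auto simp: Z_def)
      have "g w \<in> W'" using zw(2) W(5) gP by (auto simp: W'_def)
      moreover have "g w = \<one> \<otimes> g w" using c gc by simp
      ultimately have "g w \<in> Y" unfolding Y_def set_mult_def using sub_one[OF sZ] by blast
      then show "g y \<in> Y" using gz zw(3) c hom_mult[OF gh] sub_mult[OF sY] by simp
    qed
    \<comment> \<open>For each \<open>w\<close> one partner in \<open>K\<close> is fixed that brings
      it into \<open>H\<close>. Two partners of the same \<open>w\<close> differ by an element of
      \<open>H \<inter> K\<close>, so the sums \<open>w + y0 w\<close> represent all cosets.\<close>
    define y0 where "y0 w = (SOME y. y \<in> K \<and> w \<otimes> y \<in> H)" for w
    have y0: "y0 w \<in> K \<and> w \<otimes> y0 w \<in> H" if "y \<in> K" "w \<otimes> y \<in> H" for w y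
      unfolding y0_def using someI[of "\<lambda>y. y \<in> K \<and> w \<otimes> y \<in> H" y] that by blast
    \<comment> \<open>For a \<open>w\<close> without partner \<open>y0 w\<close> is arbitrary, hence
      the intersection with the carrier.\<close>
    define S1 where "S1 = (\<lambda>w. w \<otimes> y0 w) ` W' \<inter> carrier G"
    show ?thesis
    proof (rule almost_leI)
      show "finite S1" using W(2) by (simp add: S1_def W'_def)
      show "S1 \<subseteq> carrier G" by (simp add: S1_def)
      fix h assume h: "h \<in> H"
      obtain x y where xy: "x \<in> ?P" "y \<in> K" "h = x \<otimes> y" using dec[OF Hc[OF h]] by blast
      have c: "x \<in> carrier G" "y \<in> carrier G" using Pc Kc xy by auto
      have \<phi>hL: "\<phi> h \<in> L"
      proof -
        have "g h [^] n = g (h [^] n)" using hom_pow[OF gh Hc[OF h]] by simp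
        then show ?thesis unfolding \<phi>_def L_def set_mult_def using sub_pow[OF H h] sub_inv[OF H] by blast
      qed
      have e: "\<phi> h = \<phi> x \<otimes> \<phi> y" using xy c hom_mult[OF \<phi>h] by simp
      obtain k where k: "\<phi> x [^] (p ^ k) = \<one>" using \<phi>P[OF xy(1)] by (auto simp: primary_def)
      obtain s :: int where s: "\<not> p dvd s" "\<phi> y [^] s = \<one>" using xy(2) by (auto simp: K_def prime_to_def)
      obtain a b where ab: "a * s + b * p ^ k = 1"
        using bezout_int[of s "p ^ k"] prime_not_dvd_coprime[OF p(1) s(1), of k] by auto
      \<comment> \<open>The multiplier \<open>s * a\<close> kills \<open>\<phi> y\<close> and is
        congruent to \<open>1\<close> modulo a power of \<open>p\<close> that kills
        \<open>\<phi> x\<close>.\<close>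
      have "\<phi> x = (\<phi> h) [^] (s * a)"
      proof -
        have "(\<phi> h) [^] (s * a) = \<phi> x [^] (a * s) \<otimes> (\<phi> y [^] s) [^] a"
          unfolding e using c \<phi>c by (simp add: int_pow_distrib int_pow_pow mult.commute)
        also have "\<dots> = \<phi> x [^] (a * s)" using s c \<phi>c by simp
        also have "\<dots> = \<phi> x [^] (1::int)"
        proof (rule pow_cong[OF \<phi>c[OF c(1)] k])
          have "a * s - 1 = p ^ k * (- b)" using ab by (simp add: algebra_simps)
          then show "p ^ k dvd a * s - 1" by (rule dvdI)
        qed
        finally show ?thesis using \<phi>c[OF c(1)] by simp
      qed
      then have "\<phi> x \<in> L \<inter> ?P" using \<phi>P[OF xy(1)] sub_pow[OF sL \<phi>hL] by simp
      then have "\<phi> x \<in> Y" by (rule LPY)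
      then obtain x' where x': "x' \<in> Y" "\<phi> x' = \<phi> x" using \<phi>surj[OF sY YP gY] by blast
      then have "x \<in> Y" using \<phi>inj[of x' x] YP xy(1) by blast
      then obtain z w where zw: "z \<in> Z" "w \<in> W'" "x = z \<otimes> w" unfolding Y_def set_mult_def by blast
      have cz: "z \<in> carrier G" "w \<in> carrier G" using sub_carr[OF sZ zw(1)] sub_carr[OF sW' zw(2)] by auto
      have "inv z \<otimes> h = w \<otimes> y" unfolding xy(3) zw(3) using cz c by (simp add: m_assoc)
      moreover have zH: "z \<in> H" using zw by (simp add: Z_def)
      ultimately have wyH: "w \<otimes> y \<in> H" using sub_mult[OF H sub_inv[OF H zH] h] by simp
      then have y0w: "y0 w \<in> K" "w \<otimes> y0 w \<in> H" using y0[OF xy(2)] by auto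
      have cy: "y0 w \<in> carrier G" using Kc y0w by blast
      have "(w \<otimes> y) \<otimes> inv (w \<otimes> y0 w) = ((y \<otimes> inv (y0 w)) \<otimes> w) \<otimes> inv w"
        using cz c cy by (simp add: inv_mult_group m_ac)
      also have "\<dots> = y \<otimes> inv (y0 w)" using cz c cy by (simp only: m_inv_cancel m_closed inv_closed)
      finally have "y \<otimes> inv (y0 w) \<in> H" using sub_mult[OF H wyH sub_inv[OF H y0w(2)]] by simp
      then have yy: "y \<otimes> inv (y0 w) \<in> H \<inter> K" using xy(2) y0w(1) sub_mult[OF sK] sub_inv[OF sK] by blast
      have "h = (z \<otimes> (y \<otimes> inv (y0 w))) \<otimes> (w \<otimes> y0 w)"
      proof -
        have "(z \<otimes> (y \<otimes> inv (y0 w))) \<otimes> (w \<otimes> y0 w) = (z \<otimes> (y \<otimes> inv (y0 w))) \<otimes> (y0 w \<otimes> w)"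
          using cz cy by (simp add: m_comm)
        also have "\<dots> = z \<otimes> (y \<otimes> w)" using cz c cy by (simp add: m_assoc)
        also have "\<dots> = h" unfolding xy(3) zw(3) using cz c by (simp add: m_ac)
        finally show ?thesis by simp
      qed
      moreover have "z \<otimes> (y \<otimes> inv (y0 w)) \<in> (H \<inter> ?P) <#> (H \<inter> K)"
        using zw(1) yy unfolding set_mult_def Z_def by blast
      moreover have "w \<otimes> y0 w \<in> S1" using zw(2) cz cy by (simp add: S1_def)
      ultimately show "\<exists>h'\<in>(H \<inter> ?P) <#> (H \<inter> K). \<exists>s\<in>S1. h = h' \<otimes> s" by blast
    qed
  qed
  have carr: "carrier G \<subseteq> ?P <#> K" unfolding set_mult_def using dec by blast
  show ?thesis by (rule that[of K]) (use p(1) sK PK carr div alm in \<open>auto simp: splitting_def\<close>)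
qed

text \<open>By the last clause of \<open>splitting\<close>, a fixed nonzero multiple of
  \<open>K'\<close> lies in \<open>K\<close>, and divisibility removes its \<open>p\<close>-part.
  The decomposition of \<open>G\<close> puts some \<open>p ^ k x\<close> into \<open>K\<close> as
  well, and coprime multipliers give \<open>x\<close> itself.\<close>

lemma splitting_maximal:
  assumes s: "splitting G p K" and K': "subgroup K' G" "primary G p \<inter> K' \<subseteq> {\<one>}" "p_divisible G p K'"
  shows "K' \<subseteq> K"
proof
  fix x assume x: "x \<in> K'"
  have p: "prime p" and sK: "subgroup K G" and carr: "carrier G \<subseteq> primary G p <#> K"
    using s by (auto simp: splitting_def)
  have xc: "x \<in> carrier G" using sub_carr[OF K'(1) x] .
  have "almost_le G K' ((K' \<inter> primary G p) <#> (K' \<inter> K))" using s K' by (simp add: splitting_def)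
  moreover have "(K' \<inter> primary G p) <#> (K' \<inter> K) \<subseteq> K"
  proof
    fix y assume "y \<in> (K' \<inter> primary G p) <#> (K' \<inter> K)"
    then obtain a b where ab: "a \<in> K' \<inter> primary G p" "b \<in> K' \<inter> K" "y = a \<otimes> b" unfolding set_mult_def by blast
    have "a = \<one>" using ab(1) K'(2) by blast
    then show "y \<in> K" using ab sub_carr[OF sK, of b] by simp
  qed
  ultimately have al: "almost_le G K' K" using almost_le_mono by blast
  obtain e :: int where e: "e > 0" "\<forall>k\<in>K'. k [^] e \<in> K" using almost_le_exponent[OF al sK K'(1)] by blast
  obtain a e' where ae: "e = p ^ a * e'" "\<not> p dvd e'" using prime_decompose[OF p, of e] e by auto
  have "K' \<subseteq> carrier G" using sub_carr[OF K'(1)] by blast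
  then obtain y where y: "y \<in> K'" "x = y [^] (p ^ a)" using p_divisible_pow[OF K'(3) _ x] by blast
  have "y [^] e = x [^] e'" unfolding y(2) ae(1) using sub_carr[OF K'(1) y(1)] by (simp add: int_pow_pow)
  then have 1: "x [^] e' \<in> K" using e(2) y(1) by metis
  obtain u v where uv: "u \<in> primary G p" "v \<in> K" "x = u \<otimes> v" using carr xc unfolding set_mult_def by blast
  obtain k where k: "u [^] (p ^ k) = \<one>" "u \<in> carrier G" using uv(1) by (auto simp: primary_def)
  have "x [^] (p ^ k) = v [^] (p ^ k)" unfolding uv(3) using k sub_carr[OF sK uv(2)] by (simp add: int_pow_distrib)
  then have 2: "x [^] (p ^ k) \<in> K" using sub_pow[OF sK uv(2)] by simp
  show "x \<in> K" by (rule coprime_pow_mem[OF sK xc 1 2 prime_not_dvd_coprime[OF p ae(2)]])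
qed

text \<open>An automorphism transports divisibility and triviality of the \<open>p\<close>-torsion
  from \<open>K\<close> to its image, and \<open>K\<close> contains every subgroup with these two
  properties. No inertiality is involved, which is why scalings commute with all
  automorphisms.\<close>

lemma splitting_invariant:
  assumes s: "splitting G p K" and a: "a \<in> iso G G" shows "a ` K \<subseteq> K"
proof (rule splitting_maximal[OF s])
  note ah = iso_hom[OF a]
  have sK: "subgroup K G" and div: "p_divisible G p K" and PK: "primary G p \<inter> K \<subseteq> {\<one>}"
    using s by (auto simp: splitting_def)
  note Kc = sub_carr[OF sK]
  show "subgroup (a ` K) G" by (rule hom_image_subgroup[OF ah sK])
  show "p_divisible G p (a ` K)"
    unfolding p_divisible_def
  proof
    fix x assume "x \<in> a ` K"
    then obtain y where y: "y \<in> K" "x = a y" by blast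
    then obtain z where z: "z \<in> K" "y = z [^] p" using div unfolding p_divisible_def by blast
    have "x = a z [^] p" unfolding y(2) z(2) using hom_pow[OF ah Kc[OF z(1)]] by simp
    then show "\<exists>y\<in>a ` K. x = y [^] p" using z by blast
  qed
  show "primary G p \<inter> a ` K \<subseteq> {\<one>}"
  proof
    fix x assume "x \<in> primary G p \<inter> a ` K"
    then obtain y n where y: "y \<in> K" "x = a y" "x [^] (p ^ n) = \<one>" by (auto simp: primary_def)
    have "a (y [^] (p ^ n)) = \<one>" using y hom_pow[OF ah Kc[OF y(1)]] by simp
    then have "y [^] (p ^ n) = \<one>" using iso_eq_one[OF a, of "y [^] (p ^ n)"] Kc[OF y(1)] by simp
    then have "y \<in> primary G p" using Kc[OF y(1)] by (auto simp: primary_def)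
    then have "y = \<one>" using PK y(1) by blast
    then show "x \<in> {\<one>}" using y hom_one'[OF ah] by simp
  qed
qed

lemma splitting_no_torsion:
  assumes "splitting G p K" "x \<in> K" "x [^] p = \<one>" shows "x = \<one>"
proof -
  have "subgroup K G" using assms by (simp add: splitting_def)
  then have "x \<in> carrier G" using sub_carr assms(2) by blast
  then have "x \<in> primary G p" using assms(3) by (auto simp: primary_def intro!: exI[of _ 1])
  then show ?thesis using assms by (auto simp: splitting_def)
qed

lemma splitting_decompose:
  assumes "splitting G p K" "x \<in> carrier G"
  obtains u v where "u \<in> primary G p" "v \<in> K" "x = u \<otimes> v"
  using assms unfolding splitting_def set_mult_def by blast

section \<open>Scalings\<close>

lemma scaling_exists:
  assumes s: "splitting G p K"
  obtains g where "g \<in> auto G" "scaling G p K g"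
proof -
  let ?P = "primary G p"
  have p: "prime p" and sK: "subgroup K G" and div: "p_divisible G p K" and PK: "?P \<inter> K \<subseteq> {\<one>}"
    using s by (auto simp: splitting_def)
  have sP: "subgroup ?P G" by (rule primary_subgroup)
  note Kc = sub_carr[OF sK] and Pc = sub_carr[OF sP]
  \<comment> \<open>The projection onto \<open>K\<close> along the
    \<open>p\<close>-component.\<close>
  define r where "r x = (SOME v. v \<in> K \<and> (\<exists>u\<in>?P. x = u \<otimes> v))" for x
  have r: "r (u \<otimes> v) = v" if uv: "u \<in> ?P" "v \<in> K" for u v
  proof -
    have "\<exists>v'. v' \<in> K \<and> (\<exists>u'\<in>?P. u \<otimes> v = u' \<otimes> v')" using uv by blast
    then have "r (u \<otimes> v) \<in> K \<and> (\<exists>u'\<in>?P. u \<otimes> v = u' \<otimes> r (u \<otimes> v))" unfolding r_def by (rule someI_ex)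
    then obtain u' where u': "r (u \<otimes> v) \<in> K" "u' \<in> ?P" "u \<otimes> v = u' \<otimes> r (u \<otimes> v)" by blast
    define v' where "v' = r (u \<otimes> v)"
    have v': "v' \<in> K" "u \<otimes> v = u' \<otimes> v'" using u' by (simp_all add: v'_def)
    have c: "u \<in> carrier G" "v \<in> carrier G" "u' \<in> carrier G" "v' \<in> carrier G" using uv u' v' Kc Pc by auto
    have "inv u' \<otimes> u = inv u' \<otimes> (u \<otimes> v) \<otimes> inv v" using c by (simp add: m_assoc)
    also have "\<dots> = v' \<otimes> inv v" unfolding v'(2) using c by simp
    finally have e: "inv u' \<otimes> u = v' \<otimes> inv v" .
    have "inv u' \<otimes> u \<in> ?P" using uv u' sub_mult[OF sP] sub_inv[OF sP] by blast
    moreover have "v' \<otimes> inv v \<in> K" using uv v' sub_mult[OF sK] sub_inv[OF sK] by blast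
    ultimately have "v' \<otimes> inv v = \<one>" using e PK by auto
    then have "v' = v" using c by (metis inv_closed inv_equality inv_inv)
    then show ?thesis by (simp add: v'_def)
  qed
  \<comment> \<open>Adding \<open>p - 1\<close> times the \<open>K\<close>-part to \<open>x\<close>
    multiplies that part by \<open>p\<close> and leaves the other unchanged. The restriction makes
    \<open>g\<close> extensional, as membership in \<open>auto G\<close> demands.\<close>
  define g where "g = (\<lambda>x\<in>carrier G. x \<otimes> r x [^] (p - 1))"
  have g: "g (u \<otimes> v) = u \<otimes> v [^] p" if uv: "u \<in> ?P" "v \<in> K" for u v
  proof -
    have "v \<otimes> v [^] (p - 1) = v [^] (1 + (p - 1))" using Kc[OF uv(2)] int_pow_mult[of v 1 "p - 1"] by simp
    then show ?thesis using uv Kc Pc by (simp add: g_def r m_assoc)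
  qed
  have gh: "g \<in> hom G G"
  proof (rule homI)
    fix x assume x: "x \<in> carrier G"
    obtain u v where "u \<in> ?P" "v \<in> K" "x = u \<otimes> v" by (rule splitting_decompose[OF s x])
    then show "g x \<in> carrier G" using g Kc Pc by simp
    fix y assume y: "y \<in> carrier G"
    obtain u' v' where uv': "u' \<in> ?P" "v' \<in> K" "y = u' \<otimes> v'" by (rule splitting_decompose[OF s y])
    have "x \<otimes> y = (u \<otimes> u') \<otimes> (v \<otimes> v')" using uv' \<open>u \<in> ?P\<close> \<open>v \<in> K\<close> \<open>x = u \<otimes> v\<close> Kc Pc by (simp add: m_ac)
    then have "g (x \<otimes> y) = (u \<otimes> u') \<otimes> (v \<otimes> v') [^] p"
      using g[of "u \<otimes> u'" "v \<otimes> v'"] uv' \<open>u \<in> ?P\<close> \<open>v \<in> K\<close> sub_mult[OF sP] sub_mult[OF sK] by simp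
    then show "g (x \<otimes> y) = g x \<otimes> g y"
      using g[of u v] g[of u' v'] uv' \<open>u \<in> ?P\<close> \<open>v \<in> K\<close> \<open>x = u \<otimes> v\<close> Kc Pc by (simp add: int_pow_distrib m_ac)
  qed
  have inj: "inj_on g (carrier G)"
  proof (rule inj_onI)
    fix x y assume xy: "x \<in> carrier G" "y \<in> carrier G" "g x = g y"
    have "g (x \<otimes> inv y) = \<one>" using xy hom_in_carrier[OF gh] by (simp add: hom_mult[OF gh] hom_inv'[OF gh])
    moreover have zc: "x \<otimes> inv y \<in> carrier G" using xy by simp
    obtain u v where uv: "u \<in> ?P" "v \<in> K" "x \<otimes> inv y = u \<otimes> v" by (rule splitting_decompose[OF s zc])
    ultimately have e: "u \<otimes> v [^] p = \<one>" using g by simp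
    have c: "u \<in> carrier G" "v \<in> carrier G" using uv Kc Pc by auto
    have "v [^] p = inv u" using e c by (metis inv_equality int_pow_closed m_comm)
    then have "v [^] p \<in> ?P" using sub_inv[OF sP uv(1)] by simp
    then have vp: "v [^] p = \<one>" using PK sub_pow[OF sK uv(2)] by blast
    then have "v = \<one>" using splitting_no_torsion[OF s uv(2)] by blast
    moreover have "u = \<one>" using e vp c by simp
    ultimately have "x \<otimes> inv y = \<one>" using uv(3) by simp
    then show "x = y" using xy by (metis inv_closed inv_equality inv_inv)
  qed
  have surj: "g ` carrier G = carrier G"
  proof
    show "g ` carrier G \<subseteq> carrier G" using hom_in_carrier[OF gh] by blast
    show "carrier G \<subseteq> g ` carrier G"
    proof
      fix y assume y: "y \<in> carrier G"
      obtain u v where uv: "u \<in> ?P" "v \<in> K" "y = u \<otimes> v" by (rule splitting_decompose[OF s y])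
      obtain w where w: "w \<in> K" "v = w [^] p" using div uv by (auto simp: p_divisible_def)
      have "g (u \<otimes> w) = y" using g[OF uv(1) w(1)] uv w by simp
      moreover have "u \<otimes> w \<in> carrier G" using uv w Kc Pc by simp
      ultimately show "y \<in> g ` carrier G" by blast
    qed
  qed
  have gauto: "g \<in> auto G"
    using gh inj surj by (simp add: auto_def Bij_def bij_betw_def g_def extensional_def)
  have "g x = x" if "x \<in> ?P" for x using g[OF that sub_one[OF sK]] Pc[OF that] by simp
  moreover have "g x = x [^] p" if "x \<in> K" for x using g[OF sub_one[OF sP] that] Kc[OF that] by simp
  moreover have "g \<in> iso G G" using gh inj surj by (simp add: iso_def bij_betw_def)
  ultimately show ?thesis using that gauto by (simp add: scaling_def)
qed

text \<open>The scaling maps the sum of \<open>H \<inter> primary G p\<close> and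
  \<open>H \<inter> K\<close> into \<open>H\<close>, and this sum has only finitely many cosets in
  \<open>H\<close>.\<close>

lemma scaling_inertial:
  assumes s: "splitting G p K" and g: "scaling G p K g" shows "inertial_map G g"
  unfolding inertial_map_def
proof (intro conjI allI impI)
  show gi: "g \<in> iso G G" using g by (simp add: scaling_def)
  note gh = iso_hom[OF gi]
  fix H assume H: "subgroup H G"
  let ?H0 = "(H \<inter> primary G p) <#> (H \<inter> K)"
  have sK: "subgroup K G" using s by (simp add: splitting_def)
  have H0: "?H0 \<subseteq> H" unfolding set_mult_def using sub_mult[OF H] by blast
  then have H0c: "?H0 \<subseteq> carrier G" using sub_carr[OF H] by blast
  have "almost_le G H ?H0" using s H by (simp add: splitting_def)
  then have "almost_le G (g ` H) (g ` ?H0)" by (rule almost_le_image[OF _ gh H0c])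
  moreover have "g ` ?H0 \<subseteq> H"
  proof
    fix y assume "y \<in> g ` ?H0"
    then obtain u v where uv: "u \<in> H \<inter> primary G p" "v \<in> H \<inter> K" "y = g (u \<otimes> v)" unfolding set_mult_def by blast
    have "y = u \<otimes> v [^] p" using uv g sub_carr[OF H] hom_mult[OF gh] by (simp add: scaling_def)
    then show "y \<in> H" using uv sub_mult[OF H] sub_pow[OF H] by blast
  qed
  ultimately show "almost_le G (g ` H) H" using almost_le_mono by blast
qed

lemma scaling_action:
  assumes s: "splitting G p K" and g: "scaling G p K g" shows "rational_action G g p 1"
  unfolding rational_action_def
proof
  fix x assume x: "x \<in> carrier G"
  have p: "prime p" and sK: "subgroup K G" using s by (auto simp: splitting_def)
  note gh = iso_hom[of g]
  obtain u v where uv: "u \<in> primary G p" "v \<in> K" "x = u \<otimes> v" by (rule splitting_decompose[OF s x])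
  have c: "u \<in> carrier G" "v \<in> carrier G" using uv sub_carr[OF sK] by (auto simp: primary_def)
  have gx: "g x = u \<otimes> v [^] p" using g uv c hom_mult[OF gh, of u v] by (simp add: scaling_def)
  have "g x [^] (1::int) \<otimes> inv (x [^] p) = (u \<otimes> v [^] p) \<otimes> inv (x [^] p)" using gx c by simp
  also have "\<dots> = (u \<otimes> v [^] p) \<otimes> inv (u [^] p \<otimes> v [^] p)"
    unfolding uv(3) using c by (simp add: int_pow_distrib)
  also have "\<dots> = u \<otimes> inv (u [^] p)" using c by (simp add: inv_mult_group m_assoc)
  finally have "g x [^] (1::int) \<otimes> inv (x [^] p) \<in> primary G p"
    using uv(1) by (simp add: sub_mult[OF primary_subgroup] sub_inv[OF primary_subgroup] sub_pow[OF primary_subgroup])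
  then show "g x [^] (1::int) \<otimes> inv (x [^] p) \<in> torsion_subgroup G" using primary_torsion[OF p] by blast
qed

text \<open>Here \<open>k\<close> is \<open>b\<close> divided by the scaling. On the
  \<open>p\<close>-component the two agree. For \<open>h\<close> in \<open>H \<inter> K\<close> both
  \<open>n (k h)\<close> and \<open>p (k h)\<close> lie in \<open>H \<inter> K\<close> up to
  finitely many summands: the former because \<open>n (b h)\<close> is \<open>m h\<close> plus
  torsion and \<open>p\<close> divides \<open>m\<close>, the latter because it is
  \<open>b h\<close>. As \<open>n\<close> is prime to \<open>p\<close>, the same follows for
  \<open>k h\<close>.\<close>

lemma divide_scaling_inertial:
  assumes s: "splitting G p K" and g: "scaling G p K g"
    and b: "inertial_map G b" "rational_action G b m n" "coprime m n" "p dvd m"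
    and k: "k \<in> iso G G" "\<forall>x\<in>carrier G. g (k x) = b x"
  shows "inertial_map G k"
  unfolding inertial_map_def
proof (intro conjI allI impI)
  let ?T = "torsion_subgroup G" and ?P = "primary G p"
  show "k \<in> iso G G" by (rule k(1))
  fix H assume H: "subgroup H G"
  note kh = iso_hom[OF k(1)] and bh = inertial_hom[OF b(1)]
  note kc = hom_in_carrier[OF kh] and bc = hom_in_carrier[OF bh]
  have p: "prime p" and sK: "subgroup K G" and div: "p_divisible G p K" using s by (auto simp: splitting_def)
  have gP: "\<forall>x\<in>?P. g x = x" and gK: "\<forall>x\<in>K. g x = x [^] p" using g by (auto simp: scaling_def)
  note Hc = sub_carr[OF H] and Kc = sub_carr[OF sK]
  have np: "\<not> p dvd n" using b(3,4) p by (meson coprime_common_divisor not_prime_unit)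
  have "k ` (H \<inter> ?P) \<subseteq> b ` H"
  proof
    fix y assume "y \<in> k ` (H \<inter> ?P)"
    then obtain x where x: "x \<in> H" "x \<in> ?P" "y = k x" by blast
    have "k x \<in> ?P" using hom_primary[OF kh] x by blast
    then have "k x = b x" using gP k(2) Hc[OF x(1)] by metis
    then show "y \<in> b ` H" using x by blast
  qed
  then have al1: "almost_le G (k ` (H \<inter> ?P)) H" using inertial_almost_le[OF b(1) H] almost_le_mono by blast
  define H1 where "H1 = H \<inter> K"
  have sH1: "subgroup H1 G" unfolding H1_def by (rule subgroup_Int[OF H sK])
  note H1c = sub_carr[OF sH1]
  define L where "L = b ` H1 <#> H1"
  have sL: "subgroup L G" unfolding L_def by (rule mult_subgroups[OF hom_image_subgroup[OF bh sH1] sH1])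
  have Lc: "L \<subseteq> carrier G" using sub_carr[OF sL] by blast
  have bK: "b x \<in> K" if "x \<in> K" for x using splitting_invariant[OF s inertial_iso[OF b(1)]] that by blast
  have kK: "k x \<in> K" if "x \<in> K" for x using splitting_invariant[OF s k(1)] that by blast
  have LK: "L \<subseteq> K" unfolding L_def set_mult_def H1_def using bK sub_mult[OF sK] by blast
  have "almost_le G H1 H1" using H1c by (intro almost_le_refl) auto
  then have alL: "almost_le G L H1" unfolding L_def using almost_le_mult[OF inertial_almost_le[OF b(1) sH1] _ sH1] by blast
  have alT: "almost_le G (L \<inter> ?T) (H1 \<inter> ?T)" by (rule almost_le_restrict[OF alL sH1 Lc torsion_subgroup])
  have LTc: "L \<inter> ?T \<subseteq> carrier G" using Lc by blast
  obtain S where S: "finite S" "S \<subseteq> L \<inter> ?T" "\<forall>x\<in>L \<inter> ?T. \<exists>h\<in>H1 \<inter> ?T. \<exists>s\<in>S. x = h \<otimes> s"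
    using almost_leD'[OF alT subgroup_Int[OF sH1 torsion_subgroup] LTc] by blast
  obtain S' where S': "finite S'" "S' \<subseteq> L" "\<forall>x\<in>L. \<exists>h\<in>H1. \<exists>s\<in>S'. x = h \<otimes> s"
    using almost_leD'[OF alL sH1 Lc] by blast
  have "\<forall>s\<in>S. \<exists>y. y \<in> K \<and> s = y [^] p" using S(2) LK div unfolding p_divisible_def by blast
  then obtain \<sigma> where \<sigma>: "\<forall>s\<in>S. \<sigma> s \<in> K \<and> s = \<sigma> s [^] p" by metis
  obtain u v where uv: "u * n + v * p = 1"
    using bezout_int[of n p] prime_not_dvd_coprime[OF p np, of 1] by auto
  obtain m' where m': "m = p * m'" using b(4) by blast
  define S1 where "S1 = (\<lambda>(s, s'). \<sigma> s [^] u \<otimes> s' [^] v) ` (S \<times> S')"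
  have al2: "almost_le G (k ` H1) H1"
  proof (rule almost_leI)
    show "finite S1" using S(1) S'(1) by (simp add: S1_def)
    show "S1 \<subseteq> carrier G"
    proof
      fix x assume "x \<in> S1"
      then obtain s s' where "s \<in> S" "s' \<in> S'" "x = \<sigma> s [^] u \<otimes> s' [^] v" by (auto simp: S1_def)
      moreover have "\<sigma> s \<in> carrier G" "s' \<in> carrier G" using calculation \<sigma> Kc S'(2) Lc by blast+
      ultimately show "x \<in> carrier G" by simp
    qed
    fix y assume "y \<in> k ` H1"
    then obtain h where h: "h \<in> H1" "y = k h" by blast
    have hc: "h \<in> carrier G" "b h \<in> carrier G" "y \<in> carrier G" using H1c[OF h(1)] bc kc h by auto
    have hK: "h \<in> K" using h by (simp add: H1_def)
    have yK: "y \<in> K" using kK[OF hK] h by simp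
    have yp: "y [^] p = b h" using gK yK k(2) hc(1) h(2) by metis
    have "b h = b h \<otimes> \<one>" using hc by simp
    then have bL: "b h \<in> L" unfolding L_def set_mult_def using h(1) sub_one[OF sH1] by blast
    have hL: "h \<in> L"
    proof -
      have "h = b \<one> \<otimes> h" using hom_one'[OF bh] hc by simp
      then show ?thesis unfolding L_def set_mult_def using h(1) sub_one[OF sH1] by blast
    qed
    let ?t = "b h [^] n \<otimes> inv (h [^] m)"
    have "?t \<in> L" using bL hL by (simp add: sub_mult[OF sL] sub_inv[OF sL] sub_pow[OF sL])
    moreover have "?t \<in> ?T" using b(2) hc(1) by (simp add: rational_action_def)
    ultimately obtain t1 s where t1: "t1 \<in> H1 \<inter> ?T" "s \<in> S" "?t = t1 \<otimes> s" using S(3) by blast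
    have t1c: "t1 \<in> carrier G" "t1 \<in> H1" "t1 \<in> K" using t1 H1c by (auto simp: H1_def)
    \<comment> \<open>\<open>K\<close> has no elements of order \<open>p\<close>, so the order of
      \<open>t1\<close> is effectively prime to \<open>p\<close>, and a \<open>p\<close>-th part of
      \<open>t1\<close> is found among its multiples and thus in \<open>H1\<close>.\<close>
    obtain t2 where t2: "t2 \<in> H1" "t1 = t2 [^] p"
    proof -
      obtain N :: int where N: "N > 0" "t1 [^] N = \<one>" using t1 torsion_iff by blast
      obtain a e where ae: "N = p ^ a * e" "\<not> p dvd e" using prime_decompose[OF p, of N] N by auto
      have "(t1 [^] e) [^] (p ^ a) = \<one>" using N ae t1c by (simp add: int_pow_pow mult.commute)
      then have "t1 [^] e \<in> ?P" using t1c by (auto simp: primary_def)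
      moreover have "t1 [^] e \<in> K" using sub_pow[OF sK t1c(3)] .
      ultimately have te: "t1 [^] e = \<one>" using s by (auto simp: splitting_def)
      obtain c d where cd: "c * e + d * p = 1"
        using bezout_int[of e p] prime_not_dvd_coprime[OF p ae(2), of 1] by auto
      have "t1 [^] (c * e + d * p) = (t1 [^] e) [^] c \<otimes> (t1 [^] d) [^] p"
        using t1c(1) by (simp add: int_pow_mult int_pow_pow mult.commute)
      then have "t1 = (t1 [^] d) [^] p" using te cd t1c by simp
      then show ?thesis using that sub_pow[OF sH1 t1c(2)] by blast
    qed
    have c: "t2 \<in> carrier G" "\<sigma> s \<in> carrier G" "\<sigma> s \<in> K" "s = \<sigma> s [^] p" "t2 \<in> K"
      using t2 H1c \<sigma> t1(2) Kc by (auto simp: H1_def)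
    have "b h [^] n = ?t \<otimes> h [^] m" using hc by simp
    also have "\<dots> = (t2 [^] p \<otimes> \<sigma> s [^] p) \<otimes> h [^] m" unfolding t1(3) using t2(2) c(4) by simp
    also have "\<dots> = (t2 \<otimes> \<sigma> s \<otimes> h [^] m') [^] p"
      unfolding m' using c hc by (simp add: int_pow_distrib int_pow_pow mult.commute)
    finally have bn: "b h [^] n = (t2 \<otimes> \<sigma> s \<otimes> h [^] m') [^] p" .
    let ?w = "t2 \<otimes> \<sigma> s \<otimes> h [^] m'"
    have wK: "?w \<in> K" using c hK by (simp add: sub_mult[OF sK] sub_pow[OF sK])
    have "(y [^] n) [^] p = b h [^] n" unfolding yp[symmetric] using hc by (simp add: int_pow_pow mult.commute)
    \<comment> \<open>Cancelling the common factor \<open>p\<close> is allowed because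
      multiplication by \<open>p\<close> is injective on \<open>K\<close>.\<close>
    then have "(y [^] n \<otimes> inv ?w) [^] p = \<one>" using bn hc Kc[OF wK] by (simp add: int_pow_distrib int_pow_inv)
    moreover have "y [^] n \<otimes> inv ?w \<in> K" using yK wK by (simp add: sub_mult[OF sK] sub_inv[OF sK] sub_pow[OF sK])
    ultimately have "y [^] n \<otimes> inv ?w = \<one>" using splitting_no_torsion[OF s] by blast
    then have yn: "y [^] n = ?w" using hc Kc[OF wK] by (metis int_pow_closed inv_closed inv_equality inv_inv)
    obtain h1 s' where hs': "h1 \<in> H1" "s' \<in> S'" "b h = h1 \<otimes> s'" using S'(3) bL by blast
    have c': "h1 \<in> carrier G" "s' \<in> carrier G" using H1c hs' S'(2) Lc by blast+
    \<comment> \<open>Bezout combines the two multiples of \<open>y\<close>; the parts outside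
      \<open>H1\<close> are built from \<open>\<sigma> s\<close> and \<open>s'\<close>, of which
      there are finitely many.\<close>
    have "y = y [^] (u * n + v * p)" using uv hc by simp
    also have "\<dots> = (y [^] n) [^] u \<otimes> (y [^] p) [^] v" using hc by (simp add: int_pow_mult int_pow_pow mult.commute)
    also have "\<dots> = (t2 [^] u \<otimes> (h [^] m') [^] u \<otimes> h1 [^] v) \<otimes> (\<sigma> s [^] u \<otimes> s' [^] v)"
      unfolding yn yp hs'(3) using c c' hc by (simp add: int_pow_distrib m_ac)
    finally have "y = (t2 [^] u \<otimes> (h [^] m') [^] u \<otimes> h1 [^] v) \<otimes> (\<sigma> s [^] u \<otimes> s' [^] v)" .
    moreover have "t2 [^] u \<otimes> (h [^] m') [^] u \<otimes> h1 [^] v \<in> H1"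
      using t2(1) h(1) hs'(1) by (simp add: sub_mult[OF sH1] sub_pow[OF sH1])
    moreover have "\<sigma> s [^] u \<otimes> s' [^] v \<in> S1" using t1(2) hs'(2) by (auto simp: S1_def)
    ultimately show "\<exists>h\<in>H1. \<exists>s\<in>S1. y = h \<otimes> s" by blast
  qed
  have "H1 \<subseteq> H" by (simp add: H1_def)
  then have "almost_le G (k ` H1) H" using al2 almost_le_mono by blast
  then have "almost_le G (k ` (H \<inter> ?P) <#> k ` H1) H" using almost_le_mult[OF al1 _ H] by blast
  moreover have "k ` ((H \<inter> ?P) <#> H1) \<subseteq> k ` (H \<inter> ?P) <#> k ` H1"
  proof
    fix y assume "y \<in> k ` ((H \<inter> ?P) <#> H1)"
    then obtain c d where cd: "c \<in> H \<inter> ?P" "d \<in> H1" "y = k (c \<otimes> d)" unfolding set_mult_def by blast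
    have "y = k c \<otimes> k d" unfolding cd(3) using cd Hc H1c by (intro hom_mult[OF kh]) auto
    then show "y \<in> k ` (H \<inter> ?P) <#> k ` H1" unfolding set_mult_def using cd by blast
  qed
  ultimately have a3: "almost_le G (k ` ((H \<inter> ?P) <#> H1)) H" using almost_le_mono by blast
  have "(H \<inter> ?P) <#> H1 \<subseteq> carrier G" unfolding set_mult_def using Hc H1c by auto
  moreover have "almost_le G H ((H \<inter> ?P) <#> H1)" using s H by (simp add: splitting_def H1_def)
  ultimately have "almost_le G (k ` H) (k ` ((H \<inter> ?P) <#> H1))" using almost_le_image[OF _ kh] by blast
  then show "almost_le G (k ` H) H" using almost_le_trans[OF _ a3] Hc by blast
qed

lemma rational_action_comp:
  assumes g: "g \<in> hom G G" "rational_action G g m n" and h: "h \<in> hom G G" "rational_action G h m' n'"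
  shows "rational_action G (g \<circ> h) (m * m') (n * n')"
  unfolding rational_action_def
proof
  fix x assume x: "x \<in> carrier G"
  note gc = hom_in_carrier[OF g(1)] and hc = hom_in_carrier[OF h(1)]
  let ?T = "torsion_subgroup G"
  let ?a = "g (h x) [^] n \<otimes> inv (h x [^] m)" and ?b = "h x [^] n' \<otimes> inv (x [^] m')"
  have a: "?a \<in> ?T" using g(2) hc[OF x] by (simp add: rational_action_def)
  have b: "?b \<in> ?T" using h(2) x by (simp add: rational_action_def)
  have "?a [^] n' \<otimes> ?b [^] m = g (h x) [^] (n * n') \<otimes> inv (h x [^] (m * n')) \<otimes> (h x [^] (m * n') \<otimes> inv (x [^] (m * m')))"
    using x gc hc by (simp add: int_pow_distrib int_pow_inv int_pow_pow mult.commute)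
  also have "\<dots> = g (h x) [^] (n * n') \<otimes> inv (x [^] (m * m'))" using x gc hc by (simp add: m_assoc)
  finally have "g (h x) [^] (n * n') \<otimes> inv (x [^] (m * m')) \<in> ?T"
    using a b sub_mult[OF torsion_subgroup] sub_pow[OF torsion_subgroup] by metis
  then show "(g \<circ> h) x [^] (n * n') \<otimes> inv (x [^] (m * m')) \<in> ?T" by simp
qed

lemma rational_action_cancel:
  assumes "g \<in> hom G G" "rational_action G g (d * m) (d * n)" "d \<noteq> 0"
  shows "rational_action G g m n"
  unfolding rational_action_def
proof
  fix x assume x: "x \<in> carrier G"
  note gc = hom_in_carrier[OF assms(1)]
  let ?z = "g x [^] n \<otimes> inv (x [^] m)"
  have "?z [^] d = g x [^] (d * n) \<otimes> inv (x [^] (d * m))"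
    using x gc by (simp add: int_pow_distrib int_pow_pow int_pow_inv mult.commute)
  then have "?z [^] d \<in> torsion_subgroup G" using assms(2) x by (simp add: rational_action_def)
  then show "?z \<in> torsion_subgroup G" using torsion_root[of ?z d] assms(3) x gc by simp
qed

text \<open>Eliminating \<open>g a\<close> from the two relations leaves a torsion multiple of
  \<open>a\<close>, and \<open>a\<close> has infinite order.\<close>

lemma rational_action_unique:
  assumes a: "a \<in> carrier G" "a \<notin> torsion_subgroup G" and g: "g \<in> hom G G"
    and act: "rational_action G g m n" "rational_action G g m' n'"
  shows "m * n' = m' * n"
proof -
  let ?T = "torsion_subgroup G"
  have gc: "g a \<in> carrier G" using hom_in_carrier[OF g a(1)] .
  let ?y = "g a [^] n \<otimes> inv (a [^] m)" and ?z = "g a [^] n' \<otimes> inv (a [^] m')"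
  have "?y \<in> ?T" "?z \<in> ?T" using act a(1) by (auto simp: rational_action_def)
  then have "inv (?y [^] n') \<otimes> ?z [^] n \<in> ?T"
    by (simp add: sub_mult[OF torsion_subgroup] sub_inv[OF torsion_subgroup] sub_pow[OF torsion_subgroup])
  also have "inv (?y [^] n') \<otimes> ?z [^] n = a [^] (m * n' - m' * n)"
  proof -
    have "inv (?y [^] n') = a [^] (m * n') \<otimes> inv (g a [^] (n * n'))"
      using a gc by (simp add: int_pow_distrib int_pow_pow int_pow_inv inv_mult_group)
    moreover have "?z [^] n = g a [^] (n * n') \<otimes> inv (a [^] (m' * n))"
      using a gc by (simp add: int_pow_distrib int_pow_pow int_pow_inv mult.commute)
    ultimately show ?thesis using a gc by (simp add: int_pow_diff m_assoc)
  qed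
  finally have "a [^] (m * n' - m' * n) \<in> ?T" .
  then show ?thesis using torsion_root[OF a(1), of "m * n' - m' * n"] a(2) by auto
qed

end

section \<open>Groups of inertial automorphisms\<close>

lemma (in group) normal_inI:
  assumes "subgroup M G" "subgroup N G" "N \<subseteq> M" "\<And>x h. x \<in> M \<Longrightarrow> h \<in> N \<Longrightarrow> x \<otimes> h \<otimes> inv x \<in> N"
  shows "N \<lhd> G\<lparr>carrier := M\<rparr>"
proof -
  interpret M: group "G\<lparr>carrier := M\<rparr>" by (rule subgroup_imp_group[OF assms(1)])
  show ?thesis
    by (rule M.normal_invI[OF subgroup_incl[OF assms(2,1,3)]]) (use assms in simp)
qed

lemma (in group) subgroup_if_closed:
  assumes "N \<subseteq> carrier G" "\<one> \<in> N" "\<And>x y. x \<in> N \<Longrightarrow> y \<in> N \<Longrightarrow> x \<otimes> y \<in> N" "\<And>x. x \<in> N \<Longrightarrow> inv x \<in> N"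
  shows "subgroup N G"
  using assms by (intro subgroupI) auto

context comm_group
begin

abbreviation Aut :: "('a \<Rightarrow> 'a) monoid" where "Aut \<equiv> AutoGroup G"

lemma Aut_group: "group Aut" by (rule AutoGroup)

lemma Aut_carrier [simp]: "carrier Aut = auto G" by (simp add: AutoGroup_def)

lemma auto_iso: "f \<in> auto G \<Longrightarrow> f \<in> iso G G"
  by (auto simp: auto_def Bij_def iso_def)

lemma auto_hom: "f \<in> auto G \<Longrightarrow> f \<in> hom G G"
  by (auto simp: auto_def)

lemma auto_carr: "f \<in> auto G \<Longrightarrow> x \<in> carrier G \<Longrightarrow> f x \<in> carrier G"
  by (rule hom_in_carrier[OF auto_hom])

lemma auto_eqI:
  assumes "f \<in> auto G" "g \<in> auto G" "\<And>x. x \<in> carrier G \<Longrightarrow> f x = g x" shows "f = g"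
  using assms by (intro extensionalityI[of f "carrier G" g]) (auto simp: auto_def Bij_def)

lemma Aut_mult: "f \<in> auto G \<Longrightarrow> g \<in> auto G \<Longrightarrow> x \<in> carrier G \<Longrightarrow> (f \<otimes>\<^bsub>Aut\<^esub> g) x = f (g x)"
  by (simp add: AutoGroup_def BijGroup_def auto_def compose_def)

lemma Aut_one: "x \<in> carrier G \<Longrightarrow> \<one>\<^bsub>Aut\<^esub> x = x"
  by (simp add: AutoGroup_def BijGroup_def)

lemma Aut_mult_closed: "f \<in> auto G \<Longrightarrow> g \<in> auto G \<Longrightarrow> f \<otimes>\<^bsub>Aut\<^esub> g \<in> auto G"
  using monoid.m_closed[OF group.is_monoid[OF Aut_group]] by simp

lemma Aut_one_closed: "\<one>\<^bsub>Aut\<^esub> \<in> auto G"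
  using monoid.one_closed[OF group.is_monoid[OF Aut_group]] by simp

lemma Aut_inv_closed: "f \<in> auto G \<Longrightarrow> inv\<^bsub>Aut\<^esub> f \<in> auto G"
  using group.inv_closed[OF Aut_group] by simp

lemma Aut_inv_left:
  assumes "f \<in> auto G" "x \<in> carrier G" shows "(inv\<^bsub>Aut\<^esub> f) (f x) = x"
proof -
  have "(inv\<^bsub>Aut\<^esub> f \<otimes>\<^bsub>Aut\<^esub> f) = \<one>\<^bsub>Aut\<^esub>" using group.l_inv[OF Aut_group] assms by simp
  then have "(inv\<^bsub>Aut\<^esub> f \<otimes>\<^bsub>Aut\<^esub> f) x = x" using Aut_one[OF assms(2)] by simp
  then show ?thesis using Aut_mult[OF Aut_inv_closed[OF assms(1)] assms] by simp
qed

lemma Aut_inv_right: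
  assumes "f \<in> auto G" "x \<in> carrier G" shows "f ((inv\<^bsub>Aut\<^esub> f) x) = x"
proof -
  have "(f \<otimes>\<^bsub>Aut\<^esub> inv\<^bsub>Aut\<^esub> f) = \<one>\<^bsub>Aut\<^esub>" using group.r_inv[OF Aut_group] assms by simp
  then have "(f \<otimes>\<^bsub>Aut\<^esub> inv\<^bsub>Aut\<^esub> f) x = x" using Aut_one[OF assms(2)] by simp
  then show ?thesis using Aut_mult[OF assms(1) Aut_inv_closed[OF assms(1)] assms(2)] by simp
qed

text \<open>Adding \<open>H\<close> to its image does not change the set of cosets of
  \<open>H\<close> up to finiteness, so the quotient in the definition is finite exactly when the
  image meets finitely many cosets.\<close>

lemma inertial_automorphism_iff:
  "inertial_automorphism G f \<longleftrightarrow> f \<in> auto G \<and> inertial_map G f"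
proof -
  have "finite (carrier ((G\<lparr>carrier := H <#> (f ` H)\<rparr>) Mod H)) \<longleftrightarrow> almost_le G (f ` H) H"
    if f: "f \<in> auto G" and H: "subgroup H G" for H
  proof -
    note Hc = sub_carr[OF H]
    have fH: "subgroup (f ` H) G" by (rule hom_image_subgroup[OF auto_hom[OF f] H])
    have c: "H <#> (f ` H) \<subseteq> carrier G" using sub_carr[OF mult_subgroups[OF H fH]] by blast
    have r: "r_coset (G\<lparr>carrier := H <#> (f ` H)\<rparr>) H x = H #> x" for x by (simp add: r_coset_def)
    have "carrier ((G\<lparr>carrier := H <#> (f ` H)\<rparr>) Mod H) = (\<lambda>x. H #> x) ` (H <#> (f ` H))"
      by (simp add: carrier_FactGroup r)
    then have "finite (carrier ((G\<lparr>carrier := H <#> (f ` H)\<rparr>) Mod H)) \<longleftrightarrow> almost_le G (H <#> (f ` H)) H"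
      using almost_le_iff_finite_cosets[OF H c] by simp
    also have "\<dots> \<longleftrightarrow> almost_le G (f ` H) H"
    proof
      assume a: "almost_le G (H <#> (f ` H)) H"
      have "f ` H \<subseteq> H <#> (f ` H)"
      proof
        fix y assume y: "y \<in> f ` H"
        then have "y = \<one> \<otimes> y" using sub_carr[OF fH] by simp
        then show "y \<in> H <#> (f ` H)" unfolding set_mult_def using y sub_one[OF H] by blast
      qed
      then show "almost_le G (f ` H) H" using a almost_le_mono by blast
    next
      assume a: "almost_le G (f ` H) H"
      have "almost_le G H H" using Hc by (intro almost_le_refl) auto
      then show "almost_le G (H <#> (f ` H)) H" using almost_le_mult[OF _ a H] by blast
    qed
    finally show ?thesis .
  qed
  then show ?thesis using auto_iso by (auto simp: inertial_automorphism_def inertial_map_def)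
qed

lemma torsion_coset_eq_iff:
  assumes "x \<in> carrier G" "y \<in> carrier G"
  shows "torsion_subgroup G #> x = torsion_subgroup G #> y \<longleftrightarrow> x \<otimes> inv y \<in> torsion_subgroup G"
proof
  assume e: "torsion_subgroup G #> x = torsion_subgroup G #> y"
  have "x \<in> torsion_subgroup G #> y" using rcos_self[OF assms(1) torsion_subgroup] e by simp
  then obtain t where "t \<in> torsion_subgroup G" "x = t \<otimes> y" unfolding r_coset_def by blast
  then show "x \<otimes> inv y \<in> torsion_subgroup G" using assms torsion_carr by (simp add: m_assoc)
next
  assume t: "x \<otimes> inv y \<in> torsion_subgroup G"
  have "(x \<otimes> inv y) \<otimes> y = x" using assms by simp
  then have "x \<in> torsion_subgroup G #> y" using t unfolding r_coset_def by force
  then show "torsion_subgroup G #> x = torsion_subgroup G #> y"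
    using repr_independence[OF _ assms(2) torsion_subgroup] by simp
qed

definition unipotent :: "('a \<Rightarrow> 'a) \<Rightarrow> bool" where
  "unipotent f \<longleftrightarrow> (\<forall>x\<in>carrier G. f x \<otimes> inv x \<in> torsion_subgroup G)"

lemma unipotent_iff: "f \<in> hom G G \<Longrightarrow> unipotent f \<longleftrightarrow> rational_action G f 1 1"
  using hom_in_carrier[of f G G] by (auto simp: unipotent_def rational_action_def)

definition inertial_group :: "('a \<Rightarrow> 'a) set" where
  "inertial_group = generate Aut {f. inertial_automorphism G f}"

lemma IAut_eq: "IAut G = Aut\<lparr>carrier := inertial_group\<rparr>"
  by (simp add: IAut_def inertial_group_def)

lemma inertial_subset_Aut: "{f. inertial_automorphism G f} \<subseteq> carrier Aut"
  by (auto simp: inertial_automorphism_iff)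

lemma inertial_group_subgroup: "subgroup inertial_group Aut"
  unfolding inertial_group_def by (rule group.generate_is_subgroup[OF Aut_group inertial_subset_Aut])

lemma inertial_group_auto: "f \<in> inertial_group \<Longrightarrow> f \<in> auto G"
  using subgroup.mem_carrier[OF inertial_group_subgroup] by simp

lemma inertial_in_group: "f \<in> auto G \<Longrightarrow> inertial_map G f \<Longrightarrow> f \<in> inertial_group"
  unfolding inertial_group_def by (rule generate.incl) (simp add: inertial_automorphism_iff)

lemma IAut1_iff: "f \<in> IAut1 G \<longleftrightarrow> f \<in> auto G \<and> inertial_map G f \<and> unipotent f"
proof -
  have "(\<forall>a\<in>carrier G. torsion_subgroup G #> f a = torsion_subgroup G #> a) \<longleftrightarrow> unipotent f" if "f \<in> auto G"
    unfolding unipotent_def using torsion_coset_eq_iff auto_carr[OF that] by blast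
  then show ?thesis using inertial_in_group by (auto simp: IAut1_def IAut_eq inertial_automorphism_iff)
qed

lemma unipotent_mult:
  assumes "f \<in> auto G" "g \<in> auto G" "unipotent f" "unipotent g" shows "unipotent (f \<otimes>\<^bsub>Aut\<^esub> g)"
  unfolding unipotent_def
proof
  fix x assume x: "x \<in> carrier G"
  have c: "g x \<in> carrier G" "f (g x) \<in> carrier G" using x assms auto_carr by auto
  have "f (g x) \<otimes> inv (g x) \<in> torsion_subgroup G" "g x \<otimes> inv x \<in> torsion_subgroup G"
    using assms x c by (auto simp: unipotent_def)
  then have "(f (g x) \<otimes> inv (g x)) \<otimes> (g x \<otimes> inv x) \<in> torsion_subgroup G"
    by (rule sub_mult[OF torsion_subgroup])
  also have "(f (g x) \<otimes> inv (g x)) \<otimes> (g x \<otimes> inv x) = f (g x) \<otimes> inv x" using x c by (simp add: m_assoc)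
  finally show "(f \<otimes>\<^bsub>Aut\<^esub> g) x \<otimes> inv x \<in> torsion_subgroup G" using Aut_mult[OF assms(1,2) x] by simp
qed

lemma unipotent_inv:
  assumes "f \<in> auto G" "unipotent f" shows "unipotent (inv\<^bsub>Aut\<^esub> f)"
  unfolding unipotent_def
proof
  fix x assume x: "x \<in> carrier G"
  define y where "y = (inv\<^bsub>Aut\<^esub> f) x"
  have y: "y \<in> carrier G" "f y = x" using auto_carr[OF Aut_inv_closed[OF assms(1)] x] Aut_inv_right[OF assms(1) x]
    by (simp_all add: y_def)
  have "inv (f y \<otimes> inv y) \<in> torsion_subgroup G"
    using assms(2) y(1) by (intro sub_inv[OF torsion_subgroup]) (auto simp: unipotent_def)
  also have "inv (f y \<otimes> inv y) = y \<otimes> inv x" using x y by (simp add: inv_mult_group)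
  finally show "(inv\<^bsub>Aut\<^esub> f) x \<otimes> inv x \<in> torsion_subgroup G" by (simp add: y_def)
qed

lemma inertial_mult:
  assumes "f \<in> auto G" "g \<in> auto G" "inertial_map G f" "inertial_map G g" shows "inertial_map G (f \<otimes>\<^bsub>Aut\<^esub> g)"
proof -
  have i: "inertial_map G (f \<circ> g)" using inertial_comp assms by blast
  have e: "(f \<otimes>\<^bsub>Aut\<^esub> g) ` H = (f \<circ> g) ` H" if "subgroup H G" for H
    using Aut_mult[OF assms(1,2)] sub_carr[OF that] by (auto simp: image_iff)
  show ?thesis
    unfolding inertial_map_def
  proof (intro conjI allI impI)
    show "f \<otimes>\<^bsub>Aut\<^esub> g \<in> iso G G" by (rule auto_iso[OF Aut_mult_closed[OF assms(1,2)]])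
    show "almost_le G ((f \<otimes>\<^bsub>Aut\<^esub> g) ` H) H" if "subgroup H G" for H
      using inertial_almost_le[OF i that] e[OF that] by simp
  qed
qed

text \<open>Closure under inverses is the substantial part. It rests on
  \<open>inertial_inverse\<close>, which needs triviality modulo torsion.\<close>

lemma IAut1_subgroup: "subgroup (IAut1 G) Aut"
proof (rule group.subgroup_if_closed[OF Aut_group])
  show "IAut1 G \<subseteq> carrier Aut" by (auto simp: IAut1_iff)
  have one: "\<one>\<^bsub>Aut\<^esub> ` H = H" if "subgroup H G" for H
    using Aut_one sub_carr[OF that] by (auto simp: image_iff)
  have "almost_le G H H" if "subgroup H G" for H
    using sub_carr[OF that] by (intro almost_le_refl) auto
  then have "inertial_map G \<one>\<^bsub>Aut\<^esub>"
    using auto_iso[OF Aut_one_closed] one by (simp add: inertial_map_def)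
  moreover have "unipotent \<one>\<^bsub>Aut\<^esub>" using Aut_one sub_one[OF torsion_subgroup] by (simp add: unipotent_def)
  ultimately show "\<one>\<^bsub>Aut\<^esub> \<in> IAut1 G" using Aut_one_closed by (simp add: IAut1_iff)
  show "f \<otimes>\<^bsub>Aut\<^esub> g \<in> IAut1 G" if "f \<in> IAut1 G" "g \<in> IAut1 G" for f g
    using that inertial_mult unipotent_mult Aut_mult_closed by (simp add: IAut1_iff)
  show "inv\<^bsub>Aut\<^esub> f \<in> IAut1 G" if f: "f \<in> IAut1 G" for f
  proof -
    have fa: "f \<in> auto G" "inertial_map G f" "unipotent f" using f by (auto simp: IAut1_iff)
    have "inertial_map G (inv\<^bsub>Aut\<^esub> f)"
      by (rule inertial_inverse[OF fa(2)]) (use fa Aut_inv_left auto_iso[OF Aut_inv_closed] in \<open>auto simp: unipotent_def\<close>)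
    then show ?thesis using fa unipotent_inv Aut_inv_closed by (simp add: IAut1_iff)
  qed
qed

section \<open>The group generated by inversion and the scalings\<close>

definition inversion :: "'a \<Rightarrow> 'a" where "inversion = (\<lambda>x\<in>carrier G. inv x)"

lemma inversion_auto: "inversion \<in> auto G"
proof -
  have "inversion \<in> hom G G" by (intro homI) (simp_all add: inversion_def inv_mult)
  moreover have "bij_betw inversion (carrier G) (carrier G)"
    by (rule bij_betw_byWitness[of _ inversion]) (auto simp: inversion_def)
  ultimately show ?thesis by (simp add: auto_def Bij_def inversion_def)
qed

lemma inversion_inertial: "inertial_map G inversion"
  unfolding inertial_map_def
proof (intro conjI allI impI)
  show "inversion \<in> iso G G" by (rule auto_iso[OF inversion_auto])
  fix H assume H: "subgroup H G"
  have "inversion ` H \<subseteq> H" using sub_inv[OF H] sub_carr[OF H] by (auto simp: inversion_def)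
  then show "almost_le G (inversion ` H) H" using sub_carr[OF H] by (intro almost_le_refl) auto
qed

lemma inversion_action: "rational_action G inversion (-1) 1"
  using sub_one[OF torsion_subgroup] by (auto simp: rational_action_def inversion_def int_pow_neg)

text \<open>Inversion supplies the sign of a rational number, the scalings its primes. For each
  prime there is at most one \<open>K\<close>, hence at most one scaling in
  \<open>auto G\<close>.\<close>

definition scaling_gens :: "('a \<Rightarrow> 'a) set" where
  "scaling_gens = {inversion} \<union> {g \<in> auto G. \<exists>p K. splitting G p K \<and> scaling G p K g}"

definition scaling_group :: "('a \<Rightarrow> 'a) set" where "scaling_group = generate Aut scaling_gens"

lemma scaling_gens_auto: "scaling_gens \<subseteq> carrier Aut"
  using inversion_auto by (auto simp: scaling_gens_def)

lemma scaling_group_subgroup: "subgroup scaling_group Aut"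
  unfolding scaling_group_def by (rule group.generate_is_subgroup[OF Aut_group scaling_gens_auto])

lemma scaling_group_auto: "f \<in> scaling_group \<Longrightarrow> f \<in> auto G"
  using subgroup.mem_carrier[OF scaling_group_subgroup] by simp

lemma scaling_group_le: "scaling_group \<subseteq> inertial_group"
  unfolding scaling_group_def
proof (rule group.generate_subgroup_incl[OF Aut_group _ inertial_group_subgroup])
  show "scaling_gens \<subseteq> inertial_group"
    using inversion_auto inversion_inertial scaling_inertial inertial_in_group by (auto simp: scaling_gens_def)
qed

text \<open>Every automorphism preserves both the \<open>p\<close>-component and its complement, and
  on each of them a scaling is multiplication by a fixed integer.\<close>

lemma scaling_gens_central:
  assumes q: "q \<in> scaling_gens" and a: "a \<in> auto G" shows "q \<otimes>\<^bsub>Aut\<^esub> a = a \<otimes>\<^bsub>Aut\<^esub> q"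
proof -
  have qa: "q \<in> auto G" using q scaling_gens_auto by auto
  have "q (a x) = a (q x)" if x: "x \<in> carrier G" for x
  proof (cases "q = inversion")
    case True
    then show ?thesis using x auto_carr[OF a x] hom_inv'[OF auto_hom[OF a]] by (simp add: inversion_def)
  next
    case False
    then obtain p K where pK: "splitting G p K" "scaling G p K q" using q by (auto simp: scaling_gens_def)
    note qP = pK(2)[unfolded scaling_def, THEN conjunct2, THEN conjunct1]
      and qK = pK(2)[unfolded scaling_def, THEN conjunct2, THEN conjunct2]
    have sK: "subgroup K G" using pK(1) by (simp add: splitting_def)
    obtain u v where uv: "u \<in> primary G p" "v \<in> K" "x = u \<otimes> v" using splitting_decompose[OF pK(1) x] by blast
    have c: "u \<in> carrier G" "v \<in> carrier G" using uv sub_carr[OF sK] by (auto simp: primary_def)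
    have au: "a u \<in> primary G p" using hom_primary[OF auto_hom[OF a]] uv by blast
    have av: "a v \<in> K" using splitting_invariant[OF pK(1) auto_iso[OF a]] uv by blast
    have "q (a x) = q (a u) \<otimes> q (a v)"
      unfolding uv(3) using c auto_carr[OF a] by (simp add: hom_mult[OF auto_hom[OF a]] hom_mult[OF auto_hom[OF qa]])
    also have "\<dots> = a u \<otimes> a v [^] p" using qP qK au av by simp
    also have "\<dots> = a (q u \<otimes> q v)"
      using qP qK uv c by (simp add: hom_mult[OF auto_hom[OF a]] hom_pow[OF auto_hom[OF a]])
    also have "\<dots> = a (q x)" unfolding uv(3) using c by (simp add: hom_mult[OF auto_hom[OF qa]])
    finally show ?thesis .
  qed
  then show ?thesis
    by (intro auto_eqI Aut_mult_closed qa a) (simp add: Aut_mult[OF qa a] Aut_mult[OF a qa])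
qed

lemma scaling_group_central:
  assumes "q \<in> scaling_group" and a: "a \<in> auto G" shows "q \<otimes>\<^bsub>Aut\<^esub> a = a \<otimes>\<^bsub>Aut\<^esub> q"
proof -
  interpret A: group Aut by (rule Aut_group)
  have "q \<otimes>\<^bsub>Aut\<^esub> a = a \<otimes>\<^bsub>Aut\<^esub> q" using assms(1) unfolding scaling_group_def
  proof (induction rule: generate.induct)
    case one
    then show ?case using a by simp
  next
    case (incl h)
    then show ?case by (rule scaling_gens_central[OF _ a])
  next
    case (inv h)
    have hc: "h \<in> carrier Aut" "a \<in> carrier Aut" using inv scaling_gens_auto a by auto
    have "inv\<^bsub>Aut\<^esub> h \<otimes>\<^bsub>Aut\<^esub> a = inv\<^bsub>Aut\<^esub> h \<otimes>\<^bsub>Aut\<^esub> (a \<otimes>\<^bsub>Aut\<^esub> h) \<otimes>\<^bsub>Aut\<^esub> inv\<^bsub>Aut\<^esub> h"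
      using hc by (simp add: A.m_assoc del: Aut_carrier)
    also have "\<dots> = inv\<^bsub>Aut\<^esub> h \<otimes>\<^bsub>Aut\<^esub> (h \<otimes>\<^bsub>Aut\<^esub> a) \<otimes>\<^bsub>Aut\<^esub> inv\<^bsub>Aut\<^esub> h"
      using scaling_gens_central[OF inv a] by simp
    also have "\<dots> = a \<otimes>\<^bsub>Aut\<^esub> inv\<^bsub>Aut\<^esub> h" using hc by (simp add: A.m_assoc[symmetric] del: Aut_carrier)
    finally show ?case .
  next
    case (eng h1 h2)
    have hc: "h1 \<in> carrier Aut" "h2 \<in> carrier Aut" "a \<in> carrier Aut"
      using eng scaling_group_auto a by (auto simp: scaling_group_def)
    have "h1 \<otimes>\<^bsub>Aut\<^esub> h2 \<otimes>\<^bsub>Aut\<^esub> a = h1 \<otimes>\<^bsub>Aut\<^esub> (a \<otimes>\<^bsub>Aut\<^esub> h2)" using hc eng by (simp add: A.m_assoc del: Aut_carrier)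
    also have "\<dots> = (a \<otimes>\<^bsub>Aut\<^esub> h1) \<otimes>\<^bsub>Aut\<^esub> h2" using hc eng by (simp add: A.m_assoc[symmetric] del: Aut_carrier)
    finally show ?case using hc by (simp add: A.m_assoc del: Aut_carrier)
  qed
  then show ?thesis .
qed

text \<open>Meaningful only for primes that admit a splitting; for these
  \<open>complement_eq\<close> shows that the choice is forced.\<close>

definition complement :: "int \<Rightarrow> 'a set" where "complement p = (SOME K. splitting G p K)"

lemma complement_eq: assumes "splitting G p K" shows "complement p = K"
proof -
  have s: "splitting G p (complement p)" unfolding complement_def using assms by (rule someI)
  have "complement p \<subseteq> K" using splitting_maximal[OF assms, of "complement p"] s by (simp add: splitting_def)
  moreover have "K \<subseteq> complement p" using splitting_maximal[OF s, of K] assms by (simp add: splitting_def)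
  ultimately show ?thesis by blast
qed

text \<open>The carrier is built in so that the empty set of primes yields the whole group.\<close>

definition complement_Inter :: "int set \<Rightarrow> 'a set" where "complement_Inter \<P> = {x \<in> carrier G. \<forall>p\<in>\<P>. x \<in> complement p}"

text \<open>An element of \<open>scaling_group\<close> acts on each component \<open>primary G p\<close> as the rational number \<open>m / n\<close>
  with its powers of \<open>p\<close> removed.\<close>

definition canonical :: "('a \<Rightarrow> 'a) \<Rightarrow> int \<Rightarrow> int \<Rightarrow> bool" where
  "canonical g m n \<longleftrightarrow> m \<noteq> 0 \<and> n \<noteq> 0 \<and> (\<exists>\<P>. finite \<P> \<and> (\<forall>p\<in>\<P>. splitting G p (complement p)) \<and>
     (\<forall>p. prime p \<longrightarrow> p dvd m * n \<longrightarrow> p \<in> \<P>) \<and> (\<forall>x\<in>complement_Inter \<P>. g x [^] n = x [^] m)) \<and>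
     (\<forall>p. prime p \<longrightarrow> (\<exists>(k::nat) (l::nat) m' n'. \<not> p dvd m' \<and> \<not> p dvd n' \<and> p ^ k * m' * n = p ^ l * n' * m \<and>
       (\<forall>x\<in>primary G p. g x [^] n' = x [^] m')))"

section \<open>Canonical form of the elements of the scaling group\<close>

lemma complement_Inter_subgroup: "\<forall>p\<in>\<P>. splitting G p (complement p) \<Longrightarrow> subgroup (complement_Inter \<P>) G"
proof (rule subgroupI')
  assume P: "\<forall>p\<in>\<P>. splitting G p (complement p)"
  then have sub: "subgroup (complement p) G" if "p \<in> \<P>" for p using that by (simp add: splitting_def)
  show "complement_Inter \<P> \<subseteq> carrier G" by (auto simp: complement_Inter_def)
  show "\<one> \<in> complement_Inter \<P>" using sub_one[OF sub] by (simp add: complement_Inter_def)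
  fix x y assume "x \<in> complement_Inter \<P>" "y \<in> complement_Inter \<P>"
  then show "x \<otimes> inv y \<in> complement_Inter \<P>" using sub_mult[OF sub] sub_inv[OF sub] by (simp add: complement_Inter_def)
qed

lemma complement_Inter_invariant:
  assumes "\<forall>p\<in>\<P>. splitting G p (complement p)" "f \<in> auto G" "x \<in> complement_Inter \<P>" shows "f x \<in> complement_Inter \<P>"
proof -
  have "f x \<in> complement p" if "p \<in> \<P>" for p
  proof -
    have "f ` complement p \<subseteq> complement p" using splitting_invariant[OF _ auto_iso[OF assms(2)]] assms(1) that by blast
    then show ?thesis using assms(3) that by (auto simp: complement_Inter_def)
  qed
  then show ?thesis using assms(3) auto_carr[OF assms(2)] by (simp add: complement_Inter_def)
qed

lemma canonical_mult:
  assumes f: "f \<in> auto G" "canonical f m n" and g: "g \<in> auto G" "canonical g m' n'"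
  shows "canonical (f \<otimes>\<^bsub>Aut\<^esub> g) (m * m') (n * n')"
proof -
  note fh = auto_hom[OF f(1)] and gc = auto_carr[OF g(1)] and fc = auto_carr[OF f(1)]
  obtain \<P> where P: "finite \<P>" "\<forall>p\<in>\<P>. splitting G p (complement p)"
    "\<forall>p. prime p \<longrightarrow> p dvd m * n \<longrightarrow> p \<in> \<P>" "\<forall>x\<in>complement_Inter \<P>. f x [^] n = x [^] m"
    using f(2) unfolding canonical_def by blast
  obtain \<P>' where P': "finite \<P>'" "\<forall>p\<in>\<P>'. splitting G p (complement p)"
    "\<forall>p. prime p \<longrightarrow> p dvd m' * n' \<longrightarrow> p \<in> \<P>'" "\<forall>x\<in>complement_Inter \<P>'. g x [^] n' = x [^] m'"
    using g(2) unfolding canonical_def by blast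
  have comb: "(f \<otimes>\<^bsub>Aut\<^esub> g) x [^] (a * b) = x [^] (c * d)"
    if x: "x \<in> carrier G" "f (g x) [^] a = g x [^] c" "g x [^] b = x [^] d" for x and a b c d :: int
  proof -
    have "(f \<otimes>\<^bsub>Aut\<^esub> g) x [^] (a * b) = (f (g x) [^] a) [^] b" using Aut_mult[OF f(1) g(1) x(1)] x(1) fc gc by (simp add: int_pow_pow)
    also have "\<dots> = (g x [^] b) [^] c" unfolding x(2) using x(1) gc by (simp add: int_pow_pow mult.commute)
    also have "\<dots> = x [^] (c * d)" unfolding x(3) using x(1) by (simp add: int_pow_pow mult.commute)
    finally show ?thesis .
  qed
  have "\<exists>\<P>. finite \<P> \<and> (\<forall>p\<in>\<P>. splitting G p (complement p)) \<and>
     (\<forall>p. prime p \<longrightarrow> p dvd (m * m') * (n * n') \<longrightarrow> p \<in> \<P>) \<and>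
     (\<forall>x\<in>complement_Inter \<P>. (f \<otimes>\<^bsub>Aut\<^esub> g) x [^] (n * n') = x [^] (m * m'))"
  proof (intro exI[of _ "\<P> \<union> \<P>'"] conjI)
    show "finite (\<P> \<union> \<P>')" using P P' by simp
    show "\<forall>p\<in>\<P> \<union> \<P>'. splitting G p (complement p)" using P P' by blast
    show "\<forall>p. prime p \<longrightarrow> p dvd (m * m') * (n * n') \<longrightarrow> p \<in> \<P> \<union> \<P>'"
    proof (intro allI impI)
      fix p :: int assume p: "prime p" "p dvd (m * m') * (n * n')"
      then have "p dvd m * n \<or> p dvd m' * n'" by (auto simp: prime_dvd_mult_iff)
      then show "p \<in> \<P> \<union> \<P>'" using p P(3) P'(3) by blast
    qed
    show "\<forall>x\<in>complement_Inter (\<P> \<union> \<P>'). (f \<otimes>\<^bsub>Aut\<^esub> g) x [^] (n * n') = x [^] (m * m')"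
    proof
      fix x assume x: "x \<in> complement_Inter (\<P> \<union> \<P>')"
      then have x': "x \<in> complement_Inter \<P>" "x \<in> complement_Inter \<P>'" "x \<in> carrier G" by (auto simp: complement_Inter_def)
      have "g x \<in> complement_Inter \<P>" by (rule complement_Inter_invariant[OF P(2) g(1) x'(1)])
      then show "(f \<otimes>\<^bsub>Aut\<^esub> g) x [^] (n * n') = x [^] (m * m')"
        using comb[OF x'(3)] P(4) P'(4) x'(2) by blast
    qed
  qed
  moreover have "\<exists>(k::nat) (l::nat) a b. \<not> p dvd a \<and> \<not> p dvd b \<and> p ^ k * a * (n * n') = p ^ l * b * (m * m') \<and>
       (\<forall>x\<in>primary G p. (f \<otimes>\<^bsub>Aut\<^esub> g) x [^] b = x [^] a)" if p: "prime p" for p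
  proof -
    obtain k l :: nat and a b where 1: "\<not> p dvd a" "\<not> p dvd b" "p ^ k * a * n = p ^ l * b * m"
      "\<forall>x\<in>primary G p. f x [^] b = x [^] a" using f(2) p unfolding canonical_def by blast
    obtain k' l' :: nat and a' b' where 2: "\<not> p dvd a'" "\<not> p dvd b'" "p ^ k' * a' * n' = p ^ l' * b' * m'"
      "\<forall>x\<in>primary G p. g x [^] b' = x [^] a'" using g(2) p unfolding canonical_def by blast
    have "p ^ (k + k') * (a * a') * (n * n') = (p ^ k * a * n) * (p ^ k' * a' * n')" by (simp add: power_add mult_ac)
    also have "\<dots> = p ^ (l + l') * (b * b') * (m * m')" unfolding 1(3) 2(3) by (simp add: power_add mult_ac)
    finally have "p ^ (k + k') * (a * a') * (n * n') = p ^ (l + l') * (b * b') * (m * m')" .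
    moreover have "\<not> p dvd a * a'" "\<not> p dvd b * b'" using 1 2 p by (auto simp: prime_dvd_mult_iff)
    moreover have "\<forall>x\<in>primary G p. (f \<otimes>\<^bsub>Aut\<^esub> g) x [^] (b * b') = x [^] (a * a')"
    proof
      fix x assume x: "x \<in> primary G p"
      then have gx: "g x \<in> primary G p" using hom_primary[OF auto_hom[OF g(1)]] by blast
      have xc: "x \<in> carrier G" using x by (simp add: primary_def)
      show "(f \<otimes>\<^bsub>Aut\<^esub> g) x [^] (b * b') = x [^] (a * a')"
        using comb[OF xc] 1(4) 2(4) x gx by blast
    qed
    ultimately show ?thesis by blast
  qed
  moreover have "m * m' \<noteq> 0" "n * n' \<noteq> 0" using f(2) g(2) by (auto simp: canonical_def)
  ultimately show ?thesis unfolding canonical_def by blast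
qed

lemma canonical_inv:
  assumes f: "f \<in> auto G" "canonical f m n" shows "canonical (inv\<^bsub>Aut\<^esub> f) n m"
proof -
  let ?i = "inv\<^bsub>Aut\<^esub> f"
  note ia = Aut_inv_closed[OF f(1)]
  obtain \<P> where P: "finite \<P>" "\<forall>p\<in>\<P>. splitting G p (complement p)"
    "\<forall>p. prime p \<longrightarrow> p dvd m * n \<longrightarrow> p \<in> \<P>" "\<forall>x\<in>complement_Inter \<P>. f x [^] n = x [^] m"
    using f(2) unfolding canonical_def by blast
  have "\<exists>\<P>. finite \<P> \<and> (\<forall>p\<in>\<P>. splitting G p (complement p)) \<and>
     (\<forall>p. prime p \<longrightarrow> p dvd n * m \<longrightarrow> p \<in> \<P>) \<and> (\<forall>x\<in>complement_Inter \<P>. ?i x [^] m = x [^] n)"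
  proof (intro exI[of _ \<P>] conjI)
    show "\<forall>p. prime p \<longrightarrow> p dvd n * m \<longrightarrow> p \<in> \<P>" using P(3) by (simp add: mult.commute)
    show "\<forall>x\<in>complement_Inter \<P>. ?i x [^] m = x [^] n"
    proof
      fix x assume x: "x \<in> complement_Inter \<P>"
      then have "?i x \<in> complement_Inter \<P>" by (rule complement_Inter_invariant[OF P(2) ia])
      then have "f (?i x) [^] n = ?i x [^] m" using P(4) by blast
      then show "?i x [^] m = x [^] n" using Aut_inv_right[OF f(1)] x by (simp add: complement_Inter_def)
    qed
  qed (use P in auto)
  moreover have "\<exists>(k::nat) (l::nat) a b. \<not> p dvd a \<and> \<not> p dvd b \<and> p ^ k * a * m = p ^ l * b * n \<and>
       (\<forall>x\<in>primary G p. ?i x [^] b = x [^] a)" if p: "prime p" for p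
  proof -
    obtain k l :: nat and a b where 1: "\<not> p dvd a" "\<not> p dvd b" "p ^ k * a * n = p ^ l * b * m"
      "\<forall>x\<in>primary G p. f x [^] b = x [^] a" using f(2) p unfolding canonical_def by blast
    have "\<forall>x\<in>primary G p. ?i x [^] a = x [^] b"
    proof
      fix x assume x: "x \<in> primary G p"
      then have "?i x \<in> primary G p" using hom_primary[OF auto_hom[OF ia]] by blast
      then have "f (?i x) [^] b = ?i x [^] a" using 1(4) by blast
      then show "?i x [^] a = x [^] b" using Aut_inv_right[OF f(1)] x by (simp add: primary_def)
    qed
    then show ?thesis using 1(1-3) by metis
  qed
  ultimately show ?thesis using f(2) unfolding canonical_def by blast
qed

lemma canonical_inversion: "canonical inversion (-1) 1"
proof -
  have n: "inversion x [^] (1::int) = x [^] (-1::int)" if "x \<in> carrier G" for x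
    using that by (simp add: inversion_def int_pow_neg)
  have "\<exists>(k::nat) (l::nat) a b. \<not> p dvd a \<and> \<not> p dvd b \<and> p ^ k * a * 1 = p ^ l * b * (-1) \<and>
       (\<forall>x\<in>primary G p. inversion x [^] b = x [^] a)" if p: "prime p" for p :: int
    using n p not_prime_unit[of p]
    by (intro exI[of _ 0] exI[of _ "-1"] exI[of _ 1]) (auto simp: primary_def)
  moreover have "\<not> prime p \<or> \<not> p dvd -1 * 1" for p :: int using not_prime_unit by auto
  ultimately show ?thesis
    unfolding canonical_def using n by (intro conjI exI[of _ "{}"]) (auto simp: complement_Inter_def)
qed

text \<open>The \<open>p\<close>-part \<open>u\<close> of a \<open>q\<close>-element
  \<open>x\<close> has a \<open>q\<close>-power multiple in both summands, so it is a
  \<open>q\<close>-element as well as a \<open>p\<close>-element.\<close>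

lemma primary_in_splitting:
  assumes s: "splitting G p K" and q: "prime q" "q \<noteq> p" and x: "x \<in> primary G q" shows "x \<in> K"
proof -
  have xc: "x \<in> carrier G" using x by (simp add: primary_def)
  have p: "prime p" and sK: "subgroup K G" and PK: "primary G p \<inter> K \<subseteq> {\<one>}" using s by (auto simp: splitting_def)
  obtain u v where uv: "u \<in> primary G p" "v \<in> K" "x = u \<otimes> v" using splitting_decompose[OF s xc] by blast
  have c: "u \<in> carrier G" "v \<in> carrier G" using uv sub_carr[OF sK] by (auto simp: primary_def)
  obtain k where k: "x [^] (q ^ k) = \<one>" using x by (auto simp: primary_def)
  have "u [^] (q ^ k) \<otimes> v [^] (q ^ k) = \<one>" using k uv(3) c by (simp add: int_pow_distrib)
  then have e: "u [^] (q ^ k) = inv (v [^] (q ^ k))" using c by (metis inv_equality int_pow_closed)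
  have "u [^] (q ^ k) \<in> primary G p" by (rule sub_pow[OF primary_subgroup uv(1)])
  moreover have "inv (v [^] (q ^ k)) \<in> K" using sub_pow[OF sK uv(2)] sub_inv[OF sK] by blast
  ultimately have "u [^] (q ^ k) = \<one>" using e PK by auto
  then have "u \<in> primary G q" using c by (auto simp: primary_def)
  then have "u = \<one>" using primary_disjoint[OF p q(1) _ uv(1)] q(2) by blast
  then show ?thesis using uv c by simp
qed

lemma canonical_scaling:
  assumes s: "splitting G q K" and g: "scaling G q K g" shows "canonical g q 1"
proof -
  have q: "prime q" using s by (simp add: splitting_def)
  have q1: "\<not> q dvd 1" using q not_prime_unit by blast
  have K: "complement q = K" by (rule complement_eq[OF s])
  have gi: "g \<in> iso G G" using g by (simp add: scaling_def)
  note gc = hom_in_carrier[OF iso_hom[OF gi]]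
  have "\<exists>\<P>. finite \<P> \<and> (\<forall>p\<in>\<P>. splitting G p (complement p)) \<and>
     (\<forall>p. prime p \<longrightarrow> p dvd q * 1 \<longrightarrow> p \<in> \<P>) \<and> (\<forall>x\<in>complement_Inter \<P>. g x [^] (1::int) = x [^] q)"
  proof (intro exI[of _ "{q}"] conjI)
    show "\<forall>p. prime p \<longrightarrow> p dvd q * 1 \<longrightarrow> p \<in> {q}" using q primes_dvd_imp_eq by auto
    show "\<forall>x\<in>complement_Inter {q}. g x [^] (1::int) = x [^] q" using g K gc by (auto simp: complement_Inter_def scaling_def)
  qed (use s K in auto)
  moreover have "\<exists>(k::nat) (l::nat) a b. \<not> p dvd a \<and> \<not> p dvd b \<and> p ^ k * a * 1 = p ^ l * b * q \<and>
       (\<forall>x\<in>primary G p. g x [^] b = x [^] a)" if p: "prime p" for p :: int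
  proof (cases "p = q")
    case True
    \<comment> \<open>On its own component the scaling is the identity, that is, \<open>q\<close>
      with its factor \<open>q\<close> removed; hence \<open>k = 1\<close> and
      \<open>l = 0\<close>.\<close>
    have "\<forall>x\<in>primary G p. g x [^] (1::int) = x [^] (1::int)" using g True by (auto simp: scaling_def primary_def)
    then show ?thesis using q1 True by (intro exI[of _ 1] exI[of _ 0]) auto
  next
    case False
    have "\<not> p dvd q" using p q False primes_dvd_imp_eq by blast
    moreover have "\<not> p dvd 1" using p not_prime_unit by blast
    moreover have "\<forall>x\<in>primary G p. g x [^] (1::int) = x [^] q"
    proof
      fix x assume x: "x \<in> primary G p"
      then have "x \<in> K" using primary_in_splitting[OF s p] False by blast
      then have "g x = x [^] q" using g by (simp add: scaling_def)
      moreover have "g x \<in> carrier G" using gc x by (simp add: primary_def)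
      ultimately show "g x [^] (1::int) = x [^] q" by simp
    qed
    ultimately show ?thesis by (intro exI[of _ 0] exI[of _ q] exI[of _ 1]) auto
  qed
  ultimately show ?thesis unfolding canonical_def using q by auto
qed

lemma scaling_group_canonical:
  assumes "f \<in> scaling_group" shows "\<exists>m n. canonical f m n"
  using assms unfolding scaling_group_def
proof (induction rule: generate.induct)
  case one
  \<comment> \<open>The identity inherits a canonical form as the square of the inversion.\<close>
  have "inversion \<otimes>\<^bsub>Aut\<^esub> inversion = \<one>\<^bsub>Aut\<^esub>"
  proof (rule auto_eqI[OF Aut_mult_closed[OF inversion_auto inversion_auto] Aut_one_closed])
    fix x assume x: "x \<in> carrier G"
    then have "inversion (inversion x) = x" by (simp add: inversion_def)
    then show "(inversion \<otimes>\<^bsub>Aut\<^esub> inversion) x = \<one>\<^bsub>Aut\<^esub> x" using x by (simp add: Aut_mult[OF inversion_auto inversion_auto] Aut_one)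
  qed
  then show ?case using canonical_mult[OF inversion_auto canonical_inversion inversion_auto canonical_inversion] by auto
next
  case (incl h)
  then show ?case using canonical_inversion canonical_scaling unfolding scaling_gens_def by blast
next
  case (inv h)
  then have "\<exists>m n. canonical h m n" using canonical_inversion canonical_scaling unfolding scaling_gens_def by blast
  moreover have "h \<in> auto G" using inv scaling_gens_auto by auto
  ultimately show ?case using canonical_inv by blast
next
  case (eng h1 h2)
  have "h1 \<in> auto G" "h2 \<in> auto G" using eng scaling_group_auto by (auto simp: scaling_group_def)
  then show ?case using eng canonical_mult by blast
qed

text \<open>The primes of \<open>n\<close> are stripped off one at a time, since each of the
  complements involved has no element of the corresponding prime order.\<close>

lemma complement_Inter_no_torsion:
  assumes P: "\<forall>p\<in>\<P>. splitting G p (complement p)" "\<forall>p. prime p \<longrightarrow> p dvd n \<longrightarrow> p \<in> \<P>"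
    and n: "n \<noteq> 0" and x: "x \<in> complement_Inter \<P>" "x [^] (n::int) = \<one>"
  shows "x = \<one>"
  using P(2) n x
proof (induction "nat \<bar>n\<bar>" arbitrary: n x rule: less_induct)
  case less
  have xc: "x \<in> carrier G" using less.prems by (simp add: complement_Inter_def)
  show ?case
  proof (cases "is_unit n")
    case True
    then have "x [^] (1::int) = \<one>" by (rule pow_dvd_one[OF xc less.prems(4)])
    then show ?thesis using xc by simp
  next
    case False
    then obtain p where p: "prime p" "p dvd n" using less.prems(2) prime_divisorE by blast
    then obtain q where q: "n = p * q" by blast
    have pP: "p \<in> \<P>" using less.prems(1) p by blast
    have "x [^] q \<in> complement_Inter \<P>" by (rule sub_pow[OF complement_Inter_subgroup[OF P(1)] less.prems(3)])
    then have "x [^] q \<in> complement p" using pP by (simp add: complement_Inter_def)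
    moreover have "(x [^] q) [^] p = \<one>" using less.prems(4) q xc by (simp add: int_pow_pow mult.commute)
    ultimately have "x [^] q = \<one>" using splitting_no_torsion[of p "complement p"] P(1) pP by blast
    moreover have "nat \<bar>q\<bar> < nat \<bar>n\<bar>"
      using q less.prems(2) prime_gt_1_int[OF p(1)] by (simp add: abs_mult)
    moreover have "\<forall>p. prime p \<longrightarrow> p dvd q \<longrightarrow> p \<in> \<P>" using less.prems(1) q by auto
    moreover have "q \<noteq> 0" using q less.prems(2) by auto
    ultimately show ?thesis using less.hyps less.prems(3) by blast
  qed
qed

text \<open>When a prime \<open>p\<close> is added, the new \<open>p\<close>-part is moved to the
  torsion summand. It already lies in the complements of the other primes, and therefore so does the
  rest.\<close>

lemma torsion_complement_Inter:
  assumes "finite \<P>" "\<forall>p\<in>\<P>. splitting G p (complement p)" "x \<in> carrier G"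
  shows "\<exists>t\<in>torsion_subgroup G. \<exists>y\<in>complement_Inter \<P>. x = t \<otimes> y"
  using assms
proof (induction \<P>)
  case empty
  then show ?case using sub_one[OF torsion_subgroup] by (intro bexI[of _ \<one>] bexI[of _ x]) (auto simp: complement_Inter_def)
next
  case (insert p \<P>)
  then obtain t y where ty: "t \<in> torsion_subgroup G" "y \<in> complement_Inter \<P>" "x = t \<otimes> y" by auto
  have s: "splitting G p (complement p)" and P: "\<forall>p\<in>\<P>. splitting G p (complement p)" using insert by auto
  have p: "prime p" using s by (simp add: splitting_def)
  have yc: "y \<in> carrier G" using ty by (simp add: complement_Inter_def)
  obtain u v where uv: "u \<in> primary G p" "v \<in> complement p" "y = u \<otimes> v" using splitting_decompose[OF s yc] by blast
  have c: "u \<in> carrier G" "v \<in> carrier G" "t \<in> carrier G" using uv s sub_carr[of "complement p" v] torsion_carr ty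
    by (auto simp: primary_def splitting_def)
  have "u \<in> complement_Inter \<P>"
  proof -
    have "u \<in> complement q" if "q \<in> \<P>" for q
      using primary_in_splitting[of q "complement q" p u] P that p uv(1) insert.hyps(2) by auto
    then show ?thesis using c by (simp add: complement_Inter_def)
  qed
  then have "v \<in> complement_Inter \<P>" using sub_cancel[OF complement_Inter_subgroup[OF P], of u v] ty(2) uv(3) c by simp
  then have "v \<in> complement_Inter (insert p \<P>)" using uv by (simp add: complement_Inter_def)
  moreover have "t \<otimes> u \<in> torsion_subgroup G"
    using ty uv primary_torsion[OF p] sub_mult[OF torsion_subgroup] by blast
  moreover have "x = (t \<otimes> u) \<otimes> v" unfolding ty(3) uv(3) using c by (simp add: m_assoc)
  ultimately show ?case by blast
qed

text \<open>An element of infinite order in the intersection of the complements forces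
  \<open>m = n\<close>. There \<open>f - 1\<close> is then killed by \<open>n\<close> and takes
  values without \<open>n\<close>-torsion. On a component the stripped fraction is also
  \<open>1\<close>, and \<open>f - 1\<close> is killed by an integer prime to \<open>p\<close>.
  These subgroups together generate the group.\<close>

lemma canonical_unipotent_trivial:
  assumes a: "a \<in> carrier G" "a \<notin> torsion_subgroup G"
    and f: "f \<in> auto G" "canonical f m n" "unipotent f" and x: "x \<in> carrier G"
  shows "f x = x"
proof -
  let ?T = "torsion_subgroup G"
  note fh = auto_hom[OF f(1)] and fc = auto_carr[OF f(1)]
  have mn0: "m \<noteq> 0" "n \<noteq> 0" using f(2) by (auto simp: canonical_def)
  obtain \<P> where P: "finite \<P>" "\<forall>p\<in>\<P>. splitting G p (complement p)"
    "\<forall>p. prime p \<longrightarrow> p dvd m * n \<longrightarrow> p \<in> \<P>" "\<forall>x\<in>complement_Inter \<P>. f x [^] n = x [^] m"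
    using f(2) unfolding canonical_def by blast
  note sPI = complement_Inter_subgroup[OF P(2)]
  obtain t b where b: "t \<in> ?T" "b \<in> complement_Inter \<P>" "a = t \<otimes> b" using torsion_complement_Inter[OF P(1,2) a(1)] by blast
  have bc: "b \<in> carrier G" using b by (simp add: complement_Inter_def)
  have bT: "b \<notin> ?T" using a b sub_mult[OF torsion_subgroup] by blast
  have "m = n"
  proof (rule ccontr)
    assume ne: "m \<noteq> n"
    have "(f b \<otimes> inv b) [^] n \<in> ?T" using f(3) bc by (intro sub_pow[OF torsion_subgroup]) (simp add: unipotent_def)
    also have "(f b \<otimes> inv b) [^] n = b [^] (m - n)"
      using P(4) b(2) bc fc by (simp add: int_pow_distrib int_pow_inv int_pow_diff)
    finally show False using torsion_root[OF bc, of "m - n"] ne bT by auto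
  qed
  have fP: "f y = y" if y: "y \<in> complement_Inter \<P>" for y
  proof -
    have yc: "y \<in> carrier G" using y by (simp add: complement_Inter_def)
    have "(f y \<otimes> inv y) [^] n = \<one>" using P(4) y yc fc \<open>m = n\<close> by (simp add: int_pow_distrib int_pow_inv)
    moreover have "f y \<otimes> inv y \<in> complement_Inter \<P>"
      using y complement_Inter_invariant[OF P(2) f(1) y] sub_mult[OF sPI] sub_inv[OF sPI] by blast
    moreover have "\<forall>p. prime p \<longrightarrow> p dvd n \<longrightarrow> p \<in> \<P>" using P(3) by auto
    ultimately have "f y \<otimes> inv y = \<one>" using complement_Inter_no_torsion[OF P(2) _ mn0(2)] by blast
    then show ?thesis using yc fc by (metis inv_closed inv_equality inv_inv)
  qed
  have fT: "f y = y" if "y \<in> ?T" for y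
    using that
  proof (induction rule: torsion_induct)
    case one
    then show ?case by (rule hom_one'[OF fh])
  next
    case (primary p y)
    have yc: "y \<in> carrier G" using primary by (simp add: primary_def)
    obtain k l :: nat and m' n' where 1: "\<not> p dvd m'" "\<not> p dvd n'" "p ^ k * m' * n = p ^ l * n' * m"
      "\<forall>x\<in>primary G p. f x [^] n' = x [^] m'" using f(2) primary(1) unfolding canonical_def by blast
    have e: "p ^ k * m' = p ^ l * n'" using 1(3) \<open>m = n\<close> mn0 by simp
    have p0: "p \<noteq> 0" using primary(1) by auto
    \<comment> \<open>Since \<open>m'\<close> and \<open>n'\<close> are both prime to
      \<open>p\<close>, the powers of \<open>p\<close> on the two sides of \<open>e\<close> must
      agree.\<close>
    have "k = l"
    proof (rule ccontr)
      assume "k \<noteq> l"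
      then consider "k < l" | "l < k" by linarith
      then show False
      proof cases
        case 1
        then have "p ^ l = p ^ k * p ^ (l - k)" by (simp flip: power_add)
        then have "m' = p ^ (l - k) * n'" using e p0 by simp
        moreover have "p dvd p ^ (l - k)" using 1 by (intro dvd_power) auto
        ultimately show False using \<open>\<not> p dvd m'\<close> by simp
      next
        case 2
        then have "p ^ k = p ^ l * p ^ (k - l)" by (simp flip: power_add)
        then have "n' = p ^ (k - l) * m'" using e p0 by simp
        moreover have "p dvd p ^ (k - l)" using 2 by (intro dvd_power) auto
        ultimately show False using \<open>\<not> p dvd n'\<close> by simp
      qed
    qed
    then have "m' = n'" using e p0 by simp
    then have 2: "(f y \<otimes> inv y) [^] n' = \<one>" using 1(4) primary yc fc by (simp add: int_pow_distrib int_pow_inv)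
    have fy: "f y \<in> primary G p" using hom_primary[OF fh] primary by blast
    then have "f y \<otimes> inv y \<in> primary G p"
      using primary sub_mult[OF primary_subgroup] sub_inv[OF primary_subgroup] by blast
    moreover have "f y \<otimes> inv y \<in> prime_to p" using 1(2) 2 yc fc[OF yc] unfolding prime_to_def by blast
    ultimately have "f y \<otimes> inv y = \<one>" by (rule primary_prime_to[OF primary(1)])
    then show ?case using yc fc by (metis inv_closed inv_equality inv_inv)
  next
    case (mult y z)
    then show ?case using hom_mult[OF fh] torsion_carr by simp
  qed
  obtain s y where sy: "s \<in> ?T" "y \<in> complement_Inter \<P>" "x = s \<otimes> y" using torsion_complement_Inter[OF P(1,2) x] by blast
  have "s \<in> carrier G" "y \<in> carrier G" using sy torsion_carr by (auto simp: complement_Inter_def)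
  then show ?thesis using sy fT fP hom_mult[OF fh] by simp
qed

section \<open>Decomposition of inertial automorphisms\<close>

lemma rational_action_mult:
  assumes "f \<in> auto G" "g \<in> auto G" "rational_action G f m n" "rational_action G g m' n'"
  shows "rational_action G (f \<otimes>\<^bsub>Aut\<^esub> g) (m * m') (n * n')"
  using rational_action_comp[OF auto_hom[OF assms(1)] assms(3) auto_hom[OF assms(2)] assms(4)]
    Aut_mult[OF assms(1,2)] by (simp add: rational_action_def)

lemma rational_action_inv:
  assumes f: "f \<in> auto G" "rational_action G f m n" shows "rational_action G (inv\<^bsub>Aut\<^esub> f) n m"
  unfolding rational_action_def
proof
  fix x assume x: "x \<in> carrier G"
  define y where "y = (inv\<^bsub>Aut\<^esub> f) x"
  have y: "y \<in> carrier G" "f y = x" using auto_carr[OF Aut_inv_closed[OF f(1)] x] Aut_inv_right[OF f(1) x]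
    by (simp_all add: y_def)
  have "inv (f y [^] n \<otimes> inv (y [^] m)) \<in> torsion_subgroup G"
    using f(2) y(1) by (intro sub_inv[OF torsion_subgroup]) (auto simp: rational_action_def)
  also have "inv (f y [^] n \<otimes> inv (y [^] m)) = y [^] m \<otimes> inv (x [^] n)" using x y by (simp add: inv_mult_group)
  finally show "(inv\<^bsub>Aut\<^esub> f) x [^] m \<otimes> inv (x [^] n) \<in> torsion_subgroup G" by (simp add: y_def)
qed

text \<open>Induction on \<open>\<bar>m\<bar> n\<close>: a prime divisor of \<open>m\<close> or \<open>n\<close> is removed by a rational_factor in \<open>scaling_group\<close>.\<close>

lemma inertial_decompose:
  assumes "f \<in> auto G" "inertial_map G f" "n > 0" "m \<noteq> 0" "coprime m n" "rational_action G f m n"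
  shows "\<exists>q\<in>scaling_group. \<exists>\<kappa>\<in>IAut1 G. f = q \<otimes>\<^bsub>Aut\<^esub> \<kappa>"
  using assms
proof (induction "nat (\<bar>m\<bar> * n)" arbitrary: f m n rule: less_induct)
  case less
  interpret A: group Aut by (rule Aut_group)
  note f = less.prems
  have fA: "f \<in> carrier Aut" using f(1) by simp
  show ?case
  proof (cases "is_unit (m * n)")
    case True
    then have "is_unit m" "is_unit n" using is_unit_mult_iff by blast+
    then have n: "n = 1" and m: "m = 1 \<or> m = -1" using f(3) by auto
    show ?thesis
    proof (cases "m = 1")
      case True
      then have "unipotent f" using f(6) n unipotent_iff[OF auto_hom[OF f(1)]] by simp
      then have "f \<in> IAut1 G" using f by (simp add: IAut1_iff)
      moreover have "f = \<one>\<^bsub>Aut\<^esub> \<otimes>\<^bsub>Aut\<^esub> f" using A.l_one[OF fA] by simp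
      ultimately show ?thesis using subgroup.one_closed[OF scaling_group_subgroup] by blast
    next
      case False
      let ?k = "inversion \<otimes>\<^bsub>Aut\<^esub> f"
      have ka: "?k \<in> auto G" by (rule Aut_mult_closed[OF inversion_auto f(1)])
      have "rational_action G ?k 1 1"
        using rational_action_mult[OF inversion_auto f(1) inversion_action f(6)] False m n by simp
      then have "?k \<in> IAut1 G" using ka inertial_mult[OF inversion_auto f(1) inversion_inertial f(2)] unipotent_iff[OF auto_hom[OF ka]]
        by (simp add: IAut1_iff)
      moreover have "f = inversion \<otimes>\<^bsub>Aut\<^esub> ?k"
        using f(1) inversion_auto ka by (intro auto_eqI Aut_mult_closed) (simp_all add: Aut_mult auto_carr[OF f(1)] inversion_def)
      moreover have "inversion \<in> scaling_group" unfolding scaling_group_def by (rule generate.incl) (simp add: scaling_gens_def)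
      ultimately show ?thesis by blast
    qed
  next
    case False
    then obtain p where p: "prime p" "p dvd m * n" using f(3,4) prime_divisorE[of "m * n"] by auto
    have p1: "p > 1" using prime_gt_1_int[OF p(1)] .
    have pmn: "p dvd m \<or> p dvd n" using p by (simp add: prime_dvd_mult_iff)
    obtain K where K: "splitting G p K" using inertial_splitting[OF f(2,6,5) p(1) pmn] by blast
    obtain g where g: "g \<in> auto G" "scaling G p K g" using scaling_exists[OF K] by blast
    have gQ: "g \<in> scaling_group" unfolding scaling_group_def using g K by (intro generate.incl) (auto simp: scaling_gens_def)
    note gi = scaling_inertial[OF K g(2)] and gact = scaling_action[OF K g(2)]
    show ?thesis
    proof (cases "p dvd m")
      case True
      then obtain m1 where m1: "m = p * m1" by blast
      \<comment> \<open>The inverse of \<open>g\<close> may fail to be inertial; the product is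
        inertial because \<open>p\<close> divides \<open>m\<close>.\<close>
      let ?k = "inv\<^bsub>Aut\<^esub> g \<otimes>\<^bsub>Aut\<^esub> f"
      have ka: "?k \<in> auto G" by (rule Aut_mult_closed[OF Aut_inv_closed[OF g(1)] f(1)])
      have gk: "g (?k x) = f x" if "x \<in> carrier G" for x
        using that Aut_mult[OF Aut_inv_closed[OF g(1)] f(1)] Aut_inv_right[OF g(1)] auto_carr[OF f(1)] by simp
      have ki: "inertial_map G ?k"
        by (rule divide_scaling_inertial[OF K g(2) f(2,6,5) True auto_iso[OF ka]]) (use gk in blast)
      have "rational_action G ?k (1 * m) (p * n)"
        by (rule rational_action_mult[OF Aut_inv_closed[OF g(1)] f(1) rational_action_inv[OF g(1) gact] f(6)])
      then have kact: "rational_action G ?k m1 n"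
        using rational_action_cancel[OF auto_hom[OF ka], of p m1 n] p1 m1 by simp
      have "\<bar>m1\<bar> * n < \<bar>m\<bar> * n" using m1 p1 f(3,4) by (simp add: abs_mult)
      then have "nat (\<bar>m1\<bar> * n) < nat (\<bar>m\<bar> * n)" using f(3) by simp
      moreover have "m1 \<noteq> 0" "coprime m1 n" using m1 f(4,5) by auto
      ultimately obtain q \<kappa> where qk: "q \<in> scaling_group" "\<kappa> \<in> IAut1 G" "?k = q \<otimes>\<^bsub>Aut\<^esub> \<kappa>"
        using less.hyps[of m1 n ?k] ka ki f(3) kact by blast
      have qa: "q \<in> auto G" "\<kappa> \<in> auto G" using scaling_group_auto qk by (auto simp: IAut1_iff)
      have "f = g \<otimes>\<^bsub>Aut\<^esub> ?k"
        by (rule auto_eqI[OF f(1) Aut_mult_closed[OF g(1) ka]]) (simp add: Aut_mult[OF g(1) ka] gk)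
      also have "\<dots> = (g \<otimes>\<^bsub>Aut\<^esub> q) \<otimes>\<^bsub>Aut\<^esub> \<kappa>" unfolding qk(3) using g(1) qa by (simp add: A.m_assoc)
      finally show ?thesis using qk subgroup.m_closed[OF scaling_group_subgroup gQ qk(1)] by blast
    next
      case False
      then obtain n1 where n1: "n = p * n1" using pmn by blast
      \<comment> \<open>A prime of the denominator is cancelled by \<open>g\<close> itself, and its
        inverse enters only the factor from \<open>scaling_group\<close>.\<close>
      let ?k = "g \<otimes>\<^bsub>Aut\<^esub> f"
      have ka: "?k \<in> auto G" by (rule Aut_mult_closed[OF g(1) f(1)])
      have ki: "inertial_map G ?k" by (rule inertial_mult[OF g(1) f(1) gi f(2)])
      have "rational_action G ?k (p * m) (1 * n)" by (rule rational_action_mult[OF g(1) f(1) gact f(6)])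
      then have kact: "rational_action G ?k m n1"
        using rational_action_cancel[OF auto_hom[OF ka], of p m n1] p1 n1 by simp
      have n1p: "n1 > 0" using n1 p1 f(3) by (simp add: zero_less_mult_iff)
      have "\<bar>m\<bar> * n1 < \<bar>m\<bar> * n" using n1 p1 n1p f(4) by simp
      then have "nat (\<bar>m\<bar> * n1) < nat (\<bar>m\<bar> * n)" using f(3,4) by (simp add: zero_less_mult_iff)
      moreover have "coprime m n1" using n1 f(5) by auto
      ultimately obtain q \<kappa> where qk: "q \<in> scaling_group" "\<kappa> \<in> IAut1 G" "?k = q \<otimes>\<^bsub>Aut\<^esub> \<kappa>"
        using less.hyps[of m n1 ?k] ka ki f(4) n1p kact by blast
      have qa: "q \<in> auto G" "\<kappa> \<in> auto G" using scaling_group_auto qk by (auto simp: IAut1_iff)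
      have ig: "inv\<^bsub>Aut\<^esub> g \<in> scaling_group" by (rule subgroup.m_inv_closed[OF scaling_group_subgroup gQ])
      have "f = inv\<^bsub>Aut\<^esub> g \<otimes>\<^bsub>Aut\<^esub> ?k"
        using f(1) g(1) ka Aut_inv_closed[OF g(1)] Aut_inv_left[OF g(1)] auto_carr[OF f(1)]
        by (intro auto_eqI Aut_mult_closed) (simp_all add: Aut_mult)
      also have "\<dots> = (inv\<^bsub>Aut\<^esub> g \<otimes>\<^bsub>Aut\<^esub> q) \<otimes>\<^bsub>Aut\<^esub> \<kappa>"
        unfolding qk(3) using Aut_inv_closed[OF g(1)] qa by (simp add: A.m_assoc)
      finally show ?thesis using qk subgroup.m_closed[OF scaling_group_subgroup ig qk(1)] by blast
    qed
  qed
qed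

end

lemma group_rat_mult: "group rat_mult_group"
proof (rule groupI)
  fix x :: rat assume "x \<in> carrier rat_mult_group"
  then show "\<exists>y\<in>carrier rat_mult_group. y \<otimes>\<^bsub>rat_mult_group\<^esub> x = \<one>\<^bsub>rat_mult_group\<^esub>"
    by (intro bexI[of _ "inverse x"]) (auto simp: rat_mult_group_def)
qed (auto simp: rat_mult_group_def)

context comm_group
begin

lemma inertial_in_product:
  assumes a: "a \<in> carrier G" "a \<notin> torsion_subgroup G" and f: "f \<in> auto G" "inertial_map G f"
  shows "f \<in> IAut1 G <#>\<^bsub>Aut\<^esub> scaling_group"
proof -
  obtain m n where "n > 0" "m \<noteq> 0" "coprime m n" "rational_action G f m n" using inertial_factor[OF f(2) a] by blast
  then obtain q \<kappa> where qk: "q \<in> scaling_group" "\<kappa> \<in> IAut1 G" "f = q \<otimes>\<^bsub>Aut\<^esub> \<kappa>" using inertial_decompose[OF f] by blast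
  have "f = \<kappa> \<otimes>\<^bsub>Aut\<^esub> q" unfolding qk(3) using scaling_group_central[OF qk(1)] qk(2) by (simp add: IAut1_iff)
  then show ?thesis unfolding set_mult_def using qk by blast
qed

text \<open>As \<open>scaling_group\<close> is central, the product of the two subgroups is a
  subgroup. It contains all inertial automorphisms and so also the inverses that are not
  inertial.\<close>

lemma inertial_group_product:
  assumes a: "a \<in> carrier G" "a \<notin> torsion_subgroup G"
  shows "inertial_group = IAut1 G <#>\<^bsub>Aut\<^esub> scaling_group"
proof
  interpret A: group Aut by (rule Aut_group)
  have k1: "\<kappa> \<in> carrier Aut" if "\<kappa> \<in> IAut1 G" for \<kappa> using that by (simp add: IAut1_iff)
  have q1: "q \<in> carrier Aut" if "q \<in> scaling_group" for q using scaling_group_auto that by simp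
  have comm: "q \<otimes>\<^bsub>Aut\<^esub> k = k \<otimes>\<^bsub>Aut\<^esub> q" if "q \<in> scaling_group" "k \<in> IAut1 G" for q k
    using scaling_group_central that by (simp add: IAut1_iff)
  have "subgroup (IAut1 G <#>\<^bsub>Aut\<^esub> scaling_group) Aut"
  proof (rule A.subgroup_if_closed)
    show "IAut1 G <#>\<^bsub>Aut\<^esub> scaling_group \<subseteq> carrier Aut" unfolding set_mult_def using k1 q1 A.m_closed by blast
    have "\<one>\<^bsub>Aut\<^esub> = \<one>\<^bsub>Aut\<^esub> \<otimes>\<^bsub>Aut\<^esub> \<one>\<^bsub>Aut\<^esub>" by (rule A.l_one[OF A.one_closed, symmetric])
    then show "\<one>\<^bsub>Aut\<^esub> \<in> IAut1 G <#>\<^bsub>Aut\<^esub> scaling_group" unfolding set_mult_def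
      using subgroup.one_closed[OF IAut1_subgroup] subgroup.one_closed[OF scaling_group_subgroup] by blast
  next
    fix x y assume "x \<in> IAut1 G <#>\<^bsub>Aut\<^esub> scaling_group" "y \<in> IAut1 G <#>\<^bsub>Aut\<^esub> scaling_group"
    then obtain k q k' q' where *: "k \<in> IAut1 G" "q \<in> scaling_group" "k' \<in> IAut1 G" "q' \<in> scaling_group"
      "x = k \<otimes>\<^bsub>Aut\<^esub> q" "y = k' \<otimes>\<^bsub>Aut\<^esub> q'" unfolding set_mult_def by blast
    note c = k1[OF *(1)] q1[OF *(2)] k1[OF *(3)] q1[OF *(4)]
    have "x \<otimes>\<^bsub>Aut\<^esub> y = k \<otimes>\<^bsub>Aut\<^esub> (q \<otimes>\<^bsub>Aut\<^esub> k') \<otimes>\<^bsub>Aut\<^esub> q'"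
      unfolding *(5,6) using c by (simp add: A.m_assoc del: Aut_carrier)
    also have "\<dots> = (k \<otimes>\<^bsub>Aut\<^esub> k') \<otimes>\<^bsub>Aut\<^esub> (q \<otimes>\<^bsub>Aut\<^esub> q')"
      unfolding comm[OF *(2,3)] using c by (simp add: A.m_assoc del: Aut_carrier)
    finally show "x \<otimes>\<^bsub>Aut\<^esub> y \<in> IAut1 G <#>\<^bsub>Aut\<^esub> scaling_group" unfolding set_mult_def
      using subgroup.m_closed[OF IAut1_subgroup *(1,3)] subgroup.m_closed[OF scaling_group_subgroup *(2,4)] by blast
  next
    fix x assume "x \<in> IAut1 G <#>\<^bsub>Aut\<^esub> scaling_group"
    then obtain k q where *: "k \<in> IAut1 G" "q \<in> scaling_group" "x = k \<otimes>\<^bsub>Aut\<^esub> q" unfolding set_mult_def by blast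
    note c = k1[OF *(1)] q1[OF *(2)]
    have "inv\<^bsub>Aut\<^esub> x = inv\<^bsub>Aut\<^esub> q \<otimes>\<^bsub>Aut\<^esub> inv\<^bsub>Aut\<^esub> k" unfolding *(3) using c by (rule A.inv_mult_group)
    also have "\<dots> = inv\<^bsub>Aut\<^esub> k \<otimes>\<^bsub>Aut\<^esub> inv\<^bsub>Aut\<^esub> q"
      by (rule comm[OF subgroup.m_inv_closed[OF scaling_group_subgroup *(2)] subgroup.m_inv_closed[OF IAut1_subgroup *(1)]])
    finally show "inv\<^bsub>Aut\<^esub> x \<in> IAut1 G <#>\<^bsub>Aut\<^esub> scaling_group" unfolding set_mult_def
      using subgroup.m_inv_closed[OF IAut1_subgroup *(1)] subgroup.m_inv_closed[OF scaling_group_subgroup *(2)] by blast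
  qed
  then show "inertial_group \<subseteq> IAut1 G <#>\<^bsub>Aut\<^esub> scaling_group"
    unfolding inertial_group_def using inertial_in_product[OF a]
    by (intro A.generate_subgroup_incl) (auto simp: inertial_automorphism_iff)
  have "IAut1 G \<subseteq> inertial_group" using inertial_in_group by (auto simp: IAut1_iff)
  then show "IAut1 G <#>\<^bsub>Aut\<^esub> scaling_group \<subseteq> inertial_group"
    unfolding set_mult_def using scaling_group_le subgroup.m_closed[OF inertial_group_subgroup] by blast
qed

lemma IAut1_le_inertial_group: "IAut1 G \<subseteq> inertial_group"
  using inertial_in_group by (auto simp: IAut1_iff)

lemma scaling_group_IAut1_trivial:
  assumes a: "a \<in> carrier G" "a \<notin> torsion_subgroup G" and f: "f \<in> scaling_group" "unipotent f"
  shows "f = \<one>\<^bsub>Aut\<^esub>"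
proof -
  obtain m n where "canonical f m n" using scaling_group_canonical[OF f(1)] by blast
  then show ?thesis
    using canonical_unipotent_trivial[OF a scaling_group_auto[OF f(1)] _ f(2)]
    by (intro auto_eqI[OF scaling_group_auto[OF f(1)] Aut_one_closed]) (simp add: Aut_one)
qed

text \<open>Conjugation by \<open>k q\<close> with \<open>q\<close> in the central
  \<open>scaling_group\<close> is conjugation by \<open>k\<close>, so \<open>IAut1 G\<close> is
  normal in the product. The intersection is trivial by the canonical form.\<close>

lemma IAut_direct_product:
  assumes a: "a \<in> carrier G" "a \<notin> torsion_subgroup G"
  shows "internal_direct_product (IAut G) (IAut1 G) scaling_group"
proof -
  interpret A: group Aut by (rule Aut_group)
  have k1: "\<kappa> \<in> carrier Aut" if "\<kappa> \<in> IAut1 G" for \<kappa> using that by (simp add: IAut1_iff)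
  have q1: "q \<in> carrier Aut" if "q \<in> scaling_group" for q using scaling_group_auto that by simp
  have i1: "x \<in> carrier Aut" if "x \<in> inertial_group" for x using inertial_group_auto that by simp
  have "IAut1 G \<lhd> Aut\<lparr>carrier := inertial_group\<rparr>"
  proof (rule A.normal_inI[OF inertial_group_subgroup IAut1_subgroup IAut1_le_inertial_group])
    fix x h assume x: "x \<in> inertial_group" and h: "h \<in> IAut1 G"
    obtain k q where *: "k \<in> IAut1 G" "q \<in> scaling_group" "x = k \<otimes>\<^bsub>Aut\<^esub> q"
      using x inertial_group_product[OF a] unfolding set_mult_def by blast
    note c = k1[OF *(1)] q1[OF *(2)] k1[OF h] i1[OF x]
    let ?y = "k \<otimes>\<^bsub>Aut\<^esub> h \<otimes>\<^bsub>Aut\<^esub> inv\<^bsub>Aut\<^esub> k"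
    have hq: "q \<otimes>\<^bsub>Aut\<^esub> h = h \<otimes>\<^bsub>Aut\<^esub> q" using scaling_group_central[OF *(2)] h by (simp add: IAut1_iff)
    have "x \<otimes>\<^bsub>Aut\<^esub> h = k \<otimes>\<^bsub>Aut\<^esub> (q \<otimes>\<^bsub>Aut\<^esub> h)" unfolding *(3) using c by (simp add: A.m_assoc del: Aut_carrier)
    also have "\<dots> = ?y \<otimes>\<^bsub>Aut\<^esub> x"
    proof -
      have "inv\<^bsub>Aut\<^esub> k \<otimes>\<^bsub>Aut\<^esub> (k \<otimes>\<^bsub>Aut\<^esub> q) = q"
        using A.m_assoc[OF A.inv_closed[OF c(1)] c(1,2)] A.l_inv[OF c(1)] A.l_one[OF c(2)] by metis
      then show ?thesis unfolding hq *(3) using c by (simp add: A.m_assoc del: Aut_carrier)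
    qed
    finally have "x \<otimes>\<^bsub>Aut\<^esub> h \<otimes>\<^bsub>Aut\<^esub> inv\<^bsub>Aut\<^esub> x = ?y" using c by (simp add: A.m_assoc del: Aut_carrier)
    moreover have "?y \<in> IAut1 G" using *(1) h
      by (intro subgroup.m_closed[OF IAut1_subgroup] subgroup.m_inv_closed[OF IAut1_subgroup])
    ultimately show "x \<otimes>\<^bsub>Aut\<^esub> h \<otimes>\<^bsub>Aut\<^esub> inv\<^bsub>Aut\<^esub> x \<in> IAut1 G" by simp
  qed
  moreover have "scaling_group \<lhd> Aut\<lparr>carrier := inertial_group\<rparr>"
  proof (rule A.normal_inI[OF inertial_group_subgroup scaling_group_subgroup scaling_group_le])
    fix x h assume x: "x \<in> inertial_group" and h: "h \<in> scaling_group"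
    have "x \<otimes>\<^bsub>Aut\<^esub> h \<otimes>\<^bsub>Aut\<^esub> inv\<^bsub>Aut\<^esub> x = h"
      using scaling_group_central[OF h inertial_group_auto[OF x]] i1[OF x] q1[OF h] by (metis A.inv_solve_right A.m_closed)
    then show "x \<otimes>\<^bsub>Aut\<^esub> h \<otimes>\<^bsub>Aut\<^esub> inv\<^bsub>Aut\<^esub> x \<in> scaling_group" using h by simp
  qed
  moreover have "IAut1 G \<inter> scaling_group = {\<one>\<^bsub>Aut\<^esub>}"
  proof
    show "IAut1 G \<inter> scaling_group \<subseteq> {\<one>\<^bsub>Aut\<^esub>}"
    proof
      fix f assume f: "f \<in> IAut1 G \<inter> scaling_group"
      then have "unipotent f" using IAut1_iff by blast
      then show "f \<in> {\<one>\<^bsub>Aut\<^esub>}" using scaling_group_IAut1_trivial[OF a] f by blast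
    qed
    show "{\<one>\<^bsub>Aut\<^esub>} \<subseteq> IAut1 G \<inter> scaling_group"
      using subgroup.one_closed[OF IAut1_subgroup] subgroup.one_closed[OF scaling_group_subgroup] by blast
  qed
  moreover have "IAut1 G <#>\<^bsub>Aut\<lparr>carrier := inertial_group\<rparr>\<^esub> scaling_group = inertial_group"
    using inertial_group_product[OF a] by (simp add: set_mult_def)
  ultimately show ?thesis by (simp add: internal_direct_product_def IAut_eq)
qed

definition rational_factor :: "('a \<Rightarrow> 'a) \<Rightarrow> rat" where
  "rational_factor f = (THE r. \<exists>m n. m \<noteq> 0 \<and> n \<noteq> 0 \<and> rational_action G f m n \<and> r = of_int m / of_int n)"

lemma rational_factor_eq:
  assumes a: "a \<in> carrier G" "a \<notin> torsion_subgroup G" and f: "f \<in> auto G"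
    and mn: "m \<noteq> 0" "n \<noteq> 0" "rational_action G f m n"
  shows "rational_factor f = of_int m / of_int n"
  unfolding rational_factor_def
proof (rule the_equality)
  show "\<exists>m' n'. m' \<noteq> 0 \<and> n' \<noteq> 0 \<and> rational_action G f m' n' \<and> (of_int m / of_int n :: rat) = of_int m' / of_int n'"
    using mn by blast
  fix r :: rat assume "\<exists>m n. m \<noteq> 0 \<and> n \<noteq> 0 \<and> rational_action G f m n \<and> r = of_int m / of_int n"
  then obtain m' n' where *: "n' \<noteq> 0" "rational_action G f m' n'" "r = of_int m' / of_int n'" by blast
  have "m * n' = m' * n" by (rule rational_action_unique[OF a auto_hom[OF f] mn(3) *(2)])
  then have "(of_int m :: rat) * of_int n' = of_int m' * of_int n" by (metis of_int_mult)
  then show "r = of_int m / of_int n" using * mn by (simp add: frac_eq_eq)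
qed

lemma inertial_group_action:
  assumes a: "a \<in> carrier G" "a \<notin> torsion_subgroup G" and f: "f \<in> inertial_group"
  shows "\<exists>m n. m \<noteq> 0 \<and> n \<noteq> 0 \<and> rational_action G f m n"
  using f unfolding inertial_group_def
proof (induction rule: generate.induct)
  case one
  have "rational_action G \<one>\<^bsub>Aut\<^esub> 1 1"
    using Aut_one sub_one[OF torsion_subgroup] by (simp add: rational_action_def)
  then show ?case by (intro exI[of _ 1]) simp
next
  case (incl h)
  then have h: "h \<in> auto G" "inertial_map G h" by (auto simp: inertial_automorphism_iff)
  obtain m n where "n > 0" "m \<noteq> 0" "rational_action G h m n" using inertial_factor[OF h(2) a] by blast
  then show ?case by (intro exI[of _ m] exI[of _ n]) auto
next
  case (inv h)
  then have h: "h \<in> auto G" "inertial_map G h" by (auto simp: inertial_automorphism_iff)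
  obtain m n where "n > 0" "m \<noteq> 0" "rational_action G h m n" using inertial_factor[OF h(2) a] by blast
  then show ?case using rational_action_inv[OF h(1)] by (intro exI[of _ n] exI[of _ m]) auto
next
  case (eng h1 h2)
  then obtain m n m' n' where "m \<noteq> 0" "n \<noteq> 0" "rational_action G h1 m n" "m' \<noteq> 0" "n' \<noteq> 0" "rational_action G h2 m' n'"
    by blast
  moreover have "h1 \<in> auto G" "h2 \<in> auto G" using eng inertial_group_auto by (auto simp: inertial_group_def)
  ultimately show ?case using rational_action_mult[of h1 h2 m n m' n'] by (intro exI[of _ "m * m'"] exI[of _ "n * n'"]) auto
qed

text \<open>The factor by which a map acts modulo torsion is multiplicative. An element of its
  kernel is trivial modulo torsion, and in \<open>scaling_group\<close> only the identity has this
  property.\<close>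

lemma scaling_group_rational:
  assumes a: "a \<in> carrier G" "a \<notin> torsion_subgroup G"
  shows "\<exists>R. subgroup R rat_mult_group \<and> Aut\<lparr>carrier := scaling_group\<rparr> \<cong> rat_mult_group\<lparr>carrier := R\<rparr>"
proof -
  interpret A: group Aut by (rule Aut_group)
  have act: "\<exists>m n. m \<noteq> 0 \<and> n \<noteq> 0 \<and> rational_action G f m n" if "f \<in> scaling_group" for f
    using inertial_group_action[OF a] scaling_group_le that by blast
  have nz: "rational_factor f \<noteq> 0" if f: "f \<in> scaling_group" for f
  proof -
    obtain m n where "m \<noteq> 0" "n \<noteq> 0" "rational_action G f m n" using act[OF f] by blast
    then show ?thesis using rational_factor_eq[OF a scaling_group_auto[OF f]] by simp
  qed
  have mult: "rational_factor (f \<otimes>\<^bsub>Aut\<^esub> g) = rational_factor f * rational_factor g" if fg: "f \<in> scaling_group" "g \<in> scaling_group" for f g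
  proof -
    obtain m n where 1: "m \<noteq> 0" "n \<noteq> 0" "rational_action G f m n" using act[OF fg(1)] by blast
    obtain m' n' where 2: "m' \<noteq> 0" "n' \<noteq> 0" "rational_action G g m' n'" using act[OF fg(2)] by blast
    note fa = scaling_group_auto[OF fg(1)] scaling_group_auto[OF fg(2)]
    have "rational_factor (f \<otimes>\<^bsub>Aut\<^esub> g) = of_int (m * m') / of_int (n * n')"
      using 1 2 by (intro rational_factor_eq[OF a Aut_mult_closed[OF fa]] rational_action_mult[OF fa]) auto
    then show ?thesis using rational_factor_eq[OF a fa(1) 1] rational_factor_eq[OF a fa(2) 2] by simp
  qed
  have hom: "rational_factor \<in> hom (Aut\<lparr>carrier := scaling_group\<rparr>) rat_mult_group"
    using nz mult by (intro homI) (auto simp: rat_mult_group_def)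
  have gh: "group_hom (Aut\<lparr>carrier := scaling_group\<rparr>) rat_mult_group rational_factor"
    using A.subgroup_imp_group[OF scaling_group_subgroup] group_rat_mult hom
    by (simp add: group_hom_def group_hom_axioms_def)
  have R: "subgroup (rational_factor ` scaling_group) rat_mult_group" using group_hom.img_is_subgroup[OF gh] by simp
  have one: "f = \<one>\<^bsub>Aut\<^esub>" if f: "f \<in> scaling_group" "rational_factor f = 1" for f
  proof -
    obtain m n where 1: "m \<noteq> 0" "n \<noteq> 0" "rational_action G f m n" using act[OF f(1)] by blast
    have "m = n" using rational_factor_eq[OF a scaling_group_auto[OF f(1)] 1] f(2) 1 by simp
    then have "rational_action G f 1 1" using rational_action_cancel[OF auto_hom[OF scaling_group_auto[OF f(1)]], of m 1 1] 1 by simp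
    then have "unipotent f" using unipotent_iff[OF auto_hom[OF scaling_group_auto[OF f(1)]]] by simp
    then show ?thesis by (rule scaling_group_IAut1_trivial[OF a f(1)])
  qed
  have inj: "inj_on rational_factor scaling_group"
  proof (rule inj_onI)
    fix f g assume fg: "f \<in> scaling_group" "g \<in> scaling_group" "rational_factor f = rational_factor g"
    have ig: "inv\<^bsub>Aut\<^esub> g \<in> scaling_group" by (rule subgroup.m_inv_closed[OF scaling_group_subgroup fg(2)])
    have c: "f \<in> carrier Aut" "g \<in> carrier Aut" using scaling_group_auto fg by auto
    have "rational_factor (f \<otimes>\<^bsub>Aut\<^esub> inv\<^bsub>Aut\<^esub> g) = rational_factor (g \<otimes>\<^bsub>Aut\<^esub> inv\<^bsub>Aut\<^esub> g)"
      using mult[OF fg(1) ig] mult[OF fg(2) ig] fg(3) by simp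
    also have "g \<otimes>\<^bsub>Aut\<^esub> inv\<^bsub>Aut\<^esub> g = \<one>\<^bsub>Aut\<^esub>" using c(2) by (rule A.r_inv)
    also have "rational_factor \<one>\<^bsub>Aut\<^esub> = 1"
    proof -
      have "rational_action G \<one>\<^bsub>Aut\<^esub> 1 1"
        using Aut_one sub_one[OF torsion_subgroup] by (simp add: rational_action_def)
      then show ?thesis using rational_factor_eq[OF a Aut_one_closed, of 1 1] by simp
    qed
    finally have "f \<otimes>\<^bsub>Aut\<^esub> inv\<^bsub>Aut\<^esub> g = \<one>\<^bsub>Aut\<^esub>"
      using one subgroup.m_closed[OF scaling_group_subgroup fg(1) ig] by blast
    then show "f = g" using c by (metis A.inv_closed A.inv_equality A.inv_inv)
  qed
  have "rational_factor \<in> iso (Aut\<lparr>carrier := scaling_group\<rparr>) (rat_mult_group\<lparr>carrier := rational_factor ` scaling_group\<rparr>)"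
    using hom inj by (auto simp: iso_def hom_def bij_betw_def)
  then show ?thesis using R is_isoI by blast
qed

section \<open>Automorphisms acting by powers on primary components\<close>

text \<open>Equivalently, the elements of \<open>IAut1 G\<close> that map every torsion subgroup of
  \<open>G\<close> into itself.\<close>

definition \<Gamma> :: "('a \<Rightarrow> 'a) set" where
  "\<Gamma> = {f \<in> IAut1 G. \<forall>p. prime p \<longrightarrow> power_on G f (primary G p)}"

lemma power_on_one: "K \<subseteq> carrier G \<Longrightarrow> power_on G \<one>\<^bsub>Aut\<^esub> K"
  unfolding power_on_def using Aut_one by (auto intro!: exI[of _ 1])

lemma power_on_mult:
  assumes "f \<in> auto G" "g \<in> auto G" "power_on G f K" "power_on G g K" "K \<subseteq> carrier G"
  shows "power_on G (f \<otimes>\<^bsub>Aut\<^esub> g) K"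
  unfolding power_on_def
proof
  fix x assume x: "x \<in> K"
  then have xc: "x \<in> carrier G" using assms by blast
  obtain k where k: "g x = x [^] (k::int)" using assms x by (auto simp: power_on_def)
  obtain l where l: "f x = x [^] (l::int)" using assms x by (auto simp: power_on_def)
  have "(f \<otimes>\<^bsub>Aut\<^esub> g) x = x [^] (l * k)"
    using Aut_mult[OF assms(1,2) xc] k l xc by (simp add: hom_pow[OF auto_hom[OF assms(1)]] int_pow_pow)
  then show "\<exists>k::int. (f \<otimes>\<^bsub>Aut\<^esub> g) x = x [^] k" by blast
qed

text \<open>A torsion element generates a finite cyclic group, which \<open>f\<close> maps into
  itself injectively and hence onto itself.\<close>

lemma power_on_inv:
  assumes f: "f \<in> auto G" "power_on G f K" and K: "subgroup K G" "K \<subseteq> torsion_subgroup G"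
  shows "power_on G (inv\<^bsub>Aut\<^esub> f) K"
  unfolding power_on_def
proof
  fix x assume x: "x \<in> K"
  then have xc: "x \<in> carrier G" using sub_carr[OF K(1)] by blast
  obtain k where k: "f x = x [^] (k::int)" using f x by (auto simp: power_on_def)
  define C where "C = adjoin G {\<one>} x"
  have Cc: "C \<subseteq> carrier G" using sub_carr[OF adjoin_subgroup[OF subgroup_one_set xc]] by (auto simp: C_def)
  have "x \<in> torsion_subgroup G" using x K(2) by blast
  then have "finite C" unfolding C_def by (intro adjoin_finite' subgroup_one_set) auto
  moreover have "f ` C \<subseteq> C"
  proof
    fix y assume "y \<in> f ` C"
    then obtain l where l: "y = f (x [^] (l::int))" using xc by (auto simp: C_def adjoin_def)
    have "y = \<one> \<otimes> x [^] (k * l)" using l k xc by (simp add: hom_pow[OF auto_hom[OF f(1)]] int_pow_pow)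
    then show "y \<in> C" by (auto simp: C_def adjoin_def)
  qed
  moreover have "inj_on f C" using iso_inj[OF auto_iso[OF f(1)]] Cc by (rule inj_on_subset)
  ultimately have "f ` C = C" by (rule endo_inj_surj)
  moreover have "x \<in> C" unfolding C_def by (rule adjoin_self[OF subgroup_one_set xc])
  ultimately obtain y where y: "y \<in> C" "x = f y" by (metis imageE)
  then obtain l where l: "y = x [^] (l::int)" using xc by (auto simp: C_def adjoin_def)
  have "(inv\<^bsub>Aut\<^esub> f) x = y" using y Cc Aut_inv_left[OF f(1), of y] by auto
  then show "\<exists>k::int. (inv\<^bsub>Aut\<^esub> f) x = x [^] k" using l by blast
qed

lemma primary_carr: "primary G p \<subseteq> carrier G"
  by (auto simp: primary_def)

lemma \<Gamma>_subgroup: "subgroup \<Gamma> Aut"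
proof (rule group.subgroup_if_closed[OF Aut_group])
  show "\<Gamma> \<subseteq> carrier Aut" by (auto simp: \<Gamma>_def IAut1_iff)
  show "\<one>\<^bsub>Aut\<^esub> \<in> \<Gamma>" using subgroup.one_closed[OF IAut1_subgroup] power_on_one primary_carr by (simp add: \<Gamma>_def)
  show "f \<otimes>\<^bsub>Aut\<^esub> g \<in> \<Gamma>" if "f \<in> \<Gamma>" "g \<in> \<Gamma>" for f g
    using that subgroup.m_closed[OF IAut1_subgroup] power_on_mult primary_carr by (simp add: \<Gamma>_def IAut1_iff)
  show "inv\<^bsub>Aut\<^esub> f \<in> \<Gamma>" if "f \<in> \<Gamma>" for f
    using that subgroup.m_inv_closed[OF IAut1_subgroup] power_on_inv primary_subgroup primary_torsion
    by (simp add: \<Gamma>_def IAut1_iff)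
qed

lemma \<Gamma>_normal: "\<Gamma> \<lhd> Aut\<lparr>carrier := IAut1 G\<rparr>"
proof (rule group.normal_inI[OF Aut_group IAut1_subgroup \<Gamma>_subgroup])
  show "\<Gamma> \<subseteq> IAut1 G" by (auto simp: \<Gamma>_def)
  fix x h assume x: "x \<in> IAut1 G" and h: "h \<in> \<Gamma>"
  have xa: "x \<in> auto G" and ha: "h \<in> auto G" "h \<in> IAut1 G" using x h by (auto simp: \<Gamma>_def IAut1_iff)
  note ia = Aut_inv_closed[OF xa]
  have "power_on G (x \<otimes>\<^bsub>Aut\<^esub> h \<otimes>\<^bsub>Aut\<^esub> inv\<^bsub>Aut\<^esub> x) (primary G p)" if p: "prime p" for p
    unfolding power_on_def
  proof
    fix y assume y: "y \<in> primary G p"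
    then have yc: "y \<in> carrier G" using primary_carr by blast
    define z where "z = (inv\<^bsub>Aut\<^esub> x) y"
    have z: "z \<in> primary G p" "z \<in> carrier G" "x z = y"
      using hom_primary[OF auto_hom[OF ia]] y auto_carr[OF ia yc] Aut_inv_right[OF xa yc] by (auto simp: z_def)
    obtain k where k: "h z = z [^] (k::int)" using h z p by (auto simp: \<Gamma>_def power_on_def)
    have "(x \<otimes>\<^bsub>Aut\<^esub> h \<otimes>\<^bsub>Aut\<^esub> inv\<^bsub>Aut\<^esub> x) y = x (h z)"
      using Aut_mult[OF Aut_mult_closed[OF xa ha(1)] ia yc] Aut_mult[OF xa ha(1) z(2)] by (simp add: z_def)
    also have "\<dots> = y [^] k" unfolding k using z hom_pow[OF auto_hom[OF xa], of z k] by simp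
    finally show "\<exists>k::int. (x \<otimes>\<^bsub>Aut\<^esub> h \<otimes>\<^bsub>Aut\<^esub> inv\<^bsub>Aut\<^esub> x) y = y [^] k" by blast
  qed
  moreover have "x \<otimes>\<^bsub>Aut\<^esub> h \<otimes>\<^bsub>Aut\<^esub> inv\<^bsub>Aut\<^esub> x \<in> IAut1 G"
    using x ha by (intro subgroup.m_closed[OF IAut1_subgroup] subgroup.m_inv_closed[OF IAut1_subgroup])
  ultimately show "x \<otimes>\<^bsub>Aut\<^esub> h \<otimes>\<^bsub>Aut\<^esub> inv\<^bsub>Aut\<^esub> x \<in> \<Gamma>" by (simp add: \<Gamma>_def)
qed

lemma image_comp_inv:
  assumes "f \<in> auto G" "W \<subseteq> carrier G" "f ` W = W" shows "(inv\<^bsub>Aut\<^esub> f) ` W = W"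
proof -
  have "(\<lambda>x. (inv\<^bsub>Aut\<^esub> f) (f x)) ` W = (\<lambda>x. x) ` W"
    by (rule image_cong[OF refl]) (use Aut_inv_left[OF assms(1)] assms(2) in blast)
  then have "(inv\<^bsub>Aut\<^esub> f) ` (f ` W) = W" by (simp only: image_image image_ident)
  then show ?thesis using assms(3) by simp
qed

definition bounded_primary :: "int \<Rightarrow> nat \<Rightarrow> 'a set" where
  "bounded_primary p j = {y \<in> primary G p. y [^] (p ^ j) = \<one>}"

text \<open>\<open>j\<close> is the bound for the part of the component outside \<open>K\<close>. A
  map that fixes the layer of exponent \<open>p ^ j\<close> and multiplies \<open>k\<close> in
  \<open>K\<close> by \<open>l\<close> does the same to \<open>k + y\<close> with \<open>y\<close>
  in the layer: either \<open>k\<close> is in the layer too, or the order of \<open>k\<close> forces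
  \<open>l\<close> to be \<open>1\<close> modulo \<open>p ^ j\<close>.\<close>

lemma finite_action_on_primary:
  assumes p: "prime p" and F: "finite F" "F \<subseteq> auto G" "\<forall>g\<in>F. inertial_map G g"
  obtains j where "finite ((\<lambda>\<theta>. restrict \<theta> (bounded_primary p j)) ` generate Aut F)"
    "\<forall>\<theta>\<in>generate Aut F. (\<forall>y\<in>bounded_primary p j. \<theta> y = y) \<longrightarrow> power_on G \<theta> (primary G p)"
proof -
  let ?P = "primary G p"
  note P = p_subgroup_primary[OF p]
  obtain K j where K: "subgroup K G" "K \<subseteq> ?P" "\<forall>g\<in>F. power_on G g K"
    "\<forall>x\<in>?P. \<exists>k\<in>K. \<exists>y\<in>?P. y [^] (p ^ j) = \<one> \<and> x = k \<otimes> y"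
    using inertial_primary_structure[OF p F(1,3)] by blast
  have F': "\<forall>g\<in>F. inertial_map G g \<and> g ` ?P \<subseteq> ?P" using F hom_primary inertial_hom by blast
  obtain C where C: "finite_socle G p ?P C" "\<forall>g\<in>F. power_on G g C"
    using inertial_common_power_on[OF P F(1) F'] by blast
  have sC: "subgroup C G" "C \<subseteq> ?P" using C by (auto simp: finite_socle_def)
  obtain S where S: "finite S" "S \<subseteq> {y\<in>?P. y [^] (p ^ j) = \<one>}"
    "\<forall>y\<in>{y\<in>?P. y [^] (p ^ j) = \<one>}. \<exists>c\<in>C. \<exists>s\<in>S. c [^] (p ^ j) = \<one> \<and> y = c \<otimes> s"
    by (rule bounded_primary_cover[OF p C(1)])
  have ST: "S \<subseteq> torsion_subgroup G" using S(2) primary_torsion[OF p] by blast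
  obtain W where W: "subgroup W G" "finite W" "S \<subseteq> W" "\<forall>g\<in>F. g ` W = W"
    using finite_invariant[OF F(1,3) S(1) ST] by blast
  have Wc: "W \<subseteq> carrier G" using sub_carr[OF W(1)] by blast
  have KT: "K \<subseteq> torsion_subgroup G" "C \<subseteq> torsion_subgroup G" using K(2) sC(2) primary_torsion[OF p] by auto
  have Kc: "K \<subseteq> carrier G" "C \<subseteq> carrier G" using sub_carr[OF K(1)] sub_carr[OF sC(1)] by auto
  have gen: "\<theta> \<in> auto G \<and> power_on G \<theta> K \<and> power_on G \<theta> C \<and> \<theta> ` W = W" if "\<theta> \<in> generate Aut F" for \<theta>
    using that
  proof (induction rule: generate.induct)
    case one
    have "\<one>\<^bsub>Aut\<^esub> ` W = (\<lambda>x. x) ` W"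
      by (rule image_cong[OF refl]) (use Aut_one Wc in blast)
    then have "\<one>\<^bsub>Aut\<^esub> ` W = W" by (simp only: image_ident)
    then show ?case using Aut_one_closed power_on_one Kc by blast
  next
    case (incl h)
    then show ?case using F(2) K(3) C(2) W(4) by blast
  next
    case (inv h)
    then have h: "h \<in> auto G" "power_on G h K" "power_on G h C" "h ` W = W" using F(2) K(3) C(2) W(4) by blast+
    then show ?case
      using Aut_inv_closed power_on_inv[OF _ _ K(1) KT(1)] power_on_inv[OF _ _ sC(1) KT(2)] image_comp_inv[OF _ Wc] by blast
  next
    case (eng f g)
    then have fg: "f \<in> auto G" "g \<in> auto G" by blast+
    have "(f \<otimes>\<^bsub>Aut\<^esub> g) ` W = (\<lambda>x. f (g x)) ` W"
      by (rule image_cong[OF refl]) (use Aut_mult[OF fg] Wc in blast)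
    then have "(f \<otimes>\<^bsub>Aut\<^esub> g) ` W = f ` (g ` W)" by (simp only: image_image)
    then show ?case using eng Aut_mult_closed power_on_mult Kc by simp
  qed
  have fin: "finite ((\<lambda>\<theta>. restrict \<theta> (bounded_primary p j)) ` generate Aut F)"
  proof (rule finite_restrictions[OF W(2) Wc])
    show "{c\<in>C. c [^] (p ^ j) = \<one>} \<subseteq> carrier G" using Kc by blast
    show "\<forall>c\<in>{c\<in>C. c [^] (p ^ j) = \<one>}. c [^] (p ^ j) = \<one>" by blast
    show "p ^ j > 0" using prime_gt_0_int[OF p] by simp
    show "\<forall>y\<in>bounded_primary p j. \<exists>c\<in>{c\<in>C. c [^] (p ^ j) = \<one>}. \<exists>w\<in>W. y = c \<otimes> w"
      using S(3) W(3) unfolding bounded_primary_def by blast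
    show "\<forall>\<theta>\<in>generate Aut F. \<theta> \<in> hom G G \<and> \<theta> ` W \<subseteq> W \<and> (\<exists>k::int. \<forall>c\<in>{c\<in>C. c [^] (p ^ j) = \<one>}. \<theta> c = c [^] k)"
    proof
      fix \<theta> assume "\<theta> \<in> generate Aut F"
      then have \<theta>: "\<theta> \<in> hom G G" "power_on G \<theta> C" "\<theta> ` W = W" using gen auto_hom by blast+
      have "\<exists>k::int. \<forall>c\<in>{c\<in>C. c [^] (p ^ j) = \<one>}. \<theta> c = c [^] k"
      proof (rule power_on_uniform[OF p pow_kernel_subgroup[OF sC(1)] \<theta>(1), of "p ^ j" j])
        show "power_on G \<theta> {c\<in>C. c [^] (p ^ j) = \<one>}" using \<theta>(2) by (auto simp: power_on_def)
      qed simp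
      then show "\<theta> \<in> hom G G \<and> \<theta> ` W \<subseteq> W \<and> (\<exists>k::int. \<forall>c\<in>{c\<in>C. c [^] (p ^ j) = \<one>}. \<theta> c = c [^] k)"
        using \<theta> by blast
    qed
  qed
  have "power_on G \<theta> ?P" if \<theta>: "\<theta> \<in> generate Aut F" and fixed: "\<forall>y\<in>bounded_primary p j. \<theta> y = y" for \<theta>
    unfolding power_on_def
  proof
    have ta: "\<theta> \<in> auto G" "power_on G \<theta> K" using gen[OF \<theta>] by auto
    fix x assume x: "x \<in> ?P"
    obtain k y where ky: "k \<in> K" "y \<in> ?P" "y [^] (p ^ j) = \<one>" "x = k \<otimes> y" using K(4) x by blast
    have c: "k \<in> carrier G" "y \<in> carrier G" "k \<in> ?P" using ky K(2) Kc primary_carr[of p] by blast+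
    have ty: "\<theta> y = y" using fixed ky by (simp add: bounded_primary_def)
    have tx: "\<theta> x = \<theta> k \<otimes> y" using ky(4) c ty hom_mult[OF auto_hom[OF ta(1)]] by simp
    obtain l where l: "\<theta> k = k [^] (l::int)" using ta(2) ky(1) by (auto simp: power_on_def)
    show "\<exists>l::int. \<theta> x = x [^] l"
    proof (cases "k [^] (p ^ j) = \<one>")
      case True
      then have "\<theta> k = k" using fixed c by (simp add: bounded_primary_def)
      then have "\<theta> x = x [^] (1::int)" using tx ky(4) c by simp
      then show ?thesis by blast
    next
      case False
      obtain N where N: "k [^] (p ^ N) = \<one>" using c(3) by (auto simp: primary_def)
      have "k \<noteq> \<one>" using False by auto
      then obtain m where m: "k [^] (p ^ Suc m) = \<one>" "k [^] (p ^ m) \<noteq> \<one>" using exact_order[OF c(1) N] by blast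
      have jm: "j \<le> m"
      proof (rule ccontr)
        assume "\<not> j \<le> m"
        then have "Suc m \<le> j" by simp
        then show False using pow_p_mono[OF c(1) m(1)] False by blast
      qed
      \<comment> \<open>The multiple \<open>p ^ e k\<close> has order exactly \<open>p ^ j\<close>
        and is fixed by \<open>\<theta>\<close>, which determines \<open>l\<close> modulo
        \<open>p ^ j\<close>.\<close>
      define e where "e = Suc m - j"
      have e: "p ^ e * p ^ j = p ^ Suc m" using jm by (simp add: e_def flip: power_add)
      have "(k [^] (p ^ e)) [^] (p ^ j) = \<one>" using c e m(1) by (simp add: int_pow_pow)
      moreover have "k [^] (p ^ e) \<in> ?P" by (rule sub_pow[OF primary_subgroup c(3)])
      ultimately have "\<theta> (k [^] (p ^ e)) = k [^] (p ^ e)" using fixed by (simp add: bounded_primary_def)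
      moreover have "\<theta> (k [^] (p ^ e)) = k [^] (l * p ^ e)" using hom_pow[OF auto_hom[OF ta(1)] c(1)] l c by (simp add: int_pow_pow)
      ultimately have "k [^] (l * p ^ e) = k [^] (p ^ e)" by simp
      then have "k [^] (l * p ^ e - p ^ e) = \<one>" using c by (simp add: int_pow_diff)
      then have "p ^ e * p ^ j dvd l * p ^ e - p ^ e" using pow_one_dvd[OF p c(1) m] e by simp
      moreover have "l * p ^ e - p ^ e = p ^ e * (l - 1)" by (simp add: algebra_simps)
      ultimately have "p ^ j dvd l - 1" using p by (simp add: dvd_mult_cancel_left)
      then have "y [^] l = y [^] (1::int)" by (rule pow_cong[OF c(2) ky(3)])
      then have "\<theta> x = x [^] l" using tx l ky(4) c by (simp add: int_pow_distrib)
      then show ?thesis by blast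
    qed
  qed
  then show ?thesis using that[of j] fin by blast
qed

lemma bounded_primary_invariant:
  assumes "f \<in> auto G" "y \<in> bounded_primary p j" shows "f y \<in> bounded_primary p j"
proof -
  have y: "y \<in> primary G p" "y [^] (p ^ j) = \<one>" "y \<in> carrier G" using assms primary_carr by (auto simp: bounded_primary_def)
  have "f y [^] (p ^ j) = \<one>" using hom_pow[OF auto_hom[OF assms(1)] y(3), of "p ^ j"] y(2) hom_one'[OF auto_hom[OF assms(1)]] by simp
  then show ?thesis using hom_primary[OF auto_hom[OF assms(1)]] y by (auto simp: bounded_primary_def)
qed

text \<open>\<open>D\<close> records the action on one bounded layer for each of the finitely many
  exceptional primes. Equal records mean that the quotient of the two maps fixes these layers, and
  on all other components every map generated by \<open>F\<close> acts by multiples anyway.\<close>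

lemma IAut1_mod_\<Gamma>_finite:
  assumes F: "finite F" "F \<subseteq> IAut1 G"
  obtains D :: "('a \<Rightarrow> 'a) \<Rightarrow> int \<Rightarrow> 'a \<Rightarrow> 'a" where "finite (D ` generate Aut F)"
    "\<forall>\<theta>\<in>generate Aut F. \<forall>\<eta>\<in>generate Aut F. D \<theta> = D \<eta> \<longrightarrow> \<theta> \<otimes>\<^bsub>Aut\<^esub> inv\<^bsub>Aut\<^esub> \<eta> \<in> \<Gamma>"
proof -
  interpret A: group Aut by (rule Aut_group)
  have Fa: "F \<subseteq> auto G" "\<forall>g\<in>F. inertial_map G g" using F by (auto simp: IAut1_iff)
  let ?M = "generate Aut F"
  have M1: "?M \<subseteq> IAut1 G" by (rule A.generate_subgroup_incl[OF F(2) IAut1_subgroup])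
  have sM: "subgroup ?M Aut" by (rule A.generate_is_subgroup) (use Fa in simp)
  obtain \<P> where P: "finite \<P>" "\<forall>p\<in>\<P>. prime (p::int)"
    "\<forall>g\<in>F. \<forall>p. prime p \<longrightarrow> p \<notin> \<P> \<longrightarrow> power_on G g (primary G p)"
    by (rule inertial_power_on_almost_all[OF F(1) Fa(2)])
  have out: "power_on G \<theta> (primary G p)" if p: "prime p" "p \<notin> \<P>" and \<theta>: "\<theta> \<in> ?M" for p \<theta>
    using \<theta>
  proof (induction rule: generate.induct)
    case one
    then show ?case using power_on_one primary_carr by blast
  next
    case (incl h)
    then show ?case using P(3) p by blast
  next
    case (inv h)
    then show ?case using P(3) p power_on_inv[OF _ _ primary_subgroup primary_torsion[OF p(1)]] Fa by blast
  next
    case (eng f g)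
    then show ?case using power_on_mult[OF _ _ _ _ primary_carr] subgroup.mem_carrier[OF sM] by simp
  qed
  have "\<forall>p\<in>\<P>. \<exists>j. finite ((\<lambda>\<theta>. restrict \<theta> (bounded_primary p j)) ` ?M) \<and>
    (\<forall>\<theta>\<in>?M. (\<forall>y\<in>bounded_primary p j. \<theta> y = y) \<longrightarrow> power_on G \<theta> (primary G p))"
    using finite_action_on_primary[OF _ F(1) Fa] P(2) by metis
  then obtain j where j: "\<forall>p\<in>\<P>. finite ((\<lambda>\<theta>. restrict \<theta> (bounded_primary p (j p))) ` ?M) \<and>
    (\<forall>\<theta>\<in>?M. (\<forall>y\<in>bounded_primary p (j p). \<theta> y = y) \<longrightarrow> power_on G \<theta> (primary G p))" by metis
  \<comment> \<open>Restricting in both arguments makes the values of \<open>D\<close> lie in a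
    product of finite sets.\<close>
  define D where "D \<theta> = (\<lambda>p\<in>\<P>. restrict \<theta> (bounded_primary p (j p)))" for \<theta> :: "'a \<Rightarrow> 'a"
  have "D ` ?M \<subseteq> (\<Pi>\<^sub>E p\<in>\<P>. (\<lambda>\<theta>. restrict \<theta> (bounded_primary p (j p))) ` ?M)"
    by (auto simp: D_def)
  moreover have "finite (\<Pi>\<^sub>E p\<in>\<P>. (\<lambda>\<theta>. restrict \<theta> (bounded_primary p (j p))) ` ?M)"
    using P(1) j by (intro finite_PiE) auto
  ultimately have fin: "finite (D ` ?M)" using finite_subset by blast
  have "\<theta> \<otimes>\<^bsub>Aut\<^esub> inv\<^bsub>Aut\<^esub> \<eta> \<in> \<Gamma>" if \<theta>: "\<theta> \<in> ?M" and \<eta>: "\<eta> \<in> ?M" and D: "D \<theta> = D \<eta>" for \<theta> \<eta>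
  proof -
    have ta: "\<theta> \<in> auto G" "\<eta> \<in> auto G" using \<theta> \<eta> M1 by (auto simp: IAut1_iff)
    note ia = Aut_inv_closed[OF ta(2)]
    have m: "\<theta> \<otimes>\<^bsub>Aut\<^esub> inv\<^bsub>Aut\<^esub> \<eta> \<in> ?M"
      using \<theta> \<eta> by (intro subgroup.m_closed[OF sM] subgroup.m_inv_closed[OF sM])
    have "power_on G (\<theta> \<otimes>\<^bsub>Aut\<^esub> inv\<^bsub>Aut\<^esub> \<eta>) (primary G p)" if p: "prime p" for p
    proof (cases "p \<in> \<P>")
      case True
      have "(\<theta> \<otimes>\<^bsub>Aut\<^esub> inv\<^bsub>Aut\<^esub> \<eta>) y = y" if y: "y \<in> bounded_primary p (j p)" for y
      proof -
        have yc: "y \<in> carrier G" using y primary_carr by (auto simp: bounded_primary_def)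
        define z where "z = (inv\<^bsub>Aut\<^esub> \<eta>) y"
        have z: "z \<in> bounded_primary p (j p)" unfolding z_def by (rule bounded_primary_invariant[OF ia y])
        have "restrict \<theta> (bounded_primary p (j p)) = restrict \<eta> (bounded_primary p (j p))"
          using fun_cong[OF D, of p] True by (simp add: D_def)
        then have "\<theta> z = \<eta> z" using z by (metis restrict_apply')
        also have "\<dots> = y" unfolding z_def by (rule Aut_inv_right[OF ta(2) yc])
        finally show ?thesis using Aut_mult[OF ta(1) ia yc] by (simp add: z_def)
      qed
      then show ?thesis using j True m by blast
    next
      case False
      then show ?thesis using out[OF p _ m] by blast
    qed
    then show ?thesis using m M1 by (auto simp: \<Gamma>_def)
  qed
  then show ?thesis using that[of D] fin by blast
qed

lemma IAut1_mod_\<Gamma>_locally_finite: "locally_finite (Aut\<lparr>carrier := IAut1 G\<rparr> Mod \<Gamma>)"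
  unfolding locally_finite_def
proof (intro allI impI)
  interpret A: group Aut by (rule Aut_group)
  let ?N = "Aut\<lparr>carrier := IAut1 G\<rparr>"
  interpret N: group ?N by (rule A.subgroup_imp_group[OF IAut1_subgroup])
  interpret nN: normal \<Gamma> ?N by (rule \<Gamma>_normal)
  fix S assume S: "S \<subseteq> carrier (?N Mod \<Gamma>)" "finite S"
  define c where "c x = \<Gamma> #>\<^bsub>?N\<^esub> x" for x
  have "S \<subseteq> c ` IAut1 G" using S(1) by (simp add: carrier_FactGroup c_def)
  then obtain F where F: "F \<subseteq> IAut1 G" "finite F" "S = c ` F" using finite_subset_image[OF S(2)] by metis
  have "c = (\<lambda>x. \<Gamma> #>\<^bsub>?N\<^esub> x)" by (rule ext) (simp add: c_def)
  then have "c \<in> hom ?N (?N Mod \<Gamma>)" using nN.r_coset_hom_Mod by (simp only:)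
  then have gh: "group_hom ?N (?N Mod \<Gamma>) c"
    using nN.factorgroup_is_group N.is_group by (simp add: group_hom_def group_hom_axioms_def)
  have "generate (?N Mod \<Gamma>) S = c ` generate ?N F"
    unfolding F(3) using group_hom.generate_img[OF gh, of F] F(1) by simp
  also have "generate ?N F = generate Aut F" by (rule A.generate_consistent[OF F(1) IAut1_subgroup])
  finally have e: "generate (?N Mod \<Gamma>) S = c ` generate Aut F" .
  obtain D :: "('a \<Rightarrow> 'a) \<Rightarrow> int \<Rightarrow> 'a \<Rightarrow> 'a" where D: "finite (D ` generate Aut F)"
    "\<forall>\<theta>\<in>generate Aut F. \<forall>\<eta>\<in>generate Aut F. D \<theta> = D \<eta> \<longrightarrow> \<theta> \<otimes>\<^bsub>Aut\<^esub> inv\<^bsub>Aut\<^esub> \<eta> \<in> \<Gamma>"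
    by (rule IAut1_mod_\<Gamma>_finite[OF F(2,1)])
  have M1: "generate Aut F \<subseteq> IAut1 G" by (rule A.generate_subgroup_incl[OF F(1) IAut1_subgroup])
  have cD: "c \<theta> = c \<eta>" if \<theta>: "\<theta> \<in> generate Aut F" "\<eta> \<in> generate Aut F" "D \<theta> = D \<eta>" for \<theta> \<eta>
  proof -
    have tN: "\<theta> \<in> carrier Aut" "\<eta> \<in> carrier Aut" "\<eta> \<in> carrier ?N" using \<theta> M1 by (auto simp: IAut1_iff)
    have "\<theta> \<otimes>\<^bsub>Aut\<^esub> inv\<^bsub>Aut\<^esub> \<eta> \<in> \<Gamma>" using D(2) \<theta> by blast
    moreover have "\<theta> = (\<theta> \<otimes>\<^bsub>Aut\<^esub> inv\<^bsub>Aut\<^esub> \<eta>) \<otimes>\<^bsub>?N\<^esub> \<eta>" using tN by (simp add: A.m_assoc del: Aut_carrier)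
    ultimately have "\<theta> \<in> \<Gamma> #>\<^bsub>?N\<^esub> \<eta>" unfolding r_coset_def by blast
    then show ?thesis unfolding c_def using N.repr_independence[OF _ tN(3) nN.is_subgroup] by simp
  qed
  \<comment> \<open>The coset depends only on the record \<open>D \<theta>\<close>, so choosing a
    preimage of each record reaches all cosets.\<close>
  define s where "s d = c (SOME \<theta>. \<theta> \<in> generate Aut F \<and> D \<theta> = d)" for d
  have "c ` generate Aut F \<subseteq> s ` (D ` generate Aut F)"
  proof
    fix u assume "u \<in> c ` generate Aut F"
    then obtain \<theta> where \<theta>: "\<theta> \<in> generate Aut F" "u = c \<theta>" by blast
    let ?r = "SOME \<eta>. \<eta> \<in> generate Aut F \<and> D \<eta> = D \<theta>"
    have "?r \<in> generate Aut F \<and> D ?r = D \<theta>" by (rule someI[of _ \<theta>]) (use \<theta> in simp)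
    then have "c ?r = c \<theta>" using cD \<theta> by blast
    then have "u = s (D \<theta>)" by (simp add: s_def \<theta>(2))
    then show "u \<in> s ` (D ` generate Aut F)" using \<theta> by blast
  qed
  then show "finite (generate (?N Mod \<Gamma>) S)" unfolding e using D(1) finite_surj by blast
qed

text \<open>Part of the stability group of the series \<open>0 \<le> T \<le> G\<close>, which is
  abelian because \<open>f - 1\<close> corresponds to a homomorphism from \<open>G/T\<close> to
  \<open>T\<close> and composition to addition. Finiteness of the image gives finite order.\<close>

definition finitary_stable :: "('a \<Rightarrow> 'a) set" where
  "finitary_stable = {f \<in> auto G. unipotent f \<and> (\<forall>t\<in>torsion_subgroup G. f t = t) \<and>
     finite ((\<lambda>x. f x \<otimes> inv x) ` carrier G)}"

section \<open>The derived subgroup\<close>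

lemma split_diff:
  assumes "x \<in> carrier G" "y \<in> carrier G" shows "x \<otimes> (y \<otimes> inv x) = y"
  using assms m_comm[of x "y \<otimes> inv x"] by (simp add: m_assoc)

text \<open>\<open>f\<close> fixes the torsion element \<open>g x - x\<close>, so the displacements
  of \<open>f\<close> and \<open>g\<close> simply add up.\<close>

lemma finitary_stable_mult_apply:
  assumes f: "f \<in> finitary_stable" and g: "g \<in> finitary_stable" and x: "x \<in> carrier G"
  shows "f (g x) = x \<otimes> (f x \<otimes> inv x) \<otimes> (g x \<otimes> inv x)"
proof -
  have fa: "f \<in> auto G" "g \<in> auto G" using f g by (auto simp: finitary_stable_def)
  have c: "g x \<in> carrier G" "f x \<in> carrier G" using fa x auto_carr by auto
  have T: "g x \<otimes> inv x \<in> torsion_subgroup G" using g x by (simp add: finitary_stable_def unipotent_def)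
  have "g x = x \<otimes> (g x \<otimes> inv x)" by (rule split_diff[OF x c(1), symmetric])
  then have "f (g x) = f (x \<otimes> (g x \<otimes> inv x))" by simp
  also have "\<dots> = f x \<otimes> f (g x \<otimes> inv x)" using x c by (intro hom_mult[OF auto_hom[OF fa(1)]]) auto
  also have "f (g x \<otimes> inv x) = g x \<otimes> inv x" using f T by (simp add: finitary_stable_def)
  also have "f x = x \<otimes> (f x \<otimes> inv x)" by (rule split_diff[OF x c(2), symmetric])
  finally show ?thesis .
qed

lemma finitary_stable_subgroup: "subgroup finitary_stable Aut"
proof (rule group.subgroup_if_closed[OF Aut_group])
  show "finitary_stable \<subseteq> carrier Aut" by (auto simp: finitary_stable_def)
  have "(\<lambda>x. \<one>\<^bsub>Aut\<^esub> x \<otimes> inv x) ` carrier G \<subseteq> {\<one>}" using Aut_one by auto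
  then have "finite ((\<lambda>x. \<one>\<^bsub>Aut\<^esub> x \<otimes> inv x) ` carrier G)" using finite_subset by blast
  then show "\<one>\<^bsub>Aut\<^esub> \<in> finitary_stable"
    using Aut_one Aut_one_closed sub_one[OF torsion_subgroup] torsion_carr
    by (auto simp: finitary_stable_def unipotent_def)
next
  fix f g assume f: "f \<in> finitary_stable" and g: "g \<in> finitary_stable"
  have fa: "f \<in> auto G" "g \<in> auto G" using f g by (auto simp: finitary_stable_def)
  let ?A = "(\<lambda>x. f x \<otimes> inv x) ` carrier G" and ?B = "(\<lambda>x. g x \<otimes> inv x) ` carrier G"
  have "(\<lambda>x. (f \<otimes>\<^bsub>Aut\<^esub> g) x \<otimes> inv x) ` carrier G \<subseteq> ?A <#> ?B"
  proof
    fix y assume "y \<in> (\<lambda>x. (f \<otimes>\<^bsub>Aut\<^esub> g) x \<otimes> inv x) ` carrier G"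
    then obtain x where x: "x \<in> carrier G" "y = (f \<otimes>\<^bsub>Aut\<^esub> g) x \<otimes> inv x" by blast
    have c: "g x \<in> carrier G" "f x \<in> carrier G" using fa x auto_carr by auto
    have "y = x \<otimes> (f x \<otimes> inv x) \<otimes> (g x \<otimes> inv x) \<otimes> inv x"
      using x(2) Aut_mult[OF fa x(1)] finitary_stable_mult_apply[OF f g x(1)] by simp
    also have "\<dots> = ((f x \<otimes> inv x) \<otimes> (g x \<otimes> inv x)) \<otimes> x \<otimes> inv x" using x(1) c by (simp add: m_ac)
    also have "\<dots> = (f x \<otimes> inv x) \<otimes> (g x \<otimes> inv x)" using x(1) c by (simp only: m_inv_cancel m_closed inv_closed)
    finally show "y \<in> ?A <#> ?B" unfolding set_mult_def using x(1) by blast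
  qed
  moreover have "finite ?A" "finite ?B" using f g by (simp_all add: finitary_stable_def)
  then have "finite (?A <#> ?B)" unfolding set_mult_def by (intro finite_UN_I) blast+
  ultimately have "finite ((\<lambda>x. (f \<otimes>\<^bsub>Aut\<^esub> g) x \<otimes> inv x) ` carrier G)" by (rule finite_subset)
  moreover have "(f \<otimes>\<^bsub>Aut\<^esub> g) t = t" if "t \<in> torsion_subgroup G" for t
    using that f g Aut_mult[OF fa torsion_carr[OF that]] by (simp add: finitary_stable_def)
  ultimately show "f \<otimes>\<^bsub>Aut\<^esub> g \<in> finitary_stable"
    using f g unipotent_mult[OF fa] Aut_mult_closed[OF fa] by (simp add: finitary_stable_def)
next
  fix f assume f: "f \<in> finitary_stable"
  have fa: "f \<in> auto G" using f by (auto simp: finitary_stable_def)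
  note ia = Aut_inv_closed[OF fa]
  let ?A = "(\<lambda>x. f x \<otimes> inv x) ` carrier G"
  have "(\<lambda>x. (inv\<^bsub>Aut\<^esub> f) x \<otimes> inv x) ` carrier G \<subseteq> (\<lambda>y. inv y) ` ?A"
  proof
    fix y assume "y \<in> (\<lambda>x. (inv\<^bsub>Aut\<^esub> f) x \<otimes> inv x) ` carrier G"
    then obtain x where x: "x \<in> carrier G" "y = (inv\<^bsub>Aut\<^esub> f) x \<otimes> inv x" by blast
    define z where "z = (inv\<^bsub>Aut\<^esub> f) x"
    have z: "z \<in> carrier G" "f z = x" using auto_carr[OF ia x(1)] Aut_inv_right[OF fa x(1)] by (auto simp: z_def)
    have "y = inv (f z \<otimes> inv z)" using x z by (simp add: inv_mult_group flip: z_def)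
    then show "y \<in> (\<lambda>y. inv y) ` ?A" using z by blast
  qed
  moreover have "finite ((\<lambda>y. inv y) ` ?A)" using f by (simp add: finitary_stable_def)
  ultimately have "finite ((\<lambda>x. (inv\<^bsub>Aut\<^esub> f) x \<otimes> inv x) ` carrier G)" by (rule finite_subset)
  moreover have "(inv\<^bsub>Aut\<^esub> f) t = t" if "t \<in> torsion_subgroup G" for t
  proof -
    have "f t = t" using f that by (simp add: finitary_stable_def)
    then show ?thesis using Aut_inv_left[OF fa torsion_carr[OF that]] by simp
  qed
  moreover have "unipotent (inv\<^bsub>Aut\<^esub> f)" using unipotent_inv[OF fa] f by (simp add: finitary_stable_def)
  ultimately show "inv\<^bsub>Aut\<^esub> f \<in> finitary_stable" using ia by (simp add: finitary_stable_def)
qed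

text \<open>Writing \<open>x = g (f y)\<close> turns the displacement of the group commutator at
  \<open>x\<close> into the value of \<open>commutator_map f g\<close> at \<open>y\<close>, and
  these values are finite in number. On torsion elements \<open>f\<close> and \<open>g\<close>
  commute because both act by multiples on each component.\<close>

lemma \<Gamma>_commutator:
  assumes f: "f \<in> \<Gamma>" and g: "g \<in> \<Gamma>"
  shows "f \<otimes>\<^bsub>Aut\<^esub> g \<otimes>\<^bsub>Aut\<^esub> inv\<^bsub>Aut\<^esub> f \<otimes>\<^bsub>Aut\<^esub> inv\<^bsub>Aut\<^esub> g \<in> finitary_stable"
proof -
  interpret A: group Aut by (rule Aut_group)
  have fa: "f \<in> auto G" "inertial_map G f" "unipotent f" "g \<in> auto G" "inertial_map G g" "unipotent g"
    using f g by (auto simp: \<Gamma>_def IAut1_iff)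
  note fh = auto_hom[OF fa(1)] and gh = auto_hom[OF fa(4)]
  let ?c = "f \<otimes>\<^bsub>Aut\<^esub> g \<otimes>\<^bsub>Aut\<^esub> inv\<^bsub>Aut\<^esub> f \<otimes>\<^bsub>Aut\<^esub> inv\<^bsub>Aut\<^esub> g"
  note ifa = Aut_inv_closed[OF fa(1)] and iga = Aut_inv_closed[OF fa(4)]
  have c1: "f \<otimes>\<^bsub>Aut\<^esub> g \<in> auto G" by (rule Aut_mult_closed[OF fa(1,4)])
  have c2: "f \<otimes>\<^bsub>Aut\<^esub> g \<otimes>\<^bsub>Aut\<^esub> inv\<^bsub>Aut\<^esub> f \<in> auto G" by (rule Aut_mult_closed[OF c1 ifa])
  have ca: "?c \<in> auto G" by (rule Aut_mult_closed[OF c2 iga])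
  have cx: "\<exists>y\<in>carrier G. ?c x = f (g y) \<and> x = g (f y)" if x: "x \<in> carrier G" for x
  proof -
    define u where "u = (inv\<^bsub>Aut\<^esub> g) x"
    have u: "u \<in> carrier G" "g u = x" using auto_carr[OF iga x] Aut_inv_right[OF fa(4) x] by (auto simp: u_def)
    define y where "y = (inv\<^bsub>Aut\<^esub> f) u"
    have y: "y \<in> carrier G" "f y = u" using auto_carr[OF ifa u(1)] Aut_inv_right[OF fa(1) u(1)] by (auto simp: y_def)
    have "?c x = f (g y)"
      using Aut_mult[OF c2 iga x] Aut_mult[OF c1 ifa u(1)] Aut_mult[OF fa(1,4) y(1)] by (simp add: u_def y_def)
    then show ?thesis using y u by blast
  qed
  have "(\<lambda>x. ?c x \<otimes> inv x) ` carrier G \<subseteq> commutator_map f g ` carrier G"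
  proof
    fix z assume "z \<in> (\<lambda>x. ?c x \<otimes> inv x) ` carrier G"
    then obtain x where x: "x \<in> carrier G" "z = ?c x \<otimes> inv x" by blast
    obtain y where "y \<in> carrier G" "?c x = f (g y)" "x = g (f y)" using cx[OF x(1)] by blast
    then have "z = commutator_map f g y" using x(2) by (simp add: commutator_map_def)
    then show "z \<in> commutator_map f g ` carrier G" using \<open>y \<in> carrier G\<close> by blast
  qed
  moreover have "finite (commutator_map f g ` carrier G)"
    using commutator_finite[OF fa(2) _ fa(5)] fa(3,6) by (simp add: unipotent_def)
  ultimately have fin: "finite ((\<lambda>x. ?c x \<otimes> inv x) ` carrier G)" by (rule finite_subset)
  have fgT: "f (g t) = g (f t)" if "t \<in> torsion_subgroup G" for t
    using that
  proof (induction rule: torsion_induct)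
    case one
    then show ?case using hom_one'[OF fh] hom_one'[OF gh] by simp
  next
    case (primary p y)
    then show ?case using power_on_commute[OF fh gh, of "primary G p" y] f g primary_carr by (auto simp: \<Gamma>_def)
  next
    case (mult y z)
    then show ?case using torsion_carr hom_in_carrier[OF fh] hom_in_carrier[OF gh] by (simp add: hom_mult[OF fh] hom_mult[OF gh])
  qed
  have cT: "?c t = t" if t: "t \<in> torsion_subgroup G" for t
  proof -
    obtain y where y: "y \<in> carrier G" "?c t = f (g y)" "t = g (f y)" using cx[OF torsion_carr[OF t]] by blast
    have "y = (inv\<^bsub>Aut\<^esub> f) ((inv\<^bsub>Aut\<^esub> g) t)"
      using y Aut_inv_left[OF fa(1) y(1)] Aut_inv_left[OF fa(4) auto_carr[OF fa(1) y(1)]] by simp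
    then have "y \<in> torsion_subgroup G" using hom_torsion[OF auto_hom[OF ifa]] hom_torsion[OF auto_hom[OF iga] t] by simp
    then show ?thesis using fgT y by simp
  qed
  have "unipotent ?c"
    using fa by (intro unipotent_mult unipotent_inv Aut_mult_closed Aut_inv_closed)
  then show ?thesis using ca fin cT by (simp add: finitary_stable_def)
qed

lemma derived_\<Gamma>_le: "derived Aut \<Gamma> \<subseteq> finitary_stable"
  unfolding derived_def
  by (rule group.generate_subgroup_incl[OF Aut_group _ finitary_stable_subgroup]) (use \<Gamma>_commutator in blast)

lemma finitary_stable_commute:
  assumes "f \<in> finitary_stable" "g \<in> finitary_stable" shows "f \<otimes>\<^bsub>Aut\<^esub> g = g \<otimes>\<^bsub>Aut\<^esub> f"
proof -
  have fa: "f \<in> auto G" "g \<in> auto G" using assms by (auto simp: finitary_stable_def)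
  show ?thesis
  proof (rule auto_eqI[OF Aut_mult_closed[OF fa] Aut_mult_closed[OF fa(2,1)]])
    fix x assume x: "x \<in> carrier G"
    have c: "f x \<in> carrier G" "g x \<in> carrier G" using fa x auto_carr by auto
    show "(f \<otimes>\<^bsub>Aut\<^esub> g) x = (g \<otimes>\<^bsub>Aut\<^esub> f) x"
      using Aut_mult[OF fa x] Aut_mult[OF fa(2,1) x] finitary_stable_mult_apply[OF assms x]
        finitary_stable_mult_apply[OF assms(2,1) x] x c by (simp add: m_ac)
  qed
qed

lemma finitary_stable_pow:
  assumes f: "f \<in> finitary_stable" and x: "x \<in> carrier G"
  shows "(f [^]\<^bsub>Aut\<^esub> (n::nat)) x = x \<otimes> (f x \<otimes> inv x) [^] int n"
proof -
  interpret A: group Aut by (rule Aut_group)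
  have fa: "f \<in> auto G" using f by (auto simp: finitary_stable_def)
  have fx: "f x \<in> carrier G" using fa x auto_carr by auto
  have pa: "f [^]\<^bsub>Aut\<^esub> (k::nat) \<in> auto G" for k using A.nat_pow_closed[of f k] fa by simp
  show ?thesis
  proof (induction n)
    case 0
    then show ?case using x Aut_one by simp
  next
    case (Suc n)
    have "f [^]\<^bsub>Aut\<^esub> Suc n = f \<otimes>\<^bsub>Aut\<^esub> f [^]\<^bsub>Aut\<^esub> n" using A.nat_pow_Suc2[of f n] fa by simp
    then have "(f [^]\<^bsub>Aut\<^esub> Suc n) x = f (x \<otimes> (f x \<otimes> inv x) [^] int n)" using Aut_mult[OF fa pa x] Suc by simp
    also have "\<dots> = f x \<otimes> f ((f x \<otimes> inv x) [^] int n)" using x fx by (intro hom_mult[OF auto_hom[OF fa]]) auto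
    also have "f ((f x \<otimes> inv x) [^] int n) = (f x \<otimes> inv x) [^] int n"
    proof -
      have "f x \<otimes> inv x \<in> torsion_subgroup G" using f x by (simp add: finitary_stable_def unipotent_def)
      then have "(f x \<otimes> inv x) [^] int n \<in> torsion_subgroup G" by (rule sub_pow[OF torsion_subgroup])
      then show ?thesis using f by (simp add: finitary_stable_def)
    qed
    also have "f x \<otimes> (f x \<otimes> inv x) [^] int n = x \<otimes> ((f x \<otimes> inv x) \<otimes> (f x \<otimes> inv x) [^] int n)"
    proof -
      have "f x = x \<otimes> (f x \<otimes> inv x)" by (rule split_diff[OF x fx, symmetric])
      then have "f x \<otimes> (f x \<otimes> inv x) [^] int n = (x \<otimes> (f x \<otimes> inv x)) \<otimes> (f x \<otimes> inv x) [^] int n" by simp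
      then show ?thesis using x fx by (simp add: m_assoc)
    qed
    also have "(f x \<otimes> inv x) \<otimes> (f x \<otimes> inv x) [^] int n = (f x \<otimes> inv x) [^] int (Suc n)"
      using x fx int_pow_mult[of "f x \<otimes> inv x" 1 "int n"] by simp
    finally show ?case .
  qed
qed

lemma difference_hom: "f \<in> hom G G \<Longrightarrow> (\<lambda>x. f x \<otimes> inv x) \<in> hom G G"
  using hom_in_carrier[of f G G] by (intro homI) (simp_all add: hom_mult inv_mult_group m_ac)

text \<open>The displacements form a finite group, being the image of the homomorphism
  \<open>f - 1\<close>.\<close>

lemma finitary_stable_exponent:
  assumes f: "f \<in> finitary_stable"
  obtains e :: nat where "e > 0" "\<forall>x\<in>carrier G. (f x \<otimes> inv x) [^] int e = \<one>"
proof -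
  have fh: "f \<in> hom G G" using f auto_hom by (auto simp: finitary_stable_def)
  let ?D = "(\<lambda>x. f x \<otimes> inv x) ` carrier G"
  have sD: "subgroup ?D G" by (rule hom_image_subgroup[OF difference_hom[OF fh] subgroup_self])
  have "finite ?D" using f by (simp add: finitary_stable_def)
  moreover have "?D \<subseteq> carrier G" using sub_carr[OF sD] by blast
  ultimately have "almost_le G ?D {\<one>}" using almost_le_one_iff by blast
  then obtain e :: int where e: "e > 0" "\<forall>k\<in>?D. k [^] e \<in> {\<one>}"
    using almost_le_exponent[OF _ subgroup_one_set sD] by blast
  show ?thesis by (rule that[of "nat e"]) (use e in auto)
qed

text \<open>Chinese remaindering: the exponent for the \<open>p\<close>-part and the one obtained
  inductively for the rest are combined by the Bezout coefficients.\<close>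

lemma power_on_torsion_uniform:
  assumes k: "k \<in> hom G G" "\<forall>p. prime p \<longrightarrow> power_on G k (primary G p)"
  shows "e > 0 \<Longrightarrow> \<exists>l::int. \<forall>d\<in>carrier G. d [^] int e = \<one> \<longrightarrow> k d = d [^] l"
proof (induction e rule: less_induct)
  case (less e)
  show ?case
  proof (cases "e = 1")
    case True
    then show ?thesis using hom_one'[OF k(1)] by (intro exI[of _ 1]) auto
  next
    case False
    then obtain q where q: "prime (q::nat)" "q dvd e" using prime_factor_nat by blast
    define p where "p = int q"
    have p: "prime p" "p dvd int e" using q by (auto simp: p_def)
    obtain a e' where ae: "int e = p ^ a * e'" "\<not> p dvd e'" using prime_decompose[OF p(1), of "int e"] less.prems by auto
    have a: "a \<noteq> 0" using ae p(2) by (intro notI) simp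
    have p1: "p > 1" using p(1) prime_gt_1_int by blast
    have e': "e' > 0" using ae(1) less.prems p1
      by (metis of_nat_0_less_iff zero_less_mult_pos zero_less_power order_less_trans zero_less_one)
    have "e' * 1 < e' * p ^ a" using e' p1 a by (intro mult_strict_left_mono) (auto intro: one_less_power)
    then have lt: "nat e' < e" using ae(1) e' by (simp add: mult.commute nat_less_iff)
    obtain l2 :: int where l2: "\<forall>d\<in>carrier G. d [^] e' = \<one> \<longrightarrow> k d = d [^] l2"
      using less.IH[OF lt] e' by auto
    have "\<exists>l::int. \<forall>c\<in>{c\<in>primary G p. c [^] (p ^ a) = \<one>}. k c = c [^] l"
    proof (rule power_on_uniform[OF p(1) pow_kernel_subgroup[OF primary_subgroup] k(1), of p "p ^ a" a])
      show "power_on G k {c\<in>primary G p. c [^] (p ^ a) = \<one>}" using k(2) p by (auto simp: power_on_def)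
    qed simp
    then obtain l1 :: int where l1: "\<forall>c\<in>{c\<in>primary G p. c [^] (p ^ a) = \<one>}. k c = c [^] l1" by blast
    have "coprime (p ^ a) e'" using prime_not_dvd_coprime[OF p(1) ae(2)] by (simp add: coprime_commute)
    then obtain u v where uv: "u * p ^ a + v * e' = 1" using bezout_int[of "p ^ a" e'] by auto
    define l where "l = l1 * (v * e') + l2 * (u * p ^ a)"
    have "k d = d [^] l" if d: "d \<in> carrier G" "d [^] int e = \<one>" for d
    proof -
      define y z where "y = d [^] (u * p ^ a)" and "z = d [^] (v * e')"
      have c: "y \<in> carrier G" "z \<in> carrier G" using d by (auto simp: y_def z_def)
      have "d = y \<otimes> z" unfolding y_def z_def using d uv int_pow_mult[of d "u * p ^ a" "v * e'"] by simp
      have "y [^] e' = (d [^] int e) [^] u" unfolding y_def ae(1) using d(1) by (simp add: int_pow_pow mult_ac)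
      then have ky: "k y = y [^] l2" using l2 c d by simp
      have "z [^] (p ^ a) = (d [^] int e) [^] v" unfolding z_def ae(1) using d(1) by (simp add: int_pow_pow mult_ac)
      then have kz: "k z = z [^] l1" using l1 c d by (auto simp: primary_def)
      have "k d = k y \<otimes> k z" using \<open>d = y \<otimes> z\<close> c hom_mult[OF k(1)] by simp
      also have "\<dots> = d [^] (l2 * (u * p ^ a)) \<otimes> d [^] (l1 * (v * e'))"
        unfolding ky kz unfolding y_def z_def using d by (simp add: int_pow_pow mult.commute)
      also have "\<dots> = d [^] l" unfolding l_def int_pow_mult[OF d(1)] using d(1) by (intro m_comm) auto
      finally show ?thesis .
    qed
    then show ?thesis by blast
  qed
qed

text \<open>\<open>k\<close> multiplies the displacements of \<open>f\<close>, which have bounded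
  order, by a common integer \<open>l\<close>. Moreover \<open>x\<close> and its preimage under
  \<open>k\<close> differ by torsion, where \<open>f - 1\<close> vanishes. Thus the conjugate is
  \<open>1 + l (f - 1)\<close>, which is a power of \<open>f\<close>.\<close>

lemma \<Gamma>_conjugate:
  assumes k: "k \<in> \<Gamma>" and f: "f \<in> finitary_stable"
  obtains n :: nat where "k \<otimes>\<^bsub>Aut\<^esub> f \<otimes>\<^bsub>Aut\<^esub> inv\<^bsub>Aut\<^esub> k = f [^]\<^bsub>Aut\<^esub> n"
proof -
  interpret A: group Aut by (rule Aut_group)
  have ka: "k \<in> auto G" "unipotent k" using k by (auto simp: \<Gamma>_def IAut1_iff)
  have fa: "f \<in> auto G" using f by (auto simp: finitary_stable_def)
  note kh = auto_hom[OF ka(1)] and fh = auto_hom[OF fa] and ia = Aut_inv_closed[OF ka(1)]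
  obtain e where e: "e > 0" "\<forall>x\<in>carrier G. (f x \<otimes> inv x) [^] int e = \<one>" by (rule finitary_stable_exponent[OF f])
  obtain l :: int where l: "\<forall>d\<in>carrier G. d [^] int e = \<one> \<longrightarrow> k d = d [^] l"
    using power_on_torsion_uniform[OF kh _ e(1)] k by (auto simp: \<Gamma>_def)
  \<comment> \<open>Reduction modulo the exponent of the displacements yields a nonnegative
    exponent, as needed for a natural power.\<close>
  define n where "n = nat (l mod int e)"
  have n: "int n = l mod int e" using e(1) by (simp add: n_def)
  have "k \<otimes>\<^bsub>Aut\<^esub> f \<otimes>\<^bsub>Aut\<^esub> inv\<^bsub>Aut\<^esub> k = f [^]\<^bsub>Aut\<^esub> n"
  proof (rule auto_eqI)
    show "k \<otimes>\<^bsub>Aut\<^esub> f \<otimes>\<^bsub>Aut\<^esub> inv\<^bsub>Aut\<^esub> k \<in> auto G" using ka(1) fa ia by (intro Aut_mult_closed)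
    show "f [^]\<^bsub>Aut\<^esub> n \<in> auto G" using A.nat_pow_closed[of f n] fa by simp
    fix x assume x: "x \<in> carrier G"
    define y where "y = (inv\<^bsub>Aut\<^esub> k) x"
    have y: "y \<in> carrier G" "k y = x" using auto_carr[OF ia x] Aut_inv_right[OF ka(1) x] by (auto simp: y_def)
    have fc: "f x \<in> carrier G" "f y \<in> carrier G" using auto_carr[OF fa] x y by auto
    have "k y \<otimes> inv y \<in> torsion_subgroup G" using ka(2) y(1) unfolding unipotent_def by blast
    then have "inv (k y \<otimes> inv y) \<in> torsion_subgroup G" by (rule sub_inv[OF torsion_subgroup])
    then have T: "y \<otimes> inv x \<in> torsion_subgroup G" using x y by (simp add: inv_mult_group)
    \<comment> \<open>The displacement is additive and vanishes on the torsion element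
      \<open>y - x\<close>.\<close>
    have dy: "f y \<otimes> inv y = f x \<otimes> inv x"
    proof -
      have yx: "y = (y \<otimes> inv x) \<otimes> x" using x y by simp
      have "f y = f (y \<otimes> inv x) \<otimes> f x"
        using hom_mult[OF fh, of "y \<otimes> inv x" x] x y by simp
      also have "f (y \<otimes> inv x) = y \<otimes> inv x" using f T by (simp add: finitary_stable_def)
      finally have "f y \<otimes> inv y = (f x \<otimes> inv x \<otimes> y) \<otimes> inv y" using x y fc by (simp add: m_ac)
      then show ?thesis using x y fc by (simp only: m_inv_cancel m_closed inv_closed)
    qed
    have "(k \<otimes>\<^bsub>Aut\<^esub> f \<otimes>\<^bsub>Aut\<^esub> inv\<^bsub>Aut\<^esub> k) x = k (f y)"
      using Aut_mult[OF Aut_mult_closed[OF ka(1) fa] ia x] Aut_mult[OF ka(1) fa y(1)] by (simp add: y_def)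
    also have "f y = y \<otimes> (f y \<otimes> inv y)" by (rule split_diff[OF y(1) fc(2), symmetric])
    also have "k (y \<otimes> (f y \<otimes> inv y)) = x \<otimes> k (f y \<otimes> inv y)" using y fc hom_mult[OF kh] by simp
    also have "k (f y \<otimes> inv y) = (f x \<otimes> inv x) [^] l" using l e(2) x fc unfolding dy by simp
    also have "\<dots> = (f x \<otimes> inv x) [^] int n"
      unfolding n using x fc e(2) by (intro pow_mod) auto
    finally show "(k \<otimes>\<^bsub>Aut\<^esub> f \<otimes>\<^bsub>Aut\<^esub> inv\<^bsub>Aut\<^esub> k) x = (f [^]\<^bsub>Aut\<^esub> n) x"
      using finitary_stable_pow[OF f x] by simp
  qed
  then show ?thesis by (rule that)
qed

lemma IAut_structure:
  assumes a: "a \<in> carrier G" "a \<notin> torsion_subgroup G"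
  shows "(\<exists>Q. subgroup Q (IAut G) \<and>
            (\<exists>R. subgroup R rat_mult_group \<and>
                 (IAut G)\<lparr>carrier := Q\<rparr> \<cong> rat_mult_group\<lparr>carrier := R\<rparr>) \<and>
            internal_direct_product (IAut G) (IAut1 G) Q) \<and>
         (\<exists>\<Gamma>. \<Gamma> \<lhd> (IAut G)\<lparr>carrier := IAut1 G\<rparr> \<and>
            locally_finite ((IAut G)\<lparr>carrier := IAut1 G\<rparr> Mod \<Gamma>) \<and>
            comm_group ((IAut G)\<lparr>carrier := derived (IAut G) \<Gamma>\<rparr>) \<and>
            periodic ((IAut G)\<lparr>carrier := derived (IAut G) \<Gamma>\<rparr>) \<and>
            (\<forall>K. subgroup K ((IAut G)\<lparr>carrier := derived (IAut G) \<Gamma>\<rparr>) \<longrightarrow>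
                 K \<lhd> (IAut G)\<lparr>carrier := \<Gamma>\<rparr>))"
proof
  interpret A: group Aut by (rule Aut_group)
  have "subgroup scaling_group (IAut G)" unfolding IAut_eq by (rule A.subgroup_incl[OF scaling_group_subgroup inertial_group_subgroup scaling_group_le])
  then show "\<exists>Q. subgroup Q (IAut G) \<and>
            (\<exists>R. subgroup R rat_mult_group \<and>
                 (IAut G)\<lparr>carrier := Q\<rparr> \<cong> rat_mult_group\<lparr>carrier := R\<rparr>) \<and>
            internal_direct_product (IAut G) (IAut1 G) Q"
    using scaling_group_rational[OF a] IAut_direct_product[OF a] by (intro exI[of _ scaling_group]) (simp add: IAut_eq)
  have \<Gamma>inertial_group: "\<Gamma> \<subseteq> inertial_group" using IAut1_le_inertial_group by (auto simp: \<Gamma>_def)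
  have d: "derived (IAut G) \<Gamma> = derived Aut \<Gamma>"
    unfolding IAut_eq by (rule A.derived_consistent[OF \<Gamma>inertial_group inertial_group_subgroup])
  let ?D = "derived Aut \<Gamma>"
  have sD: "subgroup ?D Aut" by (rule A.derived_is_subgroup[OF subgroup.subset[OF \<Gamma>_subgroup]])
  have D\<Gamma>: "?D \<subseteq> \<Gamma>" using A.derived_incl[OF order_refl \<Gamma>_subgroup] .
  have "comm_group (Aut\<lparr>carrier := ?D\<rparr>)"
  proof (rule group.group_comm_groupI[OF A.subgroup_imp_group[OF sD]])
    fix x y assume "x \<in> carrier (Aut\<lparr>carrier := ?D\<rparr>)" "y \<in> carrier (Aut\<lparr>carrier := ?D\<rparr>)"
    then show "x \<otimes>\<^bsub>Aut\<lparr>carrier := ?D\<rparr>\<^esub> y = y \<otimes>\<^bsub>Aut\<lparr>carrier := ?D\<rparr>\<^esub> x"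
      using finitary_stable_commute derived_\<Gamma>_le by auto
  qed
  moreover have "periodic (Aut\<lparr>carrier := ?D\<rparr>)"
    unfolding periodic_def
  proof
    fix f assume "f \<in> carrier (Aut\<lparr>carrier := ?D\<rparr>)"
    then have f: "f \<in> finitary_stable" using derived_\<Gamma>_le by auto
    then have fa: "f \<in> auto G" by (simp add: finitary_stable_def)
    obtain e where e: "e > 0" "\<forall>x\<in>carrier G. (f x \<otimes> inv x) [^] int e = \<one>" by (rule finitary_stable_exponent[OF f])
    have "f [^]\<^bsub>Aut\<^esub> e = \<one>\<^bsub>Aut\<^esub>"
    proof (rule auto_eqI[OF _ Aut_one_closed])
      show "f [^]\<^bsub>Aut\<^esub> e \<in> auto G" using A.nat_pow_closed[of f e] fa by simp
      fix x assume x: "x \<in> carrier G"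
      show "(f [^]\<^bsub>Aut\<^esub> e) x = \<one>\<^bsub>Aut\<^esub> x"
        unfolding finitary_stable_pow[OF f x] Aut_one[OF x] using e(2) x by simp
    qed
    then have "f [^]\<^bsub>Aut\<lparr>carrier := ?D\<rparr>\<^esub> e = \<one>\<^bsub>Aut\<lparr>carrier := ?D\<rparr>\<^esub>"
      using A.nat_pow_consistent[of f e ?D] by simp
    then show "\<exists>n::nat. n > 0 \<and> f [^]\<^bsub>Aut\<lparr>carrier := ?D\<rparr>\<^esub> n = \<one>\<^bsub>Aut\<lparr>carrier := ?D\<rparr>\<^esub>" using e(1) by blast
  qed
  moreover have "K \<lhd> Aut\<lparr>carrier := \<Gamma>\<rparr>" if K: "subgroup K (Aut\<lparr>carrier := ?D\<rparr>)" for K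
  proof -
    have sK: "subgroup K Aut" by (rule A.incl_subgroup[OF sD K])
    have KD: "K \<subseteq> ?D" using subgroup.subset[OF K] by simp
    show ?thesis
    proof (rule A.normal_inI[OF \<Gamma>_subgroup sK])
      show "K \<subseteq> \<Gamma>" using KD D\<Gamma> by blast
      fix k f assume k: "k \<in> \<Gamma>" and f: "f \<in> K"
      then have "f \<in> finitary_stable" using KD derived_\<Gamma>_le by blast
      then obtain n :: nat where n: "k \<otimes>\<^bsub>Aut\<^esub> f \<otimes>\<^bsub>Aut\<^esub> inv\<^bsub>Aut\<^esub> k = f [^]\<^bsub>Aut\<^esub> n" by (rule \<Gamma>_conjugate[OF k])
      have "f [^]\<^bsub>Aut\<^esub> n \<in> K"
        by (induction n) (simp_all add: subgroup.one_closed[OF sK] subgroup.m_closed[OF sK _ f])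
      then show "k \<otimes>\<^bsub>Aut\<^esub> f \<otimes>\<^bsub>Aut\<^esub> inv\<^bsub>Aut\<^esub> k \<in> K" using n by simp
    qed
  qed
  ultimately show "\<exists>\<Gamma>. \<Gamma> \<lhd> (IAut G)\<lparr>carrier := IAut1 G\<rparr> \<and>
            locally_finite ((IAut G)\<lparr>carrier := IAut1 G\<rparr> Mod \<Gamma>) \<and>
            comm_group ((IAut G)\<lparr>carrier := derived (IAut G) \<Gamma>\<rparr>) \<and>
            periodic ((IAut G)\<lparr>carrier := derived (IAut G) \<Gamma>\<rparr>) \<and>
            (\<forall>K. subgroup K ((IAut G)\<lparr>carrier := derived (IAut G) \<Gamma>\<rparr>) \<longrightarrow>
                 K \<lhd> (IAut G)\<lparr>carrier := \<Gamma>\<rparr>)"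
    using \<Gamma>_normal IAut1_mod_\<Gamma>_locally_finite by (intro exI[of _ \<Gamma>]) (simp add: d, simp add: IAut_eq)
qed

end

theorem theoremB:
  fixes A :: "('a, 'b) monoid_scheme"
  assumes "comm_group A"
    and "\<not> periodic A"
  shows "(\<exists>Q. subgroup Q (IAut A) \<and>
            (\<exists>R. subgroup R rat_mult_group \<and>
                 (IAut A)\<lparr>carrier := Q\<rparr> \<cong> rat_mult_group\<lparr>carrier := R\<rparr>) \<and>
            internal_direct_product (IAut A) (IAut1 A) Q) \<and>
         (\<exists>\<Gamma>. \<Gamma> \<lhd> (IAut A)\<lparr>carrier := IAut1 A\<rparr> \<and>
            locally_finite ((IAut A)\<lparr>carrier := IAut1 A\<rparr> Mod \<Gamma>) \<and>
            comm_group ((IAut A)\<lparr>carrier := derived (IAut A) \<Gamma>\<rparr>) \<and>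
            periodic ((IAut A)\<lparr>carrier := derived (IAut A) \<Gamma>\<rparr>) \<and>
            (\<forall>K. subgroup K ((IAut A)\<lparr>carrier := derived (IAut A) \<Gamma>\<rparr>) \<longrightarrow>
                 K \<lhd> (IAut A)\<lparr>carrier := \<Gamma>\<rparr>))"
proof -
  obtain a where "a \<in> carrier A" "a \<notin> torsion_subgroup A"
    using assms(2) unfolding periodic_def torsion_subgroup_def by blast
  then show ?thesis by (rule comm_group.IAut_structure[OF assms(1)])
qed

end
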